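(* Let $H:T^*M\times\Omega\to\mathbb{R}$ satisfy assumptions (a)--(e) of the context, and let $\phi_\varepsilon$ be the associated rescaled minimal action. There exist a map $\overline{L}:\mathbb{R}^b\to\mathbb{R}$ and a set $\overline{\Omega}\subseteq\Omega$ of probability $1$ such that, for any $x\in M$, $k\in\mathcal{T}$, $h\in\mathbb{R}^b$ and $\omega\in\overline{\Omega}$, $$\lim_{\varepsilon\to0^+}\phi_\varepsilon\big((0,k)(x),(\Phi_\varepsilon(h),k)(x),1,\omega\big)=\overline{L}(h).$$
   Context: **Manifold and group.** $M$ is a smooth connected finite-dimensional manifold without boundary with a complete Riemannian metric; $|\cdot|_x$ denotes the induced norms on $T_xM$ and $T^*_xM$, and $d$ the Riemannian distance. $G$ is a finitely generated abelian group of rank $b$ acting on $M$ by isometries, and the action is free ($g(x)=x$ for some $x$ implies $g=e$), totally discontinuous (every $x\in M$ has a neighborhood $U$ with $g(U)\cap U=\emptyset$ for all $g$ with $g(x)\neq x$) and co-compact ($M/G$ is compact). An identification $G\simeq\mathbb{Z}^b\times\mathcal{T}$ with $\mathcal{T}$ a finite (torsion) group is fixed, and elements of $G$ are written $(h,k)$; $\mathbb{Z}^0=\mathbb{R}^0=\{0\}$. $G$ acts on $T^*M$ by $g^*(x,p)=(g(x),p\circ(\mathrm{d}g_x)^{-1})$. $\|\cdot\|$ is the Euclidean norm on $\mathbb{R}^b$. **Probability space.** $(\Omega,\mathcal{F},\mathbb{P})$ is a probability space with a dynamical system $\{\tau_g\}_{g\in G}$: maps $\tau_g:\Omega\to\Omega$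 with $\tau_{gg'}=\tau_g\circ\tau_{g'}$, each measurable with $\mathbb{P}(\tau_gE)=\mathbb{P}(E)$ for all $E\in\mathcal{F}$, and $(g,\omega)\mapsto\tau_g\omega$ jointly measurable ($G$ carrying the Borel $\sigma$-algebra of its given topology). It is ergodic: if $E\in\mathcal{F}$ satisfies $\mathbb{P}(\tau_gE\,\Delta\,E)=0$ for all $g\in G$, then $\mathbb{P}(E)\in\{0,1\}$. **Assumptions on $H$.** (a) $\omega\mapsto H(\cdot,\cdot,\omega)$ is a continuous random function, i.e. a measurable map from $\Omega$ to $C(T^*M)$ with the topology of uniform convergence on compact sets; (b) $H(\cdot,\cdot,\omega)$ is $C^2$ for each $\omega$; (c) $p\mapsto H(x,p,\omega)$ is strictly convex for all $(x,\omega)$; (d) there are convex nondecreasing superlinearly coercive functions $\vartheta,\Theta:[0,\infty)\to\mathbb{R}$ (superlinearly coercive: $f(r)/r\to\infty$ as $r\to\infty$) with $\vartheta(|p|_x)\le H(x,p,\omega)\le\Theta(|p|_x)$ for all $(x,p,\omega)\in T^*M\times\Omega$; (e) $H(x,p,\tau_g\omega)=H(g^*(x,p),\omega)$ for all $(x,p,\omega)\in T^*M\times\Omega$, $g\in G$. **Minimal action.** $L$ is the convex conjugate of $H$: $L(x,q,\omega)=\sup_{p\in T_x^*M}\{p(q)-H(x,p,\omega)\}$, and $L_\varepsilon(x,q,\omega)=L(x,\varepsilon q,\omega)$ for $\varepsilon>0$. $\phi_\varepsilon(x',x,t,\omega)=\inf\int_0^tL_\varepsilon(\gamma,\dot\gamma,\omega)\,d\tau$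 over absolutely continuous $\gamma:[0,t]\to M$ with $\gamma(0)=x'$, $\gamma(t)=x$. **Maps $\Phi_\varepsilon$.** Maps $\Phi_\varepsilon:\mathbb{R}^b\to\mathbb{Z}^b$ ($\varepsilon>0$) are fixed with $\|\varepsilon\Phi_\varepsilon(h)-h\|\le C_\varepsilon$ for all $h\in\mathbb{R}^b$, where $C_\varepsilon\to0$ as $\varepsilon\to0^+$. *)

theory Defs
  imports
    "HOL-Probability.Probability"
    "HOL-Algebra.Group_Action"
    "HOL-Algebra.Product_Groups"
    "HOL-Algebra.Elementary_Groups"
begin

section \<open>Smooth manifolds\<close>

text \<open>
  A manifold is a whole type \<open>'m\<close> with a smooth atlas \<open>A\<close>.  The model space is a type of
  sort \<open>{real_inner, heine_borel}\<close>, that is, a finite-dimensional inner product space: a normed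
  space is finite-dimensional iff its bounded sequences have convergent subsequences.  Unlike
  \<^class>\<open>euclidean_space\<close>, this sort does not exclude dimension 0.

  A chart is a pair of a domain and a coordinate map; the map is irrelevant outside the domain.
\<close>

type_synonym ('m, 'e) chart = "'m set \<times> ('m \<Rightarrow> 'e)"

abbreviation chart_inv :: "('m, 'e) chart \<Rightarrow> 'e \<Rightarrow> 'm" where
  "chart_inv c \<equiv> inv_into (fst c) (snd c)"

abbreviation chart_image :: "('m, 'e) chart \<Rightarrow> 'e set" where
  "chart_image c \<equiv> snd c ` fst c"

text \<open>\<open>Ck_on k S f\<close>: \<open>f\<close> is of class \<open>C^k\<close> on \<open>S\<close>.  Only used for open \<open>S\<close> and
  finite-dimensional domains, where continuity of the derivative can be tested directionwise.\<close>

primrec Ck_on ::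
  "nat \<Rightarrow> 'a::real_normed_vector set \<Rightarrow> ('a \<Rightarrow> 'b::real_normed_vector) \<Rightarrow> bool" where
  "Ck_on 0 S f \<longleftrightarrow> continuous_on S f"
| "Ck_on (Suc k) S f \<longleftrightarrow> (\<forall>x\<in>S. f differentiable (at x)) \<and>
     (\<forall>v. Ck_on k S (\<lambda>x. frechet_derivative f (at x) v))"

definition smooth_on ::
  "'a::real_normed_vector set \<Rightarrow> ('a \<Rightarrow> 'b::real_normed_vector) \<Rightarrow> bool" where
  "smooth_on S f \<longleftrightarrow> (\<forall>k. Ck_on k S f)"

definition smooth_atlas ::
  "('m::{t2_space, second_countable_topology}, 'e::{real_inner, heine_borel}) chart set \<Rightarrow> bool"
  where
  "smooth_atlas A \<longleftrightarrow>
     (\<Union>c\<in>A. fst c) = UNIV \<and>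
     (\<forall>c\<in>A. open (fst c) \<and> open (chart_image c) \<and>
        homeomorphism (fst c) (chart_image c) (snd c) (chart_inv c)) \<and>
     (\<forall>c\<in>A. \<forall>c'\<in>A. smooth_on (snd c ` (fst c \<inter> fst c')) (snd c' \<circ> chart_inv c))"

text \<open>A tangent vector at \<open>x\<close> is the family of its coordinate representations, one for each
  chart around \<open>x\<close>, related by the derivatives of the chart transitions.  Linear operations are
  pointwise.\<close>

type_synonym ('m, 'e) tvec = "('m, 'e) chart \<Rightarrow> 'e"
type_synonym ('m, 'e) covec = "('m, 'e) tvec \<Rightarrow> real"

definition tangent_space ::
  "('m, 'e::real_inner) chart set \<Rightarrow> 'm \<Rightarrow> ('m, 'e) tvec set" where
  "tangent_space A x = {v.
     (\<forall>c. \<not> (c \<in> A \<and> x \<in> fst c) \<longrightarrow> v c = 0) \<and>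
     (\<forall>c\<in>A. \<forall>c'\<in>A. x \<in> fst c \<longrightarrow> x \<in> fst c' \<longrightarrow>
        v c' = frechet_derivative (snd c' \<circ> chart_inv c) (at (snd c x)) (v c))}"

text \<open>The tangent vector at \<open>x\<close> with coordinates \<open>a\<close> in the chart \<open>c\<close>.\<close>

definition tvec_of ::
  "('m, 'e::real_inner) chart set \<Rightarrow> ('m, 'e) chart \<Rightarrow> 'm \<Rightarrow> 'e \<Rightarrow> ('m, 'e) tvec" where
  "tvec_of A c x a = (\<lambda>c'. if c' \<in> A \<and> x \<in> fst c'
     then frechet_derivative (snd c' \<circ> chart_inv c) (at (snd c x)) a else 0)"

text \<open>Covectors are linear forms on the tangent space, extended by 0 to the ambient type.\<close>

definition cotangent_space ::
  "('m, 'e::real_inner) chart set \<Rightarrow> 'm \<Rightarrow> ('m, 'e) covec set" where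
  "cotangent_space A x = {p.
     (\<forall>v\<in>tangent_space A x. \<forall>w\<in>tangent_space A x. \<forall>a b.
        p (\<lambda>c. a *\<^sub>R v c + b *\<^sub>R w c) = a * p v + b * p w) \<and>
     (\<forall>v. v \<notin> tangent_space A x \<longrightarrow> p v = 0)}"

definition cotangent_bundle ::
  "('m, 'e::real_inner) chart set \<Rightarrow> ('m \<times> ('m, 'e) covec) set" where
  "cotangent_bundle A = (SIGMA x:UNIV. cotangent_space A x)"

text \<open>The inverse of the bundle chart of \<open>T*M\<close> induced by \<open>c\<close>, defined on
  \<open>chart_image c \<times> UNIV\<close>; linear forms on \<open>'e\<close> are represented by vectors through the inner
  product.\<close>

definition cot_param ::
  "('m, 'e::real_inner) chart set \<Rightarrow> ('m, 'e) chart \<Rightarrow> 'e \<times> 'e \<Rightarrow> 'm \<times> ('m, 'e) covec" where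
  "cot_param A c = (\<lambda>(y, \<xi>). (chart_inv c y,
     \<lambda>v. if v \<in> tangent_space A (chart_inv c y) then inner \<xi> (v c) else 0))"

definition cot_topology ::
  "('m, 'e::real_inner) chart set \<Rightarrow> ('m \<times> ('m, 'e) covec) topology" where
  "cot_topology A = topology (\<lambda>S. S \<subseteq> cotangent_bundle A \<and>
     (\<forall>c\<in>A. open {z \<in> chart_image c \<times> UNIV. cot_param A c z \<in> S}))"

definition smooth_map ::
  "('m::topological_space, 'e::real_inner) chart set \<Rightarrow> ('m \<Rightarrow> 'm) \<Rightarrow> bool" where
  "smooth_map A f \<longleftrightarrow> continuous_on UNIV f \<and>
     (\<forall>c\<in>A. \<forall>c'\<in>A. smooth_on (snd c ` (fst c \<inter> f -` fst c')) (snd c' \<circ> f \<circ> chart_inv c))"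

text \<open>The differential of \<open>f\<close> at \<open>x\<close>, computed in some chart around \<open>x\<close>; on tangent vectors
  the result does not depend on the choice.\<close>

definition differential ::
  "('m, 'e::real_inner) chart set \<Rightarrow> ('m \<Rightarrow> 'm) \<Rightarrow> 'm \<Rightarrow> ('m, 'e) tvec \<Rightarrow> ('m, 'e) tvec" where
  "differential A f x v = (let c = (SOME c. c \<in> A \<and> x \<in> fst c) in
     (\<lambda>c'. if c' \<in> A \<and> f x \<in> fst c'
        then frechet_derivative (snd c' \<circ> f \<circ> chart_inv c) (at (snd c x)) (v c) else 0))"

text \<open>\<open>(x, p)\<close> is sent to \<open>(f x, p \<circ> (d f\<^sub>x)\<^sup>-\<^sup>1)\<close>, for a diffeomorphism \<open>f\<close>.\<close>

definition cot_lift :: "('m, 'e::real_inner) chart set \<Rightarrow> ('m \<Rightarrow> 'm) \<Rightarrow>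
    'm \<times> ('m, 'e) covec \<Rightarrow> 'm \<times> ('m, 'e) covec" where
  "cot_lift A f = (\<lambda>(x, p). (f x,
     \<lambda>w. if w \<in> tangent_space A (f x)
         then p (inv_into (tangent_space A x) (differential A f x) w) else 0))"

section \<open>Curves and Riemannian metrics\<close>

definition velocity ::
  "('m, 'e::real_inner) chart set \<Rightarrow> (real \<Rightarrow> 'm) \<Rightarrow> real \<Rightarrow> ('m, 'e) tvec" where
  "velocity A \<gamma> s = (\<lambda>c. if c \<in> A \<and> \<gamma> s \<in> fst c
     then vector_derivative (snd c \<circ> \<gamma>) (at s) else 0)"

definition riemannian_metric :: "('m, 'e::real_inner) chart set \<Rightarrow>
    ('m \<Rightarrow> ('m, 'e) tvec \<Rightarrow> ('m, 'e) tvec \<Rightarrow> real) \<Rightarrow> bool" where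
  "riemannian_metric A \<rho> \<longleftrightarrow>
     (\<forall>x. \<forall>u\<in>tangent_space A x. \<forall>v\<in>tangent_space A x. \<forall>w\<in>tangent_space A x. \<forall>a b.
        \<rho> x (\<lambda>c. a *\<^sub>R u c + b *\<^sub>R v c) w = a * \<rho> x u w + b * \<rho> x v w) \<and>
     (\<forall>x. \<forall>v\<in>tangent_space A x. \<forall>w\<in>tangent_space A x. \<rho> x v w = \<rho> x w v) \<and>
     (\<forall>x. \<forall>v\<in>tangent_space A x. v \<noteq> (\<lambda>c. 0) \<longrightarrow> \<rho> x v v > 0) \<and>
     (\<forall>c\<in>A. \<forall>a b. smooth_on (chart_image c)
        (\<lambda>y. \<rho> (chart_inv c y) (tvec_of A c (chart_inv c y) a) (tvec_of A c (chart_inv c y) b)))"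

definition riem_norm :: "('m \<Rightarrow> ('m, 'e) tvec \<Rightarrow> ('m, 'e) tvec \<Rightarrow> real) \<Rightarrow>
    'm \<Rightarrow> ('m, 'e) tvec \<Rightarrow> real" where
  "riem_norm \<rho> x v = sqrt (\<rho> x v v)"

definition dual_norm :: "('m, 'e::real_inner) chart set \<Rightarrow>
    ('m \<Rightarrow> ('m, 'e) tvec \<Rightarrow> ('m, 'e) tvec \<Rightarrow> real) \<Rightarrow> 'm \<Rightarrow> ('m, 'e) covec \<Rightarrow> real" where
  "dual_norm A \<rho> x p = (SUP v\<in>{v \<in> tangent_space A x. riem_norm \<rho> x v \<le> 1}. \<bar>p v\<bar>)"

definition pw_C1_path ::
  "('m::topological_space, 'e::real_inner) chart set \<Rightarrow> (real \<Rightarrow> 'm) \<Rightarrow> bool" where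
  "pw_C1_path A \<gamma> \<longleftrightarrow> continuous_on {0..1} \<gamma> \<and>
     (\<exists>S. finite S \<and>
        (\<forall>c\<in>A. (snd c \<circ> \<gamma>) C1_differentiable_on ({s\<in>{0..1}. \<gamma> s \<in> fst c} - S)))"

text \<open>As in the library's \<open>piecewise_C1_differentiable_on\<close>, the derivative may be unbounded near
  the exceptional points.  The length is therefore taken in \<^typ>\<open>ennreal\<close>, so that paths of
  infinite length do not contribute to the distance.\<close>

definition curve_length :: "('m, 'e::real_inner) chart set \<Rightarrow>
    ('m \<Rightarrow> ('m, 'e) tvec \<Rightarrow> ('m, 'e) tvec \<Rightarrow> real) \<Rightarrow> (real \<Rightarrow> 'm) \<Rightarrow> ennreal" where
  "curve_length A \<rho> \<gamma> =
     (\<integral>\<^sup>+ s\<in>{0..1}. ennreal (riem_norm \<rho> (\<gamma> s) (velocity A \<gamma> s)) \<partial>lborel)"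

definition riem_dist :: "('m::topological_space, 'e::real_inner) chart set \<Rightarrow>
    ('m \<Rightarrow> ('m, 'e) tvec \<Rightarrow> ('m, 'e) tvec \<Rightarrow> real) \<Rightarrow> 'm \<Rightarrow> 'm \<Rightarrow> real" where
  "riem_dist A \<rho> x y =
     enn2real (INF \<gamma>\<in>{\<gamma>. pw_C1_path A \<gamma> \<and> \<gamma> 0 = x \<and> \<gamma> 1 = y}. curve_length A \<rho> \<gamma>)"

definition riem_complete :: "('m::topological_space, 'e::real_inner) chart set \<Rightarrow>
    ('m \<Rightarrow> ('m, 'e) tvec \<Rightarrow> ('m, 'e) tvec \<Rightarrow> real) \<Rightarrow> bool" where
  "riem_complete A \<rho> \<longleftrightarrow> Metric_space.mcomplete UNIV (riem_dist A \<rho>)"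

definition riem_isometry :: "('m::topological_space, 'e::real_inner) chart set \<Rightarrow>
    ('m \<Rightarrow> ('m, 'e) tvec \<Rightarrow> ('m, 'e) tvec \<Rightarrow> real) \<Rightarrow> ('m \<Rightarrow> 'm) \<Rightarrow> bool" where
  "riem_isometry A \<rho> f \<longleftrightarrow> bij f \<and> smooth_map A f \<and> smooth_map A (inv_into UNIV f) \<and>
     (\<forall>x. \<forall>v\<in>tangent_space A x. \<forall>w\<in>tangent_space A x.
        \<rho> (f x) (differential A f x v) (differential A f x w) = \<rho> x v w)"

definition abs_cont_curve :: "('m \<Rightarrow> 'm \<Rightarrow> real) \<Rightarrow> real \<Rightarrow> real \<Rightarrow> (real \<Rightarrow> 'm) \<Rightarrow> bool" where
  "abs_cont_curve d a b \<gamma> \<longleftrightarrow> (\<forall>e>0. \<exists>\<delta>>0. \<forall>(n::nat) (s::nat \<Rightarrow> real) (t::nat \<Rightarrow> real).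
     (\<forall>i<n. a \<le> s i \<and> s i \<le> t i \<and> t i \<le> b) \<longrightarrow>
     (\<forall>i<n. \<forall>j<n. i \<noteq> j \<longrightarrow> {s i<..<t i} \<inter> {s j<..<t j} = {}) \<longrightarrow>
     (\<Sum>i<n. t i - s i) < \<delta> \<longrightarrow>
     (\<Sum>i<n. d (\<gamma> (s i)) (\<gamma> (t i))) < e)"

section \<open>Lagrangian and minimal action\<close>

definition lagrangian :: "('m, 'e::real_inner) chart set \<Rightarrow>
    ('m \<times> ('m, 'e) covec \<Rightarrow> 'w \<Rightarrow> real) \<Rightarrow> 'm \<Rightarrow> ('m, 'e) tvec \<Rightarrow> 'w \<Rightarrow> real" where
  "lagrangian A H x q \<omega> = (SUP p\<in>cotangent_space A x. p q - H (x, p) \<omega>)"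

definition lagrangian_eps :: "('m, 'e::real_inner) chart set \<Rightarrow>
    ('m \<times> ('m, 'e) covec \<Rightarrow> 'w \<Rightarrow> real) \<Rightarrow> real \<Rightarrow> 'm \<Rightarrow> ('m, 'e) tvec \<Rightarrow> 'w \<Rightarrow> real" where
  "lagrangian_eps A H \<epsilon> x q \<omega> = lagrangian A H x (\<lambda>c. \<epsilon> *\<^sub>R q c) \<omega>"

text \<open>The integral of a function bounded from below, with value \<open>\<infinity>\<close> if it is not integrable.\<close>

definition ext_integral :: "real set \<Rightarrow> (real \<Rightarrow> real) \<Rightarrow> ereal" where
  "ext_integral I f =
     enn2ereal (\<integral>\<^sup>+ s\<in>I. ennreal (f s) \<partial>lborel) - enn2ereal (\<integral>\<^sup>+ s\<in>I. ennreal (- f s) \<partial>lborel)"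

definition min_action :: "('m::topological_space, 'e::real_inner) chart set \<Rightarrow>
    ('m \<Rightarrow> ('m, 'e) tvec \<Rightarrow> ('m, 'e) tvec \<Rightarrow> real) \<Rightarrow> ('m \<times> ('m, 'e) covec \<Rightarrow> 'w \<Rightarrow> real) \<Rightarrow>
    real \<Rightarrow> 'm \<Rightarrow> 'm \<Rightarrow> real \<Rightarrow> 'w \<Rightarrow> ereal" where
  "min_action A \<rho> H \<epsilon> x' x t \<omega> =
     (INF \<gamma>\<in>{\<gamma>. abs_cont_curve (riem_dist A \<rho>) 0 t \<gamma> \<and> \<gamma> 0 = x' \<and> \<gamma> t = x}.
        ext_integral {0..t} (\<lambda>s. lagrangian_eps A H \<epsilon> (\<gamma> s) (velocity A \<gamma> s) \<omega>))"

section \<open>Group actions\<close>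

definition free_action :: "('g, 'r) monoid_scheme \<Rightarrow> ('g \<Rightarrow> 'm \<Rightarrow> 'm) \<Rightarrow> bool" where
  "free_action G \<alpha> \<longleftrightarrow> (\<forall>g\<in>carrier G. (\<exists>x. \<alpha> g x = x) \<longrightarrow> g = \<one>\<^bsub>G\<^esub>)"

definition totally_discontinuous_action ::
  "('g, 'r) monoid_scheme \<Rightarrow> ('g \<Rightarrow> 'm::topological_space \<Rightarrow> 'm) \<Rightarrow> bool" where
  "totally_discontinuous_action G \<alpha> \<longleftrightarrow>
     (\<forall>x. \<exists>U. open U \<and> x \<in> U \<and> (\<forall>g\<in>carrier G. \<alpha> g x \<noteq> x \<longrightarrow> \<alpha> g ` U \<inter> U = {}))"

definition orbit_topology ::
  "('g, 'r) monoid_scheme \<Rightarrow> ('g \<Rightarrow> 'm::topological_space \<Rightarrow> 'm) \<Rightarrow> 'm set topology" where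
  "orbit_topology G \<alpha> =
     topology (\<lambda>S. S \<subseteq> orbits G UNIV \<alpha> \<and> open {x. orbit G \<alpha> x \<in> S})"

definition cocompact_action ::
  "('g, 'r) monoid_scheme \<Rightarrow> ('g \<Rightarrow> 'm::topological_space \<Rightarrow> 'm) \<Rightarrow> bool" where
  "cocompact_action G \<alpha> \<longleftrightarrow> compact_space (orbit_topology G \<alpha>)"

text \<open>\<open>\<real>\<^sup>b\<close> and \<open>\<int>\<^sup>b\<close> consist of functions on \<open>{..<b}\<close>; for \<open>b = 0\<close> they have one
  element.\<close>

definition Rpow :: "nat \<Rightarrow> (nat \<Rightarrow> real) set" where
  "Rpow b = (\<Pi>\<^sub>E i\<in>{..<b}. UNIV)"

definition Zpow :: "nat \<Rightarrow> (nat \<Rightarrow> int) monoid" where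
  "Zpow b = product_group {..<b} (\<lambda>_. integer_group)"

section \<open>Probability\<close>

definition borel_of :: "'a topology \<Rightarrow> 'a measure" where
  "borel_of X = sigma (topspace X) {U. openin X U}"

text \<open>The space \<open>C(X)\<close> of continuous real functions with uniform convergence on compact sets;
  a set in the subbase is a neighbourhood of \<open>f\<close> because \<open>\<bar>f' - f\<bar>\<close> attains its maximum
  on \<open>K\<close>.\<close>

definition cont_funs :: "'a topology \<Rightarrow> ('a \<Rightarrow> real) set" where
  "cont_funs X = {f \<in> extensional (topspace X). continuous_map X euclideanreal f}"

definition compact_conv_topology :: "'a topology \<Rightarrow> ('a \<Rightarrow> real) topology" where
  "compact_conv_topology X = topology_generated_by
     {{f' \<in> cont_funs X. \<forall>z\<in>K. \<bar>f' z - f z\<bar> < r} | f K r.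
        f \<in> cont_funs X \<and> compactin X K \<and> 0 < r}"

definition dynamical_system ::
  "('g, 'r) monoid_scheme \<Rightarrow> 'g topology \<Rightarrow> 'w measure \<Rightarrow> ('g \<Rightarrow> 'w \<Rightarrow> 'w) \<Rightarrow> bool" where
  "dynamical_system G \<T> P \<tau> \<longleftrightarrow>
     (\<forall>g\<in>carrier G. \<forall>g'\<in>carrier G. \<forall>\<omega>\<in>space P. \<tau> (g \<otimes>\<^bsub>G\<^esub> g') \<omega> = \<tau> g (\<tau> g' \<omega>)) \<and>
     (\<forall>g\<in>carrier G. \<tau> g \<in> P \<rightarrow>\<^sub>M P) \<and>
     (\<forall>g\<in>carrier G. \<forall>E\<in>sets P. \<tau> g ` E \<in> sets P \<and> measure P (\<tau> g ` E) = measure P E) \<and>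
     (\<lambda>(g, \<omega>). \<tau> g \<omega>) \<in> borel_of \<T> \<Otimes>\<^sub>M P \<rightarrow>\<^sub>M P"

definition ergodic_system ::
  "('g, 'r) monoid_scheme \<Rightarrow> 'w measure \<Rightarrow> ('g \<Rightarrow> 'w \<Rightarrow> 'w) \<Rightarrow> bool" where
  "ergodic_system G P \<tau> \<longleftrightarrow>
     (\<forall>E\<in>sets P. (\<forall>g\<in>carrier G. measure P (sym_diff (\<tau> g ` E) E) = 0) \<longrightarrow>
        measure P E \<in> {0, 1})"

definition superlinearly_coercive :: "(real \<Rightarrow> real) \<Rightarrow> bool" where
  "superlinearly_coercive f \<longleftrightarrow> filterlim (\<lambda>r. f r / r) at_top at_top"

section \<open>The topologies defined through \<open>topology\<close> are topologies\<close>

lemma openin_cot_topology: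
  "openin (cot_topology A) S \<longleftrightarrow> S \<subseteq> cotangent_bundle A \<and>
     (\<forall>c\<in>A. open {z \<in> chart_image c \<times> UNIV. cot_param A c z \<in> S})"
proof -
  let ?T = "\<lambda>S c. {z \<in> chart_image c \<times> UNIV. cot_param A c z \<in> S}"
  have "?T (S \<inter> S') c = ?T S c \<inter> ?T S' c" "?T (\<Union>K) c = (\<Union>S\<in>K. ?T S c)" for S S' K c
    by auto
  then have "istopology (\<lambda>S. S \<subseteq> cotangent_bundle A \<and> (\<forall>c\<in>A. open (?T S c)))"
    unfolding istopology_def by (auto simp only: open_Int intro!: open_UN)
  then show ?thesis
    unfolding cot_topology_def by (simp add: topology_inverse')
qed

lemma openin_orbit_topology:
  "openin (orbit_topology G \<alpha>) S \<longleftrightarrow> S \<subseteq> orbits G UNIV \<alpha> \<and> open {x. orbit G \<alpha> x \<in> S}"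
proof -
  let ?T = "\<lambda>S. {x. orbit G \<alpha> x \<in> S}"
  have "?T (S \<inter> S') = ?T S \<inter> ?T S'" "?T (\<Union>K) = (\<Union>S\<in>K. ?T S)" for S S' K
    by auto
  then have "istopology (\<lambda>S. S \<subseteq> orbits G UNIV \<alpha> \<and> open (?T S))"
    unfolding istopology_def by (auto simp only: open_Int intro!: open_UN)
  then show ?thesis
    unfolding orbit_topology_def by (simp add: topology_inverse')
qed

end

theory Submission imports Defs begin

text \<open>The action is compared with a discrete cost. A chain is a finite sequence of hops; a hop is a straight
segment of a chart, translated by a group element, that is travelled in time \<open>s\<close> at a cost \<open>s * B\<close>, where
\<open>B\<close> bounds the Lagrangian along the segment. Let \<open>cost \<omega> x y t\<close> be the infimum of the costs of the
chains that lead from \<open>x\<close> to \<open>y\<close> in time exactly \<open>t\<close>. It is subadditive under concatenation; it is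
stationary, \<open>cost \<omega> (\<alpha> g x) (\<alpha> g y) t = cost (\<tau> g \<omega>) x y t\<close>, since a group element only relabels the
hops; and it is measurable in \<open>\<omega>\<close>, since a chain keeps its cost up to a small error when the Hamiltonian
is changed slightly on a compact set (\<open>reach_measurable\<close>).

Chains and curves are interchangeable at the scale of the limit. A chain of duration \<open>1 / \<epsilon>\<close> and cost
\<open>c\<close> is a piecewise smooth curve of rescaled action at most \<open>\<epsilon> * c\<close> (\<open>reach_min_action\<close>). Conversely,
an absolutely continuous curve of finite action yields a chain with almost the same duration and cost
(\<open>curve_to_chain\<close>). There a short piece of the curve is replaced by a straight segment in a chart, and the
Lagrangian is bounded from below by a linear form that is frozen on the piece. This rests on the
fundamental theorem of calculus for absolutely continuous functions (\<open>abs_cont_local_FTC\<close>), which is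
derived from Vitali's covering theorem and the Radon-Nikodym theorem.

Fix a base point \<open>x\<close>, a lattice vector \<open>z\<close>, with group element \<open>shift z\<close>, and a period \<open>N\<close>. The costs from
\<open>x\<close> to the translates of \<open>x\<close> by the powers of \<open>shift z\<close>, the \<open>n\<close>-th in time \<open>n * N\<close>, form a subadditive
process over the measure preserving map \<open>\<tau> (shift z)\<close>. This map alone need not be ergodic. But shifting
\<open>\<omega>\<close> by any group element moves both endpoints by that element, which changes the costs by a bounded amount
if a few more periods are allowed; so the lower and the upper limit of the averages are invariant under all
of \<open>G\<close>, hence almost surely constant. Two applications of the covering argument behind Kingman's
theorem (\<open>tiling\<close>) show that the two constants agree (\<open>subadditive_limits_agree\<close>). As there are countably
many pairs \<open>(z, N)\<close>, all these limits \<open>l\<close> exist on one event of probability 1.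

On this event the rest is deterministic. If \<open>z / N\<close> is within \<open>\<eta>\<close> of \<open>h\<close>, then the target point, which
is the translate of the starting point by about \<open>h / \<epsilon>\<close>, is at a distance of order \<open>\<eta> / \<epsilon>\<close> from the ray
of multiples of \<open>z\<close>, because the length of connecting chains grows at most linearly in the lattice
(\<open>linear_growth\<close>). Inserting connecting chains that take a time of order \<open>\<eta> / \<epsilon>\<close> therefore has a cost
of order \<open>\<eta> / \<epsilon>\<close>, and the rescaled action lies within \<open>D * \<eta>\<close> of \<open>l / N\<close> for small \<open>\<epsilon>\<close>, with \<open>D\<close>
depending only on \<open>h\<close> (\<open>action_near_ray_cost\<close>). Letting \<open>\<eta>\<close> tend to 0 along rational approximations of
\<open>h\<close> shows that the numbers \<open>l / N\<close> converge, and that the rescaled action has the same limit.\<close>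


section \<open>A subadditive ergodic theorem with constant limits\<close>

lemma distr_funpow_eq:
  assumes T: "T \<in> M \<rightarrow>\<^sub>M M" "distr M M T = M"
  shows "T ^^ i \<in> M \<rightarrow>\<^sub>M M" "distr M M (T ^^ i) = M"
proof -
  show *: "T ^^ i \<in> M \<rightarrow>\<^sub>M M" for i
    proof (induction i)
    case (Suc i)
    then show ?case using measurable_comp[OF Suc T(1)] by (simp add: o_def)
  qed (simp add: id_def)
  show "distr M M (T ^^ i) = M"
  proof (induction i)
    case 0
    then show ?case using distr_id[of M] by (simp add: id_def)
  next
    case (Suc i)
    then show ?case
      using distr_distr[OF T(1) *[of i]] T(2) by (simp add: o_def)
  qed
qed

text \<open>Walk along the orbit of \<open>x\<close>: from a point with a good time \<open>n \<le> N\<close> jump \<open>n\<close> steps, at a cost of at most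
\<open>c * n\<close>; from any other point make one step, at a cost of at most \<open>K\<close>. The points without good time form
a set \<open>A N\<close> of small probability, so after integration the single steps contribute little.\<close>

lemma tiling:
  fixes b :: "nat \<Rightarrow> 'a \<Rightarrow> real"
  assumes "prob_space M"
    and T: "T \<in> M \<rightarrow>\<^sub>M M" "distr M M T = M"
    and b[measurable]: "\<And>n. b n \<in> borel_measurable M"
    and sub: "\<And>m n x. x \<in> space M \<Longrightarrow> b (m + n) x \<le> b m x + b n ((T ^^ m) x)"
    and bd: "\<And>n x. x \<in> space M \<Longrightarrow> \<bar>b n x\<bar> \<le> K * real n"
    and good: "AE x in M. \<exists>n\<ge>1. b n x \<le> c * real n"
    and "0 < \<delta>"
  shows "\<exists>m\<ge>1. (\<integral>x. b m x \<partial>M) \<le> (c + \<delta>) * real m"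
proof -
  interpret prob_space M by fact
  obtain x0 where x0: "x0 \<in> space M" using not_empty by auto
  \<comment> \<open>\<open>D\<close> bounds the excess of one step over the budget \<open>c\<close>\<close>
  define D where "D = K + \<bar>c\<bar>"
  have K0: "0 \<le> K" using bd[OF x0, of 1] by (auto intro: order_trans[OF abs_ge_zero])
  then have D0: "0 \<le> D" "c \<le> D" "K \<le> c + D" by (auto simp: D_def)
  define A where "A N = {x \<in> space M. \<not> (\<exists>n\<in>{1..N}. b n x \<le> c * real n)}" for N :: nat
  have A[measurable]: "A N \<in> sets M" for N unfolding A_def by measurable
  have "(\<lambda>N. prob (A N)) \<longlonglongrightarrow> prob (\<Inter>N. A N)"
    by (rule finite_Lim_measure_decseq) (auto simp: decseq_def A_def)
  moreover have "prob (\<Inter>N. A N) = 0"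
  proof -
    have "AE x in M. x \<notin> (\<Inter>N. A N)"
      using good by eventually_elim (force simp: A_def)
    then show ?thesis by (subst prob_eq_0) auto
  qed
  ultimately have "(\<lambda>N. D * prob (A N)) \<longlonglongrightarrow> 0"
    using tendsto_mult_right_zero by fastforce
  then have "eventually (\<lambda>N. D * prob (A N) < \<delta> / 2) sequentially"
    using \<open>0 < \<delta>\<close> by (intro order_tendstoD) auto
  then obtain N where N: "D * prob (A N) < \<delta> / 2"
    by (auto simp: eventually_sequentially)
  have Tn: "T ^^ i \<in> M \<rightarrow>\<^sub>M M" "distr M M (T ^^ i) = M" for i
    using distr_funpow_eq[OF T] by auto
  have Tsp: "x \<in> space M \<Longrightarrow> (T ^^ i) x \<in> space M" for i x
    using Tn(1)[of i] by (auto simp: measurable_def)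
  \<comment> \<open>the summand \<open>D * N\<close> pays for the last jump, which may overshoot \<open>m\<close>\<close>
  have tile: "b m x \<le> c * real m + D * ((\<Sum>i<m. indicator (A N) ((T ^^ i) x)) + real N)"
    if "x \<in> space M" for m x
    using that
  proof (induction m arbitrary: x rule: less_induct)
    case (less m)
    show ?case
    proof (cases "m = 0")
      case True
      then show ?thesis using bd[OF less.prems, of 0] D0 by auto
    next
      case m0: False
      have split: "(\<Sum>i<m. indicator (A N) ((T ^^ i) x) :: real) =
          (\<Sum>i<k. indicator (A N) ((T ^^ i) x)) + (\<Sum>i<m - k. indicator (A N) ((T ^^ i) ((T ^^ k) x)))"
        if "k \<le> m" for k
      proof -
        have "(\<Sum>i<m. indicator (A N) ((T ^^ i) x) :: real) =
            (\<Sum>i<k. indicator (A N) ((T ^^ i) x)) + (\<Sum>i=k..<m. indicator (A N) ((T ^^ i) x))"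
          using sum.atLeastLessThan_concat[of 0 k m "\<lambda>i. indicator (A N) ((T ^^ i) x) :: real"] that
          by (simp add: atLeast0LessThan)
        also have "(\<Sum>i=k..<m. indicator (A N) ((T ^^ i) x)) =
            (\<Sum>i=0..<m-k. indicator (A N) ((T ^^ (i + k)) x) :: real)"
          using sum.shift_bounds_nat_ivl[of "\<lambda>i. indicator (A N) ((T ^^ i) x) :: real" 0 k "m - k"] that
          by simp
        finally show ?thesis by (simp add: funpow_add atLeast0LessThan)
      qed
      have nn: "0 \<le> (\<Sum>i<k. indicator (A N) ((T ^^ i) y) :: real)" for k y
        by (intro sum_nonneg) auto
      show ?thesis
      proof (cases "x \<in> A N")
        case True
        have "b m x \<le> b 1 x + b (m - 1) (T x)"
          using sub[OF less.prems, of 1 "m - 1"] m0 by simp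
        also have "b 1 x \<le> c + D" using bd[OF less.prems, of 1] D0 by auto
        also have "b (m - 1) (T x) \<le> c * real (m - 1) +
            D * ((\<Sum>i<m-1. indicator (A N) ((T ^^ i) (T x))) + real N)"
          using less.IH[of "m-1" "T x"] m0 Tsp[OF less.prems, of 1] by simp
        finally show ?thesis using split[of 1] m0 True by (simp add: algebra_simps of_nat_diff)
      next
        case False
        then obtain n where n: "1 \<le> n" "n \<le> N" "b n x \<le> c * real n"
          using less.prems by (auto simp: A_def)
        show ?thesis
        proof (cases "n \<le> m")
          case True
          have "b m x \<le> b n x + b (m - n) ((T ^^ n) x)"
            using sub[OF less.prems, of n "m - n"] True by simp
          also have "b (m - n) ((T ^^ n) x) \<le> c * real (m - n) +
              D * ((\<Sum>i<m-n. indicator (A N) ((T ^^ i) ((T ^^ n) x))) + real N)"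
            using less.IH[of "m-n" "(T ^^ n) x"] n True m0 Tsp[OF less.prems] by simp
          finally have "b m x \<le> c * real m + D * ((\<Sum>i<m-n. indicator (A N) ((T ^^ i) ((T ^^ n) x))) + real N)"
            using n True by (simp add: algebra_simps of_nat_diff)
          also have "\<dots> \<le> c * real m + D * ((\<Sum>i<m. indicator (A N) ((T ^^ i) x)) + real N)"
            using split[OF True] nn[of x n] D0 by (intro add_left_mono mult_left_mono) auto
          finally show ?thesis .
        next
          case False
          have "b m x \<le> K * real m" using bd[OF less.prems, of m] by auto
          also have "\<dots> \<le> (c + D) * real m" using D0 by (intro mult_right_mono) auto
          also have "D * real m \<le> D * real N" using D0 n False by (intro mult_left_mono) auto
          then have "(c + D) * real m \<le> c * real m + D * real N" by (simp add: algebra_simps)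
          also have "\<dots> \<le> c * real m + D * ((\<Sum>i<m. indicator (A N) ((T ^^ i) x)) + real N)"
            using nn[of x m] D0 by (intro add_left_mono mult_left_mono) auto
          finally show ?thesis .
        qed
      qed
    qed
  qed
  have int_ind: "(\<integral>x. indicator (A N) ((T ^^ i) x) \<partial>M) = prob (A N)" for i
    using integral_distr[OF Tn(1)[of i], of "indicator (A N) :: _ \<Rightarrow> real"] Tn(2)[of i]
    by simp
  have meas_ind[measurable]: "(\<lambda>x. indicator (A N) ((T ^^ i) x) :: real) \<in> borel_measurable M" for i
    by (rule measurable_compose[OF Tn(1) borel_measurable_indicator[OF A]])
  have integ_ind: "integrable M (\<lambda>x. indicator (A N) ((T ^^ i) x) :: real)" for i
    by (rule integrable_const_bound[of _ 1, OF _ meas_ind]) (simp add: indicator_def)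
  have bint: "integrable M (b m)" for m
    by (rule integrable_const_bound[of _ "K * real m"]) (auto intro!: bd)
  have Eb: "(\<integral>x. b m x \<partial>M) \<le> c * real m + D * (real m * prob (A N) + real N)" for m
  proof -
    have "(\<integral>x. b m x \<partial>M) \<le> (\<integral>x. c * real m + D * ((\<Sum>i<m. indicator (A N) ((T ^^ i) x)) + real N) \<partial>M)"
      by (rule integral_mono[OF bint]) (use tile integ_ind in \<open>auto intro!: Bochner_Integration.integrable_add integrable_mult_right Bochner_Integration.integrable_sum\<close>)
    also have "\<dots> = c * real m + D * (real m * prob (A N) + real N)"
      using integ_ind by (simp add: int_ind prob_space)
    finally show ?thesis .
  qed
  obtain m :: nat where m: "D * real N / (\<delta> / 2) < real m" using reals_Archimedean2 by blast
  have m': "D * real N \<le> (\<delta> / 2) * real m" using m \<open>0 < \<delta>\<close> by (simp add: field_simps)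
  have "0 \<le> D * real N / (\<delta> / 2)" using D0 \<open>0 < \<delta>\<close> by auto
  then have m1: "m \<ge> 1" using m by (cases m) auto
  have "(\<integral>x. b m x \<partial>M) \<le> c * real m + real m * (D * prob (A N)) + D * real N"
    using Eb[of m] by (simp add: algebra_simps)
  also have "\<dots> \<le> c * real m + real m * (\<delta> / 2) + (\<delta> / 2) * real m"
    using mult_left_mono[of "D * prob (A N)" "\<delta> / 2" "real m"] N m' by (auto simp: mult.commute[of \<delta>])
  finally show ?thesis using m1 by (auto simp: algebra_simps)
qed

text \<open>By the tiling lemma for \<open>a\<close>, some \<open>a m\<close> has mean at most \<open>(l + 2 * \<delta>) * m\<close>. The Birkhoff sums of \<open>a m\<close>
over \<open>T ^^ m\<close> dominate \<open>a\<close> along the multiples of \<open>m\<close>, so they often exceed \<open>(u - 2 * \<delta>) * m\<close> per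
step. The tiling lemma for the negatives of these sums, which are additive, then bounds the same mean from
below.\<close>

theorem subadditive_limits_agree:
  fixes a :: "nat \<Rightarrow> 'a \<Rightarrow> real"
  assumes P: "prob_space M"
    and T: "T \<in> M \<rightarrow>\<^sub>M M" "distr M M T = M"
    and a[measurable]: "\<And>n. a n \<in> borel_measurable M"
    and sub: "\<And>m n x. x \<in> space M \<Longrightarrow> a (m + n) x \<le> a m x + a n ((T ^^ m) x)"
    and bd: "\<And>n x. x \<in> space M \<Longrightarrow> \<bar>a n x\<bar> \<le> K * real n"
    and low: "\<And>\<delta>. 0 < \<delta> \<Longrightarrow> AE x in M. \<exists>\<^sub>F n in sequentially. a n x \<le> (l + \<delta>) * real n"
    and up: "\<And>\<delta>. 0 < \<delta> \<Longrightarrow> AE x in M. \<exists>\<^sub>F n in sequentially. (u - \<delta>) * real n \<le> a n x"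
  shows "u \<le> l"
proof (rule field_le_epsilon)
  fix e :: real assume "0 < e"
  define \<delta> where "\<delta> = e / 5"
  have \<delta>: "0 < \<delta>" using \<open>0 < e\<close> by (simp add: \<delta>_def)
  interpret prob_space M by fact
  obtain x0 where x0: "x0 \<in> space M" using not_empty by auto
  have K0: "0 \<le> K" using bd[OF x0, of 1] by (auto intro: order_trans[OF abs_ge_zero])
  have "AE x in M. \<exists>n\<ge>1. a n x \<le> (l + \<delta>) * real n"
    using low[OF \<delta>] by eventually_elim (auto simp: frequently_sequentially)
  from tiling[OF P T a sub bd this \<delta>]
  obtain m where m: "m \<ge> 1" "(\<integral>x. a m x \<partial>M) \<le> (l + \<delta> + \<delta>) * real m" by auto
  define S where "S = T ^^ m"
  have Tn: "T ^^ i \<in> M \<rightarrow>\<^sub>M M" "distr M M (T ^^ i) = M" for i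
    using distr_funpow_eq[OF T] by auto
  have Tsp: "x \<in> space M \<Longrightarrow> (T ^^ i) x \<in> space M" for i x
    using Tn(1)[of i] by (auto simp: measurable_def)
  have S: "S \<in> M \<rightarrow>\<^sub>M M" "distr M M S = M" using Tn by (auto simp: S_def)
  have Sn: "S ^^ i \<in> M \<rightarrow>\<^sub>M M" "distr M M (S ^^ i) = M" for i
    using distr_funpow_eq[OF S] by auto
  have Ssp: "x \<in> space M \<Longrightarrow> (S ^^ i) x \<in> space M" for i x
    using Sn(1)[of i] by (auto simp: measurable_def)
  have Spow: "S ^^ i = T ^^ (m * i)" for i by (simp add: S_def funpow_mult)
  define b where "b n x = - (\<Sum>i<n. a m ((S ^^ i) x))" for n x
  have aS[measurable]: "(\<lambda>x. a m ((S ^^ i) x)) \<in> borel_measurable M" for i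
    using measurable_compose[OF Sn(1)[of i] a[of m]] by simp
  have block: "a (m * n) x \<le> - b n x" if "x \<in> space M" for n x
    using that
  proof (induction n)
    case 0
    then show ?case using bd[of x 0] by (simp add: b_def)
  next
    case (Suc n)
    have "a (m * Suc n) x \<le> a (m * n) x + a m ((S ^^ n) x)"
      using sub[OF Suc.prems, of "m * n" m] by (simp add: Spow algebra_simps)
    then show ?case using Suc by (simp add: b_def)
  qed
  have "AE x in M. \<exists>n\<ge>1. b n x \<le> (- (u - 2 * \<delta>) * real m) * real n"
    using up[OF \<delta>] AE_space
  proof eventually_elim
    fix x assume fr: "\<exists>\<^sub>F n in sequentially. (u - \<delta>) * real n \<le> a n x" and x: "x \<in> space M"
    obtain N0 :: nat where N0: "(\<bar>u - \<delta>\<bar> * real m + K * real m) / (\<delta> * real m) < real N0"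
      using reals_Archimedean2 by blast
    obtain N where N: "N \<ge> m * (N0 + 1)" "(u - \<delta>) * real N \<le> a N x"
      using fr by (auto simp: frequently_sequentially)
    define n where "n = N div m"
    define r where "r = N mod m"
    have Nr: "N = m * n + r" "r < m" using m by (auto simp: n_def r_def)
    have nN0: "n \<ge> N0 + 1" using N(1) m by (simp add: n_def less_eq_div_iff_mult_less_eq mult.commute)
    \<comment> \<open>\<open>N\<close> is so large that the incomplete last block does not matter\<close>
    have nbig: "\<bar>u - \<delta>\<bar> * real m + K * real m \<le> \<delta> * real m * real n"
    proof -
      have "(\<bar>u - \<delta>\<bar> * real m + K * real m) / (\<delta> * real m) \<le> real n" using N0 nN0 by linarith
      then show ?thesis using \<delta> m by (simp add: pos_divide_le_eq mult.commute mult.left_commute)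
    qed
    have "a N x \<le> a (m * n) x + a r ((T ^^ (m * n)) x)" using sub[OF x, of "m * n" r] Nr by simp
    also have "a r ((T ^^ (m * n)) x) \<le> K * real m"
      using bd[OF Tsp[OF x], of r "m*n"] K0 Nr mult_left_mono[of "real r" "real m" K] by linarith
    finally have 1: "a (m * n) x \<ge> (u - \<delta>) * real N - K * real m" using N by linarith
    have 2: "(u - \<delta>) * real N = (u - \<delta>) * (real m * real n) + (u - \<delta>) * real r"
      using Nr by (simp add: algebra_simps)
    have "\<bar>(u - \<delta>) * real r\<bar> \<le> \<bar>u - \<delta>\<bar> * real m" using Nr by (simp add: abs_mult mult_left_mono)
    then have "a (m * n) x \<ge> (u - \<delta>) * (real m * real n) - \<delta> * real m * real n"
      using nbig 1 2 by linarith
    then have "a (m * n) x \<ge> (u - 2 * \<delta>) * real m * real n" by (simp add: algebra_simps)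
    then show "\<exists>n\<ge>1. b n x \<le> (- (u - 2 * \<delta>) * real m) * real n"
      using block[OF x, of n] nN0 by (intro exI[of _ n]) (auto simp: algebra_simps)
  qed
  moreover have "b (k + n) x \<le> b k x + b n ((S ^^ k) x)" for k n x
  proof -
    have "b (k + n) x = b k x + b n ((S ^^ k) x)"
    proof (induction n)
      case (Suc n)
      have e: "(S ^^ (k + n)) x = (S ^^ n) ((S ^^ k) x)"
        by (simp add: funpow_add add.commute[of k n])
      show ?case using Suc by (simp add: b_def e)
    qed (simp add: b_def)
    then show ?thesis by simp
  qed
  moreover have "\<bar>b n x\<bar> \<le> (K * real m) * real n" if "x \<in> space M" for n x
  proof -
    have "\<bar>b n x\<bar> \<le> (\<Sum>i<n. \<bar>a m ((S ^^ i) x)\<bar>)" unfolding b_def by (simp add: sum_abs)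
    also have "\<dots> \<le> (\<Sum>i<n. K * real m)" by (intro sum_mono bd Ssp that)
    finally show ?thesis by (simp add: mult.commute)
  qed
  moreover have "b n \<in> borel_measurable M" for n unfolding b_def by measurable
  ultimately obtain k where k: "k \<ge> 1"
      "(\<integral>x. b k x \<partial>M) \<le> (- (u - 2 * \<delta>) * real m + \<delta> * real m) * real k"
    using tiling[OF P S, of b "K * real m" "- (u - 2 * \<delta>) * real m" "\<delta> * real m"] \<delta> m by auto
  have "(\<integral>x. a m ((S ^^ i) x) \<partial>M) = (\<integral>x. a m x \<partial>M)" for i
    using integral_distr[OF Sn(1)[of i] a[of m]] Sn(2)[of i] by simp
  moreover have "integrable M (\<lambda>x. a m ((S ^^ i) x))" for i
    by (rule integrable_const_bound[of _ "K * real m"]) (auto intro!: bd Ssp)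
  ultimately have "(\<integral>x. b k x \<partial>M) = - (real k * (\<integral>x. a m x \<partial>M))"
    by (simp add: b_def[abs_def])
  then have "real k * (\<integral>x. a m x \<partial>M) \<ge> real k * (((u - 2 * \<delta>) - \<delta>) * real m)"
    using k(2) by (simp add: algebra_simps)
  then have "((u - 2 * \<delta>) - \<delta>) * real m \<le> (\<integral>x. a m x \<partial>M)"
    by (rule mult_left_le_imp_le) (use k(1) in auto)
  then have "(u - 3 * \<delta>) * real m \<le> (l + 2 * \<delta>) * real m" using m(2) by (simp add: algebra_simps)
  then have "u - 3 * \<delta> \<le> l + 2 * \<delta>" using m(1) by simp
  then show "u \<le> l + e" by (simp add: \<delta>_def)
qed

section \<open>Differentiation of indefinite integrals\<close>

text \<open>The measure with density \<open>h - p\<close> on \<open>{h > p}\<close> vanishes on \<open>{h \<le> p}\<close>, hence is small on some open set \<open>U\<close>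
that contains the set in question. Vitali's theorem covers this set, up to a null set, by disjoint
intervals in \<open>U\<close> on which the average of \<open>h\<close> exceeds \<open>q\<close>; the measure of each of them is at least
\<open>q - p\<close> times its length, so their total length is small.\<close>

lemma steep_averages_negligible:
  fixes h f :: "real \<Rightarrow> real"
  assumes h: "integrable lborel h"
    and f: "\<And>x y. a \<le> x \<Longrightarrow> x \<le> y \<Longrightarrow> y \<le> b \<Longrightarrow> f y - f x = (LINT s:{x..y}|lborel. h s)"
    and pq: "p < q"
  shows "negligible {x \<in> {a<..<b}. h x \<le> p \<and>
    (\<forall>e>0. \<exists>c d. c \<le> x \<and> x \<le> d \<and> c < d \<and> d - c < e \<and> q * (d - c) < f d - f c)}"
    (is "negligible ?S")
  unfolding negligible_outer
proof (intro allI impI)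
  fix e :: real assume e: "0 < e"
  have [measurable]: "h \<in> borel_measurable borel" using h by auto
  define \<nu> where "\<nu> = density lborel (\<lambda>x. ennreal (h x - p) * indicator {a<..<b} x)"
  have sets_\<nu>: "sets \<nu> = sets borel" by (simp add: \<nu>_def)
  have int_p: "integrable lborel (\<lambda>x. (h x - p) * indicator {c..d} x)" for c d
  proof -
    have "integrable lborel (\<lambda>x. h x * indicator {c..d} x - p * indicator {c..d} x)"
      by (intro Bochner_Integration.integrable_diff integrable_mult_right integrable_real_mult_indicator h
          integrable_real_indicator) (auto simp: emeasure_lborel_Icc_eq)
    then show ?thesis by (simp add: algebra_simps)
  qed
  have "emeasure \<nu> UNIV < \<infinity>"
  proof -
    have "emeasure \<nu> UNIV \<le> (\<integral>\<^sup>+ x. ennreal (norm ((h x - p) * indicator {a..b} x)) \<partial>lborel)"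
      by (auto simp: \<nu>_def emeasure_density ennreal_leI intro!: nn_integral_mono split: split_indicator)
    also have "\<dots> < \<infinity>"
      using int_p[of a b] by (subst (asm) integrable_iff_bounded) auto
    finally show ?thesis .
  qed
  then have fin: "emeasure \<nu> (space \<nu>) \<noteq> \<infinity>" by (auto simp: \<nu>_def)
  define E where "E = {x \<in> {a<..<b}. h x \<le> p}"
  have E[measurable]: "E \<in> sets borel" unfolding E_def by measurable
  have "emeasure \<nu> E = 0"
    by (auto simp: \<nu>_def emeasure_density E_def nn_integral_0_iff_AE ennreal_neg split: split_indicator intro!: AE_I2)
  then have "(INF U \<in> {U. E \<subseteq> U \<and> open U}. emeasure \<nu> U) < ennreal ((q - p) * e)"
    using outer_regular[OF sets_\<nu> fin E] pq e by simp
  then obtain U where U: "E \<subseteq> U" "open U" "emeasure \<nu> U < ennreal ((q - p) * e)"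
    by (auto simp: INF_less_iff)
  define K where "K = {(c, d). c < d \<and> {c..d} \<subseteq> U \<inter> {a<..<b} \<and> q * (d - c) < f d - f c}"
  define mid where "mid = (\<lambda>(c, d). (c + d) / 2 :: real)"
  define rad where "rad = (\<lambda>(c, d). (d - c) / 2 :: real)"
  have ball: "cball (mid i) (rad i) = {fst i..snd i}" for i
    by (auto simp: mid_def rad_def cball_eq_atLeastAtMost field_simps split: prod.splits)
  have cov: "\<exists>i. i \<in> K \<and> x \<in> cball (mid i) (rad i) \<and> rad i < d" if x: "x \<in> ?S" and "0 < d" for x d
  proof -
    have "x \<in> U \<inter> {a<..<b}" using x U by (auto simp: E_def)
    then obtain r where r: "0 < r" "ball x r \<subseteq> U \<inter> {a<..<b}"
      using U(2) by (metis open_Int open_greaterThanLessThan open_contains_ball)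
    obtain c d' where cd: "c \<le> x" "x \<le> d'" "c < d'" "d' - c < min r d" "q * (d' - c) < f d' - f c"
      using x \<open>0 < r\<close> \<open>0 < d\<close> by (auto dest!: spec[of _ "min r d"])
    have "{c..d'} \<subseteq> ball x r" using cd by (auto simp: dist_real_def)
    then show ?thesis
      using cd r by (intro exI[of _ "(c, d')"]) (auto simp: K_def ball, auto simp: rad_def)
  qed
  have pos: "0 < rad i" if "i \<in> K" for i using that by (auto simp: K_def rad_def)
  obtain C where C: "countable C" "C \<subseteq> K"
      "pairwise (\<lambda>i j. disjnt (cball (mid i) (rad i)) (cball (mid j) (rad j))) C"
      "negligible (?S - (\<Union>i \<in> C. cball (mid i) (rad i)))"
    by (rule Vitali_covering_theorem_cballs[of K rad ?S mid, OF pos cov])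
  define B where "B = (\<Union>i\<in>C. {fst i..snd i})"
  have B[measurable]: "B \<in> sets borel" using C(1) by (auto simp: B_def)
  have BU: "B \<subseteq> U" using C(2) by (fastforce simp: B_def K_def)
  have disj: "disjoint_family_on (\<lambda>i. {fst i..snd i}) C"
    using C(3) by (auto simp: disjoint_family_on_def pairwise_def ball disjnt_def)
  have "ennreal (q - p) * emeasure lborel B
      = ennreal (q - p) * (\<integral>\<^sup>+ i. emeasure lborel {fst i..snd i} \<partial>count_space C)"
    unfolding B_def by (subst emeasure_UN_countable) (use C(1) disj in auto)
  also have "\<dots> = (\<integral>\<^sup>+ i. ennreal (q - p) * emeasure lborel {fst i..snd i} \<partial>count_space C)"
    by (rule nn_integral_cmult[symmetric]) auto
  also have "\<dots> \<le> (\<integral>\<^sup>+ i. emeasure \<nu> {fst i..snd i} \<partial>count_space C)"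
  proof (rule nn_integral_mono)
    fix i assume "i \<in> space (count_space C)"
    then obtain c d where i: "i = (c, d)" "c < d" "{c..d} \<subseteq> U \<inter> {a<..<b}" "q * (d - c) < f d - f c"
      using C(2) by (auto simp: K_def)
    then have "c \<in> U \<inter> {a<..<b}" "d \<in> U \<inter> {a<..<b}" using subsetD[OF i(3), of c] subsetD[OF i(3), of d] by auto
    then have ab: "a \<le> c" "d \<le> b" by auto
    let ?g = "\<lambda>x. (h x - p) * indicator {c..d} x"
    have "(q - p) * (d - c) \<le> (LINT s:{c..d}|lborel. h s) - p * (d - c)"
      using i f[of c d] ab by (simp add: algebra_simps)
    also have "\<dots> = (LINT s|lborel. h s * indicator {c..d} s - p * indicator {c..d} s)"
      using i(2) h by (subst Bochner_Integration.integral_diff)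
        (auto simp: set_lebesgue_integral_def mult.commute intro!: integrable_real_mult_indicator)
    also have "\<dots> = (LINT s|lborel. ?g s)" by (simp add: algebra_simps)
    also have "\<dots> \<le> (LINT s|lborel. max 0 (?g s))"
      by (rule integral_mono) (use int_p in auto)
    finally have "ennreal ((q - p) * (d - c)) \<le> ennreal (LINT s|lborel. max 0 (?g s))"
      by (rule ennreal_leI)
    also have "\<dots> = (\<integral>\<^sup>+ s. ennreal (max 0 (?g s)) \<partial>lborel)"
      by (rule nn_integral_eq_integral[symmetric]) (use int_p in auto)
    also have "\<dots> = emeasure \<nu> {c..d}"
      using i(3) by (auto simp: \<nu>_def emeasure_density max_def ennreal_neg intro!: nn_integral_cong split: split_indicator)
    finally show "ennreal (q - p) * emeasure lborel {fst i..snd i} \<le> emeasure \<nu> {fst i..snd i}"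
      using i pq by (simp add: ennreal_mult)
  qed
  also have "\<dots> = emeasure \<nu> B"
    unfolding B_def by (subst emeasure_UN_countable) (use C(1) disj in \<open>auto simp: sets_\<nu>\<close>)
  also have "\<dots> \<le> emeasure \<nu> U"
    using U(2) BU by (intro emeasure_mono) (auto simp: sets_\<nu>)
  also note U(3)
  finally have "ennreal (q - p) * emeasure lborel B < ennreal (q - p) * ennreal e"
    using pq e by (simp add: ennreal_mult)
  then have Be: "emeasure lborel B < ennreal e"
    using mult_left_mono[of "ennreal e" "emeasure lborel B" "ennreal (q - p)"] by (meson leD not_le_imp_less zero_le)
  have Bf: "B \<in> fmeasurable lebesgue"
    using Be by (intro fmeasurableI) (auto simp: top.not_eq_extremum[symmetric] intro: less_trans)
  have null: "?S - B \<in> null_sets lebesgue"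
    using C(4) by (simp add: B_def ball negligible_iff_null_sets)
  show "\<exists>T. ?S \<subseteq> T \<and> T \<in> lmeasurable \<and> measure lebesgue T < e"
  proof (intro exI conjI)
    show "?S \<subseteq> B \<union> (?S - B)" by blast
    show "B \<union> (?S - B) \<in> lmeasurable"
      using Bf null by (intro fmeasurable.Un) (auto simp: fmeasurable_def null_sets_def)
    have "measure lebesgue (B \<union> (?S - B)) = measure lebesgue B"
      using null by (intro measure_Un_null_set) auto
    also have "\<dots> = measure lborel B" by simp
    also have "\<dots> < e"
    proof -
      have "emeasure lborel B \<noteq> \<infinity>" using Be by (intro notI) simp
      then have "emeasure lborel B = ennreal (measure lborel B)" by (simp add: emeasure_eq_ennreal_measure)
      then show ?thesis using Be by (simp add: ennreal_less_iff)
    qed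
    finally show "measure lebesgue (B \<union> (?S - B)) < e" .
  qed
qed

text \<open>Outside the exceptional sets for \<open>h\<close> and \<open>- h\<close> and all rational \<open>p < q\<close>, the difference quotients over
short intervals around \<open>x\<close> are squeezed to \<open>h x\<close>.\<close>

theorem indefinite_integral_has_derivative_AE:
  fixes h f :: "real \<Rightarrow> real"
  assumes h: "integrable lborel h"
    and f: "\<And>x y. a \<le> x \<Longrightarrow> x \<le> y \<Longrightarrow> y \<le> b \<Longrightarrow> f y - f x = (LINT s:{x..y}|lborel. h s)"
  shows "AE x in lborel. a < x \<and> x < b \<longrightarrow> (f has_real_derivative h x) (at x)"
proof -
  define S where "S g k p q = {x \<in> {a<..<b}. g x \<le> p \<and>
    (\<forall>e>0. \<exists>c d. c \<le> x \<and> x \<le> d \<and> c < d \<and> d - c < e \<and> q * (d - c) < k d - k c)}"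
    for g k :: "real \<Rightarrow> real" and p q :: real
  define Q where "Q = {(p, q). p \<in> \<rat> \<and> q \<in> \<rat> \<and> p < (q::real)}"
  have "countable Q"
    by (rule countable_subset[of _ "\<rat> \<times> \<rat>"]) (auto simp: Q_def countable_rat)
  define N where "N = (\<Union>(p,q)\<in>Q. S h f p q \<union> S (\<lambda>x. - h x) (\<lambda>x. - f x) p q)"
  have "negligible N" unfolding N_def
  proof (intro negligible_countable_Union, safe)
    show "countable ((\<lambda>(p, q). S h f p q \<union> S (\<lambda>x. - h x) (\<lambda>x. - f x) p q) ` Q)"
      using \<open>countable Q\<close> by auto
    fix p q assume "(p, q) \<in> Q"
    then have "p < q" by (auto simp: Q_def)
    have "negligible (S h f p q)"
      unfolding S_def by (rule steep_averages_negligible[OF h f \<open>p < q\<close>])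
    moreover have "negligible (S (\<lambda>x. - h x) (\<lambda>x. - f x) p q)"
      unfolding S_def
    proof (rule steep_averages_negligible[of "\<lambda>x. - h x" a b "\<lambda>x. - f x", OF _ _ \<open>p < q\<close>])
      show "integrable lborel (\<lambda>x. - h x)" using h by simp
      fix x y assume "a \<le> x" "x \<le> y" "y \<le> b"
      then have "f y - f x = (LINT s:{x..y}|lborel. h s)" by (rule f)
      then show "- f y - - f x = (LINT s:{x..y}|lborel. - h s)"
        by (simp add: set_lebesgue_integral_def)
    qed
    ultimately show "negligible (S h f p q \<union> S (\<lambda>x. - h x) (\<lambda>x. - f x) p q)" by simp
  qed
  then have "AE x in lebesgue. x \<notin> N"
    by (auto simp: negligible_iff_null_sets intro: AE_not_in)
  then have "AE x in lborel. x \<notin> N" by (simp add: AE_completion_iff)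
  then show ?thesis
  proof eventually_elim
    fix x assume xN: "x \<notin> N"
    have xN1: "x \<notin> S h f p q" if "(p, q) \<in> Q" for p q using xN that by (auto simp: N_def)
    have xN2: "x \<notin> S (\<lambda>x. - h x) (\<lambda>x. - f x) p q" if "(p, q) \<in> Q" for p q using xN that by (auto simp: N_def)
    show "a < x \<and> x < b \<longrightarrow> (f has_real_derivative h x) (at x)"
    proof
      assume x: "a < x \<and> x < b"
      have slope: "\<exists>r>0. \<forall>c d. c \<le> x \<and> x \<le> d \<and> c < d \<and> d - c < r \<longrightarrow> k d - k c \<le> (g x + e) * (d - c)"
        if "0 < e" and gk: "\<And>p q. (p, q) \<in> Q \<Longrightarrow> x \<notin> S g k p q" for g k e
      proof -
        obtain p where p: "p \<in> \<rat>" "g x < p" "p < g x + e"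
          using Rats_dense_in_real[of "g x" "g x + e"] \<open>0 < e\<close> by auto
        obtain q where q: "q \<in> \<rat>" "p < q" "q < g x + e"
          using Rats_dense_in_real[of p "g x + e"] p by auto
        have "x \<notin> S g k p q" using gk p q by (auto simp: Q_def)
        then obtain r where r0: "r > 0"
          "\<not> (\<exists>c d. c \<le> x \<and> x \<le> d \<and> c < d \<and> d - c < r \<and> q * (d - c) < k d - k c)"
          using x p unfolding S_def by auto
        then have r: "k d - k c \<le> q * (d - c)" if "c \<le> x" "x \<le> d" "c < d" "d - c < r" for c d
          using that not_less by blast
        have "q * (d - c) \<le> (g x + e) * (d - c)" if "c < d" for c d
          using that q by (intro mult_right_mono) auto
        then show ?thesis using r r0(1) by (meson order_trans)
      qed
      show "(f has_real_derivative h x) (at x)"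
        unfolding has_field_derivative_iff LIM_def
      proof (intro allI impI)
        fix e :: real assume "0 < e"
        then have e2: "0 < e / 2" by simp
        obtain r1 where r1: "0 < r1" "\<And>c d. c \<le> x \<Longrightarrow> x \<le> d \<Longrightarrow> c < d \<Longrightarrow> d - c < r1 \<Longrightarrow> f d - f c \<le> (h x + e / 2) * (d - c)"
          using slope[OF e2 xN1] by blast
        obtain r2 where r2: "0 < r2" "\<And>c d. c \<le> x \<Longrightarrow> x \<le> d \<Longrightarrow> c < d \<Longrightarrow> d - c < r2 \<Longrightarrow> - f d - - f c \<le> (- h x + e / 2) * (d - c)"
          using slope[OF e2 xN2] by blast
        show "\<exists>s>0. \<forall>y. y \<noteq> x \<and> dist y x < s \<longrightarrow> dist ((f y - f x) / (y - x)) (h x) < e"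
        proof (intro exI[of _ "min r1 r2"] conjI allI impI)
          fix y assume y: "y \<noteq> x \<and> dist y x < min r1 r2"
          have "(h x - e / 2) * \<bar>y - x\<bar> \<le> (f y - f x) * sgn (y - x) \<and>
              (f y - f x) * sgn (y - x) \<le> (h x + e / 2) * \<bar>y - x\<bar>"
          proof (cases "x < y")
            case True
            then show ?thesis using y r1(2)[of x y] r2(2)[of x y]
              by (simp add: dist_real_def left_diff_distrib)
          next
            case False
            then have "y < x" using y by simp
            then show ?thesis using y r1(2)[of y x] r2(2)[of y x]
              by (simp add: dist_real_def left_diff_distrib)
          qed
          moreover have "(f y - f x) / (y - x) = (f y - f x) * sgn (y - x) / \<bar>y - x\<bar>"
            using y by (simp add: sgn_if abs_if field_simps)
          ultimately have "h x - e / 2 \<le> (f y - f x) / (y - x) \<and> (f y - f x) / (y - x) \<le> h x + e / 2"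
            using y by (simp add: pos_le_divide_eq pos_divide_le_eq)
          then show "dist ((f y - f x) / (y - x)) (h x) < e"
            using \<open>0 < e\<close> by (auto simp: dist_real_def abs_less_iff)
        qed (use r1 r2 in auto)
      qed
    qed
  qed
qed

section \<open>Absolutely continuous functions are indefinite integrals\<close>

text \<open>Arbitrary finite index sets, instead of initial segments of the natural numbers, allow systems of intervals
to be enlarged and merged without renumbering.\<close>

definition nonoverlapping :: "real \<Rightarrow> real \<Rightarrow> nat set \<Rightarrow> (nat \<Rightarrow> real) \<Rightarrow> (nat \<Rightarrow> real) \<Rightarrow> bool" where
  "nonoverlapping a b I s t \<longleftrightarrow> finite I \<and> (\<forall>i\<in>I. a \<le> s i \<and> s i \<le> t i \<and> t i \<le> b) \<and>
     (\<forall>i\<in>I. \<forall>j\<in>I. i \<noteq> j \<longrightarrow> {s i<..<t i} \<inter> {s j<..<t j} = {})"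

lemma nonoverlapping_empty [simp]: "nonoverlapping a b {} s t"
  by (simp add: nonoverlapping_def)

lemma nonoverlapping_mono:
  "nonoverlapping a b I s t \<Longrightarrow> a' \<le> a \<Longrightarrow> b \<le> b' \<Longrightarrow> nonoverlapping a' b' I s t"
  by (fastforce simp: nonoverlapping_def)

lemma nonoverlapping_clamp:
  assumes n: "nonoverlapping a b I s t" and sub: "\<And>i. {k (s i)<..<k (t i)} \<subseteq> {s i<..<t i}"
    and "\<And>i. i \<in> I \<Longrightarrow> a' \<le> k (s i) \<and> k (s i) \<le> k (t i) \<and> k (t i) \<le> b'"
  shows "nonoverlapping a' b' I (\<lambda>i. k (s i)) (\<lambda>i. k (t i))"
proof -
  have "{k (s i)<..<k (t i)} \<inter> {k (s j)<..<k (t j)} = {}" if "i \<in> I" "j \<in> I" "i \<noteq> j" for i j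
    using n that sub[of i] sub[of j] unfolding nonoverlapping_def by blast
  then show ?thesis using n assms(3) by (simp add: nonoverlapping_def)
qed

lemma nonoverlapping_length:
  assumes "nonoverlapping a b I s t" "a \<le> b"
  shows "(\<Sum>i\<in>I. t i - s i) \<le> b - a"
proof -
  have fin: "finite I" and st: "\<And>i. i \<in> I \<Longrightarrow> a \<le> s i \<and> s i \<le> t i \<and> t i \<le> b"
    and dj: "disjoint_family_on (\<lambda>i. {s i<..<t i}) I"
    using assms by (auto simp: nonoverlapping_def disjoint_family_on_def)
  have "ennreal (\<Sum>i\<in>I. t i - s i) = (\<Sum>i\<in>I. emeasure lborel {s i<..<t i})"
    using st by (subst sum_ennreal[symmetric]) auto
  also have "\<dots> = emeasure lborel (\<Union>i\<in>I. {s i<..<t i})"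
    by (rule sum_emeasure[OF _ dj fin]) auto
  also have "\<dots> \<le> emeasure lborel {a..b}"
    by (rule emeasure_mono) (use st in \<open>fastforce+\<close>)
  also have "\<dots> = ennreal (b - a)" using assms by simp
  finally show ?thesis using assms by simp
qed

lemma abs_cont_curve_nonoverlapping:
  assumes "abs_cont_curve d a b f" "0 < e"
  obtains \<delta> where "0 < \<delta>" "\<And>I s t. nonoverlapping a b I s t \<Longrightarrow> (\<Sum>i\<in>I. t i - s i) < \<delta> \<Longrightarrow>
      (\<Sum>i\<in>I. d (f (s i)) (f (t i))) < e"
proof -
  obtain \<delta> where \<delta>: "0 < \<delta>" "\<forall>(n::nat) s t. (\<forall>i<n. a \<le> s i \<and> s i \<le> t i \<and> t i \<le> b) \<longrightarrow>
     (\<forall>i<n. \<forall>j<n. i \<noteq> j \<longrightarrow> {s i<..<t i} \<inter> {s j<..<t j} = {}) \<longrightarrow>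
     (\<Sum>i<n. t i - s i) < \<delta> \<longrightarrow> (\<Sum>i<n. d (f (s i)) (f (t i))) < e"
    using assms(1)[unfolded abs_cont_curve_def, THEN spec, THEN mp, OF assms(2)] by (elim exE conjE)
  show thesis
  proof (rule that[OF \<delta>(1)])
    fix I :: "nat set" and s t
    assume n: "nonoverlapping a b I s t" and l: "(\<Sum>i\<in>I. t i - s i) < \<delta>"
    then have "finite I" by (simp add: nonoverlapping_def)
    then obtain h where h: "bij_betw h {0..<card I} I"
      using ex_bij_betw_nat_finite by blast
    have hI: "\<And>i. i < card I \<Longrightarrow> h i \<in> I" and inj: "\<And>i j. i < card I \<Longrightarrow> j < card I \<Longrightarrow> i \<noteq> j \<Longrightarrow> h i \<noteq> h j"
      using h by (auto simp: bij_betw_def inj_on_def)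
    have sumh: "(\<Sum>i<card I. g (h i)) = (\<Sum>i\<in>I. g i)" for g :: "nat \<Rightarrow> real"
      using sum.reindex_bij_betw[OF h, of g] by (simp add: atLeast0LessThan)
    have "(\<Sum>i<card I. d (f ((s \<circ> h) i)) (f ((t \<circ> h) i))) < e"
    proof (rule \<delta>(2)[THEN spec, THEN spec, THEN spec, THEN mp, THEN mp, THEN mp])
      show "\<forall>i<card I. a \<le> (s \<circ> h) i \<and> (s \<circ> h) i \<le> (t \<circ> h) i \<and> (t \<circ> h) i \<le> b"
        using n hI by (auto simp: nonoverlapping_def)
      show "\<forall>i<card I. \<forall>j<card I. i \<noteq> j \<longrightarrow> {(s \<circ> h) i<..<(t \<circ> h) i} \<inter> {(s \<circ> h) j<..<(t \<circ> h) j} = {}"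
        using n hI inj unfolding nonoverlapping_def o_def by blast
      show "(\<Sum>i<card I. (t \<circ> h) i - (s \<circ> h) i) < \<delta>"
        using sumh[of "\<lambda>i. t i - s i"] l by simp
    qed
    then show "(\<Sum>i\<in>I. d (f (s i)) (f (t i))) < e"
      using sumh[of "\<lambda>i. d (f (s i)) (f (t i))"] by simp
  qed
qed

text \<open>The positive variation on \<open>[a, x]\<close>. It exhibits a function of bounded variation as a difference of two
monotone functions.\<close>

definition pos_var :: "(real \<Rightarrow> real) \<Rightarrow> real \<Rightarrow> real \<Rightarrow> real" where
  "pos_var f a x = (SUP (I, s, t) \<in> {(I, s, t). nonoverlapping a x I s t}. \<Sum>i\<in>I. f (t i) - f (s i))"

context
  fixes f :: "real \<Rightarrow> real" and a b :: real
  assumes bound: "\<And>I s t. nonoverlapping a b I s t \<Longrightarrow> (\<Sum>i\<in>I. \<bar>f (t i) - f (s i)\<bar>) \<le> 1"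
begin

lemma pos_var_upper:
  assumes "a \<le> x" "x \<le> y" "y \<le> b" "nonoverlapping x y I s t"
  shows "(\<Sum>i\<in>I. f (t i) - f (s i)) \<le> pos_var f x y"
proof -
  have "(\<Sum>i\<in>J. f (v i) - f (u i)) \<le> 1" if "nonoverlapping x y J u v" for J u v
    using bound[OF nonoverlapping_mono[OF that, of a b]] assms
      sum_mono[of J "\<lambda>i. f (v i) - f (u i)" "\<lambda>i. \<bar>f (v i) - f (u i)\<bar>"] by force
  then have bdd: "bdd_above ((\<lambda>(I, s, t). \<Sum>i\<in>I. f (t i) - f (s i)) ` {(I, s, t). nonoverlapping x y I s t})"
    by (intro bdd_aboveI[of _ 1]) auto
  show ?thesis
    unfolding pos_var_def using assms(4) by (intro cSUP_upper2[OF bdd, of "(I, s, t)"]) auto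
qed

lemma pos_var_least:
  assumes "\<And>I s t. nonoverlapping x y I s t \<Longrightarrow> (\<Sum>i\<in>I. f (t i) - f (s i)) \<le> c"
  shows "pos_var f x y \<le> c"
  unfolding pos_var_def by (rule cSUP_least) (use assms nonoverlapping_empty in blast, use assms in auto)

lemma pos_var_incr:
  assumes "a \<le> x" "x \<le> y" "y \<le> b"
  shows "pos_var f a x + (f y - f x) \<le> pos_var f a y"
proof -
  have "pos_var f a x \<le> pos_var f a y - (f y - f x)"
  proof (rule pos_var_least)
    fix I s t assume n: "nonoverlapping a x I s t"
    then have fin: "finite I" by (simp add: nonoverlapping_def)
    then obtain k where k: "k \<notin> I" using ex_new_if_finite by auto
    have "{s i<..<t i} \<inter> {x<..<y} = {}" if "i \<in> I" for i
      using n that by (fastforce simp: nonoverlapping_def)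
    \<comment> \<open>append the interval \<open>[x, y]\<close>, under a fresh index \<open>k\<close>\<close>
    then have *: "nonoverlapping a y (insert k I) (s(k := x)) (t(k := y))"
      using n assms k unfolding nonoverlapping_def
      by (simp add: Int_commute[of "{x<..<y}"] del: greaterThanLessThan_empty_iff greaterThanLessThan_empty_iff2 Int_greaterThanLessThan)
        (meson dual_order.trans order_refl)
    have "(\<Sum>i\<in>insert k I. f ((t(k := y)) i) - f ((s(k := x)) i)) = (f y - f x) + (\<Sum>i\<in>I. f (t i) - f (s i))"
      using fin k by (subst sum.insert) (auto intro!: sum.cong)
    then show "(\<Sum>i\<in>I. f (t i) - f (s i)) \<le> pos_var f a y - (f y - f x)"
      using pos_var_upper[OF _ _ _ *] assms by simp
  qed
  then show ?thesis by simp
qed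

lemma pos_var_mono:
  assumes "a \<le> x" "x \<le> y" "y \<le> b"
  shows "pos_var f a x \<le> pos_var f a y"
  by (rule pos_var_least, rule pos_var_upper) (use assms nonoverlapping_mono in auto)

text \<open>Every interval is cut at \<open>x\<close>; the intervals on one side of \<open>x\<close> leave degenerate ones on the other.\<close>

lemma pos_var_split:
  assumes "a \<le> x" "x \<le> y" "y \<le> b"
  shows "pos_var f a y \<le> pos_var f a x + pos_var f x y"
proof (rule pos_var_least)
  fix I s t assume n: "nonoverlapping a y I s t"
  have 1: "nonoverlapping a x I (\<lambda>i. min (s i) x) (\<lambda>i. min (t i) x)"
    by (rule nonoverlapping_clamp[OF n]) (use n assms in \<open>auto simp: nonoverlapping_def min_def\<close>)
  have 2: "nonoverlapping x y I (\<lambda>i. max (s i) x) (\<lambda>i. max (t i) x)"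
    by (rule nonoverlapping_clamp[OF n]) (use n assms in \<open>auto simp: nonoverlapping_def max_def\<close>)
  have "f (t i) - f (s i) = (f (min (t i) x) - f (min (s i) x)) + (f (max (t i) x) - f (max (s i) x))" for i
    by (auto simp: min_def max_def)
  then have "(\<Sum>i\<in>I. f (t i) - f (s i)) = (\<Sum>i\<in>I. f (min (t i) x) - f (min (s i) x)) + (\<Sum>i\<in>I. f (max (t i) x) - f (max (s i) x))"
    by (simp add: sum.distrib)
  then show "(\<Sum>i\<in>I. f (t i) - f (s i)) \<le> pos_var f a x + pos_var f x y"
    using pos_var_upper[OF _ _ _ 1] pos_var_upper[OF _ _ _ 2] assms by auto
qed

text \<open>Choose in every \<open>[x j, y j]\<close> a system that nearly attains the positive variation there. Together they form
one system, of no greater total length, to which the absolute continuity of \<open>f\<close> applies.\<close>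

lemma pos_var_abs_cont:
  assumes n: "nonoverlapping a b J x y"
    and ac: "\<And>I s t. nonoverlapping a b I s t \<Longrightarrow> (\<Sum>i\<in>I. t i - s i) < \<delta> \<Longrightarrow> (\<Sum>i\<in>I. \<bar>f (t i) - f (s i)\<bar>) \<le> e"
    and len: "(\<Sum>j\<in>J. y j - x j) < \<delta>"
  shows "(\<Sum>j\<in>J. pos_var f a (y j) - pos_var f a (x j)) \<le> e"
proof (rule field_le_epsilon)
  fix r :: real assume "0 < r"
  have fin: "finite J" and xy: "\<And>j. j \<in> J \<Longrightarrow> a \<le> x j \<and> x j \<le> y j \<and> y j \<le> b"
    using n by (auto simp: nonoverlapping_def)
  define k where "k = real (card J) + 1"
  have "0 < r / k" using \<open>0 < r\<close> by (simp add: k_def)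
  have "\<exists>I s t. nonoverlapping (x j) (y j) I s t \<and> pos_var f (x j) (y j) - r / k \<le> (\<Sum>i\<in>I. f (t i) - f (s i))" for j
  proof (rule ccontr)
    assume "\<not> ?thesis"
    then have "pos_var f (x j) (y j) \<le> pos_var f (x j) (y j) - r / k"
      by (intro pos_var_least) (meson linear)
    then show False using \<open>0 < r / k\<close> by simp
  qed
  then obtain I s t where I: "\<And>j. nonoverlapping (x j) (y j) (I j) (s j) (t j)"
     "\<And>j. pos_var f (x j) (y j) - r / k \<le> (\<Sum>i\<in>I j. f (t j i) - f (s j i))"
    by metis
  \<comment> \<open>\<open>Z\<close> indexes the union of the systems by pairs, encoded as natural numbers\<close>
  define Z where "Z = prod_encode ` (SIGMA j:J. I j)"
  define u where "u m = (case prod_decode m of (j, i) \<Rightarrow> s j i)" for m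
  define v where "v m = (case prod_decode m of (j, i) \<Rightarrow> t j i)" for m
  have finI: "finite (I j)" for j using I(1)[of j] by (simp add: nonoverlapping_def)
  have sumZ: "(\<Sum>m\<in>Z. g (u m) (v m)) = (\<Sum>j\<in>J. \<Sum>i\<in>I j. g (s j i) (t j i))" for g :: "real \<Rightarrow> real \<Rightarrow> real"
  proof -
    have "(\<Sum>m\<in>Z. g (u m) (v m)) = (\<Sum>p\<in>(SIGMA j:J. I j). g (u (prod_encode p)) (v (prod_encode p)))"
      unfolding Z_def by (subst sum.reindex) (auto intro: inj_prod_encode)
    also have "\<dots> = (\<Sum>(j, i)\<in>(SIGMA j:J. I j). g (s j i) (t j i))"
      by (rule sum.cong) (auto simp: u_def v_def)
    finally show ?thesis using fin finI by (simp add: sum.Sigma)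
  qed
  have inside: "x j \<le> s j i" "s j i \<le> t j i" "t j i \<le> y j" if "i \<in> I j" for j i
    using I(1)[of j] that by (auto simp: nonoverlapping_def)
  have "nonoverlapping a b Z u v"
    unfolding nonoverlapping_def
  proof (intro conjI ballI impI)
    show "finite Z" using fin finI by (auto simp: Z_def)
    fix m assume "m \<in> Z"
    then obtain j i where ji: "m = prod_encode (j, i)" "j \<in> J" "i \<in> I j" by (auto simp: Z_def)
    show "a \<le> u m" "u m \<le> v m" "v m \<le> b"
      using ji xy[of j] inside[of i j] by (auto simp: u_def v_def)
    fix m' assume "m' \<in> Z" "m \<noteq> m'"
    then obtain j' i' where ji': "m' = prod_encode (j', i')" "j' \<in> J" "i' \<in> I j'" by (auto simp: Z_def)
    show "{u m<..<v m} \<inter> {u m'<..<v m'} = {}"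
    proof (cases "j = j'")
      case True
      then show ?thesis using I(1)[of j] ji ji' \<open>m \<noteq> m'\<close>
        unfolding nonoverlapping_def u_def v_def by auto
    next
      case False
      then have "{x j<..<y j} \<inter> {x j'<..<y j'} = {}" using n ji ji' by (auto simp: nonoverlapping_def)
      moreover have "{u m<..<v m} \<subseteq> {x j<..<y j}" "{u m'<..<v m'} \<subseteq> {x j'<..<y j'}"
        using ji ji' inside[of i j] inside[of i' j'] by (auto simp: u_def v_def)
      ultimately show ?thesis by blast
    qed
  qed
  moreover have "(\<Sum>m\<in>Z. v m - u m) < \<delta>"
  proof -
    have "(\<Sum>m\<in>Z. v m - u m) = (\<Sum>j\<in>J. \<Sum>i\<in>I j. t j i - s j i)" by (rule sumZ)
    also have "\<dots> \<le> (\<Sum>j\<in>J. y j - x j)"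
      using xy by (intro sum_mono nonoverlapping_length[OF I(1)]) auto
    finally show ?thesis using len by simp
  qed
  ultimately have "(\<Sum>m\<in>Z. \<bar>f (v m) - f (u m)\<bar>) \<le> e" by (rule ac)
  then have *: "(\<Sum>m\<in>Z. f (v m) - f (u m)) \<le> e"
    using sum_mono[of Z "\<lambda>m. f (v m) - f (u m)" "\<lambda>m. \<bar>f (v m) - f (u m)\<bar>"] by force
  have "(\<Sum>j\<in>J. pos_var f a (y j) - pos_var f a (x j)) \<le> (\<Sum>j\<in>J. r / k + (\<Sum>i\<in>I j. f (t j i) - f (s j i)))"
  proof (rule sum_mono)
    fix j assume "j \<in> J"
    then show "pos_var f a (y j) - pos_var f a (x j) \<le> r / k + (\<Sum>i\<in>I j. f (t j i) - f (s j i))"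
      using pos_var_split[of "x j" "y j"] xy[of j] I(2)[of j] by auto
  qed
  also have "\<dots> = real (card J) * (r / k) + (\<Sum>m\<in>Z. f (v m) - f (u m))"
    using sumZ[of "\<lambda>p q. f q - f p"] by (simp add: sum.distrib)
  also have "real (card J) * (r / k) \<le> r" using \<open>0 < r\<close> by (simp add: k_def field_simps)
  finally show "(\<Sum>j\<in>J. pos_var f a (y j) - pos_var f a (x j)) \<le> e + r" using * by simp
qed

end

text \<open>The density is the Radon-Nikodym derivative of the Stieltjes measure of \<open>F\<close>. To see that this measure
vanishes on a null set it suffices, by inner regularity, to consider a compact null set \<open>K\<close>; a fine grid
covers \<open>K\<close> by finitely many cells of small total length, over which \<open>F\<close> increases little.\<close>

lemma monotone_abs_cont_density:
  fixes F :: "real \<Rightarrow> real"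
  assumes "a \<le> b"
    and mono: "\<And>x y. a \<le> x \<Longrightarrow> x \<le> y \<Longrightarrow> y \<le> b \<Longrightarrow> F x \<le> F y"
    and ac: "\<And>e. 0 < e \<Longrightarrow> \<exists>\<delta>>0. \<forall>I s t. nonoverlapping a b I s t \<longrightarrow> (\<Sum>i\<in>I. t i - s i) < \<delta> \<longrightarrow>
       (\<Sum>i\<in>I. F (t i) - F (s i)) \<le> e"
  obtains h where "integrable lborel h"
    "\<And>x y. a \<le> x \<Longrightarrow> x \<le> y \<Longrightarrow> y \<le> b \<Longrightarrow> F y - F x = (LINT s:{x..y}|lborel. h s)"
proof -
  \<comment> \<open>clamping to \<open>[a, b]\<close> extends \<open>F\<close> by constants\<close>
  define cl where "cl x = max a (min b x)" for x
  have cl: "a \<le> cl x" "cl x \<le> b" "x \<le> y \<Longrightarrow> cl x \<le> cl y" "x \<le> y \<Longrightarrow> cl y - cl x \<le> y - x" for x y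
    using \<open>a \<le> b\<close> by (auto simp: cl_def max_def min_def)
  have cl_id: "a \<le> x \<Longrightarrow> x \<le> b \<Longrightarrow> cl x = x" for x by (simp add: cl_def)
  define G where "G x = F (cl x) - F a" for x
  have G_mono: "x \<le> y \<Longrightarrow> G x \<le> G y" for x y using cl mono by (simp add: G_def)
  have G_close: "\<exists>\<delta>>0. \<forall>x y. x \<le> y \<and> y - x < \<delta> \<longrightarrow> G y - G x \<le> e" if "0 < e" for e
  proof -
    obtain \<delta> where \<delta>: "0 < \<delta>" "\<And>I s t. nonoverlapping a b I s t \<Longrightarrow> (\<Sum>i\<in>I. t i - s i) < \<delta> \<Longrightarrow>
       (\<Sum>i\<in>I. F (t i) - F (s i)) \<le> e"
      using ac[OF \<open>0 < e\<close>] by blast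
    have "G y - G x \<le> e" if "x \<le> y" "y - x < \<delta>" for x y
      using \<delta>(2)[of "{0}" "\<lambda>_. cl x" "\<lambda>_. cl y"] cl(1,2) cl(3,4)[OF that(1)] that
      by (simp add: nonoverlapping_def G_def)
    then show ?thesis using \<delta>(1) by blast
  qed
  have G_cont: "continuous (at_right x) G" for x
    unfolding continuous_within LIM_def
  proof (intro tendstoI)
    fix e :: real assume "0 < e"
    then have "0 < e / 2" by simp
    then obtain \<delta> where \<delta>: "\<delta> > 0" "\<forall>x y. x \<le> y \<and> y - x < \<delta> \<longrightarrow> G y - G x \<le> e / 2"
      using G_close by blast
    have "eventually (\<lambda>y. y < x + \<delta> \<and> x < y) (at_right x)"
      using \<delta>(1) by (auto simp: eventually_at_right_field intro!: exI[of _ "x + \<delta>"])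
    then show "eventually (\<lambda>y. dist (G y) (G x) < e) (at_right x)"
    proof eventually_elim
      case (elim y)
      then have "G y - G x \<le> e / 2" "G x \<le> G y" using \<delta>(2) G_mono by auto
      then show ?case using \<open>0 < e\<close> by (auto simp: dist_real_def)
    qed
  qed
  define \<mu> where "\<mu> = interval_measure G"
  have sets_\<mu>[measurable_cong, simp]: "sets \<mu> = sets borel" by (simp add: \<mu>_def)
  have Ioc: "emeasure \<mu> {x<..y} = ennreal (G y - G x)" if "x \<le> y" for x y
    unfolding \<mu>_def using that by (rule emeasure_interval_measure_Ioc) (use G_mono G_cont in auto)
  have "eventually (\<lambda>x. G x = 0) at_bot"
    using eventually_le_at_bot[of a] by eventually_elim (use \<open>a \<le> b\<close> in \<open>simp add: G_def cl_def\<close>)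
  then have lb: "(G \<longlongrightarrow> 0) at_bot" by (rule tendsto_eventually)
  have "eventually (\<lambda>x. G x = F b - F a) at_top"
    using eventually_ge_at_top[of b] by eventually_elim (use \<open>a \<le> b\<close> in \<open>simp add: G_def cl_def\<close>)
  then have lt: "(G \<longlongrightarrow> F b - F a) at_top" by (rule tendsto_eventually)
  have tot: "emeasure \<mu> UNIV = ennreal (F b - F a)"
    unfolding \<mu>_def
    by (rule interval_measure_UNIV[OF _ _ lb lt]) (use G_mono G_cont mono \<open>a \<le> b\<close> in auto)
  have "absolutely_continuous lborel \<mu>"
    unfolding absolutely_continuous_def
  proof
    fix N :: "real set" assume N: "N \<in> null_sets lborel"
    then have Nb: "N \<in> sets borel" by auto
    have K0: "emeasure \<mu> K \<le> ennreal e" if "K \<subseteq> N" "compact K" "0 < e" for K e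
    proof -
      obtain \<delta> where \<delta>: "0 < \<delta>" "\<And>I s t. nonoverlapping a b I s t \<Longrightarrow> (\<Sum>i\<in>I. t i - s i) < \<delta> \<Longrightarrow>
         (\<Sum>i\<in>I. F (t i) - F (s i)) \<le> e"
        using ac[OF \<open>0 < e\<close>] by blast
      have Kb: "K \<in> sets borel" using \<open>compact K\<close> by (auto intro: borel_compact)
      have Knull: "K \<in> null_sets lborel" using null_sets_subset[OF N _ \<open>K \<subseteq> N\<close>] Kb by simp
      have Kl: "emeasure lebesgue K = 0" using null_setsD1[OF Knull] Kb by simp
      have "K \<in> sets lebesgue" using Kb by simp
      then obtain U where U: "open U" "K \<subseteq> U" "U - K \<in> lmeasurable" "emeasure lebesgue (U - K) < ennreal \<delta>"
        using sets_lebesgue_outer_open[OF _ \<delta>(1)] by blast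
      have "emeasure lebesgue U \<le> emeasure lebesgue (U - K) + emeasure lebesgue K"
        using emeasure_subadditive[of "U - K" lebesgue K] U Kb by (simp add: Un_absorb2)
      then have "emeasure lebesgue U < ennreal \<delta>" using U(4) Kl by simp
      then have U\<delta>: "emeasure lborel U < ennreal \<delta>" using U(1) by simp
      obtain r where r: "r > 0" "(\<Union>x\<in>K. ball x r) \<subseteq> U"
        using compact_subset_open_imp_ball_epsilon_subset[OF \<open>compact K\<close> U(1,2)] by blast
      obtain m :: nat where m: "0 < m" "1 / real m < r"
        using r(1) by (metis ex_inverse_of_nat_less inverse_eq_divide)
      define c where "c k = (real_of_int k - 1) / real m" for k
      define J where "J = (\<lambda>x. \<lceil>x * real m\<rceil>) ` K"
      obtain B where B: "\<And>x. x \<in> K \<Longrightarrow> \<bar>x\<bar> \<le> B"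
        using compact_imp_bounded[OF \<open>compact K\<close>] by (auto simp: bounded_iff)
      have "J \<subseteq> {\<lceil>- B * real m\<rceil>..\<lceil>B * real m\<rceil>}"
      proof
        fix k assume "k \<in> J"
        then obtain x where x: "x \<in> K" "k = \<lceil>x * real m\<rceil>" by (auto simp: J_def)
        have "- B * real m \<le> x * real m" "x * real m \<le> B * real m"
          using B[OF x(1)] by (intro mult_right_mono; simp)+
        then show "k \<in> {\<lceil>- B * real m\<rceil>..\<lceil>B * real m\<rceil>}"
          by (simp only: x(2) atLeastAtMost_iff ceiling_mono)
      qed
      then have fJ: "finite J" by (rule finite_subset) simp
      have cc: "c k \<le> c (k + 1)" "c (k + 1) - c k = 1 / real m" for k
        using m by (auto simp: c_def field_simps)
      have cell: "x \<in> {c \<lceil>x * real m\<rceil><..c (\<lceil>x * real m\<rceil> + 1)}" for x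
        using m ceiling_correct[of "x * real m"] by (auto simp: c_def field_simps)
      have disj: "{c k<..c (k+1)} \<inter> {c k'<..c (k'+1)} = {}" if "k \<noteq> k'" for k k'
      proof -
        have "c (k+1) \<le> c k' \<or> c (k'+1) \<le> c k"
          using that m by (auto simp: c_def divide_le_cancel)
        then show ?thesis by auto
      qed
      have cdisj: "disjoint_family_on (\<lambda>k. {c k<..c (k+1)}) J"
        unfolding disjoint_family_on_def using disj by blast
      have cellU: "{c k<..c (k+1)} \<subseteq> U" if kJ: "k \<in> J" for k
      proof -
        obtain x where x: "x \<in> K" "k = \<lceil>x * real m\<rceil>" using kJ by (auto simp: J_def)
        have "{c k<..c (k+1)} \<subseteq> ball x r"
        proof
          fix z assume "z \<in> {c k<..c (k+1)}"
          then show "z \<in> ball x r"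
            using cell[of x] x(2) cc(2)[of k] m(2) by (auto simp: dist_real_def)
        qed
        then show ?thesis using r x by blast
      qed
      define I where "I = int_encode ` J"
      define s where "s i = cl (c (int_decode i))" for i
      define t where "t i = cl (c (int_decode i + 1))" for i
      have sumI: "(\<Sum>i\<in>I. g (s i) (t i)) = (\<Sum>k\<in>J. g (cl (c k)) (cl (c (k+1))))" for g :: "real \<Rightarrow> real \<Rightarrow> real"
        unfolding I_def by (subst sum.reindex) (auto simp: s_def t_def inj_int_encode)
      have "nonoverlapping a b I s t"
        unfolding nonoverlapping_def
      proof (intro conjI ballI impI)
        show "finite I" using fJ by (simp add: I_def)
        fix i j assume ij: "i \<in> I" "j \<in> I" "i \<noteq> j"
        then have "int_decode i \<noteq> int_decode j" by (metis int_decode_inverse)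
        then have "c (int_decode i + 1) \<le> c (int_decode j) \<or> c (int_decode j + 1) \<le> c (int_decode i)"
          using m by (auto simp: c_def divide_le_cancel)
        then have "t i \<le> s j \<or> t j \<le> s i" using cl(3) by (auto simp: s_def t_def)
        then show "{s i<..<t i} \<inter> {s j<..<t j} = {}" by auto
      qed (auto simp: s_def t_def intro!: cl cc)
      moreover have "(\<Sum>i\<in>I. t i - s i) < \<delta>"
      proof -
        have "(\<Sum>i\<in>I. t i - s i) \<le> (\<Sum>k\<in>J. c (k+1) - c k)"
          unfolding sumI[of "\<lambda>p q. q - p"] by (intro sum_mono cl cc)
        moreover have "ennreal (\<Sum>k\<in>J. c (k+1) - c k) \<le> emeasure lborel U"
        proof -
          have "ennreal (\<Sum>k\<in>J. c (k+1) - c k) = (\<Sum>k\<in>J. emeasure lborel {c k<..c (k+1)})"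
            using cc(1) by (subst sum_ennreal[symmetric]) auto
          also have "\<dots> = emeasure lborel (\<Union>k\<in>J. {c k<..c (k+1)})"
            by (rule sum_emeasure[OF _ cdisj fJ]) auto
          also have "\<dots> \<le> emeasure lborel U"
            by (rule emeasure_mono) (use cellU U(1) in auto)
          finally show ?thesis .
        qed
        moreover have "0 \<le> (\<Sum>k\<in>J. c (k+1) - c k)" using cc(1) by (intro sum_nonneg) simp
        ultimately show ?thesis using order.strict_trans1[OF _ U\<delta>] by (fastforce simp: ennreal_less_iff)
      qed
      ultimately have "(\<Sum>i\<in>I. F (t i) - F (s i)) \<le> e" by (rule \<delta>(2))
      then have le: "(\<Sum>k\<in>J. G (c (k+1)) - G (c k)) \<le> e"
        unfolding sumI[of "\<lambda>p q. F q - F p"] by (simp add: G_def)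
      have "emeasure \<mu> K \<le> emeasure \<mu> (\<Union>k\<in>J. {c k<..c (k+1)})"
      proof (rule emeasure_mono)
        show "K \<subseteq> (\<Union>k\<in>J. {c k<..c (k+1)})" using cell unfolding J_def by blast
        show "(\<Union>k\<in>J. {c k<..c (k+1)}) \<in> sets \<mu>" using fJ by auto
      qed
      also have "\<dots> = (\<Sum>k\<in>J. emeasure \<mu> {c k<..c (k+1)})"
        by (rule sum_emeasure[symmetric, OF _ cdisj fJ]) auto
      also have "\<dots> = (\<Sum>k\<in>J. ennreal (G (c (k+1)) - G (c k)))"
        using Ioc cc(1) by simp
      also have "\<dots> = ennreal (\<Sum>k\<in>J. G (c (k+1)) - G (c k))"
        using G_mono[OF cc(1)] by (intro sum_ennreal) simp
      also have "\<dots> \<le> ennreal e" using le by (rule ennreal_leI)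
      finally show ?thesis .
    qed
    have Kz: "emeasure \<mu> K \<le> 0" if "K \<subseteq> N" "compact K" for K
    proof (rule ennreal_le_epsilon)
      fix e :: real assume "0 < e" then show "emeasure \<mu> K \<le> 0 + ennreal e" using K0[OF that] by simp
    qed
    have "emeasure \<mu> N = 0"
    proof -
      have "emeasure \<mu> (space \<mu>) \<noteq> \<infinity>" using tot by (simp add: \<mu>_def)
      then have "emeasure \<mu> N = (SUP K \<in> {K. K \<subseteq> N \<and> compact K}. emeasure \<mu> K)"
        using Nb by (intro inner_regular) auto
      also have "\<dots> \<le> 0" using Kz by (intro SUP_least) auto
      finally show ?thesis by simp
    qed
    then show "N \<in> null_sets \<mu>" using Nb by auto
  qed
  then obtain f where f[measurable]: "f \<in> borel_measurable lborel" "density lborel f = \<mu>"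
    using sigma_finite_measure.Radon_Nikodym[OF sigma_finite_lborel, of \<mu>] by auto
  have fin: "(\<integral>\<^sup>+ x. f x \<partial>lborel) < \<infinity>"
  proof -
    have "(\<integral>\<^sup>+ x. f x \<partial>lborel) = emeasure \<mu> UNIV"
      using emeasure_density[OF f(1), of UNIV] f(2) by simp
    also have "\<dots> < \<infinity>" unfolding tot by simp
    finally show ?thesis .
  qed
  then have "AE x in lborel. f x \<noteq> \<infinity>" by (intro nn_integral_PInf_AE) auto
  then have f_AE: "AE x in lborel. ennreal (enn2real (f x)) = f x"
    by eventually_elim (simp add: less_top)
  define h where "h x = enn2real (f x)" for x
  have [measurable]: "h \<in> borel_measurable borel" unfolding h_def using f by simp
  have inth: "integrable lborel h"
  proof (rule integrableI_bounded)
    have "(\<integral>\<^sup>+ x. ennreal (norm (h x)) \<partial>lborel) = (\<integral>\<^sup>+ x. f x \<partial>lborel)"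
      using f_AE by (intro nn_integral_cong_AE) (auto simp: h_def)
    then show "(\<integral>\<^sup>+ x. ennreal (norm (h x)) \<partial>lborel) < \<infinity>" using fin by simp
  qed simp
  show thesis
  proof (rule that[OF inth])
    fix x y assume xy: "a \<le> x" "x \<le> y" "y \<le> b"
    have "ennreal (F y - F x) = emeasure \<mu> {x<..y}" using xy by (simp add: Ioc G_def cl_id)
    also have "\<dots> = (\<integral>\<^sup>+ s. f s * indicator {x<..y} s \<partial>lborel)"
      using f(1) by (simp add: f(2)[symmetric] emeasure_density)
    also have "\<dots> = (\<integral>\<^sup>+ s. ennreal (indicator {x..y} s * h s) \<partial>lborel)"
    proof (rule nn_integral_cong_AE)
      show "AE s in lborel. f s * indicator {x<..y} s = ennreal (indicator {x..y} s * h s)"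
        using f_AE AE_lborel_singleton[of x]
        by eventually_elim (auto simp: h_def split: split_indicator)
    qed
    also have "\<dots> = ennreal (LINT s|lborel. indicator {x..y} s * h s)"
    proof (rule nn_integral_eq_integral)
      show "integrable lborel (\<lambda>s. indicator {x..y} s * h s)"
        using integrable_real_mult_indicator[OF _ inth, of "{x..y}"] by (simp add: mult.commute)
    qed (simp add: h_def)
    finally have "F y - F x = (LINT s|lborel. indicator {x..y} s * h s)"
      using mono[OF xy] by (subst (asm) ennreal_inj) (auto simp: h_def intro!: Bochner_Integration.integral_nonneg)
    then show "F y - F x = (LINT s:{x..y}|lborel. h s)" by (simp add: set_lebesgue_integral_def)
  qed
qed

text \<open>On an interval shorter than the \<open>\<delta>\<close> for variation 1, the positive variation \<open>F\<close> of \<open>f\<close> is finite, and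
\<open>F\<close> and \<open>F - f\<close> are monotone and inherit absolute continuity; so both have densities.\<close>

theorem abs_cont_local_FTC:
  fixes f :: "real \<Rightarrow> real"
  assumes "abs_cont_curve dist A B f"
  obtains \<delta> where "0 < \<delta>"
    "\<And>a b. A \<le> a \<Longrightarrow> a \<le> b \<Longrightarrow> b \<le> B \<Longrightarrow> b - a < \<delta> \<Longrightarrow>
      \<exists>h. integrable lborel h \<and>
        (\<forall>x y. a \<le> x \<longrightarrow> x \<le> y \<longrightarrow> y \<le> b \<longrightarrow> f y - f x = (LINT s:{x..y}|lborel. h s)) \<and>
        (AE x in lborel. a < x \<and> x < b \<longrightarrow> (f has_real_derivative h x) (at x))"
proof -
  have AC: "\<exists>\<delta>>0. \<forall>I s t. nonoverlapping A B I s t \<longrightarrow> (\<Sum>i\<in>I. t i - s i) < \<delta> \<longrightarrow> (\<Sum>i\<in>I. \<bar>f (t i) - f (s i)\<bar>) < e"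
    if e: "0 < e" for e
  proof -
    obtain \<delta> where \<delta>: "0 < \<delta>" "\<And>I s t. nonoverlapping A B I s t \<Longrightarrow> (\<Sum>i\<in>I. t i - s i) < \<delta> \<Longrightarrow>
        (\<Sum>i\<in>I. dist (f (s i)) (f (t i))) < e"
      using abs_cont_curve_nonoverlapping[OF assms e] by blast
    then show ?thesis by (intro exI[of _ \<delta>]) (simp add: dist_real_def abs_minus_commute)
  qed
  obtain \<delta> where \<delta>: "0 < \<delta>" "\<And>I s t. nonoverlapping A B I s t \<Longrightarrow> (\<Sum>i\<in>I. t i - s i) < \<delta> \<Longrightarrow> (\<Sum>i\<in>I. \<bar>f (t i) - f (s i)\<bar>) < 1"
    using AC[OF zero_less_one] by blast
  show thesis
  proof (rule that[OF \<delta>(1)])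
    fix a b assume ab: "A \<le> a" "a \<le> b" "b \<le> B" "b - a < \<delta>"
    have bound: "(\<Sum>i\<in>I. \<bar>f (t i) - f (s i)\<bar>) \<le> 1" if "nonoverlapping a b I s t" for I s t
      using \<delta>(2)[OF nonoverlapping_mono[OF that]] nonoverlapping_length[OF that] ab by auto
    have AC': "\<exists>\<delta>>0. \<forall>I s t. nonoverlapping a b I s t \<longrightarrow> (\<Sum>i\<in>I. t i - s i) < \<delta> \<longrightarrow> (\<Sum>i\<in>I. \<bar>f (t i) - f (s i)\<bar>) \<le> e"
      if e: "0 < e" for e
      proof -
      obtain d where "d > 0" "\<forall>I s t. nonoverlapping A B I s t \<longrightarrow> (\<Sum>i\<in>I. t i - s i) < d \<longrightarrow> (\<Sum>i\<in>I. \<bar>f (t i) - f (s i)\<bar>) < e"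
        using AC[OF e] by blast
      then show ?thesis using nonoverlapping_mono[OF _ ab(1,3)] less_imp_le by blast
    qed
    define F where "F = pos_var f a"
    have F_ac: "\<exists>\<delta>>0. \<forall>I s t. nonoverlapping a b I s t \<longrightarrow> (\<Sum>i\<in>I. t i - s i) < \<delta> \<longrightarrow> (\<Sum>i\<in>I. F (t i) - F (s i)) \<le> e"
      if e: "0 < e" for e
    proof -
      obtain d where d: "d > 0" "\<And>I s t. nonoverlapping a b I s t \<Longrightarrow> (\<Sum>i\<in>I. t i - s i) < d \<Longrightarrow> (\<Sum>i\<in>I. \<bar>f (t i) - f (s i)\<bar>) \<le> e"
        using AC'[OF e] by blast
      have "(\<Sum>i\<in>I. F (t i) - F (s i)) \<le> e" if "nonoverlapping a b I s t" "(\<Sum>i\<in>I. t i - s i) < d" for I s t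
        unfolding F_def by (rule pos_var_abs_cont[where f = f, OF bound that(1) d(2) that(2)])
      then show ?thesis using d(1) by blast
    qed
    have N_ac: "\<exists>\<delta>>0. \<forall>I s t. nonoverlapping a b I s t \<longrightarrow> (\<Sum>i\<in>I. t i - s i) < \<delta> \<longrightarrow> (\<Sum>i\<in>I. (F (t i) - f (t i)) - (F (s i) - f (s i))) \<le> e"
      if e: "0 < e" for e
    proof -
      have e2: "0 < e / 2" using e by simp
      obtain d1 where d1: "d1 > 0" "\<And>I s t. nonoverlapping a b I s t \<Longrightarrow> (\<Sum>i\<in>I. t i - s i) < d1 \<Longrightarrow> (\<Sum>i\<in>I. \<bar>f (t i) - f (s i)\<bar>) \<le> e / 2"
        using AC'[OF e2] by blast
      obtain d2 where d2: "d2 > 0" "\<And>I s t. nonoverlapping a b I s t \<Longrightarrow> (\<Sum>i\<in>I. t i - s i) < d2 \<Longrightarrow> (\<Sum>i\<in>I. F (t i) - F (s i)) \<le> e / 2"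
        using F_ac[OF e2] by blast
      have "(\<Sum>i\<in>I. (F (t i) - f (t i)) - (F (s i) - f (s i))) \<le> e" if *: "nonoverlapping a b I s t" "(\<Sum>i\<in>I. t i - s i) < min d1 d2" for I s t
      proof -
        have "(\<Sum>i\<in>I. (F (t i) - f (t i)) - (F (s i) - f (s i))) \<le> (\<Sum>i\<in>I. (F (t i) - F (s i)) + \<bar>f (t i) - f (s i)\<bar>)"
          by (rule sum_mono) linarith
        then show ?thesis using d1(2)[OF *(1)] d2(2)[OF *(1)] *(2) by (simp add: sum.distrib)
      qed
      then show ?thesis using d1(1) d2(1) by (intro exI[of _ "min d1 d2"]) auto
    qed
    have F_mono: "F x \<le> F y" if "a \<le> x" "x \<le> y" "y \<le> b" for x y
      unfolding F_def by (rule pos_var_mono[where f = f, OF bound that])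
    have N_mono: "F x - f x \<le> F y - f y" if "a \<le> x" "x \<le> y" "y \<le> b" for x y
      using pos_var_incr[where f = f, OF bound that] by (simp add: F_def)
    obtain h1 where h1: "integrable lborel h1"
      "\<And>x y. a \<le> x \<Longrightarrow> x \<le> y \<Longrightarrow> y \<le> b \<Longrightarrow> F y - F x = (LINT s:{x..y}|lborel. h1 s)"
      using monotone_abs_cont_density[OF ab(2) F_mono F_ac] by blast
    obtain h2 where h2: "integrable lborel h2"
      "\<And>x y. a \<le> x \<Longrightarrow> x \<le> y \<Longrightarrow> y \<le> b \<Longrightarrow> (F y - f y) - (F x - f x) = (LINT s:{x..y}|lborel. h2 s)"
      using monotone_abs_cont_density[OF ab(2) N_mono N_ac] by blast
    define h where "h s = h1 s - h2 s" for s
    have h: "integrable lborel h" unfolding h_def by (rule Bochner_Integration.integrable_diff[OF h1(1) h2(1)])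
    have fh: "f y - f x = (LINT s:{x..y}|lborel. h s)" if "a \<le> x" "x \<le> y" "y \<le> b" for x y
    proof -
      have "set_integrable lborel {x..y} h1" "set_integrable lborel {x..y} h2"
        unfolding set_integrable_def
        using integrable_mult_indicator[of "{x..y}" lborel h1] integrable_mult_indicator[of "{x..y}" lborel h2] h1(1) h2(1)
        by simp_all
      then have "(LINT s:{x..y}|lborel. h s) = (LINT s:{x..y}|lborel. h1 s) - (LINT s:{x..y}|lborel. h2 s)"
        unfolding h_def by (rule set_integral_diff)
      then show ?thesis using h1(2)[OF that] h2(2)[OF that] by simp
    qed
    show "\<exists>h. integrable lborel h \<and>
        (\<forall>x y. a \<le> x \<longrightarrow> x \<le> y \<longrightarrow> y \<le> b \<longrightarrow> f y - f x = (LINT s:{x..y}|lborel. h s)) \<and>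
        (AE x in lborel. a < x \<and> x < b \<longrightarrow> (f has_real_derivative h x) (at x))"
      using h fh indefinite_integral_has_derivative_AE[OF h fh] by blast
  qed
qed

section \<open>Finite-dimensional inner product spaces\<close>

definition orthonormal :: "'e::real_inner set \<Rightarrow> bool" where
  "orthonormal B \<longleftrightarrow> (\<forall>b\<in>B. \<forall>b'\<in>B. inner b b' = (if b = b' then 1 else 0))"

text \<open>The unit ball is totally bounded and orthonormal vectors have distance greater than 1, which bounds the
size of orthonormal sets; a largest one is a basis. In dimension 0 the basis is empty.\<close>

lemma finite_orthonormal_basis:
  obtains B :: "'e::{real_inner, heine_borel} set"
  where "finite B" "orthonormal B" "\<And>x. (\<Sum>b\<in>B. inner x b *\<^sub>R b) = x"
proof -
  have "compact (cball (0::'e) 1)" by (rule compact_cball)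
  then obtain k where k: "finite k" "cball (0::'e) 1 \<subseteq> (\<Union>x\<in>k. ball x (1/2))"
    unfolding compact_eq_totally_bounded by (metis half_gt_zero zero_less_one)
  have card_le: "card B \<le> card k" if B: "finite B" "orthonormal B" for B :: "'e set"
  proof -
    have "\<forall>b\<in>B. \<exists>x\<in>k. dist x b < 1/2"
    proof
      fix b assume "b \<in> B"
      then have "norm b = 1" using B(2) by (auto simp: orthonormal_def norm_eq_sqrt_inner)
      then have "b \<in> cball 0 1" by simp
      then show "\<exists>x\<in>k. dist x b < 1/2" using subsetD[OF k(2)] by (metis UN_E mem_ball)
    qed
    then obtain f where f: "\<And>b. b \<in> B \<Longrightarrow> f b \<in> k" "\<And>b. b \<in> B \<Longrightarrow> dist (f b) b < 1/2" by metis
    \<comment> \<open>vectors assigned to the same centre would have distance less than 1\<close>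
    have "inj_on f B"
    proof (rule inj_onI, rule ccontr)
      fix b b' assume b: "b \<in> B" "b' \<in> B" "f b = f b'" "b \<noteq> b'"
      have "dist b b' \<le> dist (f b) b + dist (f b') b'"
        using b(3) dist_triangle3[of b b' "f b"] by simp
      then have "dist b b' < 1" using f(2)[OF b(1)] f(2)[OF b(2)] by linarith
      moreover have "(norm (b - b'))\<^sup>2 = 2"
        using B(2) b by (simp add: power2_norm_eq_inner inner_diff orthonormal_def)
      moreover have "(norm (b - b'))\<^sup>2 < 1\<^sup>2"
        using \<open>dist b b' < 1\<close> unfolding dist_norm by (rule power_strict_mono) auto
      ultimately show False by simp
    qed
    then show ?thesis using f(1) k(1) by (intro card_inj_on_le[of f]) auto
  qed
  define n where "n = (GREATEST n. \<exists>B::'e set. finite B \<and> orthonormal B \<and> card B = n)"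
  have ex: "\<exists>B::'e set. finite B \<and> orthonormal B \<and> card B = n"
    unfolding n_def
    by (rule GreatestI_nat[of _ 0 "card k"]) (auto simp: orthonormal_def intro!: exI[of _ "{}"] dest: card_le)
  then obtain B :: "'e set" where B: "finite B" "orthonormal B" "card B = n" by blast
  have max: "card B' \<le> n" if "finite B'" "orthonormal B'" for B' :: "'e set"
    unfolding n_def by (rule Greatest_le_nat[of _ _ "card k"]) (use that card_le in auto)
  show thesis
  proof (rule that[OF B(1,2)])
    fix x :: 'e
    define r where "r = x - (\<Sum>b\<in>B. inner x b *\<^sub>R b)"
    have orth: "inner r b = 0" if "b \<in> B" for b
    proof -
      have "inner (\<Sum>b'\<in>B. inner x b' *\<^sub>R b') b = (\<Sum>b'\<in>B. if b' = b then inner x b else 0)"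
        unfolding inner_sum_left by (rule sum.cong) (use B(2) that in \<open>auto simp: orthonormal_def\<close>)
      then show ?thesis using B(1) that by (simp add: r_def inner_diff_left)
    qed
    have "r = 0"
    proof (rule ccontr)
      assume "r \<noteq> 0"
      define u where "u = r /\<^sub>R norm r"
      have u: "inner u u = 1" "\<And>b. b \<in> B \<Longrightarrow> inner u b = 0"
        using \<open>r \<noteq> 0\<close> orth by (auto simp: u_def dot_square_norm power2_eq_square field_simps)
      then have "u \<notin> B" by force
      have "orthonormal (insert u B)"
        using B(2) u \<open>u \<notin> B\<close> by (auto simp: orthonormal_def inner_commute)
      then have "card (insert u B) \<le> n" using max B(1) by simp
      then show False using B(1,3) \<open>u \<notin> B\<close> by simp
    qed
    then show "(\<Sum>b\<in>B. inner x b *\<^sub>R b) = x" by (simp add: r_def)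
  qed
qed

lemma linear_form_inner:
  fixes p :: "'e::{real_inner, heine_borel} \<Rightarrow> real"
  assumes "\<And>a b r s. p (r *\<^sub>R a + s *\<^sub>R b) = r * p a + s * p b"
  obtains \<xi> where "\<And>a. p a = inner \<xi> a"
proof -
  obtain B :: "'e set" where B: "finite B" "\<And>x. (\<Sum>b\<in>B. inner x b *\<^sub>R b) = x"
    using finite_orthonormal_basis by metis
  have p0: "p 0 = 0" using assms[of 0 0 0 0] by simp
  have sum: "p (\<Sum>b\<in>S. f b *\<^sub>R b) = (\<Sum>b\<in>S. f b * p b)" if "finite S" for S f
    using that
  proof induction
    case (insert x S)
    then show ?case using assms[of "f x" x 1 "\<Sum>b\<in>S. f b *\<^sub>R b"] by simp
  qed (use p0 in simp)
  have "p a = inner (\<Sum>b\<in>B. p b *\<^sub>R b) a" for a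
  proof -
    have "p a = (\<Sum>b\<in>B. inner a b * p b)" using sum[OF B(1), of "inner a"] B(2) by simp
    then show ?thesis by (simp add: inner_sum_left) (simp add: inner_commute mult.commute)
  qed
  then show thesis by (rule that)
qed

text \<open>The metric is only known to be continuous in the base point for fixed vectors; expanding the vectors in a basis
gives joint continuity.\<close>

lemma continuous_on_bilinear_form:
  fixes g :: "'a::topological_space \<Rightarrow> 'e::{real_inner, heine_borel} \<Rightarrow> 'e \<Rightarrow> real"
  assumes cont: "\<And>a b. continuous_on S (\<lambda>y. g y a b)"
    and bil: "\<And>y. y \<in> S \<Longrightarrow> bilinear (g y)"
  shows "continuous_on (S \<times> UNIV) (\<lambda>(y, a). g y a a)"
proof -
  obtain B :: "'e set" where B: "finite B" "\<And>x. (\<Sum>b\<in>B. inner x b *\<^sub>R b) = x"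
    using finite_orthonormal_basis by metis
  have "continuous_on (S \<times> UNIV) (\<lambda>(y, a). \<Sum>b\<in>B. \<Sum>b'\<in>B. inner a b * (inner a b' * g y b b'))"
    unfolding split_def
    by (intro continuous_intros continuous_on_compose2[OF cont]) auto
  moreover have "g y a a = (\<Sum>b\<in>B. \<Sum>b'\<in>B. inner a b * (inner a b' * g y b b'))" if "y \<in> S" for y a
  proof -
    have "g y a a = g y (\<Sum>b\<in>B. inner a b *\<^sub>R b) (\<Sum>b\<in>B. inner a b *\<^sub>R b)" by (simp add: B(2))
    also have "\<dots> = (\<Sum>(b, b')\<in>B \<times> B. g y (inner a b *\<^sub>R b) (inner a b' *\<^sub>R b'))"
      by (rule bilinear_sum[OF bil[OF that]])
    also have "\<dots> = (\<Sum>b\<in>B. \<Sum>b'\<in>B. inner a b * (inner a b' * g y b b'))"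
      using bilinear_lmul[OF bil[OF that]] bilinear_rmul[OF bil[OF that]]
      by (simp add: sum.cartesian_product mult.left_commute)
    finally show ?thesis .
  qed
  ultimately show ?thesis by (subst continuous_on_cong[OF refl]) auto
qed

lemma has_vector_derivative_inner:
  fixes f :: "real \<Rightarrow> 'e::{real_inner, heine_borel}"
  assumes B: "finite B" "\<And>x. (\<Sum>b\<in>B. inner x b *\<^sub>R b) = x"
    and d: "\<And>b. b \<in> B \<Longrightarrow> ((\<lambda>s. inner (f s) b) has_real_derivative g b) (at s)"
  shows "(f has_vector_derivative (\<Sum>b\<in>B. g b *\<^sub>R b)) (at s)"
proof -
  have "((\<lambda>s. \<Sum>b\<in>B. inner (f s) b *\<^sub>R b) has_vector_derivative (\<Sum>b\<in>B. g b *\<^sub>R b)) (at s)"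
    using d by (intro has_vector_derivative_sum) (auto intro!: derivative_eq_intros)
  then show ?thesis by (simp add: B(2))
qed

section \<open>Riemannian manifolds in charts\<close>

locale riem_manifold =
  fixes A :: "('m::{t2_space, second_countable_topology}, 'e::{real_inner, heine_borel}) chart set"
    and \<rho> :: "'m \<Rightarrow> ('m, 'e) tvec \<Rightarrow> ('m, 'e) tvec \<Rightarrow> real"
  assumes atlas: "smooth_atlas A" and metric: "riemannian_metric A \<rho>"
begin

lemma chart_exists: obtains c where "c \<in> A" "x \<in> fst c"
  using atlas unfolding smooth_atlas_def by blast

lemma chart_open: "c \<in> A \<Longrightarrow> open (fst c)" "c \<in> A \<Longrightarrow> open (chart_image c)"
  using atlas unfolding smooth_atlas_def by blast+

lemma chart_homeo: "c \<in> A \<Longrightarrow> homeomorphism (fst c) (chart_image c) (snd c) (chart_inv c)"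
  using atlas unfolding smooth_atlas_def by blast

lemma chart_inv_left [simp]: "c \<in> A \<Longrightarrow> x \<in> fst c \<Longrightarrow> chart_inv c (snd c x) = x"
  using chart_homeo[of c] unfolding homeomorphism_def by blast

lemma chart_inv_right [simp]: "c \<in> A \<Longrightarrow> y \<in> chart_image c \<Longrightarrow> snd c (chart_inv c y) = y"
  using chart_homeo[of c] unfolding homeomorphism_def by blast

lemma chart_inv_in [simp]: "c \<in> A \<Longrightarrow> y \<in> chart_image c \<Longrightarrow> chart_inv c y \<in> fst c"
  by auto

lemma chart_cont: "c \<in> A \<Longrightarrow> continuous_on (fst c) (snd c)"
    "c \<in> A \<Longrightarrow> continuous_on (chart_image c) (chart_inv c)"
  using chart_homeo[of c] unfolding homeomorphism_def by blast+

lemma chart_open_image: "c \<in> A \<Longrightarrow> open U \<Longrightarrow> U \<subseteq> fst c \<Longrightarrow> open (snd c ` U)"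
proof -
  assume c: "c \<in> A" and U: "open U" "U \<subseteq> fst c"
  have "snd c ` U = chart_image c \<inter> chart_inv c -` U"
    using c U by (auto simp: subset_iff)
  then show ?thesis
    using continuous_open_preimage[OF chart_cont(2)[OF c] chart_open(2)[OF c] U(1)] by simp
qed

lemma chart_inv_open_image: "c \<in> A \<Longrightarrow> open U \<Longrightarrow> U \<subseteq> chart_image c \<Longrightarrow> open (chart_inv c ` U)"
proof -
  assume c: "c \<in> A" and U: "open U" "U \<subseteq> chart_image c"
  have "chart_inv c ` U = fst c \<inter> snd c -` U"
  proof
    show "chart_inv c ` U \<subseteq> fst c \<inter> snd c -` U"
      using c U(2) chart_inv_right[OF c] chart_inv_in[OF c] by (auto simp: subset_iff)
    show "fst c \<inter> snd c -` U \<subseteq> chart_inv c ` U"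
      using chart_inv_left[OF c] by (force simp: image_iff)
  qed
  then show ?thesis
    using continuous_open_preimage[OF chart_cont(1)[OF c] chart_open(1)[OF c] U(1)] by simp
qed

lemma smooth_map_id: "smooth_map A (\<lambda>x. x)"
  using atlas unfolding smooth_map_def smooth_atlas_def by (simp add: o_def)

lemma smooth_map_open_domain:
  assumes "smooth_map A f" "c \<in> A" "c' \<in> A"
  shows "open (snd c ` (fst c \<inter> f -` fst c'))"
proof -
  have "open (f -` fst c')"
    using assms chart_open(1)[of c'] by (auto simp: smooth_map_def continuous_on_open_vimage)
  then show ?thesis using chart_open(1)[OF assms(2)] assms by (intro chart_open_image open_Int) auto
qed

abbreviation Jac :: "('m, 'e) chart \<Rightarrow> ('m, 'e) chart \<Rightarrow> ('m \<Rightarrow> 'm) \<Rightarrow> 'e \<Rightarrow> 'e \<Rightarrow> 'e" where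
  "Jac c c' f y \<equiv> frechet_derivative (snd c' \<circ> f \<circ> chart_inv c) (at y)"

lemma Jac_works:
  assumes "smooth_map A f" "c \<in> A" "c' \<in> A" "x \<in> fst c" "f x \<in> fst c'"
  shows "((snd c' \<circ> f \<circ> chart_inv c) has_derivative Jac c c' f (snd c x)) (at (snd c x))"
proof -
  have "Ck_on (Suc 0) (snd c ` (fst c \<inter> f -` fst c')) (snd c' \<circ> f \<circ> chart_inv c)"
    using assms unfolding smooth_map_def smooth_on_def by blast
  then show ?thesis using assms by (simp add: frechet_derivative_works[symmetric])
qed

lemma Jac_cont:
  assumes "smooth_map A f" "c \<in> A" "c' \<in> A"
  shows "continuous_on (snd c ` (fst c \<inter> f -` fst c')) (\<lambda>y. Jac c c' f y a)"
proof -
  have "Ck_on (Suc 0) (snd c ` (fst c \<inter> f -` fst c')) (snd c' \<circ> f \<circ> chart_inv c)"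
    using assms unfolding smooth_map_def smooth_on_def by blast
  then show ?thesis by simp
qed

lemma Jac_linear:
  assumes "smooth_map A f" "c \<in> A" "c' \<in> A" "x \<in> fst c" "f x \<in> fst c'"
  shows "linear (Jac c c' f (snd c x))"
  using Jac_works[OF assms] by (rule has_derivative_linear)

text \<open>The chain rule in charts; the middle chart only has to contain the intermediate point.\<close>

lemma Jac_compose:
  assumes "smooth_map A f" "smooth_map A g" "smooth_map A (\<lambda>x. g (f x))"
    and "c \<in> A" "c' \<in> A" "c'' \<in> A" "x \<in> fst c" "f x \<in> fst c'" "g (f x) \<in> fst c''"
  shows "Jac c c'' (\<lambda>x. g (f x)) (snd c x) a = Jac c' c'' g (snd c' (f x)) (Jac c c' f (snd c x) a)"
proof -
  let ?F = "snd c' \<circ> f \<circ> chart_inv c" and ?G = "snd c'' \<circ> g \<circ> chart_inv c'"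
  have F: "(?F has_derivative Jac c c' f (snd c x)) (at (snd c x))"
    by (rule Jac_works) (use assms in auto)
  have G: "(?G has_derivative Jac c' c'' g (snd c' (f x))) (at (?F (snd c x)))"
    using Jac_works[of g c' c'' "f x"] assms by simp
  have 1: "(?G \<circ> ?F has_derivative Jac c' c'' g (snd c' (f x)) \<circ> Jac c c' f (snd c x)) (at (snd c x))"
    by (rule diff_chain_at[OF F G])
  have "((snd c'' \<circ> (\<lambda>x. g (f x)) \<circ> chart_inv c) has_derivative Jac c' c'' g (snd c' (f x)) \<circ> Jac c c' f (snd c x)) (at (snd c x))"
    by (rule has_derivative_transform_within_open[OF 1 smooth_map_open_domain[OF assms(1,4,5)]])
      (use assms in auto)
  from frechet_derivative_at[OF this] show ?thesis by (metis comp_apply)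
qed

abbreviation trans :: "('m, 'e) chart \<Rightarrow> ('m, 'e) chart \<Rightarrow> 'e \<Rightarrow> 'e \<Rightarrow> 'e" where
  "trans c c' y \<equiv> frechet_derivative (snd c' \<circ> chart_inv c) (at y)"

lemma trans_Jac: "trans c c' y = Jac c c' (\<lambda>x. x) y"
  by (simp add: o_def)

lemma trans_linear:
  assumes "c \<in> A" "c' \<in> A" "x \<in> fst c" "x \<in> fst c'"
  shows "linear (trans c c' (snd c x))"
  unfolding trans_Jac by (rule Jac_linear[OF smooth_map_id]) (use assms in auto)

lemma trans_trans:
  assumes "c \<in> A" "c' \<in> A" "c'' \<in> A" "x \<in> fst c" "x \<in> fst c'" "x \<in> fst c''"
  shows "trans c' c'' (snd c' x) (trans c c' (snd c x) a) = trans c c'' (snd c x) a"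
  unfolding trans_Jac
  using Jac_compose[OF smooth_map_id smooth_map_id smooth_map_id assms(1-4), of a] assms by simp

lemma trans_same:
  assumes "c \<in> A" "x \<in> fst c"
  shows "trans c c (snd c x) a = a"
proof -
  have "((\<lambda>y. y) has_derivative (\<lambda>y. y)) (at (snd c x))" by (rule has_derivative_ident)
  then have "((snd c \<circ> chart_inv c) has_derivative (\<lambda>y. y)) (at (snd c x))"
    by (rule has_derivative_transform_within_open[OF _ chart_open(2)[OF assms(1)]]) (use assms in auto)
  from frechet_derivative_at[OF this] show ?thesis by metis
qed

lemma tvec_of_in [simp]: "c \<in> A \<Longrightarrow> x \<in> fst c \<Longrightarrow> tvec_of A c x a \<in> tangent_space A x"
  unfolding tangent_space_def tvec_of_def by (auto simp: trans_trans)

lemma tvec_of_at [simp]: "c \<in> A \<Longrightarrow> x \<in> fst c \<Longrightarrow> tvec_of A c x a c = a"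
  by (simp add: tvec_of_def trans_same)

lemma tvec_of_coord: "c \<in> A \<Longrightarrow> x \<in> fst c \<Longrightarrow> v \<in> tangent_space A x \<Longrightarrow> tvec_of A c x (v c) = v"
proof
  assume a: "c \<in> A" "x \<in> fst c" "v \<in> tangent_space A x"
  fix c'
  show "tvec_of A c x (v c) c' = v c'"
  proof (cases "c' \<in> A \<and> x \<in> fst c'")
    case True
    then have "v c' = frechet_derivative (snd c' \<circ> chart_inv c) (at (snd c x)) (v c)"
      using a unfolding tangent_space_def by blast
    then show ?thesis using True by (simp add: tvec_of_def)
  next
    case False
    then have "v c' = 0" using a unfolding tangent_space_def by blast
    then show ?thesis using False by (simp only: tvec_of_def if_False)
  qed
qed

lemma tvec_of_lin:
  assumes "c \<in> A" "x \<in> fst c"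
  shows "tvec_of A c x (r *\<^sub>R a + s *\<^sub>R b) = (\<lambda>c'. r *\<^sub>R tvec_of A c x a c' + s *\<^sub>R tvec_of A c x b c')"
  unfolding tvec_of_def
  by (rule ext) (use trans_linear[OF assms(1) _ assms(2)] in \<open>auto simp: linear_add linear_scale\<close>)

lemma tvec_of_scale:
  assumes "c \<in> A" "x \<in> fst c"
  shows "tvec_of A c x (r *\<^sub>R a) = (\<lambda>c'. r *\<^sub>R tvec_of A c x a c')"
  using tvec_of_lin[OF assms, of r a 0 a] by simp

lemma tvec_of_0: "c \<in> A \<Longrightarrow> x \<in> fst c \<Longrightarrow> tvec_of A c x 0 = (\<lambda>c'. 0)"
  using tvec_of_scale[of c x 0 0] by simp

text \<open>The metric and the norm of tangent vectors in the coordinates of a chart.\<close>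

definition gm :: "('m, 'e) chart \<Rightarrow> 'e \<Rightarrow> 'e \<Rightarrow> 'e \<Rightarrow> real" where
  "gm c y a b = \<rho> (chart_inv c y) (tvec_of A c (chart_inv c y) a) (tvec_of A c (chart_inv c y) b)"

definition nm :: "('m, 'e) chart \<Rightarrow> 'e \<Rightarrow> 'e \<Rightarrow> real" where
  "nm c y a = riem_norm \<rho> (chart_inv c y) (tvec_of A c (chart_inv c y) a)"

lemma nm_gm: "nm c y a = sqrt (gm c y a a)"
  by (simp add: nm_def gm_def riem_norm_def)

lemma metric_symmetric: "v \<in> tangent_space A x \<Longrightarrow> w \<in> tangent_space A x \<Longrightarrow> \<rho> x v w = \<rho> x w v"
  using metric[unfolded riemannian_metric_def, THEN conjunct2, THEN conjunct1] by simp

lemma metric_linear: "u \<in> tangent_space A x \<Longrightarrow> v \<in> tangent_space A x \<Longrightarrow> w \<in> tangent_space A x \<Longrightarrow>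
    \<rho> x (\<lambda>c. r *\<^sub>R u c + s *\<^sub>R v c) w = r * \<rho> x u w + s * \<rho> x v w"
  using metric[unfolded riemannian_metric_def, THEN conjunct1] by simp

lemma metric_positive: "v \<in> tangent_space A x \<Longrightarrow> v \<noteq> (\<lambda>c. 0) \<Longrightarrow> 0 < \<rho> x v v"
  using metric[unfolded riemannian_metric_def, THEN conjunct2, THEN conjunct2, THEN conjunct1] by simp

lemma gm_commute: "c \<in> A \<Longrightarrow> y \<in> chart_image c \<Longrightarrow> gm c y a b = gm c y b a"
  unfolding gm_def by (intro metric_symmetric tvec_of_in chart_inv_in)

lemma gm_linear:
  assumes "c \<in> A" "y \<in> chart_image c"
  shows "gm c y (r *\<^sub>R a + s *\<^sub>R b) d = r * gm c y a d + s * gm c y b d"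
  unfolding gm_def tvec_of_lin[OF assms(1) chart_inv_in[OF assms]]
  by (intro metric_linear tvec_of_in chart_inv_in assms)

lemma gm_bilinear:
  assumes "c \<in> A" "y \<in> chart_image c"
  shows "bilinear (gm c y)"
proof -
  have "linear (\<lambda>a. gm c y a d)" for d
    using gm_linear[OF assms, of 1 _ 1 _ d] gm_linear[OF assms, of _ _ 0 _ d] by (intro linearI) auto
  moreover have "gm c y d = (\<lambda>a. gm c y a d)" for d using gm_commute[OF assms] by (rule ext)
  ultimately show ?thesis unfolding bilinear_def
    by (metis (no_types, lifting))
qed

lemma gm_pos: "c \<in> A \<Longrightarrow> y \<in> chart_image c \<Longrightarrow> a \<noteq> 0 \<Longrightarrow> 0 < gm c y a a"
  unfolding gm_def
  by (intro metric_positive tvec_of_in chart_inv_in) (auto dest: fun_cong[of _ _ c])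

lemma gm_cont: "c \<in> A \<Longrightarrow> continuous_on (chart_image c \<times> UNIV) (\<lambda>(y, a). gm c y a a)"
proof (rule continuous_on_bilinear_form[where g = "gm c"])
  assume c: "c \<in> A"
  fix a b
  have "Ck_on 0 (chart_image c) (\<lambda>y. gm c y a b)"
    using metric c unfolding riemannian_metric_def gm_def smooth_on_def by blast
  then show "continuous_on (chart_image c) (\<lambda>y. gm c y a b)" by simp
qed (rule gm_bilinear)

lemma segment_speed_bounded:
  assumes c: "c \<in> A" and seg: "\<And>r. r \<in> {0..s} \<Longrightarrow> y + r *\<^sub>R q \<in> chart_image c"
  obtains V where "\<And>r. r \<in> {0..s} \<Longrightarrow> nm c (y + r *\<^sub>R q) q \<le> V"
proof -
  have "continuous_on {0..s} (\<lambda>r. (y + r *\<^sub>R q, q))" by (intro continuous_intros)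
  moreover have "(\<lambda>r. (y + r *\<^sub>R q, q)) ` {0..s} \<subseteq> chart_image c \<times> UNIV" using seg by blast
  ultimately have "continuous_on {0..s} (\<lambda>r. sqrt (gm c (y + r *\<^sub>R q) q q))"
    using continuous_on_compose2[OF gm_cont[OF c]] by (intro continuous_on_real_sqrt) fastforce
  then have "compact ((\<lambda>r. nm c (y + r *\<^sub>R q) q) ` {0..s})"
    unfolding nm_gm by (rule compact_continuous_image) simp
  then show thesis
    using that compact_imp_bounded[THEN bounded_imp_bdd_above] by (meson bdd_above.E image_eqI)
qed

lemma gm_scale: "c \<in> A \<Longrightarrow> y \<in> chart_image c \<Longrightarrow> gm c y (r *\<^sub>R a) (s *\<^sub>R b) = r * s * gm c y a b"
  using bilinear_lmul[OF gm_bilinear] bilinear_rmul[OF gm_bilinear] by simp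

lemma gm_nonneg: "c \<in> A \<Longrightarrow> y \<in> chart_image c \<Longrightarrow> 0 \<le> gm c y a a"
  using gm_pos[of c y a] bilinear_lzero[OF gm_bilinear, of c y 0] by (cases "a = 0") auto

lemma nm_nonneg: "c \<in> A \<Longrightarrow> y \<in> chart_image c \<Longrightarrow> 0 \<le> nm c y a"
  by (simp add: nm_gm gm_nonneg)

lemma nm_scale: "c \<in> A \<Longrightarrow> y \<in> chart_image c \<Longrightarrow> nm c y (r *\<^sub>R a) = \<bar>r\<bar> * nm c y a"
  by (simp add: nm_gm gm_scale real_sqrt_mult power2_eq_square[symmetric])

lemma nm_pos: "c \<in> A \<Longrightarrow> y \<in> chart_image c \<Longrightarrow> a \<noteq> 0 \<Longrightarrow> 0 < nm c y a"
  by (simp add: nm_gm gm_pos)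

lemma nm_0: "c \<in> A \<Longrightarrow> y \<in> chart_image c \<Longrightarrow> nm c y 0 = 0"
  using nm_scale[of c y 0 0] by simp

lemma riem_norm_nm:
  "c \<in> A \<Longrightarrow> x \<in> fst c \<Longrightarrow> v \<in> tangent_space A x \<Longrightarrow> riem_norm \<rho> x v = nm c (snd c x) (v c)"
  by (simp add: nm_def tvec_of_coord)

lemma gm_Cauchy_Schwarz:
  assumes "c \<in> A" "y \<in> chart_image c"
  shows "\<bar>gm c y a b\<bar> \<le> nm c y a * nm c y b"
proof (cases "a = 0")
  case True
  then show ?thesis using bilinear_lzero[OF gm_bilinear[OF assms], of b] nm_0[OF assms] by simp
next
  case False
  let ?g = "gm c y"
  have pos: "0 < ?g a a" using gm_pos[OF assms False] .
  define t where "t = ?g a b / ?g a a"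
  define w where "w = 1 *\<^sub>R b + (-t) *\<^sub>R a"
  have w1: "?g w d = ?g b d - t * ?g a d" for d
    unfolding w_def gm_linear[OF assms] by simp
  have "0 \<le> ?g w w" by (rule gm_nonneg[OF assms])
  also have "\<dots> = ?g w b - t * ?g w a"
    using w1[of w] gm_commute[OF assms, of b w] gm_commute[OF assms, of a w] by simp
  also have "\<dots> = ?g b b - 2 * t * ?g a b + t * t * ?g a a"
    unfolding w1 gm_commute[OF assms, of b a] by (simp add: algebra_simps)
  also have "\<dots> = ?g b b - (?g a b)\<^sup>2 / ?g a a"
    using pos by (simp add: t_def power2_eq_square field_simps)
  finally have "(?g a b)\<^sup>2 \<le> ?g a a * ?g b b" using pos by (simp add: field_simps)
  then have "sqrt ((?g a b)\<^sup>2) \<le> sqrt (?g a a * ?g b b)" by (rule real_sqrt_le_mono)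
  then show ?thesis by (simp add: nm_gm real_sqrt_mult)
qed

text \<open>By homogeneity it is enough to compare the quadratic forms on the unit sphere, and there compactness of the
sphere and uniform continuity of the metric near \<open>y0\<close> apply.\<close>

lemma nm_local:
  assumes c: "c \<in> A" and y0: "y0 \<in> chart_image c" and S: "open S" "y0 \<in> S"
  obtains r m M where "0 < r" "0 < m" "0 < M" "cball y0 r \<subseteq> chart_image c \<inter> S"
    "\<And>y a. y \<in> cball y0 r \<Longrightarrow> m * norm a \<le> nm c y a"
    "\<And>y a. y \<in> cball y0 r \<Longrightarrow> nm c y a \<le> M * norm a"
    "\<And>y z a. y \<in> cball y0 r \<Longrightarrow> z \<in> cball y0 r \<Longrightarrow> nm c y a \<le> 2 * nm c z a"
proof -
  let ?G = "\<lambda>(y, a). gm c y a a"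
  define Sp where "Sp = {a::'e. norm a = 1}"
  have cSp: "compact Sp" unfolding Sp_def compact_eq_bounded_closed
    by (intro conjI closed_Collect_eq continuous_intros) (auto simp: bounded_iff)
  have pos: "0 < gm c y0 a a" if "a \<in> Sp" for a by (rule gm_pos[OF c y0]) (use that in \<open>auto simp: Sp_def\<close>)
  obtain r0 where r0: "0 < r0" "cball y0 r0 \<subseteq> chart_image c \<inter> S"
    using open_contains_cball[THEN iffD1, OF open_Int[OF chart_open(2)[OF c] S(1)], THEN bspec, of y0] y0 S(2)
    by blast
  have cont: "continuous_on (cball y0 r0 \<times> Sp) ?G"
    by (rule continuous_on_subset[OF gm_cont[OF c]]) (use r0 in auto)
  have comp: "compact (cball y0 r0 \<times> Sp)" by (intro compact_Times compact_cball cSp)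
  have "\<exists>r>0. r \<le> r0 \<and> (\<forall>y\<in>cball y0 r. \<forall>a\<in>Sp. \<bar>gm c y a a - gm c y0 a a\<bar> \<le> gm c y0 a a / 4)"
  \<comment> \<open>the sphere is empty if the manifold has dimension 0\<close>
  proof (cases "Sp = {}")
    case True then show ?thesis using r0(1) by (intro exI[of _ r0]) auto
  next
    case False
    have "continuous_on Sp (\<lambda>a. ?G (y0, a))"
      by (rule continuous_on_compose2[OF cont]) (use r0 in \<open>auto intro!: continuous_intros\<close>)
    then obtain a0 where a0: "a0 \<in> Sp" "\<And>a. a \<in> Sp \<Longrightarrow> gm c y0 a0 a0 \<le> gm c y0 a a"
      using continuous_attains_inf[OF cSp False, of "\<lambda>a. ?G (y0, a)"] by auto
    have "uniformly_continuous_on (cball y0 r0 \<times> Sp) ?G"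
      by (rule compact_uniformly_continuous[OF cont comp])
    then obtain d where d: "d > 0" "\<And>p q. p \<in> cball y0 r0 \<times> Sp \<Longrightarrow> q \<in> cball y0 r0 \<times> Sp \<Longrightarrow> dist q p < d \<Longrightarrow>
        dist (?G q) (?G p) < gm c y0 a0 a0 / 4"
      using pos[OF a0(1)] unfolding uniformly_continuous_on_def
      by (metis (no_types, lifting) zero_less_divide_iff zero_less_numeral)
    have "\<bar>gm c y a a - gm c y0 a a\<bar> \<le> gm c y0 a a / 4" if "y \<in> cball y0 (min r0 (d/2))" "a \<in> Sp" for y a
      using d(2)[of "(y0, a)" "(y, a)"] that r0(1) d(1) a0(2)[of a]
      by (simp add: dist_Pair_Pair dist_commute dist_real_def abs_minus_commute[of "gm c y a a"])
    then show ?thesis using r0(1) d(1) by (intro exI[of _ "min r0 (d/2)"]) auto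
  qed
  then obtain r where r: "0 < r" "r \<le> r0"
    "\<And>y a. y \<in> cball y0 r \<Longrightarrow> a \<in> Sp \<Longrightarrow> \<bar>gm c y a a - gm c y0 a a\<bar> \<le> gm c y0 a a / 4" by blast
  have sub: "cball y0 r \<subseteq> chart_image c \<inter> S" using r(2) r0(2) by auto
  have "\<exists>m M. 0 < m \<and> 0 < M \<and> (\<forall>a\<in>Sp. m \<le> gm c y0 a a \<and> gm c y0 a a \<le> M)"
  proof (cases "Sp = {}")
    case True then show ?thesis by (auto intro!: exI[of _ 1])
  next
    case False
    have ct: "continuous_on Sp (\<lambda>a. ?G (y0, a))"
      by (rule continuous_on_compose2[OF cont]) (use r0 in \<open>auto intro!: continuous_intros\<close>)
    then obtain a0 where a0: "a0 \<in> Sp" "\<And>a. a \<in> Sp \<Longrightarrow> gm c y0 a0 a0 \<le> gm c y0 a a"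
      using continuous_attains_inf[OF cSp False, of "\<lambda>a. ?G (y0, a)"] by auto
    from ct obtain a1 where a1: "a1 \<in> Sp" "\<And>a. a \<in> Sp \<Longrightarrow> gm c y0 a a \<le> gm c y0 a1 a1"
      using continuous_attains_sup[OF cSp False, of "\<lambda>a. ?G (y0, a)"] by auto
    then show ?thesis using a0 pos by blast
  qed
  then obtain m M where mM: "0 < m" "0 < M" "\<And>a. a \<in> Sp \<Longrightarrow> m \<le> gm c y0 a a \<and> gm c y0 a a \<le> M" by blast
  have est: "sqrt (m / 2) * norm a \<le> nm c y a \<and> nm c y a \<le> sqrt (2 * M) * norm a \<and> nm c y a \<le> 2 * nm c z a"
    if y: "y \<in> cball y0 r" and z: "z \<in> cball y0 r" for y z a
  proof (cases "a = 0")
    case True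
    have "y \<in> chart_image c" "z \<in> chart_image c" using sub y z by blast+
    then show ?thesis using nm_0[OF c] True by simp
  next
    case False
    define u where "u = a /\<^sub>R norm a"
    have u: "u \<in> Sp" "a = norm a *\<^sub>R u" using False by (auto simp: u_def Sp_def)
    have yz: "y \<in> chart_image c" "z \<in> chart_image c" using sub y z by blast+
    have gy: "\<bar>gm c y u u - gm c y0 u u\<bar> \<le> gm c y0 u u / 4" "\<bar>gm c z u u - gm c y0 u u\<bar> \<le> gm c y0 u u / 4"
      using r(3) y z u(1) by auto
    have bd: "m \<le> gm c y0 u u" "gm c y0 u u \<le> M" using mM(3)[OF u(1)] by auto
    have 1: "m / 2 \<le> gm c y u u" "gm c y u u \<le> 2 * M" using gy bd mM(1) by linarith+
    have 2: "gm c y u u \<le> 4 * gm c z u u" using gy bd mM(1) by linarith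
    have "sqrt (m / 2) \<le> nm c y u" "nm c y u \<le> sqrt (2 * M)"
      unfolding nm_gm using 1 by auto
    moreover have "nm c y u \<le> 2 * nm c z u"
    proof -
      have "nm c y u \<le> sqrt (4 * gm c z u u)" unfolding nm_gm using 2 by (rule real_sqrt_le_mono)
      then show ?thesis by (simp add: nm_gm real_sqrt_mult)
    qed
    moreover have "nm c y a = norm a * nm c y u" "nm c z a = norm a * nm c z u"
      using nm_scale[OF c yz(1), of "norm a" u] nm_scale[OF c yz(2), of "norm a" u] u(2) by auto
    ultimately show ?thesis
      by (auto simp: mult.commute[of "norm a"] mult.assoc[symmetric] intro!: mult_right_mono)
  qed
  show thesis
    by (rule that[of r "sqrt (m / 2)" "sqrt (2 * M)"]) (use r mM sub est in auto)
qed

end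

section \<open>Covectors and the differential of an isometry\<close>

context riem_manifold
begin

lemma tangent_lin:
  assumes "v \<in> tangent_space A x" "w \<in> tangent_space A x"
  shows "(\<lambda>c. r *\<^sub>R v c + s *\<^sub>R w c) \<in> tangent_space A x"
proof -
  obtain c where c: "c \<in> A" "x \<in> fst c" by (rule chart_exists)
  have "(\<lambda>c'. r *\<^sub>R v c' + s *\<^sub>R w c') = tvec_of A c x (r *\<^sub>R v c + s *\<^sub>R w c)"
    unfolding tvec_of_lin[OF c] using tvec_of_coord[OF c] assms by simp
  then show ?thesis using c by simp
qed

lemma tangent_0: "(\<lambda>c. 0) \<in> tangent_space A x"
  using chart_exists tvec_of_0 tvec_of_in by metis

lemma tangent_scale: "v \<in> tangent_space A x \<Longrightarrow> (\<lambda>c. r *\<^sub>R v c) \<in> tangent_space A x"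
  using tangent_lin[of v x v r 0] by simp

lemma riem_norm_nonneg: "v \<in> tangent_space A x \<Longrightarrow> 0 \<le> riem_norm \<rho> x v"
proof -
  assume v: "v \<in> tangent_space A x"
  obtain c where c: "c \<in> A" "x \<in> fst c" by (rule chart_exists)
  then show ?thesis using riem_norm_nm[OF c v] nm_nonneg by auto
qed

lemma riem_norm_scale: "v \<in> tangent_space A x \<Longrightarrow> riem_norm \<rho> x (\<lambda>c. r *\<^sub>R v c) = \<bar>r\<bar> * riem_norm \<rho> x v"
proof -
  assume v: "v \<in> tangent_space A x"
  obtain c where c: "c \<in> A" "x \<in> fst c" by (rule chart_exists)
  then show ?thesis
    using riem_norm_nm[OF c v] riem_norm_nm[OF c tangent_scale[OF v]] nm_scale[of c "snd c x"] by auto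
qed

text \<open>Covectors are represented by vectors of the model space through the inner product.\<close>

definition covec :: "('m, 'e) chart \<Rightarrow> 'e \<Rightarrow> 'e \<Rightarrow> ('m, 'e) covec" where
  "covec c y \<xi> = (\<lambda>v. if v \<in> tangent_space A (chart_inv c y) then inner \<xi> (v c) else 0)"

lemma cot_param_covec: "cot_param A c (y, \<xi>) = (chart_inv c y, covec c y \<xi>)"
  by (simp add: cot_param_def covec_def)

lemma covec_in [simp]: "covec c y \<xi> \<in> cotangent_space A (chart_inv c y)"
  unfolding cotangent_space_def covec_def by (auto simp: tangent_lin inner_add_right)

lemma covec_tvec [simp]:
  "c \<in> A \<Longrightarrow> y \<in> chart_image c \<Longrightarrow> covec c y \<xi> (tvec_of A c (chart_inv c y) a) = inner \<xi> a"
  using tvec_of_in[OF _ chart_inv_in] tvec_of_at[OF _ chart_inv_in] by (simp add: covec_def)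

lemma cotangent_linear:
  "p \<in> cotangent_space A x \<Longrightarrow> v \<in> tangent_space A x \<Longrightarrow> w \<in> tangent_space A x \<Longrightarrow>
    p (\<lambda>c. r *\<^sub>R v c + s *\<^sub>R w c) = r * p v + s * p w"
  unfolding cotangent_space_def by blast

lemma cotangent_scale:
  "p \<in> cotangent_space A x \<Longrightarrow> v \<in> tangent_space A x \<Longrightarrow> p (\<lambda>c. r *\<^sub>R v c) = r * p v"
  using cotangent_linear[of p x v v r 0] by simp

lemma cotangent_out: "p \<in> cotangent_space A x \<Longrightarrow> v \<notin> tangent_space A x \<Longrightarrow> p v = 0"
  unfolding cotangent_space_def by blast

lemma cotangent_0: "(\<lambda>v. 0) \<in> cotangent_space A x"
  unfolding cotangent_space_def by simp

lemma covec_exists: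
  assumes "p \<in> cotangent_space A x" "c \<in> A" "x \<in> fst c"
  obtains \<xi> where "p = covec c (snd c x) \<xi>"
proof -
  have "p (tvec_of A c x (r *\<^sub>R a + s *\<^sub>R b)) = r * p (tvec_of A c x a) + s * p (tvec_of A c x b)" for a b r s
    unfolding tvec_of_lin[OF assms(2,3)] using assms by (intro cotangent_linear) auto
  then obtain \<xi> where \<xi>: "\<And>a. p (tvec_of A c x a) = inner \<xi> a"
    using linear_form_inner[of "\<lambda>a. p (tvec_of A c x a)"] by metis
  have "p v = covec c (snd c x) \<xi> v" for v
  proof (cases "v \<in> tangent_space A x")
    case True
    then show ?thesis using \<xi>[of "v c"] tvec_of_coord[OF assms(2,3) True] assms by (simp add: covec_def)
  next
    case False
    then show ?thesis using cotangent_out[OF assms(1)] assms by (simp add: covec_def)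
  qed
  then show thesis using that by blast
qed

lemma dual_norm_bdd:
  assumes p: "p \<in> cotangent_space A x"
  shows "bdd_above ((\<lambda>v. \<bar>p v\<bar>) ` {v \<in> tangent_space A x. riem_norm \<rho> x v \<le> 1})"
proof -
  obtain c where c: "c \<in> A" "x \<in> fst c" by (rule chart_exists)
  obtain \<xi> where \<xi>: "p = covec c (snd c x) \<xi>" using covec_exists[OF p c] .
  have y: "snd c x \<in> chart_image c" using c by simp
  obtain r m M where m: "0 < r" "0 < m" "\<And>y a. y \<in> cball (snd c x) r \<Longrightarrow> m * norm a \<le> nm c y a"
    using nm_local[OF c(1) y open_UNIV UNIV_I] by metis
  show ?thesis
  proof (rule bdd_aboveI2)
    fix v assume v: "v \<in> {v \<in> tangent_space A x. riem_norm \<rho> x v \<le> 1}"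
    then have "m * norm (v c) \<le> 1"
      using m(3)[of "snd c x" "v c"] m(1) riem_norm_nm[OF c, of v] by auto
    then have "norm (v c) \<le> 1 / m" using m(2) by (simp add: field_simps)
    have "\<bar>p v\<bar> \<le> norm \<xi> * norm (v c)"
      using v c by (simp add: \<xi> covec_def Cauchy_Schwarz_ineq2)
    also have "\<dots> \<le> norm \<xi> * (1 / m)" using \<open>norm (v c) \<le> 1 / m\<close> by (rule mult_left_mono) simp
    finally show "\<bar>p v\<bar> \<le> norm \<xi> * (1 / m)" .
  qed
qed

lemma dual_norm_nonneg: "p \<in> cotangent_space A x \<Longrightarrow> 0 \<le> dual_norm A \<rho> x p"
proof -
  assume p: "p \<in> cotangent_space A x"
  have "\<bar>p (\<lambda>c. 0)\<bar> \<le> dual_norm A \<rho> x p"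
    unfolding dual_norm_def using riem_norm_scale[OF tangent_0, of x 0] tangent_0
    by (intro cSUP_upper dual_norm_bdd p) auto
  then show ?thesis by simp
qed

lemma dual_norm_bound:
  assumes p: "p \<in> cotangent_space A x" and v: "v \<in> tangent_space A x"
  shows "\<bar>p v\<bar> \<le> dual_norm A \<rho> x p * riem_norm \<rho> x v"
proof (cases "riem_norm \<rho> x v = 0")
  case True
  obtain c where c: "c \<in> A" "x \<in> fst c" by (rule chart_exists)
  then have "v c = 0" using True riem_norm_nm[OF c v] nm_pos[of c "snd c x" "v c"] by force
  then have "v = (\<lambda>c. 0)" using tvec_of_coord[OF c v] tvec_of_0[OF c] by simp
  then show ?thesis using True cotangent_scale[OF p tangent_0, of 0] by simp
next
  case False
  then have pos: "0 < riem_norm \<rho> x v" using riem_norm_nonneg[OF v] by simp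
  define u where "u = (\<lambda>c. (1 / riem_norm \<rho> x v) *\<^sub>R v c)"
  have u: "u \<in> tangent_space A x" "riem_norm \<rho> x u = 1"
    using tangent_scale[OF v] riem_norm_scale[OF v] pos by (auto simp: u_def)
  have "\<bar>p u\<bar> \<le> dual_norm A \<rho> x p"
    unfolding dual_norm_def using u by (intro cSUP_upper dual_norm_bdd p) auto
  moreover have "p u = (1 / riem_norm \<rho> x v) * p v" unfolding u_def by (rule cotangent_scale[OF p v])
  ultimately show ?thesis using pos by (simp add: abs_mult field_simps)
qed

lemma dual_norm_le:
  assumes "\<And>v. v \<in> tangent_space A x \<Longrightarrow> \<bar>p v\<bar> \<le> K * riem_norm \<rho> x v" "0 \<le> K"
  shows "dual_norm A \<rho> x p \<le> K"
  unfolding dual_norm_def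
proof (rule cSUP_least)
  show "{v \<in> tangent_space A x. riem_norm \<rho> x v \<le> 1} \<noteq> {}"
    using tangent_0[of x] riem_norm_scale[OF tangent_0, of x 0] by (auto intro!: exI[of _ "\<lambda>c. 0"])
  fix v assume "v \<in> {v \<in> tangent_space A x. riem_norm \<rho> x v \<le> 1}"
  then show "\<bar>p v\<bar> \<le> K" using assms(1)[of v] mult_left_mono[of "riem_norm \<rho> x v" 1 K] assms(2) by auto
qed

text \<open>The covector \<open>w \<mapsto> (R / |v|) * \<rho> w v\<close> works, by the Cauchy-Schwarz inequality.\<close>

lemma norming_covector:
  assumes v: "v \<in> tangent_space A x" and "0 \<le> R"
  obtains p where "p \<in> cotangent_space A x" "p v = R * riem_norm \<rho> x v" "dual_norm A \<rho> x p \<le> R"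
proof (cases "riem_norm \<rho> x v = 0")
  case True
  have "dual_norm A \<rho> x (\<lambda>v. 0) \<le> R"
    by (rule dual_norm_le) (use riem_norm_nonneg \<open>0 \<le> R\<close> in auto)
  then show ?thesis using that[OF cotangent_0] True by simp
next
  case False
  then have pos: "0 < riem_norm \<rho> x v" using riem_norm_nonneg[OF v] by simp
  then have sq: "\<rho> x v v = (riem_norm \<rho> x v)\<^sup>2" by (simp add: riem_norm_def)
  define p where "p w = (if w \<in> tangent_space A x then R / riem_norm \<rho> x v * \<rho> x w v else 0)" for w
  have p: "p \<in> cotangent_space A x"
    unfolding cotangent_space_def p_def using v by (auto simp: tangent_lin metric_linear algebra_simps)
  have pv: "p v = R * riem_norm \<rho> x v"
    using pos v by (simp add: p_def sq power2_eq_square)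
  have CS: "\<bar>\<rho> x w v\<bar> \<le> riem_norm \<rho> x w * riem_norm \<rho> x v" if w: "w \<in> tangent_space A x" for w
  proof -
    obtain c where c: "c \<in> A" "x \<in> fst c" by (rule chart_exists)
    then show ?thesis
      using gm_Cauchy_Schwarz[OF c(1), of "snd c x" "w c" "v c"] riem_norm_nm[OF c w] riem_norm_nm[OF c v]
      by (simp add: gm_def tvec_of_coord[OF c] v w)
  qed
  have "dual_norm A \<rho> x p \<le> R"
  proof (rule dual_norm_le[OF _ \<open>0 \<le> R\<close>])
    fix w assume w: "w \<in> tangent_space A x"
    have "\<bar>p w\<bar> = R / riem_norm \<rho> x v * \<bar>\<rho> x w v\<bar>"
      using w pos \<open>0 \<le> R\<close> by (simp add: p_def abs_mult)
    also have "\<dots> \<le> R / riem_norm \<rho> x v * (riem_norm \<rho> x w * riem_norm \<rho> x v)"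
      using CS[OF w] pos \<open>0 \<le> R\<close> by (intro mult_left_mono) auto
    also have "\<dots> = R * riem_norm \<rho> x w" using pos by simp
    finally show "\<bar>p w\<bar> \<le> R * riem_norm \<rho> x w" .
  qed
  then show ?thesis using that p pv by blast
qed

lemma covec_norm_bounds:
  assumes c: "c \<in> A" and y: "y \<in> chart_image c" and m: "0 < m" "\<And>a. m * norm a \<le> nm c y a"
    and M: "0 < M" "\<And>a. nm c y a \<le> M * norm a"
  shows "dual_norm A \<rho> (chart_inv c y) (covec c y \<xi>) \<le> norm \<xi> / m"
    and "norm \<xi> \<le> M * dual_norm A \<rho> (chart_inv c y) (covec c y \<xi>)"
proof -
  show "dual_norm A \<rho> (chart_inv c y) (covec c y \<xi>) \<le> norm \<xi> / m"
  proof (rule dual_norm_le)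
    fix v assume v: "v \<in> tangent_space A (chart_inv c y)"
    have "m * norm (v c) \<le> riem_norm \<rho> (chart_inv c y) v"
      using riem_norm_nm[OF c chart_inv_in[OF c y] v] m(2) c y by simp
    then have n: "norm (v c) \<le> riem_norm \<rho> (chart_inv c y) v / m" using m(1) by (simp add: field_simps)
    have "\<bar>covec c y \<xi> v\<bar> \<le> norm \<xi> * norm (v c)"
      using v by (simp add: covec_def Cauchy_Schwarz_ineq2)
    also have "\<dots> \<le> norm \<xi> * (riem_norm \<rho> (chart_inv c y) v / m)" by (rule mult_left_mono[OF n]) simp
    finally show "\<bar>covec c y \<xi> v\<bar> \<le> norm \<xi> / m * riem_norm \<rho> (chart_inv c y) v" by simp
  qed (use m in auto)
  show "norm \<xi> \<le> M * dual_norm A \<rho> (chart_inv c y) (covec c y \<xi>)"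
  proof (cases "\<xi> = 0")
    case True
    then show ?thesis using dual_norm_nonneg[OF covec_in] M(1) by simp
  next
    case False
    let ?v = "tvec_of A c (chart_inv c y) \<xi>"
    have "norm \<xi> * norm \<xi> = covec c y \<xi> ?v" using c y by (simp add: power2_norm_eq_inner[symmetric] power2_eq_square)
    also have "\<dots> \<le> dual_norm A \<rho> (chart_inv c y) (covec c y \<xi>) * nm c y \<xi>"
      using dual_norm_bound[OF covec_in tvec_of_in[OF c chart_inv_in[OF c y]], of \<xi> \<xi>] unfolding nm_def by simp
    also have "\<dots> \<le> dual_norm A \<rho> (chart_inv c y) (covec c y \<xi>) * (M * norm \<xi>)"
      using M(2) dual_norm_nonneg[OF covec_in] by (intro mult_left_mono) auto
    finally show ?thesis using False by (simp add: mult.assoc[symmetric] mult.commute)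
  qed
qed

text \<open>The differential is defined through an arbitrary chart around \<open>x\<close>; by the chain rule any two charts give the
same result.\<close>

lemma differential_tvec:
  assumes f: "smooth_map A f" and c: "c \<in> A" "x \<in> fst c" and c': "c' \<in> A" "f x \<in> fst c'"
  shows "differential A f x (tvec_of A c x a) = tvec_of A c' (f x) (Jac c c' f (snd c x) a)"
proof
  fix c''
  define c0 where "c0 = (SOME c. c \<in> A \<and> x \<in> fst c)"
  have c0: "c0 \<in> A" "x \<in> fst c0"
    unfolding c0_def using someI[of "\<lambda>c. c \<in> A \<and> x \<in> fst c"] c by blast+
  show "differential A f x (tvec_of A c x a) c'' = tvec_of A c' (f x) (Jac c c' f (snd c x) a) c''"
  proof (cases "c'' \<in> A \<and> f x \<in> fst c''")
    case True
    have "differential A f x (tvec_of A c x a) c'' = Jac c0 c'' f (snd c0 x) (tvec_of A c x a c0)"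
      using True by (simp add: differential_def c0_def[symmetric])
    also have "tvec_of A c x a c0 = Jac c c0 (\<lambda>x. x) (snd c x) a"
      unfolding trans_Jac[symmetric] using c0 by (simp add: tvec_of_def)
    also have "Jac c0 c'' f (snd c0 x) (Jac c c0 (\<lambda>x. x) (snd c x) a) = Jac c c'' f (snd c x) a"
      using Jac_compose[OF smooth_map_id f f, of c c0 c'' x a] c c0 True by simp
    also have "\<dots> = Jac c' c'' (\<lambda>x. x) (snd c' (f x)) (Jac c c' f (snd c x) a)"
      using Jac_compose[OF f smooth_map_id f, of c c' c'' x a] c c' True by simp
    also have "\<dots> = tvec_of A c' (f x) (Jac c c' f (snd c x) a) c''"
      unfolding trans_Jac[symmetric] using True by (simp add: tvec_of_def)
    finally show ?thesis .
  next
    case False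
    then show ?thesis by (auto simp: differential_def tvec_of_def Let_def)
  qed
qed

lemma differential_in:
  assumes f: "smooth_map A f" and v: "v \<in> tangent_space A x"
  shows "differential A f x v \<in> tangent_space A (f x)"
proof -
  obtain c where c: "c \<in> A" "x \<in> fst c" by (rule chart_exists)
  obtain c' where c': "c' \<in> A" "f x \<in> fst c'" by (rule chart_exists)
  show ?thesis
    using differential_tvec[OF f c c', of "v c"] tvec_of_in[OF c'] by (simp add: tvec_of_coord[OF c v])
qed

lemma differential_linear:
  assumes f: "smooth_map A f" and v: "v \<in> tangent_space A x" and w: "w \<in> tangent_space A x"
  shows "differential A f x (\<lambda>c. r *\<^sub>R v c + s *\<^sub>R w c)
     = (\<lambda>c. r *\<^sub>R differential A f x v c + s *\<^sub>R differential A f x w c)"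
proof -
  obtain c where c: "c \<in> A" "x \<in> fst c" by (rule chart_exists)
  obtain c' where c': "c' \<in> A" "f x \<in> fst c'" by (rule chart_exists)
  have lin: "linear (Jac c c' f (snd c x))" by (rule Jac_linear[OF f c(1) c'(1) c(2) c'(2)])
  have d: "differential A f x u = tvec_of A c' (f x) (Jac c c' f (snd c x) (u c))" if "u \<in> tangent_space A x" for u
    using differential_tvec[OF f c c', of "u c"] by (simp add: tvec_of_coord[OF c that])
  show ?thesis
    unfolding d[OF v] d[OF w] d[OF tangent_lin[OF v w]] linear_add[OF lin] linear_scale[OF lin]
    by (rule tvec_of_lin[OF c'])
qed

text \<open>The chain rule for \<open>g \<circ> f\<close>, which is the identity.\<close>

lemma differential_inverse:
  assumes f: "smooth_map A f" and g: "smooth_map A g" and gf: "\<And>x. g (f x) = x"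
    and v: "v \<in> tangent_space A x"
  shows "differential A g (f x) (differential A f x v) = v"
proof -
  obtain c where c: "c \<in> A" "x \<in> fst c" by (rule chart_exists)
  obtain c' where c': "c' \<in> A" "f x \<in> fst c'" by (rule chart_exists)
  have "differential A g (f x) (differential A f x v)
      = differential A g (f x) (tvec_of A c' (f x) (Jac c c' f (snd c x) (v c)))"
    using differential_tvec[OF f c c', of "v c"] by (simp add: tvec_of_coord[OF c v])
  also have "\<dots> = tvec_of A c (g (f x)) (Jac c' c g (snd c' (f x)) (Jac c c' f (snd c x) (v c)))"
    by (rule differential_tvec[OF g c']) (use c gf in auto)
  also have "Jac c' c g (snd c' (f x)) (Jac c c' f (snd c x) (v c)) = Jac c c (\<lambda>x. g (f x)) (snd c x) (v c)"
    using Jac_compose[OF f g, of c c' c x "v c"] c c' smooth_map_id by (simp add: gf)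
  also have "\<dots> = v c" unfolding gf trans_Jac[symmetric] by (rule trans_same[OF c])
  finally show ?thesis using gf tvec_of_coord[OF c v] by simp
qed

lemma isometry_smooth: "riem_isometry A \<rho> f \<Longrightarrow> smooth_map A f" "riem_isometry A \<rho> f \<Longrightarrow> smooth_map A (inv_into UNIV f)"
  "riem_isometry A \<rho> f \<Longrightarrow> bij f"
  by (auto simp: riem_isometry_def)

lemma isometry_norm:
  "riem_isometry A \<rho> f \<Longrightarrow> v \<in> tangent_space A x \<Longrightarrow> riem_norm \<rho> (f x) (differential A f x v) = riem_norm \<rho> x v"
  by (simp add: riem_isometry_def riem_norm_def)

lemma differential_bij:
  assumes f: "riem_isometry A \<rho> f"
  shows "bij_betw (differential A f x) (tangent_space A x) (tangent_space A (f x))"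
proof (rule bij_betw_byWitness[where f' = "differential A (inv_into UNIV f) (f x)"])
  let ?g = "inv_into UNIV f"
  note sm = isometry_smooth[OF f]
  have gf: "?g (f x) = x" and fg: "f (?g x) = x" for x
    using sm(3) by (simp_all add: bij_is_inj bij_is_surj surj_f_inv_f)
  show "\<forall>v\<in>tangent_space A x. differential A ?g (f x) (differential A f x v) = v"
    using differential_inverse[OF sm(1,2) gf] by blast
  show "\<forall>w\<in>tangent_space A (f x). differential A f x (differential A ?g (f x) w) = w"
    using differential_inverse[OF sm(2,1) fg, of _ "f x"] by (simp add: gf)
  show "differential A f x ` tangent_space A x \<subseteq> tangent_space A (f x)"
    using differential_in[OF sm(1)] by blast
  show "differential A ?g (f x) ` tangent_space A (f x) \<subseteq> tangent_space A x"
    using differential_in[OF sm(2), of _ "f x"] by (auto simp: gf)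
qed

lemma cot_lift_push:
  assumes f: "riem_isometry A \<rho> f" and p: "p \<in> cotangent_space A x"
  obtains p' where "cot_lift A f (x, p) = (f x, p')" "p' \<in> cotangent_space A (f x)"
    "\<And>v. v \<in> tangent_space A x \<Longrightarrow> p' (differential A f x v) = p v"
    "dual_norm A \<rho> (f x) p' \<le> dual_norm A \<rho> x p"
proof -
  let ?i = "inv_into (tangent_space A x) (differential A f x)"
  note bij = differential_bij[OF f, of x]
  define p' where "p' = (\<lambda>w. if w \<in> tangent_space A (f x) then p (?i w) else 0)"
  have 1: "p' (differential A f x v) = p v" if "v \<in> tangent_space A x" for v
    using that differential_in[OF isometry_smooth(1)[OF f] that] bij_betw_inv_into_left[OF bij that]
    by (simp add: p'_def)
  have sur: "\<exists>v\<in>tangent_space A x. w = differential A f x v" if "w \<in> tangent_space A (f x)" for w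
    using bij that unfolding bij_betw_def by blast
  have "p' \<in> cotangent_space A (f x)"
    unfolding cotangent_space_def
  proof (clarify, intro conjI ballI allI impI)
    fix w1 w2 a b assume "w1 \<in> tangent_space A (f x)" "w2 \<in> tangent_space A (f x)"
    then obtain v1 v2 where v: "v1 \<in> tangent_space A x" "v2 \<in> tangent_space A x"
      "w1 = differential A f x v1" "w2 = differential A f x v2" using sur by metis
    show "p' (\<lambda>c. a *\<^sub>R w1 c + b *\<^sub>R w2 c) = a * p' w1 + b * p' w2"
      using 1[OF tangent_lin[OF v(1,2), of a b]] 1[OF v(1)] 1[OF v(2)] cotangent_linear[OF p v(1,2)]
      unfolding v(3,4) differential_linear[OF isometry_smooth(1)[OF f] v(1,2)] by simp
  qed (simp add: p'_def)
  moreover have "dual_norm A \<rho> (f x) p' \<le> dual_norm A \<rho> x p"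
  proof (rule dual_norm_le[OF _ dual_norm_nonneg[OF p]])
    fix w assume "w \<in> tangent_space A (f x)"
    then obtain v where v: "v \<in> tangent_space A x" "w = differential A f x v" using sur by blast
    then show "\<bar>p' w\<bar> \<le> dual_norm A \<rho> x p * riem_norm \<rho> (f x) w"
      using dual_norm_bound[OF p v(1)] 1[OF v(1)] isometry_norm[OF f v(1)] by simp
  qed
  moreover have "cot_lift A f (x, p) = (f x, p')" by (simp add: cot_lift_def p'_def)
  ultimately show thesis using that 1 by blast
qed

lemma cot_lift_pull:
  assumes f: "riem_isometry A \<rho> f" and p': "p' \<in> cotangent_space A (f x)"
  obtains p where "p \<in> cotangent_space A x" "cot_lift A f (x, p) = (f x, p')"
    "\<And>v. v \<in> tangent_space A x \<Longrightarrow> p' (differential A f x v) = p v"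
proof -
  let ?i = "inv_into (tangent_space A x) (differential A f x)"
  note bij = differential_bij[OF f, of x]
  note sm = isometry_smooth(1)[OF f]
  define p where "p = (\<lambda>v. if v \<in> tangent_space A x then p' (differential A f x v) else 0)"
  have "p \<in> cotangent_space A x"
    unfolding cotangent_space_def p_def
    using cotangent_linear[OF p' differential_in[OF sm] differential_in[OF sm]]
    by (auto simp: tangent_lin differential_linear[OF sm])
  moreover have "cot_lift A f (x, p) = (f x, p')"
  proof -
    have "(if w \<in> tangent_space A (f x) then p (?i w) else 0) = p' w" for w
      using bij_betw_inv_into_right[OF bij] bij_betwE[OF bij_betw_inv_into[OF bij]] cotangent_out[OF p']
      by (simp add: p_def)
    then show ?thesis by (simp add: cot_lift_def)
  qed
  ultimately show thesis using that by (simp add: p_def)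
qed

end

section \<open>Bounds for the Lagrangian\<close>

locale ham_manifold = riem_manifold A \<rho>
  for A :: "('m::{t2_space, second_countable_topology}, 'e::{real_inner, heine_borel}) chart set"
    and \<rho> :: "'m \<Rightarrow> ('m, 'e) tvec \<Rightarrow> ('m, 'e) tvec \<Rightarrow> real" +
  fixes H :: "'m \<times> ('m, 'e) covec \<Rightarrow> 'w \<Rightarrow> real" and W :: "'w set" and \<theta> \<Theta> :: "real \<Rightarrow> real"
  assumes \<theta>_mono: "mono_on {0..} \<theta>" and \<theta>_super: "superlinearly_coercive \<theta>"
    and \<Theta>_mono: "mono_on {0..} \<Theta>"
    and H_bounds: "\<omega> \<in> W \<Longrightarrow> p \<in> cotangent_space A x \<Longrightarrow>
       \<theta> (dual_norm A \<rho> x p) \<le> H (x, p) \<omega> \<and> H (x, p) \<omega> \<le> \<Theta> (dual_norm A \<rho> x p)"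
begin

text \<open>The convex conjugate of \<open>\<theta>\<close> on the half-line. It bounds the Lagrangian in terms of the speed alone.\<close>

definition \<theta>conj :: "real \<Rightarrow> real" where
  "\<theta>conj s = (SUP r\<in>{0..}. s * r - \<theta> r)"

lemma \<theta>_superlinear: "\<exists>R\<ge>0. \<forall>r\<ge>R. s * r + K \<le> \<theta> r"
proof -
  have "eventually (\<lambda>r. s + \<bar>K\<bar> \<le> \<theta> r / r) at_top"
    using \<theta>_super unfolding superlinearly_coercive_def filterlim_at_top by blast
  then obtain R where R: "\<And>r. r \<ge> R \<Longrightarrow> s + \<bar>K\<bar> \<le> \<theta> r / r" by (auto simp: eventually_at_top_linorder)
  have "s * r + K \<le> \<theta> r" if "r \<ge> max R 1" for r
  proof -
    have "(s + \<bar>K\<bar>) * r \<le> \<theta> r" using R[of r] that by (simp add: field_simps)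
    moreover have "\<bar>K\<bar> * 1 \<le> \<bar>K\<bar> * r" using that by (intro mult_left_mono) auto
    ultimately show ?thesis by (simp add: algebra_simps)
  qed
  then show ?thesis by (intro exI[of _ "max R 1"]) auto
qed

lemma \<theta>conj_upper:
  assumes "0 \<le> s" "0 \<le> r"
  shows "s * r - \<theta> r \<le> \<theta>conj s"
proof -
  obtain R where R: "R \<ge> 0" "\<And>r. r \<ge> R \<Longrightarrow> s * r + 0 \<le> \<theta> r" using \<theta>_superlinear by blast
  have "bdd_above ((\<lambda>r. s * r - \<theta> r) ` {0..})"
  proof (rule bdd_aboveI2)
    fix r :: real assume "r \<in> {0..}"
    then show "s * r - \<theta> r \<le> max 0 (s * R - \<theta> 0)"
    proof (cases "r \<ge> R")
      case False
      then have "s * r \<le> s * R" using assms by (intro mult_left_mono) auto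
      moreover have "\<theta> 0 \<le> \<theta> r" using \<open>r \<in> {0..}\<close> by (intro mono_onD[OF \<theta>_mono]) auto
      ultimately show ?thesis by simp
    qed (use R(2)[of r] in simp)
  qed
  then show ?thesis unfolding \<theta>conj_def using assms by (intro cSUP_upper) auto
qed

lemma \<theta>conj_mono: "0 \<le> s \<Longrightarrow> s \<le> s' \<Longrightarrow> \<theta>conj s \<le> \<theta>conj s'"
proof -
  assume s: "0 \<le> s" "s \<le> s'"
  have "s * r - \<theta> r \<le> \<theta>conj s'" if "0 \<le> r" for r
    using \<theta>conj_upper[of s' r] mult_right_mono[OF s(2) that] s that by simp
  then show ?thesis unfolding \<theta>conj_def[of s] by (intro cSUP_least) auto
qed

abbreviation L :: "'m \<Rightarrow> ('m, 'e) tvec \<Rightarrow> 'w \<Rightarrow> real" where "L \<equiv> lagrangian A H"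

text \<open>By Young's inequality for \<open>\<theta>\<close> and its conjugate.\<close>

lemma momentum_bound:
  assumes "\<omega> \<in> W" "q \<in> tangent_space A x" "p \<in> cotangent_space A x"
  shows "p q - H (x, p) \<omega> \<le> \<theta>conj (riem_norm \<rho> x q)"
proof -
  have "p q \<le> riem_norm \<rho> x q * dual_norm A \<rho> x p"
    using dual_norm_bound[OF assms(3,2)] by (simp add: mult.commute)
  then show ?thesis
    using H_bounds[OF assms(1,3)] \<theta>conj_upper[OF riem_norm_nonneg[OF assms(2)] dual_norm_nonneg[OF assms(3)]]
    by linarith
qed

lemma L_ge:
  assumes "\<omega> \<in> W" "q \<in> tangent_space A x" "p \<in> cotangent_space A x"
  shows "p q - H (x, p) \<omega> \<le> L x q \<omega>"
  unfolding lagrangian_def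
  by (rule cSUP_upper[OF assms(3)], rule bdd_aboveI2, rule momentum_bound[OF assms(1,2)])

lemma L_le: "(\<And>p. p \<in> cotangent_space A x \<Longrightarrow> p q - H (x, p) \<omega> \<le> B) \<Longrightarrow> L x q \<omega> \<le> B"
  unfolding lagrangian_def by (rule cSUP_least) (use cotangent_0 in auto)

lemma L_upper: "\<omega> \<in> W \<Longrightarrow> q \<in> tangent_space A x \<Longrightarrow> L x q \<omega> \<le> \<theta>conj (riem_norm \<rho> x q)"
  by (rule L_le, rule momentum_bound)

lemma H_zero_covector: "\<omega> \<in> W \<Longrightarrow> H (x, \<lambda>v. 0) \<omega> \<le> \<Theta> 0" "dual_norm A \<rho> x (\<lambda>v. 0) = 0"
proof -
  have "dual_norm A \<rho> x (\<lambda>v. 0) \<le> 0" by (rule dual_norm_le) auto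
  then show 0: "dual_norm A \<rho> x (\<lambda>v. 0) = 0" using dual_norm_nonneg[OF cotangent_0] by (simp add: order_antisym)
  then show "\<omega> \<in> W \<Longrightarrow> H (x, \<lambda>v. 0) \<omega> \<le> \<Theta> 0" using H_bounds[OF _ cotangent_0, of \<omega> x] by simp
qed

lemma L_lower: "\<omega> \<in> W \<Longrightarrow> q \<in> tangent_space A x \<Longrightarrow> - \<Theta> 0 \<le> L x q \<omega>"
  using L_ge[OF _ _ cotangent_0, of \<omega> q x] H_zero_covector(1)[of \<omega> x] by simp

text \<open>Superlinearity of \<open>\<theta>\<close> defeats the linear term when the velocity is bounded. Hence momenta outside a fixed
ball contribute to the supremum in the Lagrangian no more than the zero covector does, uniformly in the
point and in the random parameter.\<close>

lemma small_momenta: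
  obtains R where "0 \<le> R" "\<And>\<omega> x q p. \<omega> \<in> W \<Longrightarrow> q \<in> tangent_space A x \<Longrightarrow> riem_norm \<rho> x q \<le> V \<Longrightarrow>
      p \<in> cotangent_space A x \<Longrightarrow> R < dual_norm A \<rho> x p \<Longrightarrow> p q - H (x, p) \<omega> \<le> - \<Theta> 0"
proof -
  obtain R where R: "R \<ge> 0" "\<And>r. r \<ge> R \<Longrightarrow> V * r + \<Theta> 0 \<le> \<theta> r" using \<theta>_superlinear by blast
  show thesis
  proof (rule that[OF R(1)])
    fix \<omega> x q p
    assume a: "\<omega> \<in> W" "q \<in> tangent_space A x" "riem_norm \<rho> x q \<le> V" "p \<in> cotangent_space A x" "R < dual_norm A \<rho> x p"
    have "p q \<le> dual_norm A \<rho> x p * riem_norm \<rho> x q" using dual_norm_bound[OF a(4,2)] by simp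
    also have "\<dots> \<le> dual_norm A \<rho> x p * V" using a(3) dual_norm_nonneg[OF a(4)] by (intro mult_left_mono)
    finally show "p q - H (x, p) \<omega> \<le> - \<Theta> 0"
      using R(2)[of "dual_norm A \<rho> x p"] a(5) H_bounds[OF a(1,4)] by (simp add: mult.commute)
  qed
qed

text \<open>Every covector at \<open>f x\<close> is the push-forward of one at \<open>x\<close>, with the same pairing.\<close>

lemma L_isometry:
  assumes f: "riem_isometry A \<rho> f" and q: "q \<in> tangent_space A x" and \<omega>: "\<omega> \<in> W" "\<omega>' \<in> W"
    and e: "\<And>p. p \<in> cotangent_space A x \<Longrightarrow> H (x, p) \<omega>' = H (cot_lift A f (x, p)) \<omega>"
  shows "L (f x) (differential A f x q) \<omega> \<le> L x q \<omega>'"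
proof (rule L_le)
  fix p' assume "p' \<in> cotangent_space A (f x)"
  then obtain p where p: "p \<in> cotangent_space A x" "cot_lift A f (x, p) = (f x, p')"
    "\<And>v. v \<in> tangent_space A x \<Longrightarrow> p' (differential A f x v) = p v"
    using cot_lift_pull[OF f] by metis
  show "p' (differential A f x q) - H (f x, p') \<omega> \<le> L x q \<omega>'"
    using L_ge[OF \<omega>(2) q p(1)] p e[OF p(1)] q by simp
qed

end

section \<open>Chains of chart segments\<close>

locale stationary_ham = ham_manifold A \<rho> H W \<theta> \<Theta>
  for A :: "('m::{t2_space, second_countable_topology}, 'e::{real_inner, heine_borel}) chart set"
    and \<rho> :: "'m \<Rightarrow> ('m, 'e) tvec \<Rightarrow> ('m, 'e) tvec \<Rightarrow> real"
    and H :: "'m \<times> ('m, 'e) covec \<Rightarrow> 'w \<Rightarrow> real" and W :: "'w set" and \<theta> \<Theta> :: "real \<Rightarrow> real" +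
  fixes G :: "('g, 'r) monoid_scheme" (structure) and \<alpha> :: "'g \<Rightarrow> 'm \<Rightarrow> 'm" and \<tau> :: "'g \<Rightarrow> 'w \<Rightarrow> 'w"
  assumes comm: "comm_group G" and act: "group_action G UNIV \<alpha>"
    and isom: "g \<in> carrier G \<Longrightarrow> riem_isometry A \<rho> (\<alpha> g)"
    and \<tau>_in: "g \<in> carrier G \<Longrightarrow> \<omega> \<in> W \<Longrightarrow> \<tau> g \<omega> \<in> W"
    and \<tau>_comp: "g \<in> carrier G \<Longrightarrow> g' \<in> carrier G \<Longrightarrow> \<omega> \<in> W \<Longrightarrow> \<tau> (g \<otimes> g') \<omega> = \<tau> g (\<tau> g' \<omega>)"
    and H_stat: "\<omega> \<in> W \<Longrightarrow> g \<in> carrier G \<Longrightarrow> p \<in> cotangent_space A x \<Longrightarrow>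
        H (x, p) (\<tau> g \<omega>) = H (cot_lift A (\<alpha> g) (x, p)) \<omega>"
    and conn_UNIV: "connected (UNIV :: 'm set)"
begin

sublocale comm_group G by (rule comm)

lemma \<alpha>_comp: "g \<in> carrier G \<Longrightarrow> g' \<in> carrier G \<Longrightarrow> \<alpha> (g \<otimes> g') x = \<alpha> g (\<alpha> g' x)"
  using group_action.composition_rule[OF act UNIV_I] .

lemma \<alpha>_one [simp]: "\<alpha> \<one> x = x"
  using group_action.id_eq_one[OF act] by (metis UNIV_I restrict_apply')

text \<open>A hop is a straight segment of a chart, translated by \<open>g\<close>. The Lagrangian is evaluated on the untranslated
segment, for the shifted random parameter \<open>\<tau> g \<omega>\<close>; for a stationary Hamiltonian this is its value on the
translated segment for \<open>\<omega>\<close>. With this convention stationarity of hops needs no geometry. The constant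
\<open>B\<close> bounds the Lagrangian, so that the cost of a chain is a finite sum instead of an integral.\<close>

definition hop :: "'w \<Rightarrow> 'm \<Rightarrow> 'm \<Rightarrow> real \<Rightarrow> real \<Rightarrow> bool" where
  "hop \<omega> x x' s B \<longleftrightarrow> 0 < s \<and> (\<exists>g\<in>carrier G. \<exists>c\<in>A. \<exists>y q.
     x = \<alpha> g (chart_inv c y) \<and> x' = \<alpha> g (chart_inv c (y + s *\<^sub>R q)) \<and>
     (\<forall>r\<in>{0..s}. y + r *\<^sub>R q \<in> chart_image c \<and>
        L (chart_inv c (y + r *\<^sub>R q)) (tvec_of A c (chart_inv c (y + r *\<^sub>R q)) q) (\<tau> g \<omega>) \<le> B))"

inductive reach :: "'w \<Rightarrow> 'm \<Rightarrow> 'm \<Rightarrow> real \<Rightarrow> real \<Rightarrow> bool" for \<omega> :: 'w and x :: 'm where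
  reach_refl: "reach \<omega> x x 0 0"
| reach_hop: "reach \<omega> x y t a \<Longrightarrow> hop \<omega> y z s B \<Longrightarrow> reach \<omega> x z (t + s) (a + s * B)"

lemma reach_trans:
  assumes "reach \<omega> x y t a" "reach \<omega> y z t' a'"
  shows "reach \<omega> x z (t + t') (a + a')"
  using assms(2)
proof induction
  case reach_refl
  then show ?case using assms(1) by simp
next
  case (reach_hop y' t' a' z s B)
  from reach.reach_hop[OF reach_hop.IH reach_hop.hyps(2)] show ?case by (simp add: add.assoc)
qed

lemma reach_single: "hop \<omega> x y s B \<Longrightarrow> reach \<omega> x y s (s * B)"
  using reach_hop[OF reach_refl] by simp

text \<open>Stationarity: since hops are translates of chart segments whose cost is evaluated at the
  shifted random parameter, it is a matter of reindexing by a group element.\<close>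

lemma hop_shift:
  assumes \<omega>: "\<omega> \<in> W" and g: "g \<in> carrier G"
  shows "hop \<omega> (\<alpha> g x) (\<alpha> g y) s B \<longleftrightarrow> hop (\<tau> g \<omega>) x y s B"
proof
  assume "hop (\<tau> g \<omega>) x y s B"
  then obtain h c u q where h: "0 < s" "h \<in> carrier G" "c \<in> A" "x = \<alpha> h (chart_inv c u)" "y = \<alpha> h (chart_inv c (u + s *\<^sub>R q))"
    "\<And>r. r \<in> {0..s} \<Longrightarrow> u + r *\<^sub>R q \<in> chart_image c"
    "\<And>r. r \<in> {0..s} \<Longrightarrow> L (chart_inv c (u + r *\<^sub>R q)) (tvec_of A c (chart_inv c (u + r *\<^sub>R q)) q) (\<tau> h (\<tau> g \<omega>)) \<le> B"
    unfolding hop_def by blast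
  have "\<tau> h (\<tau> g \<omega>) = \<tau> (g \<otimes> h) \<omega>" using \<tau>_comp[OF h(2) g \<omega>] m_comm[OF g h(2)] by simp
  then show "hop \<omega> (\<alpha> g x) (\<alpha> g y) s B"
    unfolding hop_def using h g \<alpha>_comp[OF g h(2)]
    by (intro conjI bexI[of _ "g \<otimes> h"] bexI[of _ c] exI[of _ u] exI[of _ q]) auto
next
  assume "hop \<omega> (\<alpha> g x) (\<alpha> g y) s B"
  then obtain h c u q where h: "0 < s" "h \<in> carrier G" "c \<in> A" "\<alpha> g x = \<alpha> h (chart_inv c u)" "\<alpha> g y = \<alpha> h (chart_inv c (u + s *\<^sub>R q))"
    "\<And>r. r \<in> {0..s} \<Longrightarrow> u + r *\<^sub>R q \<in> chart_image c"
    "\<And>r. r \<in> {0..s} \<Longrightarrow> L (chart_inv c (u + r *\<^sub>R q)) (tvec_of A c (chart_inv c (u + r *\<^sub>R q)) q) (\<tau> h \<omega>) \<le> B"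
    unfolding hop_def by blast
  have ig: "inv g \<in> carrier G" using g by simp
  have k: "inv g \<otimes> h \<in> carrier G" using ig h(2) by simp
  have "\<tau> (inv g \<otimes> h) (\<tau> g \<omega>) = \<tau> ((inv g \<otimes> h) \<otimes> g) \<omega>" using \<tau>_comp[OF k g \<omega>] by simp
  also have "(inv g \<otimes> h) \<otimes> g = h" using g h(2) ig by (simp add: m_comm[OF k g] m_assoc[symmetric])
  finally have \<tau>: "\<tau> (inv g \<otimes> h) (\<tau> g \<omega>) = \<tau> h \<omega>" .
  have pull: "z = \<alpha> (inv g \<otimes> h) w" if "\<alpha> g z = \<alpha> h w" for z w
    using \<alpha>_comp[OF ig h(2), of w] \<alpha>_comp[OF ig g, of z] that g by simp
  show "hop (\<tau> g \<omega>) x y s B"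
    unfolding hop_def using h k \<tau> pull[OF h(4)] pull[OF h(5)]
    by (intro conjI bexI[of _ "inv g \<otimes> h"] bexI[of _ c] exI[of _ u] exI[of _ q]) auto
qed

lemma reach_shift1:
  assumes \<omega>: "\<omega> \<in> W" and g: "g \<in> carrier G"
  shows "reach (\<tau> g \<omega>) x y t a \<Longrightarrow> reach \<omega> (\<alpha> g x) (\<alpha> g y) t a"
proof (induction rule: reach.induct)
  case (reach_hop y t a z s B)
  from reach.reach_hop[OF reach_hop.IH] hop_shift[OF \<omega> g] reach_hop.hyps(2) show ?case by blast
qed (rule reach.reach_refl)

lemma \<alpha>_inv: "g \<in> carrier G \<Longrightarrow> \<alpha> g (\<alpha> (inv g) x) = x" "g \<in> carrier G \<Longrightarrow> \<alpha> (inv g) (\<alpha> g x) = x"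
  using \<alpha>_comp[of g "inv g" x] \<alpha>_comp[of "inv g" g x] by simp_all

lemma reach_shift:
  assumes \<omega>: "\<omega> \<in> W" and g: "g \<in> carrier G"
  shows "reach \<omega> (\<alpha> g x) (\<alpha> g y) t a \<longleftrightarrow> reach (\<tau> g \<omega>) x y t a"
proof
  have "reach \<omega> X Y t a \<Longrightarrow> reach (\<tau> g \<omega>) (\<alpha> (inv g) X) (\<alpha> (inv g) Y) t a" for X Y
  proof (induction rule: reach.induct)
    case (reach_hop y t a z s B)
    have "hop (\<tau> g \<omega>) (\<alpha> (inv g) y) (\<alpha> (inv g) z) s B"
      using hop_shift[OF \<omega> g, of "\<alpha> (inv g) y" "\<alpha> (inv g) z"] reach_hop.hyps(2) by (simp add: \<alpha>_inv[OF g])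
    from reach.reach_hop[OF reach_hop.IH this] show ?case .
  qed (rule reach.reach_refl)
  from this[of "\<alpha> g x" "\<alpha> g y"] show "reach \<omega> (\<alpha> g x) (\<alpha> g y) t a \<Longrightarrow> reach (\<tau> g \<omega>) x y t a"
    by (simp add: \<alpha>_inv[OF g])
qed (rule reach_shift1[OF \<omega> g])

text \<open>A segment of a chart is a hop with the neutral element. Since \<open>\<tau> \<one>\<close> need not be the identity, the bound is
required for every parameter with the same Hamiltonian on covectors.\<close>

lemma hop_chart:
  assumes "\<omega> \<in> W" "c \<in> A" "0 < s"
    and seg: "\<And>r. 0 \<le> r \<Longrightarrow> r \<le> s \<Longrightarrow> y + r *\<^sub>R q \<in> chart_image c"
    and B: "\<And>r \<omega>'. \<omega>' \<in> W \<Longrightarrow> (\<And>x p. p \<in> cotangent_space A x \<Longrightarrow> H (x, p) \<omega>' = H (x, p) \<omega>) \<Longrightarrow> 0 \<le> r \<Longrightarrow> r \<le> s \<Longrightarrow>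
       L (chart_inv c (y + r *\<^sub>R q)) (tvec_of A c (chart_inv c (y + r *\<^sub>R q)) q) \<omega>' \<le> B"
  shows "hop \<omega> (chart_inv c y) (chart_inv c (y + s *\<^sub>R q)) s B"
proof -
  have "H (x, p) (\<tau> \<one> \<omega>) = H (x, p) \<omega>" if p: "p \<in> cotangent_space A x" for x p
  proof -
    have sm: "smooth_map A (\<alpha> \<one>)" using isometry_smooth(1)[OF isom] by simp
    have "\<alpha> \<one> = (\<lambda>x. x)" by (rule ext) simp
    obtain p' where p': "cot_lift A (\<alpha> \<one>) (x, p) = (x, p')" "p' \<in> cotangent_space A x"
      "\<And>v. v \<in> tangent_space A x \<Longrightarrow> p' (differential A (\<alpha> \<one>) x v) = p v"
      using cot_lift_push[OF isom[OF one_closed] p] by (metis \<alpha>_one)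
    have "differential A (\<alpha> \<one>) x v = v" if v: "v \<in> tangent_space A x" for v
    proof -
      obtain c where c: "c \<in> A" "x \<in> fst c" by (rule chart_exists)
      have "differential A (\<lambda>x. x) x (tvec_of A c x (v c)) = tvec_of A c x (Jac c c (\<lambda>x. x) (snd c x) (v c))"
        by (rule differential_tvec[OF smooth_map_id c]) (use c in auto)
      then show ?thesis unfolding \<open>\<alpha> \<one> = (\<lambda>x. x)\<close> trans_Jac[symmetric] trans_same[OF c] tvec_of_coord[OF c v] .
    qed
    then have "p' v = p v" for v
      using p'(3) cotangent_out[OF p'(2)] cotangent_out[OF p] by (cases "v \<in> tangent_space A x") metis+
    then have "p' = p" by blast
    then show ?thesis using H_stat[OF assms(1) one_closed p] p'(1) by simp
  qed
  then show ?thesis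
    unfolding hop_def using assms \<tau>_in[OF one_closed assms(1)]
    by (intro conjI bexI[of _ \<one>] bexI[of _ c] exI[of _ y] exI[of _ q]) auto
qed

lemma hop_stay:
  assumes "\<omega> \<in> W" "0 < s"
  shows "hop \<omega> x x s (\<theta>conj 0)"
proof -
  obtain c where c: "c \<in> A" "x \<in> fst c" by (rule chart_exists)
  have "hop \<omega> (chart_inv c (snd c x)) (chart_inv c (snd c x + s *\<^sub>R 0)) s (\<theta>conj 0)"
  proof (rule hop_chart[OF assms(1) c(1) assms(2)])
    fix r \<omega>' assume "\<omega>' \<in> W"
    then show "L (chart_inv c (snd c x + r *\<^sub>R 0)) (tvec_of A c (chart_inv c (snd c x + r *\<^sub>R 0)) 0) \<omega>' \<le> \<theta>conj 0"
      using L_upper[of \<omega>' "tvec_of A c x 0" x] nm_0[OF c(1), of "snd c x"] c by (simp add: nm_def)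
  qed (use c in auto)
  then show ?thesis using c by simp
qed

text \<open>Waiting is a hop with zero velocity, so a chain can be prolonged at bounded cost per unit of time.\<close>

lemma reach_stay:
  assumes "\<omega> \<in> W" "reach \<omega> x y t a" "t \<le> t'"
  shows "reach \<omega> x y t' (a + (t' - t) * \<theta>conj 0)"
proof (cases "t = t'")
  case False
  then show ?thesis using reach_hop[OF assms(2) hop_stay[OF assms(1), of "t' - t"]] assms(3) by simp
qed (use assms in simp)

lemma reach_lower:
  assumes "\<omega> \<in> W" "reach \<omega> x y t a"
  shows "0 \<le> t \<and> - \<Theta> 0 * t \<le> a"
  using assms(2)
proof induction
  case (reach_hop y t a z s B)
  then obtain g c u q where h: "0 < s" "g \<in> carrier G" "c \<in> A"
    "u + 0 *\<^sub>R q \<in> chart_image c" "L (chart_inv c (u + 0 *\<^sub>R q)) (tvec_of A c (chart_inv c (u + 0 *\<^sub>R q)) q) (\<tau> g \<omega>) \<le> B"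
    unfolding hop_def by (metis atLeastAtMost_iff order.refl less_imp_le)
  then have "- \<Theta> 0 \<le> B"
    using L_lower[OF \<tau>_in[OF h(2) assms(1)] tvec_of_in[OF h(3) chart_inv_in[OF h(3,4)]], of q] by simp
  then have "s * - \<Theta> 0 \<le> s * B" using h(1) by (intro mult_left_mono) auto
  then show ?case using reach_hop.IH h(1) by (simp add: algebra_simps)
qed simp

text \<open>A chain of length at most \<open>l\<close> joins \<open>x\<close> to \<open>y\<close>: it can be travelled in any time \<open>t\<close> with speed \<open>l / t\<close>, at the
cost that \<open>\<theta>conj\<close> allows for this speed. The condition is uniform in the random parameter.\<close>

definition connects :: "real \<Rightarrow> 'm \<Rightarrow> 'm \<Rightarrow> bool" where
  "connects l x y \<longleftrightarrow> 0 < l \<and> (\<forall>\<omega>\<in>W. \<forall>t>0. \<exists>a \<le> t * \<theta>conj (l / t). reach \<omega> x y t a)"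

lemma connects_mono: "connects l x y \<Longrightarrow> l \<le> l' \<Longrightarrow> connects l' x y"
proof -
  assume a: "connects l x y" "l \<le> l'"
  then have l: "0 < l" by (simp add: connects_def)
  have "t * \<theta>conj (l / t) \<le> t * \<theta>conj (l' / t)" if "0 < t" for t
    using a(2) l that by (intro mult_left_mono \<theta>conj_mono divide_right_mono) auto
  then show ?thesis using a l unfolding connects_def by (meson order_trans less_le_trans)
qed

lemma connects_refl: "0 < l \<Longrightarrow> connects l x x"
proof -
  assume l: "0 < l"
  have "\<exists>a \<le> t * \<theta>conj (l / t). reach \<omega> x x t a" if "\<omega> \<in> W" "0 < t" for \<omega> t
  proof (intro exI conjI)
    show "reach \<omega> x x t (t * \<theta>conj 0)" using reach_stay[OF that(1) reach_refl, of t x] that by simp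
    show "t * \<theta>conj 0 \<le> t * \<theta>conj (l / t)" using l that by (intro mult_left_mono \<theta>conj_mono) auto
  qed
  then show ?thesis using l by (auto simp: connects_def)
qed

text \<open>The time is divided in proportion to the lengths, so that the speed is the same on both parts.\<close>

lemma connects_trans:
  assumes "connects l x y" "connects l' y z"
  shows "connects (l + l') x z"
proof -
  have l: "0 < l" "0 < l'" using assms by (auto simp: connects_def)
  have "\<exists>a \<le> t * \<theta>conj ((l + l') / t). reach \<omega> x z t a" if \<omega>: "\<omega> \<in> W" "0 < t" for \<omega> t
  proof -
    define t1 where "t1 = t * l / (l + l')"
    define t2 where "t2 = t * l' / (l + l')"
    have t: "0 < t1" "0 < t2" "l / t1 = (l + l') / t" "l' / t2 = (l + l') / t"
      using l that by (auto simp: t1_def t2_def field_simps)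
    have t12: "t1 + t2 = t"
      using l by (simp add: t1_def t2_def add_divide_distrib[symmetric] distrib_left[symmetric])
    obtain a1 where a1: "a1 \<le> t1 * \<theta>conj ((l + l') / t)" "reach \<omega> x y t1 a1"
      using assms(1) \<omega> t by (metis connects_def)
    obtain a2 where a2: "a2 \<le> t2 * \<theta>conj ((l + l') / t)" "reach \<omega> y z t2 a2"
      using assms(2) \<omega> t by (metis connects_def)
    have "a1 + a2 \<le> (t1 + t2) * \<theta>conj ((l + l') / t)" using a1(1) a2(1) by (simp add: distrib_right)
    then show ?thesis using reach_trans[OF a1(2) a2(2)] t12 by auto
  qed
  then show ?thesis using l by (auto simp: connects_def)
qed

lemma connects_shift:
  assumes "connects l x y" "g \<in> carrier G"
  shows "connects l (\<alpha> g x) (\<alpha> g y)"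
  using assms reach_shift[OF _ assms(2)] \<tau>_in[OF assms(2)] unfolding connects_def by metis

lemma connects_local:
  obtains U where "open U" "x \<in> U" "\<And>u v. u \<in> U \<Longrightarrow> v \<in> U \<Longrightarrow> \<exists>l. connects l u v"
proof -
  obtain c where c: "c \<in> A" "x \<in> fst c" by (rule chart_exists)
  have y: "snd c x \<in> chart_image c" using c by simp
  obtain r m M where r: "0 < r" "0 < M" "cball (snd c x) r \<subseteq> chart_image c"
    "\<And>y a. y \<in> cball (snd c x) r \<Longrightarrow> nm c y a \<le> M * norm a"
    using nm_local[OF c(1) y open_UNIV UNIV_I] by (metis Int_UNIV_right)
  define D where "D = ball (snd c x) r"
  have D: "D \<subseteq> chart_image c" "convex D" "\<And>y a. y \<in> D \<Longrightarrow> nm c y a \<le> M * norm a"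
    using r by (auto simp: D_def)
  have con: "\<exists>l. connects l (chart_inv c u) (chart_inv c v)" if uv: "u \<in> D" "v \<in> D" for u v
  proof
    define l where "l = M * norm (v - u) + 1"
    have l: "0 < l" using r(2) by (simp add: l_def add_nonneg_pos)
    have "\<exists>a \<le> t * \<theta>conj (l / t). reach \<omega> (chart_inv c u) (chart_inv c v) t a" if \<omega>: "\<omega> \<in> W" "0 < t" for \<omega> t
    proof -
      define q where "q = (1 / t) *\<^sub>R (v - u)"
      have seg: "u + s *\<^sub>R q \<in> D" if "0 \<le> s" "s \<le> t" for s
      proof -
        have "u + s *\<^sub>R q = (1 - s / t) *\<^sub>R u + (s / t) *\<^sub>R v" by (simp add: q_def algebra_simps)
        then show ?thesis using convexD_alt[OF D(2) uv(1,2), of "s / t"] that \<open>0 < t\<close> by simp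
      qed
      have "hop \<omega> (chart_inv c u) (chart_inv c (u + t *\<^sub>R q)) t (\<theta>conj (l / t))"
      proof (rule hop_chart[OF \<omega>(1) c(1) \<omega>(2)])
        fix s assume s: "0 \<le> s" "s \<le> t"
        then have sD: "u + s *\<^sub>R q \<in> D" by (rule seg)
        then show in_c: "u + s *\<^sub>R q \<in> chart_image c" using D(1) by blast
        fix \<omega>' assume \<omega>': "\<omega>' \<in> W"
        have "L (chart_inv c (u + s *\<^sub>R q)) (tvec_of A c (chart_inv c (u + s *\<^sub>R q)) q) \<omega>' \<le> \<theta>conj (nm c (u + s *\<^sub>R q) q)"
          unfolding nm_def by (rule L_upper[OF \<omega>' tvec_of_in[OF c(1) chart_inv_in[OF c(1) in_c]]])
        also have "\<dots> \<le> \<theta>conj (l / t)"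
        proof (rule \<theta>conj_mono[OF nm_nonneg[OF c(1) in_c]])
          have "nm c (u + s *\<^sub>R q) q \<le> M * norm q" by (rule D(3)[OF sD])
          also have "\<dots> = M * norm (v - u) / t" using \<omega>(2) by (simp add: q_def)
          also have "\<dots> \<le> l / t" using \<omega>(2) by (intro divide_right_mono) (auto simp: l_def)
          finally show "nm c (u + s *\<^sub>R q) q \<le> l / t" .
        qed
        finally show "L (chart_inv c (u + s *\<^sub>R q)) (tvec_of A c (chart_inv c (u + s *\<^sub>R q)) q) \<omega>' \<le> \<theta>conj (l / t)" .
      qed
      moreover have "u + t *\<^sub>R q = v" using \<omega>(2) by (simp add: q_def)
      ultimately show ?thesis using reach_single by force
    qed
    then show "connects l (chart_inv c u) (chart_inv c v)" using l by (auto simp: connects_def)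
  qed
  show thesis
  proof (rule that[of "chart_inv c ` D"])
    show "open (chart_inv c ` D)" by (rule chart_inv_open_image[OF c(1) _ D(1)]) (simp add: D_def)
    show "x \<in> chart_inv c ` D" using c r(1) by (intro image_eqI[of _ _ "snd c x"]) (auto simp: D_def)
  qed (use con in blast)
qed

text \<open>The points that can be joined to \<open>x\<close> form a set that is open and closed.\<close>

lemma connects_exists: "\<exists>l. connects l x y"
proof -
  define S where "S = {y. \<exists>l. connects l x y}"
  have "open S"
  proof (subst open_subopen, intro ballI)
    fix y assume y: "y \<in> S"
    obtain U where U: "open U" "y \<in> U" "\<And>u v. u \<in> U \<Longrightarrow> v \<in> U \<Longrightarrow> \<exists>l. connects l u v" using connects_local[of y] by metis
    have "U \<subseteq> S" using U(3)[OF U(2)] y connects_trans unfolding S_def by blast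
    then show "\<exists>T. open T \<and> y \<in> T \<and> T \<subseteq> S" using U by blast
  qed
  moreover have "open (- S)"
  proof (subst open_subopen, intro ballI)
    fix y assume y: "y \<in> - S"
    obtain U where U: "open U" "y \<in> U" "\<And>u v. u \<in> U \<Longrightarrow> v \<in> U \<Longrightarrow> \<exists>l. connects l u v" using connects_local[of y] by metis
    have "U \<subseteq> - S" using U(3)[OF _ U(2)] y connects_trans unfolding S_def by blast
    then show "\<exists>T. open T \<and> y \<in> T \<and> T \<subseteq> - S" using U by blast
  qed
  moreover have "x \<in> S" using connects_refl[of 1 x] by (auto simp: S_def)
  ultimately have "S = UNIV" using conn_UNIV by (auto simp: connected_clopen closed_open)
  then show ?thesis by (auto simp: S_def)
qed

end

section \<open>Measurability\<close>

context riem_manifold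
begin

lemma topspace_cot [simp]: "topspace (cot_topology A) = cotangent_bundle A"
proof
  show "topspace (cot_topology A) \<subseteq> cotangent_bundle A"
    using openin_topspace[of "cot_topology A"] unfolding openin_cot_topology by blast
  have "openin (cot_topology A) (cotangent_bundle A)"
    unfolding openin_cot_topology
  proof (intro conjI ballI order_refl)
    fix c assume c: "c \<in> A"
    have "{z \<in> chart_image c \<times> UNIV. cot_param A c z \<in> cotangent_bundle A} = chart_image c \<times> UNIV"
      by (auto simp: cot_param_covec cotangent_bundle_def)
    then show "open {z \<in> chart_image c \<times> UNIV. cot_param A c z \<in> cotangent_bundle A}"
      using chart_open(2)[OF c] by (simp add: open_Times)
  qed
  then show "cotangent_bundle A \<subseteq> topspace (cot_topology A)" by (rule openin_subset)
qed

lemma continuous_map_cot_param: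
  assumes c: "c \<in> A"
  shows "continuous_map (top_of_set (chart_image c \<times> UNIV)) (cot_topology A) (cot_param A c)"
  unfolding continuous_map_def
proof (intro conjI allI impI)
  show "cot_param A c \<in> topspace (top_of_set (chart_image c \<times> UNIV)) \<rightarrow> topspace (cot_topology A)"
    by (auto simp: cot_param_covec cotangent_bundle_def)
  fix U assume "openin (cot_topology A) U"
  then have "open {z \<in> chart_image c \<times> UNIV. cot_param A c z \<in> U}"
    using c unfolding openin_cot_topology by blast
  then show "openin (top_of_set (chart_image c \<times> UNIV))
      {x \<in> topspace (top_of_set (chart_image c \<times> UNIV)). cot_param A c x \<in> U}"
    by (subst openin_open_eq) (auto simp: open_Times chart_open(2)[OF c])
qed

text \<open>In a chart, the covectors of bounded norm over a closed ball lie in a product of two closed balls.\<close>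

lemma compact_momenta_local:
  obtains U K where "open U" "x \<in> U" "compactin (cot_topology A) K"
    "\<And>u p. u \<in> U \<Longrightarrow> p \<in> cotangent_space A u \<Longrightarrow> dual_norm A \<rho> u p \<le> R \<Longrightarrow> (u, p) \<in> K"
proof -
  obtain c where c: "c \<in> A" "x \<in> fst c" by (rule chart_exists)
  have y: "snd c x \<in> chart_image c" using c by simp
  obtain r m M where r: "0 < r" "0 < m" "0 < M" "cball (snd c x) r \<subseteq> chart_image c \<inter> UNIV"
    "\<And>y a. y \<in> cball (snd c x) r \<Longrightarrow> m * norm a \<le> nm c y a"
    "\<And>y a. y \<in> cball (snd c x) r \<Longrightarrow> nm c y a \<le> M * norm a"
    using nm_local[OF c(1) y open_UNIV UNIV_I] by metis
  define K where "K = cot_param A c ` (cball (snd c x) r \<times> cball 0 (M * R))"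
  have sub: "ball (snd c x) r \<subseteq> chart_image c" using r(4) by auto
  show thesis
  proof (rule that)
    show "open (chart_inv c ` ball (snd c x) r)" by (rule chart_inv_open_image[OF c(1) open_ball sub])
    show "x \<in> chart_inv c ` ball (snd c x) r" using c r(1) by (intro image_eqI[of _ _ "snd c x"]) auto
    show "compactin (cot_topology A) K"
      unfolding K_def
    proof (rule image_compactin[OF _ continuous_map_cot_param[OF c(1)]])
      show "compactin (top_of_set (chart_image c \<times> UNIV)) (cball (snd c x) r \<times> cball (0::'e) (M * R))"
      proof -
        have "compact (cball (snd c x) r \<times> cball (0::'e) (M * R))" by (intro compact_Times compact_cball)
        then show ?thesis using r(4) by (simp add: compactin_subtopology Times_subset_cancel2 subset_iff)
      qed
    qed
    fix u p assume u: "u \<in> chart_inv c ` ball (snd c x) r" and p: "p \<in> cotangent_space A u" "dual_norm A \<rho> u p \<le> R"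
    obtain y where y: "y \<in> ball (snd c x) r" "u = chart_inv c y" using u by blast
    have yc: "y \<in> chart_image c" using y sub by blast
    have uc: "u \<in> fst c" "snd c u = y" using y(2) chart_inv_in[OF c(1) yc] chart_inv_right[OF c(1) yc] by auto
    obtain \<xi> where \<xi>: "p = covec c y \<xi>" using covec_exists[OF p(1) c(1) uc(1)] uc(2) by metis
    have yb: "y \<in> cball (snd c x) r" using y(1) by auto
    have "norm \<xi> \<le> M * dual_norm A \<rho> u p"
      unfolding \<xi> y(2) by (rule covec_norm_bounds(2)[OF c(1) yc r(2) r(5)[OF yb] r(3) r(6)[OF yb]])
    also have "\<dots> \<le> M * R" using p(2) r(3) by (intro mult_left_mono) auto
    finally have "(y, \<xi>) \<in> cball (snd c x) r \<times> cball 0 (M * R)" using yb by simp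
    moreover have "(u, p) = cot_param A c (y, \<xi>)" by (simp add: cot_param_covec \<xi> y(2))
    ultimately show "(u, p) \<in> K" unfolding K_def by blast
  qed
qed

lemma compact_momenta:
  assumes "compact S"
  obtains K where "compactin (cot_topology A) K"
    "\<And>u p. u \<in> S \<Longrightarrow> p \<in> cotangent_space A u \<Longrightarrow> dual_norm A \<rho> u p \<le> R \<Longrightarrow> (u, p) \<in> K"
proof -
  have "\<exists>U K. open U \<and> x \<in> U \<and> compactin (cot_topology A) K \<and>
     (\<forall>u p. u \<in> U \<longrightarrow> p \<in> cotangent_space A u \<longrightarrow> dual_norm A \<rho> u p \<le> R \<longrightarrow> (u, p) \<in> K)" for x
    using compact_momenta_local[of x R] by metis
  then obtain U K where UK: "\<And>x. open (U x)" "\<And>x. x \<in> U x" "\<And>x. compactin (cot_topology A) (K x)"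
    "\<And>x u p. u \<in> U x \<Longrightarrow> p \<in> cotangent_space A u \<Longrightarrow> dual_norm A \<rho> u p \<le> R \<Longrightarrow> (u, p) \<in> K x" by metis
  have cov: "S \<subseteq> (\<Union>x\<in>S. U x)" using UK(2) by blast
  obtain T where T: "T \<subseteq> S" "finite T" "S \<subseteq> (\<Union>x\<in>T. U x)"
    by (rule compactE_image[OF assms UK(1) cov])
  show thesis
  proof (rule that[of "\<Union> (K ` T)"])
    show "compactin (cot_topology A) (\<Union> (K ` T))"
      using T(2) UK(3) by (intro compactin_Union) auto
    fix u p assume u: "u \<in> S" "p \<in> cotangent_space A u" "dual_norm A \<rho> u p \<le> R"
    then obtain x where "x \<in> T" "u \<in> U x" using T(3) by blast
    then show "(u, p) \<in> \<Union> (K ` T)" using UK(4)[OF _ u(2,3)] by blast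
  qed
qed

end

context stationary_ham
begin

text \<open>The segment is compact and its velocities are bounded, so only momenta in a compact set \<open>K\<close> matter for the
Lagrangian along the hop; there a change of the Hamiltonian by less than \<open>\<kappa>\<close> changes it by at most \<open>\<kappa>\<close>.\<close>

lemma hop_perturb:
  assumes \<omega>0: "\<omega>0 \<in> W" and hop: "hop \<omega>0 x x' s B" and "0 < \<kappa>"
  shows "\<exists>K. compactin (cot_topology A) K \<and>
    (\<forall>\<omega>\<in>W. (\<forall>z\<in>K. \<bar>H z \<omega> - H z \<omega>0\<bar> < \<kappa>) \<longrightarrow> hop \<omega> x x' s (B + \<kappa>))"
proof -
  obtain g c y q where h: "0 < s" "g \<in> carrier G" "c \<in> A" "x = \<alpha> g (chart_inv c y)" "x' = \<alpha> g (chart_inv c (y + s *\<^sub>R q))"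
    "\<And>r. r \<in> {0..s} \<Longrightarrow> y + r *\<^sub>R q \<in> chart_image c"
    "\<And>r. r \<in> {0..s} \<Longrightarrow> L (chart_inv c (y + r *\<^sub>R q)) (tvec_of A c (chart_inv c (y + r *\<^sub>R q)) q) (\<tau> g \<omega>0) \<le> B"
    using hop unfolding hop_def by blast
  let ?y = "\<lambda>r. y + r *\<^sub>R q"
  let ?x = "\<lambda>r. chart_inv c (?y r)"
  have cy: "continuous_on {0..s} ?y" by (intro continuous_intros)
  obtain V where V: "\<And>r. r \<in> {0..s} \<Longrightarrow> nm c (?y r) q \<le> V"
    using segment_speed_bounded[OF h(3,6)] by blast
  obtain R where R: "0 \<le> R" "\<And>\<omega> x q p. \<omega> \<in> W \<Longrightarrow> q \<in> tangent_space A x \<Longrightarrow> riem_norm \<rho> x q \<le> V \<Longrightarrow>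
      p \<in> cotangent_space A x \<Longrightarrow> R < dual_norm A \<rho> x p \<Longrightarrow> p q - H (x, p) \<omega> \<le> - \<Theta> 0"
    using small_momenta[of V] by metis
  have cx: "continuous_on {0..s} ?x"
    by (rule continuous_on_compose2[OF chart_cont(2)[OF h(3)] cy]) (use h(6) in auto)
  have cg: "continuous_on UNIV (\<alpha> g)"
    using isometry_smooth(1)[OF isom[OF h(2)]] by (simp add: smooth_map_def)
  have "continuous_on {0..s} (\<lambda>r. \<alpha> g (?x r))"
    by (rule continuous_on_compose2[OF cg cx]) simp
  then have "compact ((\<lambda>r. \<alpha> g (?x r)) ` {0..s})" by (rule compact_continuous_image) simp
  then obtain K where K: "compactin (cot_topology A) K"
    "\<And>u p. u \<in> (\<lambda>r. \<alpha> g (?x r)) ` {0..s} \<Longrightarrow> p \<in> cotangent_space A u \<Longrightarrow> dual_norm A \<rho> u p \<le> R \<Longrightarrow> (u, p) \<in> K"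
    using compact_momenta by metis
  have "hop \<omega> x x' s (B + \<kappa>)" if \<omega>: "\<omega> \<in> W" and close: "\<And>z. z \<in> K \<Longrightarrow> \<bar>H z \<omega> - H z \<omega>0\<bar> < \<kappa>" for \<omega>
  proof -
    have "L (?x r) (tvec_of A c (?x r) q) (\<tau> g \<omega>) \<le> B + \<kappa>" if r: "r \<in> {0..s}" for r
    proof (rule L_le)
      let ?q = "tvec_of A c (?x r) q"
      have q: "?q \<in> tangent_space A (?x r)" "riem_norm \<rho> (?x r) ?q \<le> V"
        using tvec_of_in[OF h(3) chart_inv_in[OF h(3) h(6)[OF r]]] V[OF r] by (auto simp: nm_def)
      fix p assume p: "p \<in> cotangent_space A (?x r)"
      show "p ?q - H (?x r, p) (\<tau> g \<omega>) \<le> B + \<kappa>"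
      proof (cases "R < dual_norm A \<rho> (?x r) p")
        case True
        then have "p ?q - H (?x r, p) (\<tau> g \<omega>) \<le> - \<Theta> 0"
          using R(2)[OF \<tau>_in[OF h(2) \<omega>] q p] by simp
        also have "\<dots> \<le> L (?x r) ?q (\<tau> g \<omega>0)" by (rule L_lower[OF \<tau>_in[OF h(2) \<omega>0] q(1)])
        also have "\<dots> \<le> B" by (rule h(7)[OF r])
        finally show ?thesis using \<open>0 < \<kappa>\<close> by simp
      next
        case False
        obtain p' where p': "cot_lift A (\<alpha> g) (?x r, p) = (\<alpha> g (?x r), p')"
          "p' \<in> cotangent_space A (\<alpha> g (?x r))" "dual_norm A \<rho> (\<alpha> g (?x r)) p' \<le> dual_norm A \<rho> (?x r) p"
          using cot_lift_push[OF isom[OF h(2)] p] by metis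
        have "(\<alpha> g (?x r), p') \<in> K" using K(2)[OF _ p'(2)] p'(3) False r by auto
        then have "\<bar>H (?x r, p) (\<tau> g \<omega>) - H (?x r, p) (\<tau> g \<omega>0)\<bar> < \<kappa>"
          using close[of "(\<alpha> g (?x r), p')"] H_stat[OF \<omega> h(2) p] H_stat[OF \<omega>0 h(2) p] p'(1) by simp
        moreover have "p ?q - H (?x r, p) (\<tau> g \<omega>0) \<le> B"
          using L_ge[OF \<tau>_in[OF h(2) \<omega>0] q(1) p] h(7)[OF r] by linarith
        ultimately show ?thesis by linarith
      qed
    qed
    then show ?thesis unfolding hop_def using h
      by (intro conjI bexI[of _ g] bexI[of _ c] exI[of _ y] exI[of _ q]) auto
  qed
  then show ?thesis using K(1) by blast
qed

lemma reach_perturb: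
  assumes \<omega>0: "\<omega>0 \<in> W" and "0 < \<kappa>" and reach: "reach \<omega>0 x y t a"
  shows "\<exists>K. compactin (cot_topology A) K \<and>
    (\<forall>\<omega>\<in>W. (\<forall>z\<in>K. \<bar>H z \<omega> - H z \<omega>0\<bar> < \<kappa>) \<longrightarrow> reach \<omega> x y t (a + \<kappa> * t))"
  using reach
proof induction
  case reach_refl
  then show ?case using reach.reach_refl by (intro exI[of _ "{}"]) auto
next
  case (reach_hop y t a z s B)
  obtain K1 where K1: "compactin (cot_topology A) K1"
    "\<And>\<omega>. \<omega> \<in> W \<Longrightarrow> (\<forall>z\<in>K1. \<bar>H z \<omega> - H z \<omega>0\<bar> < \<kappa>) \<Longrightarrow> reach \<omega> x y t (a + \<kappa> * t)"
    using reach_hop.IH by blast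
  obtain K2 where K2: "compactin (cot_topology A) K2"
    "\<And>\<omega>. \<omega> \<in> W \<Longrightarrow> (\<forall>z\<in>K2. \<bar>H z \<omega> - H z \<omega>0\<bar> < \<kappa>) \<Longrightarrow> hop \<omega> y z s (B + \<kappa>)"
    using hop_perturb[OF \<omega>0 reach_hop.hyps(2) \<open>0 < \<kappa>\<close>] by blast
  show ?case
  proof (intro exI conjI ballI impI)
    show "compactin (cot_topology A) (K1 \<union> K2)" using K1(1) K2(1) by (rule compactin_Un)
    fix \<omega> assume "\<omega> \<in> W" "\<forall>z\<in>K1 \<union> K2. \<bar>H z \<omega> - H z \<omega>0\<bar> < \<kappa>"
    then have "reach \<omega> x z (t + s) (a + \<kappa> * t + s * (B + \<kappa>))"
      using K1(2) K2(2) by (intro reach.reach_hop) auto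
    then show "reach \<omega> x z (t + s) (a + s * B + \<kappa> * (t + s))" by (simp add: algebra_simps)
  qed
qed

text \<open>If \<open>\<omega>0\<close> belongs to the set, so does every \<open>\<omega>\<close> whose Hamiltonian is close to that of \<open>\<omega>0\<close> on a suitable
compact set. Hence the set is the preimage of an open set of continuous functions, a possibly uncountable
union of basic neighbourhoods.\<close>

lemma reach_measurable:
  assumes W: "W = space P"
    and H: "(\<lambda>\<omega>. restrict (\<lambda>z. H z \<omega>) (cotangent_bundle A)) \<in> P \<rightarrow>\<^sub>M borel_of (compact_conv_topology (cot_topology A))"
  shows "{\<omega> \<in> space P. \<exists>a<e. reach \<omega> x y t a} \<in> sets P"
proof -
  define X where "X = cot_topology A"
  define \<Psi> where "\<Psi> \<omega> = restrict (\<lambda>z. H z \<omega>) (cotangent_bundle A)" for \<omega>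
  define nbh where "nbh f K r = {f' \<in> cont_funs X. \<forall>z\<in>K. \<bar>f' z - f z\<bar> < (r::real)}" for f K r
  have nbh_open: "openin (compact_conv_topology X) (nbh f K r)" if "f \<in> cont_funs X" "compactin X K" "0 < r" for f K r
    unfolding compact_conv_topology_def nbh_def by (rule topology_generated_by_Basis) (use that in blast)
  have \<Psi>_m: "\<Psi> \<in> P \<rightarrow>\<^sub>M borel_of (compact_conv_topology X)" using H by (simp add: \<Psi>_def[abs_def] X_def)
  have "topspace (compact_conv_topology X) \<subseteq> cont_funs X"
    unfolding compact_conv_topology_def topology_generated_by_topspace by blast
  then have \<Psi>_in: "\<Psi> \<omega> \<in> cont_funs X" if "\<omega> \<in> space P" for \<omega>
    using measurable_space[OF \<Psi>_m that] by (auto simp: borel_of_def space_measure_of_conv)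
  define E where "E = {\<omega> \<in> space P. \<exists>a<e. reach \<omega> x y t a}"
  have "\<exists>K r. compactin X K \<and> 0 < r \<and> (\<forall>\<omega>\<in>space P. \<Psi> \<omega> \<in> nbh (\<Psi> \<omega>0) K r \<longrightarrow> \<omega> \<in> E)" if \<omega>0E: "\<omega>0 \<in> E" for \<omega>0
  proof -
    obtain a where a: "a < e" "reach \<omega>0 x y t a" and \<omega>0: "\<omega>0 \<in> W" using \<omega>0E W by (auto simp: E_def)
    have t: "0 \<le> t" using reach_lower[OF \<omega>0 a(2)] by simp
    \<comment> \<open>the perturbed chain still costs less than \<open>e\<close>\<close>
    define \<kappa> where "\<kappa> = (e - a) / (t + 1)"
    have \<kappa>: "0 < \<kappa>" "a + \<kappa> * t < e" using a(1) t by (auto simp: \<kappa>_def field_simps)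
    obtain K where K: "compactin X K"
      "\<And>\<omega>. \<omega> \<in> W \<Longrightarrow> (\<forall>z\<in>K. \<bar>H z \<omega> - H z \<omega>0\<bar> < \<kappa>) \<Longrightarrow> reach \<omega> x y t (a + \<kappa> * t)"
      using reach_perturb[OF \<omega>0 \<kappa>(1) a(2)] unfolding X_def by blast
    have "K \<subseteq> cotangent_bundle A" using compactin_subset_topspace[OF K(1)] by (simp add: X_def)
    then have "\<forall>z\<in>K. \<Psi> \<omega> z = H z \<omega>" for \<omega> by (auto simp: \<Psi>_def)
    then have "\<omega> \<in> E" if "\<omega> \<in> space P" "\<Psi> \<omega> \<in> nbh (\<Psi> \<omega>0) K \<kappa>" for \<omega>
      using that K(2)[of \<omega>] \<kappa>(2) W by (auto simp: nbh_def E_def)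
    then show ?thesis using K(1) \<kappa>(1) by blast
  qed
  then obtain K r where Kr: "\<And>\<omega>0. \<omega>0 \<in> E \<Longrightarrow> compactin X (K \<omega>0)" "\<And>\<omega>0. \<omega>0 \<in> E \<Longrightarrow> 0 < r \<omega>0"
    "\<And>\<omega>0 \<omega>. \<omega>0 \<in> E \<Longrightarrow> \<omega> \<in> space P \<Longrightarrow> \<Psi> \<omega> \<in> nbh (\<Psi> \<omega>0) (K \<omega>0) (r \<omega>0) \<Longrightarrow> \<omega> \<in> E" by metis
  define U where "U = (\<Union>\<omega>0\<in>E. nbh (\<Psi> \<omega>0) (K \<omega>0) (r \<omega>0))"
  have Esub: "E \<subseteq> space P" by (auto simp: E_def)
  have "openin (compact_conv_topology X) U"
    unfolding U_def using Kr(1,2) \<Psi>_in Esub by (intro openin_Union) (auto intro!: nbh_open)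
  then have "U \<in> sets (borel_of (compact_conv_topology X))"
    unfolding borel_of_def by (subst sets_measure_of) (auto dest: openin_subset)
  then have "\<Psi> -` U \<inter> space P \<in> sets P" using \<Psi>_m by (rule measurable_sets[rotated])
  moreover have "\<Psi> -` U \<inter> space P = E"
  proof
    show "\<Psi> -` U \<inter> space P \<subseteq> E" using Kr(3) by (auto simp: U_def)
    show "E \<subseteq> \<Psi> -` U \<inter> space P"
      using Esub \<Psi>_in Kr(2) by (force simp: U_def nbh_def)
  qed
  ultimately show ?thesis by (simp add: E_def)
qed

end

section \<open>Chains give curves\<close>

lemma ext_integral_mono:
  assumes "AE s in lborel. s \<in> I \<longrightarrow> F s \<le> f s"
  shows "ext_integral I F \<le> ext_integral I f"
proof -
  have "(\<integral>\<^sup>+ s\<in>I. ennreal (F s) \<partial>lborel) \<le> (\<integral>\<^sup>+ s\<in>I. ennreal (f s) \<partial>lborel)"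
    "(\<integral>\<^sup>+ s\<in>I. ennreal (- f s) \<partial>lborel) \<le> (\<integral>\<^sup>+ s\<in>I. ennreal (- F s) \<partial>lborel)"
    by (rule nn_integral_mono_AE, rule AE_mp[OF assms], rule AE_I2, auto split: split_indicator intro!: ennreal_leI)+
  then show ?thesis unfolding ext_integral_def by (intro ereal_minus_mono) (auto simp: less_eq_ennreal.rep_eq)
qed

lemma ext_integral_integrable:
  fixes f :: "real \<Rightarrow> real"
  assumes "set_integrable lborel I f"
  shows "ext_integral I f = ereal (LINT s:I|lborel. f s)"
proof -
  define g where "g s = indicator I s * f s" for s
  have g: "integrable lborel g" using assms by (simp add: set_integrable_def g_def[abs_def])
  have 1: "(\<integral>\<^sup>+ s\<in>I. ennreal (f s) \<partial>lborel) = (\<integral>\<^sup>+ s. ennreal (g s) \<partial>lborel)"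
    "(\<integral>\<^sup>+ s\<in>I. ennreal (- f s) \<partial>lborel) = (\<integral>\<^sup>+ s. ennreal (- g s) \<partial>lborel)"
    by (auto intro!: nn_integral_cong simp: g_def split: split_indicator)
  have "(\<integral>\<^sup>+ s. ennreal (g s) \<partial>lborel) \<noteq> \<infinity>" "(\<integral>\<^sup>+ s. ennreal (- g s) \<partial>lborel) \<noteq> \<infinity>"
    using g by (auto simp: real_integrable_def)
  then obtain a b where "0 \<le> a" "0 \<le> b" "(\<integral>\<^sup>+ s. ennreal (g s) \<partial>lborel) = ennreal a" "(\<integral>\<^sup>+ s. ennreal (- g s) \<partial>lborel) = ennreal b"
    by (metis ennreal_cases infinity_ennreal_def)
  then show ?thesis
    using real_lebesgue_integral_def[OF g] by (simp add: ext_integral_def 1 set_lebesgue_integral_def g_def[abs_def])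
qed

context riem_manifold
begin

text \<open>Continuous differentiability near \<open>r\<close> in every chart. Being a condition on a neighbourhood, it is inherited when
curves are concatenated or reparametrized.\<close>

definition C1_at :: "(real \<Rightarrow> 'm) \<Rightarrow> real \<Rightarrow> bool" where
  "C1_at \<gamma> r \<longleftrightarrow> (\<forall>c\<in>A. \<gamma> r \<in> fst c \<longrightarrow> (\<exists>e>0. \<exists>D.
     (\<forall>s\<in>{r - e<..<r + e}. ((snd c \<circ> \<gamma>) has_vector_derivative D s) (at s)) \<and> continuous_on {r - e<..<r + e} D))"

lemma has_vector_derivative_germ:
  fixes f g :: "real \<Rightarrow> 'b::real_normed_vector"
  assumes "0 < e" "\<And>s. s \<in> {r - e<..<r + e} \<Longrightarrow> f s = g s" "s \<in> {r - e<..<r + e}"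
  shows "(f has_vector_derivative D) (at s) \<longleftrightarrow> (g has_vector_derivative D) (at s)"
  using has_vector_derivative_transform_within_open[of f D s "{r - e<..<r + e}" g]
    has_vector_derivative_transform_within_open[of g D s "{r - e<..<r + e}" f] assms by auto

lemma C1_at_cong:
  assumes e: "0 < e" "\<And>s. s \<in> {r - e<..<r + e} \<Longrightarrow> \<gamma> s = \<gamma>' s" and C: "C1_at \<gamma> r"
  shows "C1_at \<gamma>' r"
  unfolding C1_at_def
proof (intro ballI impI)
  fix c assume "c \<in> A" "\<gamma>' r \<in> fst c"
  moreover have "\<gamma> r = \<gamma>' r" using e by simp
  ultimately obtain d D where D: "d > 0" "\<And>s. s \<in> {r - d<..<r + d} \<Longrightarrow> ((snd c \<circ> \<gamma>) has_vector_derivative D s) (at s)"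
    "continuous_on {r - d<..<r + d} D"
    using C unfolding C1_at_def by metis
  have "((snd c \<circ> \<gamma>') has_vector_derivative D s) (at s)" if "s \<in> {r - min d e<..<r + min d e}" for s
  proof -
    have "s \<in> {r - d<..<r + d}" "s \<in> {r - e<..<r + e}" using that by auto
    then show ?thesis
      using has_vector_derivative_germ[of e r "snd c \<circ> \<gamma>" "snd c \<circ> \<gamma>'" s "D s"] D(2)[of s] e by simp
  qed
  moreover have "continuous_on {r - min d e<..<r + min d e} D"
    by (rule continuous_on_subset[OF D(3)]) auto
  ultimately show "\<exists>e>0. \<exists>D. (\<forall>s\<in>{r - e<..<r + e}. ((snd c \<circ> \<gamma>') has_vector_derivative D s) (at s)) \<and> continuous_on {r - e<..<r + e} D"
    using D(1) e(1) by (intro exI[of _ "min d e"] conjI exI[of _ D]) auto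
qed

lemma velocity_cong:
  assumes e: "0 < e" "\<And>s. s \<in> {r - e<..<r + e} \<Longrightarrow> \<gamma> s = \<gamma>' s"
  shows "velocity A \<gamma> r = velocity A \<gamma>' r"
proof -
  have "\<gamma> r = \<gamma>' r" using e by simp
  moreover have "vector_derivative (snd c \<circ> \<gamma>) (at r) = vector_derivative (snd c \<circ> \<gamma>') (at r)" for c :: "('m, 'e) chart"
    unfolding vector_derivative_def
    using has_vector_derivative_germ[of e r "snd c \<circ> \<gamma>" "snd c \<circ> \<gamma>'" r] e by simp
  ultimately show ?thesis by (auto simp: velocity_def fun_eq_iff)
qed

lemma C1_at_C1_differentiable_on:
  assumes "\<And>r. r \<in> E \<Longrightarrow> C1_at \<gamma> r" "c \<in> A"
  shows "(snd c \<circ> \<gamma>) C1_differentiable_on {r \<in> E. \<gamma> r \<in> fst c}"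
  unfolding C1_differentiable_on_def
proof (intro exI conjI ballI)
  let ?D = "\<lambda>r. vector_derivative (snd c \<circ> \<gamma>) (at r)"
  have *: "((snd c \<circ> \<gamma>) has_vector_derivative ?D r) (at r) \<and> isCont ?D r" if r: "r \<in> {r \<in> E. \<gamma> r \<in> fst c}" for r
  proof -
    obtain d D where D: "d > 0" "\<And>s. s \<in> {r - d<..<r + d} \<Longrightarrow> ((snd c \<circ> \<gamma>) has_vector_derivative D s) (at s)"
      "continuous_on {r - d<..<r + d} D"
      using assms(1)[of r] r assms(2) unfolding C1_at_def by (metis (no_types, lifting) mem_Collect_eq)
    have eq: "?D s = D s" if "s \<in> {r - d<..<r + d}" for s using D(2)[OF that] by (rule vector_derivative_at)
    have rin: "r \<in> {r - d<..<r + d}" using D(1) by simp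
    have "isCont D r" using D(3) rin continuous_on_eq_continuous_at[of "{r - d<..<r + d}" D] by auto
    moreover have "eventually (\<lambda>s. ?D s = D s) (nhds r)"
      using eventually_nhds_in_open[OF open_greaterThanLessThan rin] by eventually_elim (rule eq)
    ultimately have "isCont ?D r" by (subst isCont_cong)
    then show ?thesis using D(2)[OF rin] eq[OF rin] by simp
  qed
  show "((snd c \<circ> \<gamma>) has_vector_derivative ?D r) (at r)" if "r \<in> {r \<in> E. \<gamma> r \<in> fst c}" for r using *[OF that] by simp
  show "continuous_on {r \<in> E. \<gamma> r \<in> fst c} ?D"
    by (rule continuous_at_imp_continuous_on) (use * in blast)
qed

lemma C1_at_has_derivative:
  "C1_at \<gamma> r \<Longrightarrow> c \<in> A \<Longrightarrow> \<gamma> r \<in> fst c \<Longrightarrow> ((snd c \<circ> \<gamma>) has_vector_derivative velocity A \<gamma> r c) (at r)"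
proof -
  assume a: "C1_at \<gamma> r" "c \<in> A" "\<gamma> r \<in> fst c"
  then obtain e D where "e > 0" "\<forall>s\<in>{r - e<..<r + e}. ((snd c \<circ> \<gamma>) has_vector_derivative D s) (at s)"
    unfolding C1_at_def by metis
  then have "((snd c \<circ> \<gamma>) has_vector_derivative D r) (at r)" by simp
  then show ?thesis using a(2,3) by (simp add: velocity_def vector_derivative_at)
qed

lemma has_vector_derivative_affine:
  fixes f :: "real \<Rightarrow> 'b::real_normed_vector"
  assumes "(f has_vector_derivative D) (at (a + k * r))"
  shows "((\<lambda>r. f (a + k * r)) has_vector_derivative k *\<^sub>R D) (at r)"
proof -
  have "((\<lambda>r. a + k * r) has_vector_derivative k) (at r)"
    by (auto intro!: derivative_eq_intros simp: has_real_derivative_iff_has_vector_derivative[symmetric])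
  from vector_diff_chain_at[OF this assms] show ?thesis by (simp add: o_def)
qed

lemma C1_at_affine:
  assumes C: "C1_at \<gamma> (a + k * r)" and k: "0 < k"
  shows "C1_at (\<lambda>r. \<gamma> (a + k * r)) r"
    and "velocity A (\<lambda>r. \<gamma> (a + k * r)) r = (\<lambda>c. k *\<^sub>R velocity A \<gamma> (a + k * r) c)"
proof -
  show "C1_at (\<lambda>r. \<gamma> (a + k * r)) r"
    unfolding C1_at_def
  proof (intro ballI impI)
    fix c assume "c \<in> A" "\<gamma> (a + k * r) \<in> fst c"
    then obtain d D where D: "d > 0"
      "\<And>s. s \<in> {a + k * r - d<..<a + k * r + d} \<Longrightarrow> ((snd c \<circ> \<gamma>) has_vector_derivative D s) (at s)"
      "continuous_on {a + k * r - d<..<a + k * r + d} D"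
      using C unfolding C1_at_def by metis
    have im: "a + k * s \<in> {a + k * r - d<..<a + k * r + d}" if "s \<in> {r - d / k<..<r + d / k}" for s
    proof -
      have "\<bar>s - r\<bar> < d / k" using that by auto
      then have "k * \<bar>s - r\<bar> < d" using k by (simp add: field_simps)
      then have "\<bar>k * (s - r)\<bar> < d" by (simp only: abs_mult abs_of_pos[OF k])
      then have "- d < k * (s - r)" "k * (s - r) < d" by linarith+
      then show ?thesis by (simp add: algebra_simps)
    qed
    show "\<exists>e>0. \<exists>D. (\<forall>s\<in>{r - e<..<r + e}. ((snd c \<circ> (\<lambda>r. \<gamma> (a + k * r))) has_vector_derivative D s) (at s)) \<and> continuous_on {r - e<..<r + e} D"
    proof (intro exI[of _ "d / k"] conjI exI[of _ "\<lambda>s. k *\<^sub>R D (a + k * s)"] ballI)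
      show "((snd c \<circ> (\<lambda>r. \<gamma> (a + k * r))) has_vector_derivative k *\<^sub>R D (a + k * s)) (at s)"
        if "s \<in> {r - d / k<..<r + d / k}" for s
        using has_vector_derivative_affine[OF D(2)[OF im[OF that]]] by (simp add: o_def)
      show "continuous_on {r - d / k<..<r + d / k} (\<lambda>s. k *\<^sub>R D (a + k * s))"
        by (intro continuous_on_scaleR continuous_on_const continuous_on_compose2[OF D(3)])
          (use im in \<open>auto intro!: continuous_intros\<close>)
    qed (use D k in auto)
  qed
  have vd: "vector_derivative (snd c \<circ> (\<lambda>r. \<gamma> (a + k * r))) (at r) = k *\<^sub>R velocity A \<gamma> (a + k * r) c"
    if "c \<in> A" "\<gamma> (a + k * r) \<in> fst c" for c
    using has_vector_derivative_affine[OF C1_at_has_derivative[OF C that]] by (intro vector_derivative_at) (simp add: o_def)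
  show "velocity A (\<lambda>r. \<gamma> (a + k * r)) r = (\<lambda>c. k *\<^sub>R velocity A \<gamma> (a + k * r) c)"
  proof
    fix c
    show "velocity A (\<lambda>r. \<gamma> (a + k * r)) r c = k *\<^sub>R velocity A \<gamma> (a + k * r) c"
      using vd[of c] by (cases "c \<in> A \<and> \<gamma> (a + k * r) \<in> fst c") (auto simp: velocity_def)
  qed
qed

text \<open>A hop, travelled from time \<open>T\<close> on with the time scale \<open>k\<close>; here \<open>f\<close> is the action of a group element.\<close>

lemma segment_C1:
  assumes f: "smooth_map A f" and c: "c \<in> A" and in_c: "y + (k * (r - T)) *\<^sub>R q \<in> chart_image c"
  defines "\<sigma> \<equiv> \<lambda>r. f (chart_inv c (y + (k * (r - T)) *\<^sub>R q))"
  defines "x \<equiv> chart_inv c (y + (k * (r - T)) *\<^sub>R q)"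
  shows "C1_at \<sigma> r" and "velocity A \<sigma> r = (\<lambda>c'. k *\<^sub>R differential A f x (tvec_of A c x q) c')"
proof -
  let ?w = "\<lambda>r. y + (k * (r - T)) *\<^sub>R q"
  have w: "(?w has_derivative (\<lambda>h. (k * h) *\<^sub>R q)) (at s)" for s
    by (auto intro!: derivative_eq_intros)
  have x: "x \<in> fst c" "snd c x = ?w r" using c in_c by (auto simp: x_def)
  have main: "\<exists>e>0. (\<forall>s\<in>{r - e<..<r + e}. ((snd c' \<circ> \<sigma>) has_vector_derivative Jac c c' f (?w s) (k *\<^sub>R q)) (at s)) \<and>
     continuous_on {r - e<..<r + e} (\<lambda>s. Jac c c' f (?w s) (k *\<^sub>R q))"
    if c': "c' \<in> A" "\<sigma> r \<in> fst c'" for c'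
  proof -
    let ?S = "snd c ` (fst c \<inter> f -` fst c')"
    have "?w r \<in> ?S" using x c' by (auto simp: \<sigma>_def x_def intro!: image_eqI[of _ _ x])
    moreover have "open (?w -` ?S)"
      by (rule open_vimage[OF smooth_map_open_domain[OF f c c'(1)]]) (intro continuous_intros)
    ultimately have "eventually (\<lambda>s. s \<in> ?w -` ?S) (nhds r)" by (intro eventually_nhds_in_open) auto
    then obtain e where e: "e > 0" "\<And>s. dist s r < e \<Longrightarrow> ?w s \<in> ?S" unfolding eventually_nhds_metric by blast
    have eS: "?w s \<in> ?S" if "s \<in> {r - e<..<r + e}" for s using e(2)[of s] that by (simp add: dist_real_def abs_less_iff)
    show ?thesis
    proof (intro exI[of _ e] conjI ballI e(1))
      fix s assume s: "s \<in> {r - e<..<r + e}"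
      obtain z where z: "?w s = snd c z" "z \<in> fst c" "f z \<in> fst c'" using eS[OF s] by blast
      have J: "((snd c' \<circ> f \<circ> chart_inv c) has_derivative Jac c c' f (?w s)) (at (?w s))"
        unfolding z(1) by (rule Jac_works[OF f c c'(1) z(2,3)])
      have lin: "linear (Jac c c' f (?w s))" unfolding z(1) by (rule Jac_linear[OF f c c'(1) z(2,3)])
      have "((snd c' \<circ> f \<circ> chart_inv c) \<circ> ?w has_derivative Jac c c' f (?w s) \<circ> (\<lambda>h. (k * h) *\<^sub>R q)) (at s)"
        by (rule diff_chain_at[OF w J])
      moreover have "Jac c c' f (?w s) \<circ> (\<lambda>h. (k * h) *\<^sub>R q) = (\<lambda>h. h *\<^sub>R Jac c c' f (?w s) (k *\<^sub>R q))"
      proof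
        fix h
        have "Jac c c' f (?w s) ((k * h) *\<^sub>R q) = h *\<^sub>R Jac c c' f (?w s) (k *\<^sub>R q)"
          using linear_scale[OF lin, of h "k *\<^sub>R q"] by (simp add: mult.commute)
        then show "(Jac c c' f (?w s) \<circ> (\<lambda>h. (k * h) *\<^sub>R q)) h = h *\<^sub>R Jac c c' f (?w s) (k *\<^sub>R q)"
          by (simp only: comp_apply)
      qed
      moreover have "(snd c' \<circ> f \<circ> chart_inv c) \<circ> ?w = snd c' \<circ> \<sigma>" by (auto simp: \<sigma>_def)
      ultimately show "((snd c' \<circ> \<sigma>) has_vector_derivative Jac c c' f (?w s) (k *\<^sub>R q)) (at s)"
        by (simp only: has_vector_derivative_def)
    next
      show "continuous_on {r - e<..<r + e} (\<lambda>s. Jac c c' f (?w s) (k *\<^sub>R q))"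
        by (rule continuous_on_compose2[OF Jac_cont[OF f c c'(1)], of _ ?w])
          (use eS in \<open>auto intro!: continuous_intros\<close>)
    qed
  qed
  show C: "C1_at \<sigma> r" unfolding C1_at_def using main by meson
  show "velocity A \<sigma> r = (\<lambda>c'. k *\<^sub>R differential A f x (tvec_of A c x q) c')"
  proof
    fix c'
    show "velocity A \<sigma> r c' = k *\<^sub>R differential A f x (tvec_of A c x q) c'"
    proof (cases "c' \<in> A \<and> \<sigma> r \<in> fst c'")
      case True
      then obtain e where "e > 0" "\<forall>s\<in>{r - e<..<r + e}. ((snd c' \<circ> \<sigma>) has_vector_derivative Jac c c' f (?w s) (k *\<^sub>R q)) (at s)"
        using main by meson
      then have "((snd c' \<circ> \<sigma>) has_vector_derivative Jac c c' f (?w r) (k *\<^sub>R q)) (at r)" by simp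
      then have v: "velocity A \<sigma> r c' = Jac c c' f (snd c x) (k *\<^sub>R q)"
        using True x by (simp add: velocity_def vector_derivative_at)
      have fx: "f x \<in> fst c'" using True by (simp add: \<sigma>_def x_def)
      have lin: "linear (Jac c c' f (snd c x))" using Jac_linear[OF f c _ x(1) fx] True by simp
      show ?thesis unfolding v linear_scale[OF lin]
        using differential_tvec[OF f c x(1), of c' q] True fx by simp
    next
      case False
      then show ?thesis by (auto simp: velocity_def differential_def Let_def \<sigma>_def x_def)
    qed
  qed
qed

text \<open>The bound \<open>V\<close> on the speed makes such curves Lipschitz for the Riemannian distance, hence absolutely continuous.\<close>

definition nice_curve :: "real \<Rightarrow> real \<Rightarrow> real set \<Rightarrow> (real \<Rightarrow> 'm) \<Rightarrow> bool" where
  "nice_curve T V S \<gamma> \<longleftrightarrow> continuous_on {0..T} \<gamma> \<and> finite S \<and> 0 \<le> V \<and>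
     (\<forall>r\<in>{0<..<T} - S. C1_at \<gamma> r \<and> velocity A \<gamma> r \<in> tangent_space A (\<gamma> r) \<and> riem_norm \<rho> (\<gamma> r) (velocity A \<gamma> r) \<le> V)"

lemma riem_dist_refl: "riem_dist A \<rho> x x = 0"
proof -
  have C1: "C1_at (\<lambda>r. x) r" for r
    unfolding C1_at_def
  proof (intro ballI impI exI[of _ 1] exI[of _ "\<lambda>_. 0"] conjI)
    show "((snd c \<circ> (\<lambda>r. x)) has_vector_derivative 0) (at s)" for c :: "('m, 'e) chart" and s
      by (simp add: o_def)
  qed auto
  have v: "velocity A (\<lambda>r. x) s = (\<lambda>c. 0)" for s by (auto simp: velocity_def o_def)
  have pw: "pw_C1_path A (\<lambda>r. x)"
    unfolding pw_C1_path_def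
    using C1_at_C1_differentiable_on[of "{0..1}" "\<lambda>r. x"] C1 by (auto intro!: exI[of _ "{}"])
  have "riem_norm \<rho> x (\<lambda>c. 0) = 0" using riem_norm_scale[OF tangent_0, of x 0] by simp
  then have "curve_length A \<rho> (\<lambda>r. x) = 0" by (simp add: curve_length_def v)
  then have "(INF \<gamma>\<in>{\<gamma>. pw_C1_path A \<gamma> \<and> \<gamma> 0 = x \<and> \<gamma> 1 = x}. curve_length A \<rho> \<gamma>) \<le> 0"
    using pw by (intro INF_lower2[of "\<lambda>r. x"]) auto
  then show ?thesis by (simp add: riem_dist_def)
qed

text \<open>The piece between \<open>r\<close> and \<open>r'\<close>, reparametrized by \<open>[0, 1]\<close>, competes in the infimum that defines the distance.\<close>

lemma nice_curve_length:
  assumes nice: "nice_curve T V S \<gamma>" and r: "0 \<le> r" "r < r'" "r' \<le> T"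
  shows "(INF \<eta>\<in>{\<eta>. pw_C1_path A \<eta> \<and> \<eta> 0 = \<gamma> r \<and> \<eta> 1 = \<gamma> r'}. curve_length A \<rho> \<eta>) \<le> ennreal (V * (r' - r))"
proof -
  define k where "k = r' - r"
  have k: "0 < k" using r by (simp add: k_def)
  define \<eta> where "\<eta> u = \<gamma> (r + k * u)" for u
  define S' where "S' = {0, 1} \<union> (\<lambda>u. r + k * u) -` S"
  have finS': "finite S'" unfolding S'_def
    using nice k by (intro finite_UnI finite_vimageI) (auto simp: nice_curve_def inj_on_def)
  have good: "C1_at \<gamma> (r + k * u) \<and> velocity A \<gamma> (r + k * u) \<in> tangent_space A (\<gamma> (r + k * u)) \<and>
      riem_norm \<rho> (\<gamma> (r + k * u)) (velocity A \<gamma> (r + k * u)) \<le> V" if "u \<in> {0..1} - S'" for u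
  proof -
    have u: "0 < u" "u < 1" using that by (auto simp: S'_def)
    have "k * u < k * 1" using u k by (intro mult_strict_left_mono)
    moreover have "0 < k * u" using u k by simp
    moreover have "r + k \<le> T" using r by (simp add: k_def)
    ultimately have "0 < r + k * u" "r + k * u < T" using r(1) by linarith+
    then have "r + k * u \<in> {0<..<T} - S" using that by (auto simp: S'_def)
    then show ?thesis using nice by (simp add: nice_curve_def)
  qed
  have "pw_C1_path A \<eta>"
    unfolding pw_C1_path_def
  proof (intro conjI exI[of _ S'] ballI finS')
    show "continuous_on {0..1} \<eta>"
      unfolding \<eta>_def
    proof (rule continuous_on_compose2[of "{0..T}" \<gamma>])
      show "continuous_on {0..T} \<gamma>" using nice by (simp add: nice_curve_def)
      show "(\<lambda>u. r + k * u) ` {0..1} \<subseteq> {0..T}"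
      proof clarsimp
        fix u :: real assume "0 \<le> u" "u \<le> 1"
        then have "k * u \<le> k * 1" using k by (intro mult_left_mono) auto
        moreover have "0 \<le> k * u" using k \<open>0 \<le> u\<close> by simp
        moreover have "r + k \<le> T" using r by (simp add: k_def)
        ultimately show "0 \<le> r + k * u \<and> r + k * u \<le> T" using r(1) by linarith
      qed
    qed (intro continuous_intros)
    fix c assume "c \<in> A"
    from C1_at_C1_differentiable_on[of "{0..1} - S'" \<eta>, OF _ this]
    have "(snd c \<circ> \<eta>) C1_differentiable_on {u \<in> {0..1} - S'. \<eta> u \<in> fst c}"
      using good C1_at_affine(1)[OF _ k, of \<gamma> r] unfolding \<eta>_def by blast
    moreover have "{u \<in> {0..1} - S'. \<eta> u \<in> fst c} = {u \<in> {0..1}. \<eta> u \<in> fst c} - S'" by auto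
    ultimately show "(snd c \<circ> \<eta>) C1_differentiable_on {u \<in> {0..1}. \<eta> u \<in> fst c} - S'" by simp
  qed
  moreover have "curve_length A \<rho> \<eta> \<le> ennreal (V * k)"
  proof -
    have speed: "riem_norm \<rho> (\<eta> u) (velocity A \<eta> u) \<le> V * k" if u: "u \<in> {0..1} - S'" for u
    proof -
      have "velocity A \<eta> u = (\<lambda>c. k *\<^sub>R velocity A \<gamma> (r + k * u) c)"
        using C1_at_affine(2)[OF _ k] good[OF u] unfolding \<eta>_def by blast
      then have "riem_norm \<rho> (\<eta> u) (velocity A \<eta> u) = k * riem_norm \<rho> (\<gamma> (r + k * u)) (velocity A \<gamma> (r + k * u))"
        using riem_norm_scale good[OF u] k by (simp add: \<eta>_def)
      also have "\<dots> \<le> k * V" using good[OF u] k by (intro mult_left_mono) auto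
      finally show ?thesis by (simp add: mult.commute)
    qed
    have "AE u in lborel. u \<notin> S'"
      using finS' by (intro AE_not_in finite_imp_null_set_lborel)
    then have "AE u in lborel. ennreal (riem_norm \<rho> (\<eta> u) (velocity A \<eta> u)) * indicator {0..1} u
        \<le> ennreal (V * k) * indicator {0..1} u"
      by eventually_elim (auto split: split_indicator intro!: ennreal_leI speed)
    then have "curve_length A \<rho> \<eta> \<le> (\<integral>\<^sup>+ u\<in>{0..1}. ennreal (V * k) \<partial>(lborel :: real measure))"
      unfolding curve_length_def by (rule nn_integral_mono_AE)
    also have "\<dots> = ennreal (V * k)" by (simp add: nn_integral_cmult_indicator)
    finally show ?thesis .
  qed
  ultimately show ?thesis
    by (intro INF_lower2[of \<eta>]) (auto simp: \<eta>_def k_def)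
qed

lemma nice_curve_dist:
  assumes nice: "nice_curve T V S \<gamma>" and r: "0 \<le> r" "r \<le> r'" "r' \<le> T"
  shows "riem_dist A \<rho> (\<gamma> r) (\<gamma> r') \<le> V * (r' - r)"
proof (cases "r = r'")
  case False
  have "0 \<le> V" using nice by (simp add: nice_curve_def)
  then show ?thesis
    using nice_curve_length[OF nice r(1) _ r(3)] r False unfolding riem_dist_def
    by (intro enn2real_leI) auto
qed (simp add: riem_dist_refl)

lemma nice_curve_abs_cont:
  assumes nice: "nice_curve T V S \<gamma>"
  shows "abs_cont_curve (riem_dist A \<rho>) 0 T \<gamma>"
  unfolding abs_cont_curve_def
proof (intro allI impI)
  have V: "0 \<le> V" using nice by (simp add: nice_curve_def)
  fix e :: real assume e: "0 < e"
  have small: "(\<Sum>i<n. riem_dist A \<rho> (\<gamma> (s i)) (\<gamma> (t i))) < e"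
    if st: "\<forall>i<n. 0 \<le> s i \<and> s i \<le> t i \<and> t i \<le> T" and len: "(\<Sum>i<n. t i - s i) < e / (V + 1)" for n :: nat and s t
  proof -
    have nn: "0 \<le> (\<Sum>i<n. t i - s i)" using st by (intro sum_nonneg) auto
    have "(\<Sum>i<n. riem_dist A \<rho> (\<gamma> (s i)) (\<gamma> (t i))) \<le> (\<Sum>i<n. V * (t i - s i))"
      using st by (intro sum_mono nice_curve_dist[OF nice]) auto
    also have "\<dots> \<le> (V + 1) * (\<Sum>i<n. t i - s i)"
      using nn by (simp only: sum_distrib_left[symmetric] distrib_right)
    also have "\<dots> < e" using len V by (simp add: pos_less_divide_eq mult.commute)
    finally show ?thesis .
  qed
  show "\<exists>\<delta>>0. \<forall>(n::nat) s t. (\<forall>i<n. 0 \<le> s i \<and> s i \<le> t i \<and> t i \<le> T) \<longrightarrow>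
      (\<forall>i<n. \<forall>j<n. i \<noteq> j \<longrightarrow> {s i<..<t i} \<inter> {s j<..<t j} = {}) \<longrightarrow>
      (\<Sum>i<n. t i - s i) < \<delta> \<longrightarrow> (\<Sum>i<n. riem_dist A \<rho> (\<gamma> (s i)) (\<gamma> (t i))) < e"
  proof (intro exI[of _ "e / (V + 1)"] conjI allI impI)
    show "0 < e / (V + 1)" using e V by simp
  qed (erule (1) small)
qed

end

context stationary_ham
begin

text \<open>The hops are travelled one after the other, with time scaled by \<open>\<epsilon>\<close>. On each of them the rescaled Lagrangian
is at most the constant \<open>B\<close> of the hop, so a step function \<open>f\<close> dominates it.\<close>

lemma chain_curve:
  assumes \<omega>: "\<omega> \<in> W" and \<epsilon>: "0 < \<epsilon>" and reach: "reach \<omega> x y t a"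
  shows "\<exists>\<gamma> S V f. \<gamma> 0 = x \<and> \<gamma> (\<epsilon> * t) = y \<and> nice_curve (\<epsilon> * t) V S \<gamma> \<and>
    (\<forall>r\<in>{0<..<\<epsilon> * t} - S. lagrangian_eps A H \<epsilon> (\<gamma> r) (velocity A \<gamma> r) \<omega> \<le> f r) \<and>
    set_integrable lborel {0..\<epsilon> * t} f \<and> (LINT r:{0..\<epsilon> * t}|lborel. f r) = \<epsilon> * a"
  using reach
proof induction
  case reach_refl
  show ?case
    by (intro exI[of _ "\<lambda>_. x"] exI[of _ "{}"] exI[of _ 0] exI[of _ "\<lambda>_. 0"])
      (auto simp: nice_curve_def set_integrable_def set_lebesgue_integral_def)
next
  case (reach_hop y t a z s B)
  obtain \<gamma> S V f where IH: "\<gamma> 0 = x" "\<gamma> (\<epsilon> * t) = y" "nice_curve (\<epsilon> * t) V S \<gamma>"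
    "\<And>r. r \<in> {0<..<\<epsilon> * t} - S \<Longrightarrow> lagrangian_eps A H \<epsilon> (\<gamma> r) (velocity A \<gamma> r) \<omega> \<le> f r"
    "set_integrable lborel {0..\<epsilon> * t} f" "(LINT r:{0..\<epsilon> * t}|lborel. f r) = \<epsilon> * a"
    using reach_hop.IH by blast
  define T where "T = \<epsilon> * t"
  have t0: "0 \<le> t" using reach_lower[OF \<omega> reach_hop.hyps(1)] by simp
  have T0: "0 \<le> T" using t0 \<epsilon> by (simp add: T_def)
  obtain g c u q where h: "0 < s" "g \<in> carrier G" "c \<in> A" "y = \<alpha> g (chart_inv c u)" "z = \<alpha> g (chart_inv c (u + s *\<^sub>R q))"
    "\<And>r. r \<in> {0..s} \<Longrightarrow> u + r *\<^sub>R q \<in> chart_image c"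
    "\<And>r. r \<in> {0..s} \<Longrightarrow> L (chart_inv c (u + r *\<^sub>R q)) (tvec_of A c (chart_inv c (u + r *\<^sub>R q)) q) (\<tau> g \<omega>) \<le> B"
    using reach_hop.hyps(2) unfolding hop_def by blast
  have \<epsilon>s: "0 < \<epsilon> * s" using h(1) \<epsilon> by simp
  let ?w = "\<lambda>r. u + (1 / \<epsilon> * (r - T)) *\<^sub>R q"
  define \<sigma> where "\<sigma> r = \<alpha> g (chart_inv c (?w r))" for r
  have par: "1 / \<epsilon> * (r - T) \<in> {0..s}" if "r \<in> {T..T + \<epsilon> * s}" for r
    using that \<epsilon> by (auto simp: field_simps)
  have sm: "smooth_map A (\<alpha> g)" by (rule isometry_smooth(1)[OF isom[OF h(2)]])
  obtain V2 where V2: "\<And>r. r \<in> {0..s} \<Longrightarrow> nm c (u + r *\<^sub>R q) q \<le> V2"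
    using segment_speed_bounded[OF h(3,6)] by blast
  have V20: "0 \<le> V2" using V2[of 0] nm_nonneg[OF h(3) h(6)[of 0], of q] h(1) by simp
  have \<sigma>_good: "C1_at \<sigma> r \<and> velocity A \<sigma> r \<in> tangent_space A (\<sigma> r) \<and> riem_norm \<rho> (\<sigma> r) (velocity A \<sigma> r) \<le> V2 / \<epsilon> \<and>
      lagrangian_eps A H \<epsilon> (\<sigma> r) (velocity A \<sigma> r) \<omega> \<le> B" if r: "r \<in> {T..T + \<epsilon> * s}" for r
  proof -
    define x where "x = chart_inv c (?w r)"
    define v where "v = tvec_of A c x q"
    have wc: "?w r \<in> chart_image c" by (rule h(6)[OF par[OF r]])
    have v: "v \<in> tangent_space A x" unfolding v_def x_def by (rule tvec_of_in[OF h(3) chart_inv_in[OF h(3) wc]])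
    have dv: "differential A (\<alpha> g) x v \<in> tangent_space A (\<alpha> g x)" by (rule differential_in[OF sm v])
    have \<sigma>x: "\<sigma> r = \<alpha> g x" by (simp add: \<sigma>_def x_def)
    note seg = segment_C1[OF sm h(3) wc]
    have vel: "velocity A \<sigma> r = (\<lambda>c'. (1 / \<epsilon>) *\<^sub>R differential A (\<alpha> g) x v c')"
      using seg(2) by (simp only: \<sigma>_def[abs_def] x_def v_def)
    have C1: "C1_at \<sigma> r" using seg(1) by (simp only: \<sigma>_def[abs_def])
    have n: "riem_norm \<rho> (\<sigma> r) (velocity A \<sigma> r) = riem_norm \<rho> x v / \<epsilon>"
      unfolding vel \<sigma>x riem_norm_scale[OF dv] isometry_norm[OF isom[OF h(2)] v] using \<epsilon> by simp
    have "riem_norm \<rho> x v \<le> V2" using V2[OF par[OF r]] by (simp add: nm_def v_def x_def)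
    moreover have "lagrangian_eps A H \<epsilon> (\<sigma> r) (velocity A \<sigma> r) \<omega> \<le> B"
    proof -
      have "lagrangian_eps A H \<epsilon> (\<sigma> r) (velocity A \<sigma> r) \<omega> = L (\<alpha> g x) (differential A (\<alpha> g) x v) \<omega>"
        using \<epsilon> by (simp add: lagrangian_eps_def vel \<sigma>x)
      also have "\<dots> \<le> L x v (\<tau> g \<omega>)"
        by (rule L_isometry[OF isom[OF h(2)] v \<omega> \<tau>_in[OF h(2) \<omega>] H_stat[OF \<omega> h(2)]])
      also have "\<dots> \<le> B" using h(7)[OF par[OF r]] by (simp only: x_def v_def)
      finally show ?thesis .
    qed
    ultimately show ?thesis
      using C1 n \<epsilon> tangent_scale[OF dv, of "1 / \<epsilon>"] by (simp add: vel \<sigma>x divide_right_mono)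
  qed
  define \<eta> where "\<eta> r = (if r \<le> T then \<gamma> r else \<sigma> r)" for r
  define f' where "f' r = (if r \<le> T then f r else B)" for r
  have \<sigma>T: "\<sigma> T = \<gamma> T" using IH(2) h(4) by (simp add: \<sigma>_def T_def)
  have before: "C1_at \<eta> r \<longleftrightarrow> C1_at \<gamma> r" "velocity A \<eta> r = velocity A \<gamma> r" "\<eta> r = \<gamma> r" if "r < T" for r
    using C1_at_cong[of "T - r" r \<eta> \<gamma>] C1_at_cong[of "T - r" r \<gamma> \<eta>] velocity_cong[of "T - r" r \<eta> \<gamma>] that
    by (auto simp: \<eta>_def)
  have after: "C1_at \<eta> r \<longleftrightarrow> C1_at \<sigma> r" "velocity A \<eta> r = velocity A \<sigma> r" "\<eta> r = \<sigma> r" if "T < r" for r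
    using C1_at_cong[of "r - T" r \<eta> \<sigma>] C1_at_cong[of "r - T" r \<sigma> \<eta>] velocity_cong[of "r - T" r \<eta> \<sigma>] that
    by (auto simp: \<eta>_def)
  have cont: "continuous_on {0..T + \<epsilon> * s} \<eta>"
  proof -
    have "continuous_on {T..T + \<epsilon> * s} \<sigma>"
    proof -
      have cg: "continuous_on UNIV (\<alpha> g)" using sm by (simp add: smooth_map_def)
      have "continuous_on {T..T + \<epsilon> * s} (\<lambda>r. chart_inv c (?w r))"
        by (rule continuous_on_compose2[OF chart_cont(2)[OF h(3)]]) (use h(6)[OF par] \<epsilon> in \<open>auto intro!: continuous_intros\<close>)
      then show ?thesis unfolding \<sigma>_def by (rule continuous_on_compose2[OF cg]) simp
    qed
    moreover have "continuous_on {0..T} \<gamma>" using IH(3) by (simp add: nice_curve_def T_def)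
    ultimately have "continuous_on ({0..T} \<union> {T..T + \<epsilon> * s}) (\<lambda>r. if r \<le> T then \<gamma> r else \<sigma> r)"
      by (intro continuous_on_cases) (auto simp: \<sigma>T order_antisym)
    moreover have "{0..T} \<union> {T..T + \<epsilon> * s} = {0..T + \<epsilon> * s}" using T0 \<epsilon>s by auto
    ultimately show ?thesis by (simp add: \<eta>_def[abs_def])
  qed
  have Ts: "\<epsilon> * (t + s) = T + \<epsilon> * s" by (simp add: T_def algebra_simps)
  have nice: "nice_curve (T + \<epsilon> * s) (max V (V2 / \<epsilon>)) (insert T S) \<eta>"
    unfolding nice_curve_def
  proof (intro conjI ballI cont)
    show "finite (insert T S)" "0 \<le> max V (V2 / \<epsilon>)" using IH(3) by (auto simp: nice_curve_def)
    fix r assume r: "r \<in> {0<..<T + \<epsilon> * s} - insert T S"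
    have "C1_at \<eta> r \<and> velocity A \<eta> r \<in> tangent_space A (\<eta> r) \<and> riem_norm \<rho> (\<eta> r) (velocity A \<eta> r) \<le> max V (V2 / \<epsilon>)"
    proof (cases "r < T")
      case True
      then show ?thesis using IH(3) r before[OF True] by (auto simp: nice_curve_def T_def intro: le_max_iff_disj[THEN iffD2])
    next
      case False
      then have "T < r" using r by auto
      then show ?thesis using \<sigma>_good[of r] r after[OF \<open>T < r\<close>] by (auto intro: le_max_iff_disj[THEN iffD2])
    qed
    then show "C1_at \<eta> r" "velocity A \<eta> r \<in> tangent_space A (\<eta> r)" "riem_norm \<rho> (\<eta> r) (velocity A \<eta> r) \<le> max V (V2 / \<epsilon>)"
      by auto
  qed
  have lag: "lagrangian_eps A H \<epsilon> (\<eta> r) (velocity A \<eta> r) \<omega> \<le> f' r" if r: "r \<in> {0<..<T + \<epsilon> * s} - insert T S" for r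
  proof (cases "r < T")
    case True
    then show ?thesis using IH(4)[of r] r before[OF True] by (simp add: f'_def T_def)
  next
    case False
    then have "T < r" using r by auto
    then show ?thesis using \<sigma>_good[of r] r after[OF \<open>T < r\<close>] by (simp add: f'_def)
  qed
  have split: "{0..T + \<epsilon> * s} = {0..T} \<union> {T<..T + \<epsilon> * s}" using T0 \<epsilon>s by auto
  have i1: "set_integrable lborel {0..T} f'"
  proof -
    have "set_integrable lborel {0..T} f' = set_integrable lborel {0..T} f"
      by (rule set_integrable_cong) (auto simp: f'_def)
    then show ?thesis using IH(5) by (simp add: T_def)
  qed
  have i2: "set_integrable lborel {T<..T + \<epsilon> * s} f'"
  proof -
    have "set_integrable lborel {T<..T + \<epsilon> * s} f' = set_integrable lborel {T<..T + \<epsilon> * s} (\<lambda>_. B)"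
      by (rule set_integrable_cong) (auto simp: f'_def)
    moreover have "emeasure lborel {T<..T + \<epsilon> * s} < \<infinity>" using \<epsilon>s by simp
    then have "integrable lborel (indicator {T<..T + \<epsilon> * s} :: real \<Rightarrow> real)"
      by (intro integrable_real_indicator) auto
    ultimately show ?thesis by (simp add: set_integrable_def)
  qed
  have "(LINT r:{0..T + \<epsilon> * s}|lborel. f' r) = (LINT r:{0..T}|lborel. f' r) + (LINT r:{T<..T + \<epsilon> * s}|lborel. f' r)"
    unfolding split by (rule set_integral_Un[OF _ i1 i2]) auto
  also have "(LINT r:{0..T}|lborel. f' r) = (LINT r:{0..T}|lborel. f r)"
    by (rule set_lebesgue_integral_cong) (auto simp: f'_def)
  also have "(LINT r:{T<..T + \<epsilon> * s}|lborel. f' r) = (LINT r:{T<..T + \<epsilon> * s}|lborel. B)"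
    by (rule set_lebesgue_integral_cong) (auto simp: f'_def)
  also have "\<dots> = \<epsilon> * s * B" using \<epsilon>s by (simp add: set_lebesgue_integral_def)
  finally have int: "(LINT r:{0..T + \<epsilon> * s}|lborel. f' r) = \<epsilon> * (a + s * B)"
    using IH(6) by (simp add: T_def algebra_simps)
  have "set_integrable lborel {0..T + \<epsilon> * s} f'" unfolding split by (rule set_integrable_Un[OF i1 i2]) auto
  moreover have "\<eta> 0 = x" using IH(1) T0 by (simp add: \<eta>_def)
  moreover have "\<eta> (T + \<epsilon> * s) = z" using \<epsilon>s \<epsilon> h(5) by (auto simp: \<eta>_def \<sigma>_def)
  ultimately show ?case
    unfolding Ts using nice lag int
    by (intro exI[of _ \<eta>] exI[of _ "insert T S"] exI[of _ "max V (V2 / \<epsilon>)"] exI[of _ f']) blast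
qed

lemma reach_min_action:
  assumes \<omega>: "\<omega> \<in> W" and \<epsilon>: "0 < \<epsilon>" and reach: "reach \<omega> x y (1 / \<epsilon>) a"
  shows "min_action A \<rho> H \<epsilon> x y 1 \<omega> \<le> ereal (\<epsilon> * a)"
proof -
  have "\<epsilon> * (1 / \<epsilon>) = 1" using \<epsilon> by simp
  then obtain \<gamma> S V f where \<gamma>: "\<gamma> 0 = x" "\<gamma> 1 = y" "nice_curve 1 V S \<gamma>"
    "\<And>r. r \<in> {0<..<1} - S \<Longrightarrow> lagrangian_eps A H \<epsilon> (\<gamma> r) (velocity A \<gamma> r) \<omega> \<le> f r"
    "set_integrable lborel {0..1} f" "(LINT r:{0..1}|lborel. f r) = \<epsilon> * a"
    using chain_curve[OF \<omega> \<epsilon> reach] by metis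
  have "finite (S \<union> {0, 1})" using \<gamma>(3) by (simp add: nice_curve_def)
  then have "AE r in lborel. r \<notin> S \<union> {0, 1}" by (intro AE_not_in finite_imp_null_set_lborel)
  then have "AE r in lborel. r \<in> {0..1} \<longrightarrow> lagrangian_eps A H \<epsilon> (\<gamma> r) (velocity A \<gamma> r) \<omega> \<le> f r"
    by eventually_elim (auto intro!: \<gamma>(4) simp: order_less_le)
  from ext_integral_mono[OF this]
  have "ext_integral {0..1} (\<lambda>r. lagrangian_eps A H \<epsilon> (\<gamma> r) (velocity A \<gamma> r) \<omega>) \<le> ereal (\<epsilon> * a)"
    by (simp add: ext_integral_integrable[OF \<gamma>(5)] \<gamma>(6))
  then show ?thesis unfolding min_action_def
    using nice_curve_abs_cont[OF \<gamma>(3)] \<gamma>(1,2) by (intro INF_lower2[of \<gamma>]) auto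
qed

end

section \<open>Comparison of the Riemannian distance with charts\<close>

text \<open>The fundamental theorem of calculus for the gauge integral needs no integrability. If the right-hand side is
finite, then \<open>u'\<close> is Lebesgue integrable, and the two integrals agree.\<close>

lemma increment_le_nn_integral:
  fixes u u' n :: "real \<Rightarrow> real"
  assumes ab: "a \<le> b" and S: "finite S" and cont: "continuous_on {a..b} u"
    and deriv: "\<And>s. s \<in> {a<..<b} - S \<Longrightarrow> (u has_real_derivative u' s) (at s)"
    and le: "\<And>s. s \<in> {a<..<b} - S \<Longrightarrow> m * \<bar>u' s\<bar> \<le> n s" and m: "0 < m"
  shows "ennreal (m * (u b - u a)) \<le> (\<integral>\<^sup>+ s\<in>{a..b}. ennreal (n s) \<partial>lborel)"
proof (cases "(\<integral>\<^sup>+ s\<in>{a..b}. ennreal (n s) \<partial>lborel) = \<infinity>")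
  case False
  have hi0: "(u' has_integral (u b - u a)) {a..b}"
    by (rule fundamental_theorem_of_calculus_interior_strong[OF S ab _ cont])
      (use deriv in \<open>auto simp: has_real_derivative_iff_has_vector_derivative\<close>)
  have me: "(\<lambda>s. indicator {a..b} s *\<^sub>R u' s) \<in> lebesgue \<rightarrow>\<^sub>M borel"
    by (rule has_integral_implies_lebesgue_measurable[OF hi0])
  have hi: "((\<lambda>s. indicator {a..b} s *\<^sub>R u' s) has_integral (u b - u a)) UNIV"
    using has_integral_restrict_UNIV[of "{a..b}" u' "u b - u a"] hi0
    by (simp add: indicator_def if_distrib[of "\<lambda>x. x * _"] of_bool_def cong: if_cong)
  obtain g where g[measurable]: "g \<in> borel_measurable lborel" and eq: "AE s in lborel. indicator {a..b} s *\<^sub>R u' s = g s"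
    using completion_ex_borel_measurable_real[OF me] by auto
  have fS: "finite (S \<union> {a, b})" using S by simp
  have "AE s in lborel. s \<notin> S \<union> {a, b}" by (rule AE_not_in[OF finite_imp_null_set_lborel[OF fS]])
  then have "AE s in lborel. ennreal (m * \<bar>g s\<bar>) \<le> ennreal (n s) * indicator {a..b} s"
    using eq
  proof eventually_elim
    case (elim s)
    show ?case
    proof (cases "s \<in> {a..b}")
      case True
      then have "s \<in> {a<..<b} - S" using elim(1) by auto
      then show ?thesis using le[of s] elim(2) True by (simp add: ennreal_leI)
    next
      case False
      then show ?thesis using elim(2) by auto
    qed
  qed
  then have gn: "(\<integral>\<^sup>+ s. ennreal (m * \<bar>g s\<bar>) \<partial>lborel) \<le> (\<integral>\<^sup>+ s\<in>{a..b}. ennreal (n s) \<partial>lborel)"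
    by (rule nn_integral_mono_AE)
  then have fin: "(\<integral>\<^sup>+ s. ennreal (m * \<bar>g s\<bar>) \<partial>lborel) < \<infinity>"
    using False by (auto simp: less_top[symmetric] top_unique)
  have int_mg: "integrable lborel (\<lambda>s. m * \<bar>g s\<bar>)"
    by (rule integrableI_bounded) (use fin m in \<open>auto simp: abs_mult\<close>)
  then have int_ag: "integrable lborel (\<lambda>s. \<bar>g s\<bar>)" using m by simp
  have int_g: "integrable lborel g"
    by (rule Bochner_Integration.integrable_bound[OF int_ag]) auto
  have "AE s in lborel. s \<in> UNIV \<longrightarrow> indicator {a..b} s *\<^sub>R u' s = g s" using eq by eventually_elim simp
  from has_integral_AE[OF this, THEN iffD1, OF hi]
  have "(g has_integral (u b - u a)) UNIV" .
  then have "u b - u a = (LINT s|lborel. g s)"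
    using has_integral_integral_lborel[OF int_g] by (rule has_integral_unique)
  also have "\<dots> \<le> (LINT s|lborel. \<bar>g s\<bar>)" by (rule integral_mono[OF int_g int_ag]) simp
  finally have "m * (u b - u a) \<le> (LINT s|lborel. m * \<bar>g s\<bar>)" using m by simp
  then have "ennreal (m * (u b - u a)) \<le> ennreal (LINT s|lborel. m * \<bar>g s\<bar>)" by (rule ennreal_leI)
  also have "\<dots> = (\<integral>\<^sup>+ s. ennreal (m * \<bar>g s\<bar>) \<partial>lborel)"
    by (rule nn_integral_eq_integral[symmetric, OF int_mg]) (use m in simp)
  also note gn
  finally show ?thesis .
qed simp

text \<open>The integrand need not be measurable, so the substitution is carried out for the simple
  functions below it.\<close>

lemma nn_integral_reflect_le:
  fixes f :: "real \<Rightarrow> ennreal"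
  shows "(\<integral>\<^sup>+ u. f (1 - u) \<partial>lborel) \<le> (\<integral>\<^sup>+ u. f u \<partial>lborel)"
  unfolding nn_integral_def[of lborel "\<lambda>u. f (1 - u)"]
proof (rule SUP_least, clarify)
  fix g :: "real \<Rightarrow> ennreal" assume g: "simple_function lborel g" "g \<le> (\<lambda>u. f (1 - u))"
  have [measurable]: "g \<in> borel_measurable borel" using borel_measurable_simple_function[OF g(1)] by simp
  have "integral\<^sup>S lborel g = (\<integral>\<^sup>+ u. g u \<partial>lborel)" using g(1) by (rule nn_integral_eq_simple_integral[symmetric])
  also have "\<dots> = (\<integral>\<^sup>+ u. g (1 + (-1) * u) \<partial>lborel)"
    using nn_integral_real_affine[of g "-1" 1] by simp
  also have "\<dots> \<le> (\<integral>\<^sup>+ u. f u \<partial>lborel)"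
  proof (rule nn_integral_mono)
    fix u show "g (1 + (-1) * u) \<le> f u" using le_funD[OF g(2), of "1 - u"] by simp
  qed
  finally show "integral\<^sup>S lborel g \<le> (\<integral>\<^sup>+ u. f u \<partial>lborel)" .
qed

context riem_manifold
begin

text \<open>The chain rule for the transition maps; continuity keeps the curve in the chart domain near \<open>s\<close>.\<close>

lemma velocity_chart:
  assumes c: "c \<in> A" "\<gamma> s \<in> fst c" and d: "((snd c \<circ> \<gamma>) has_vector_derivative v) (at s)" and cont: "isCont \<gamma> s"
  shows "velocity A \<gamma> s = tvec_of A c (\<gamma> s) v"
proof
  fix c'
  show "velocity A \<gamma> s c' = tvec_of A c (\<gamma> s) v c'"
  proof (cases "c' \<in> A \<and> \<gamma> s \<in> fst c'")
    case True
    have J: "((snd c' \<circ> (\<lambda>x. x) \<circ> chart_inv c) has_derivative trans c c' (snd c (\<gamma> s))) (at ((snd c \<circ> \<gamma>) s))"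
      using Jac_works[OF smooth_map_id c(1) _ c(2), of c'] True by (simp add: trans_Jac)
    have "((snd c' \<circ> (\<lambda>x. x) \<circ> chart_inv c) \<circ> (snd c \<circ> \<gamma>) has_derivative trans c c' (snd c (\<gamma> s)) \<circ> (\<lambda>h. h *\<^sub>R v)) (at s)"
      by (rule diff_chain_at[OF d[unfolded has_vector_derivative_def] J])
    moreover have "trans c c' (snd c (\<gamma> s)) \<circ> (\<lambda>h. h *\<^sub>R v) = (\<lambda>h. h *\<^sub>R trans c c' (snd c (\<gamma> s)) v)"
    proof
      fix h
      have "linear (trans c c' (snd c (\<gamma> s)))" using trans_linear[OF c(1) _ c(2)] True by blast
      then show "(trans c c' (snd c (\<gamma> s)) \<circ> (\<lambda>h. h *\<^sub>R v)) h = h *\<^sub>R trans c c' (snd c (\<gamma> s)) v"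
        unfolding comp_apply by (rule linear_scale)
    qed
    ultimately have 1: "((snd c' \<circ> (\<lambda>x. x) \<circ> chart_inv c) \<circ> (snd c \<circ> \<gamma>) has_vector_derivative trans c c' (snd c (\<gamma> s)) v) (at s)"
      by (simp only: has_vector_derivative_def)
    have "eventually (\<lambda>r. \<gamma> r \<in> fst c) (nhds s)"
      using cont c chart_open(1)[OF c(1)] by (simp add: isCont_def tendsto_at_iff_tendsto_nhds topological_tendstoD)
    then obtain S where S: "open S" "s \<in> S" "\<And>r. r \<in> S \<Longrightarrow> \<gamma> r \<in> fst c" by (auto simp: eventually_nhds)
    have "((snd c' \<circ> \<gamma>) has_vector_derivative trans c c' (snd c (\<gamma> s)) v) (at s)"
      by (rule has_vector_derivative_transform_within_open[OF 1 S(1,2)]) (use S(3) c(1) in simp)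
    then show ?thesis using True by (simp add: velocity_def tvec_of_def vector_derivative_at)
  next
    case False
    then show ?thesis by (auto simp: velocity_def tvec_of_def)
  qed
qed

lemma pw_C1_path_velocity:
  assumes "pw_C1_path A \<gamma>"
  obtains S where "finite S" "{0, 1} \<subseteq> S"
    "\<And>s c. s \<in> {0..1} - S \<Longrightarrow> c \<in> A \<Longrightarrow> \<gamma> s \<in> fst c \<Longrightarrow>
      ((snd c \<circ> \<gamma>) has_vector_derivative velocity A \<gamma> s c) (at s) \<and> velocity A \<gamma> s = tvec_of A c (\<gamma> s) (velocity A \<gamma> s c)"
proof -
  obtain S where S: "finite S" "\<And>c. c \<in> A \<Longrightarrow> (snd c \<circ> \<gamma>) C1_differentiable_on ({s \<in> {0..1}. \<gamma> s \<in> fst c} - S)"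
    using assms unfolding pw_C1_path_def by blast
  show thesis
  proof (rule that[of "S \<union> {0, 1}"])
    fix s c assume s: "s \<in> {0..1} - (S \<union> {0, 1})" and c: "c \<in> A" "\<gamma> s \<in> fst c"
    have sin: "s \<in> {s \<in> {0..1}. \<gamma> s \<in> fst c} - S" using s c by auto
    obtain D where D: "\<And>s. s \<in> {s \<in> {0..1}. \<gamma> s \<in> fst c} - S \<Longrightarrow> ((snd c \<circ> \<gamma>) has_vector_derivative D s) (at s)"
      using S(2)[OF c(1)] unfolding C1_differentiable_on_def by blast
    have v: "velocity A \<gamma> s c = D s" using D[OF sin] c by (simp add: velocity_def vector_derivative_at)
    have "s \<in> {0<..<1}" using s by auto
    moreover have "continuous_on {0..1} \<gamma>" using assms by (simp add: pw_C1_path_def)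
    then have "continuous_on {0<..<1} \<gamma>" by (rule continuous_on_subset) auto
    ultimately have "isCont \<gamma> s" by (simp add: continuous_on_eq_continuous_at)
    then show "((snd c \<circ> \<gamma>) has_vector_derivative velocity A \<gamma> s c) (at s) \<and> velocity A \<gamma> s = tvec_of A c (\<gamma> s) (velocity A \<gamma> s c)"
      using velocity_chart[OF c D[OF sin]] D[OF sin] v by simp
  qed (use S in auto)
qed

text \<open>The component of the curve in the direction \<open>e\<close> of the displacement grows at most as fast as the coordinate
norm of the velocity, which is at most the Riemannian speed divided by \<open>m\<close>.\<close>

lemma path_displacement:
  assumes pw: "pw_C1_path A \<gamma>" and c: "c \<in> A" and T: "0 \<le> T" "T \<le> 1"
    and stay: "\<And>s. s \<in> {0..T} \<Longrightarrow> \<gamma> s \<in> fst c" and m: "0 < m"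
    and low: "\<And>s a. s \<in> {0..T} \<Longrightarrow> m * norm a \<le> nm c (snd c (\<gamma> s)) a"
  shows "ennreal (m * norm (snd c (\<gamma> T) - snd c (\<gamma> 0))) \<le> curve_length A \<rho> \<gamma>"
proof -
  obtain S where S: "finite S" "{0, 1} \<subseteq> S"
    "\<And>s c. s \<in> {0..1} - S \<Longrightarrow> c \<in> A \<Longrightarrow> \<gamma> s \<in> fst c \<Longrightarrow>
      ((snd c \<circ> \<gamma>) has_vector_derivative velocity A \<gamma> s c) (at s) \<and> velocity A \<gamma> s = tvec_of A c (\<gamma> s) (velocity A \<gamma> s c)"
    using pw_C1_path_velocity[OF pw] by metis
  let ?w = "\<lambda>s. snd c (\<gamma> s)"
  let ?d = "?w T - ?w 0"
  define e where "e = (1 / norm ?d) *\<^sub>R ?d"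
  have e: "norm e \<le> 1" "inner e ?d = norm ?d"
    by (cases "?d = 0"; simp add: e_def dot_square_norm power2_eq_square)+
  let ?u = "\<lambda>s. inner e (?w s)"
  have "continuous_on {0..T} \<gamma>"
    using pw T continuous_on_subset[of "{0..1}" \<gamma> "{0..T}"] by (auto simp: pw_C1_path_def)
  then have "continuous_on {0..T} ?w"
    by (rule continuous_on_compose2[OF chart_cont(1)[OF c]]) (use stay in auto)
  then have cont: "continuous_on {0..T} ?u" by (intro continuous_intros)
  have "ennreal (m * (?u T - ?u 0)) \<le> (\<integral>\<^sup>+ s\<in>{0..T}. ennreal (riem_norm \<rho> (\<gamma> s) (velocity A \<gamma> s)) \<partial>lborel)"
  proof (rule increment_le_nn_integral[OF T(1) S(1) cont _ _ m])
    fix s assume s: "s \<in> {0<..<T} - S"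
    have sc: "\<gamma> s \<in> fst c" using stay s by auto
    have v: "((snd c \<circ> \<gamma>) has_vector_derivative velocity A \<gamma> s c) (at s)"
      "velocity A \<gamma> s = tvec_of A c (\<gamma> s) (velocity A \<gamma> s c)"
      using S(3)[OF _ c sc] s T by auto
    have "((\<lambda>s. inner e ((snd c \<circ> \<gamma>) s)) has_vector_derivative inner e (velocity A \<gamma> s c)) (at s)"
      by (rule bounded_linear.has_vector_derivative[OF bounded_linear_inner_right v(1)])
    then show "(?u has_real_derivative inner e (velocity A \<gamma> s c)) (at s)"
      by (simp add: has_real_derivative_iff_has_vector_derivative)
    have "\<bar>inner e (velocity A \<gamma> s c)\<bar> \<le> norm e * norm (velocity A \<gamma> s c)" by (rule Cauchy_Schwarz_ineq2)
    also have "\<dots> \<le> norm (velocity A \<gamma> s c)" using e(1) by (simp add: mult_left_le_one_le)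
    finally have "m * \<bar>inner e (velocity A \<gamma> s c)\<bar> \<le> m * norm (velocity A \<gamma> s c)" using m by simp
    also have "\<dots> \<le> nm c (?w s) (velocity A \<gamma> s c)" using low[of s] s by auto
    also have "\<dots> = riem_norm \<rho> (\<gamma> s) (velocity A \<gamma> s)" using v(2) c sc by (simp add: nm_def)
    finally show "m * \<bar>inner e (velocity A \<gamma> s c)\<bar> \<le> riem_norm \<rho> (\<gamma> s) (velocity A \<gamma> s)" .
  qed
  also have "?u T - ?u 0 = norm ?d" using e(2) by (simp add: inner_diff_right)
  also have "(\<integral>\<^sup>+ s\<in>{0..T}. ennreal (riem_norm \<rho> (\<gamma> s) (velocity A \<gamma> s)) \<partial>lborel) \<le> curve_length A \<rho> \<gamma>"
    unfolding curve_length_def using T by (intro nn_integral_mono) (auto split: split_indicator)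
  finally show ?thesis .
qed

text \<open>If the path leaves the chart, consider the first time \<open>T\<close> at which it leaves the open ball of radius \<open>2 * r\<close>. Before \<open>T\<close> its
displacement is at most its length divided by \<open>m\<close>, which is less than \<open>r\<close>; by compactness this persists at
time \<open>T\<close>, and the path is still in the ball.\<close>

lemma path_confined:
  assumes pw: "pw_C1_path A \<gamma>" and c: "c \<in> A" and ball: "cball y0 (2 * r) \<subseteq> chart_image c"
    and m: "0 < m" "\<And>y a. y \<in> cball y0 (2 * r) \<Longrightarrow> m * norm a \<le> nm c y a"
    and start: "\<gamma> 0 \<in> fst c" "dist y0 (snd c (\<gamma> 0)) < r" and len: "curve_length A \<rho> \<gamma> < ennreal (m * r)"
  shows "\<gamma> 1 \<in> fst c" "dist y0 (snd c (\<gamma> 1)) < 2 * r"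
    "ennreal (m * norm (snd c (\<gamma> 1) - snd c (\<gamma> 0))) \<le> curve_length A \<rho> \<gamma>"
proof -
  define Bo where "Bo = chart_inv c ` ball y0 (2 * r)"
  have r: "0 < r" using start(2) zero_le_dist[of y0 "snd c (\<gamma> 0)"] by linarith
  have bsub: "ball y0 (2 * r) \<subseteq> chart_image c" using ball by auto
  have Bo_open: "open Bo" unfolding Bo_def by (rule chart_inv_open_image[OF c open_ball bsub])
  have BoD: "x \<in> fst c \<and> dist y0 (snd c x) < 2 * r" if "x \<in> Bo" for x
    using that chart_inv_in[OF c] chart_inv_right[OF c] bsub by (auto simp: Bo_def subset_iff)
  have BoI: "x \<in> Bo" if "x \<in> fst c" "dist y0 (snd c x) < 2 * r" for x
    unfolding Bo_def using that c by (intro image_eqI[of _ _ "snd c x"]) auto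
  define l where "l = enn2real (curve_length A \<rho> \<gamma>)"
  have l: "curve_length A \<rho> \<gamma> = ennreal l" "0 \<le> l" "l < m * r"
  proof -
    have "curve_length A \<rho> \<gamma> < \<infinity>" using len by (rule less_trans) simp
    then show 1: "curve_length A \<rho> \<gamma> = ennreal l" by (simp add: l_def)
    show 2: "0 \<le> l" by (simp add: l_def)
    show "l < m * r" using len 1 2 by (simp add: ennreal_less_iff)
  qed
  have disp: "m * norm (snd c (\<gamma> T) - snd c (\<gamma> 0)) \<le> l" if T: "0 \<le> T" "T \<le> 1" "\<And>s. s \<in> {0..T} \<Longrightarrow> \<gamma> s \<in> Bo" for T
  proof -
    have "ennreal (m * norm (snd c (\<gamma> T) - snd c (\<gamma> 0))) \<le> curve_length A \<rho> \<gamma>"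
    proof (rule path_displacement[OF pw c T(1,2) _ m(1)])
      fix s assume "s \<in> {0..T}"
      then have s: "\<gamma> s \<in> fst c" "dist y0 (snd c (\<gamma> s)) < 2 * r" using BoD[OF T(3)] by auto
      then show "\<gamma> s \<in> fst c" by simp
      show "m * norm a \<le> nm c (snd c (\<gamma> s)) a" for a by (rule m(2)) (use s in simp)
    qed
    then show ?thesis using l by simp
  qed
  have cont: "continuous_on {0..1} \<gamma>" using pw by (simp add: pw_C1_path_def)
  have all: "\<gamma> s \<in> Bo" if "s \<in> {0..1}" for s
  proof (rule ccontr)
    assume ns: "\<gamma> s \<notin> Bo"
    define Z where "Z = {s \<in> {0..1}. \<gamma> s \<in> - Bo}"
    have "closed Z" unfolding Z_def
      using continuous_closed_preimage[OF cont _ closed_Compl[OF Bo_open]] by (simp add: vimage_def Int_def)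
    moreover have "Z \<noteq> {}" using ns that by (auto simp: Z_def)
    moreover have bdd: "bdd_below Z" by (rule bdd_belowI[of _ 0]) (auto simp: Z_def)
    ultimately have TZ: "Inf Z \<in> Z" by (intro closed_contains_Inf)
    define T where "T = Inf Z"
    have T: "0 \<le> T" "T \<le> 1" "\<gamma> T \<notin> Bo" using TZ by (auto simp: Z_def T_def)
    have before: "\<gamma> s \<in> Bo" if "0 \<le> s" "s < T" for s
      using cInf_lower[OF _ bdd, of s] that T(2) by (force simp: Z_def T_def)
    have "\<gamma> 0 \<in> Bo" using start r by (intro BoI) auto
    then have Tpos: "0 < T" using T by (cases "T = 0") auto
    define K where "K = cball y0 (2 * r) \<inter> cball (snd c (\<gamma> 0)) (l / m)"
    have Kc: "compact K" unfolding K_def by (intro compact_Int_closed compact_cball closed_cball)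
    have Ksub: "K \<subseteq> chart_image c" using ball by (auto simp: K_def)
    have "compact (chart_inv c ` K)"
      by (rule compact_continuous_image[OF continuous_on_subset[OF chart_cont(2)[OF c] Ksub] Kc])
    then have Kcl: "closed (chart_inv c ` K)" by (rule compact_imp_closed)
    have inK: "\<gamma> s \<in> chart_inv c ` K" if s: "0 \<le> s" "s < T" for s
    proof -
      have "m * norm (snd c (\<gamma> s) - snd c (\<gamma> 0)) \<le> l" using before s T(2) by (intro disp) auto
      then have "dist (snd c (\<gamma> 0)) (snd c (\<gamma> s)) \<le> l / m"
        using m(1) by (simp add: dist_norm norm_minus_commute field_simps)
      then show ?thesis using BoD[OF before[OF s]] c unfolding K_def by (intro image_eqI[of _ _ "snd c (\<gamma> s)"]) auto
    qed
    have "T \<in> closure {0..<T}" using Tpos by simp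
    moreover have "closed ({0..1} \<inter> \<gamma> -` (chart_inv c ` K))"
      by (rule continuous_closed_preimage[OF cont _ Kcl]) simp
    then have "closure {0..<T} \<subseteq> {0..1} \<inter> \<gamma> -` (chart_inv c ` K)"
      using inK T(2) by (intro closure_minimal) auto
    ultimately obtain y where y: "y \<in> K" "\<gamma> T = chart_inv c y" by blast
    have "dist y0 y \<le> dist y0 (snd c (\<gamma> 0)) + dist (snd c (\<gamma> 0)) y" by (rule dist_triangle)
    also have "\<dots> < r + r"
    proof (rule add_less_le_mono[OF start(2)])
      have "dist (snd c (\<gamma> 0)) y \<le> l / m" using y(1) by (simp add: K_def)
      also have "\<dots> \<le> r" using l(3) m(1) by (simp add: pos_divide_le_eq mult.commute)
      finally show "dist (snd c (\<gamma> 0)) y \<le> r" .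
    qed
    finally have "y \<in> ball y0 (2 * r)" by simp
    then show False using T(3) y(2) by (auto simp: Bo_def)
  qed
  show "\<gamma> 1 \<in> fst c" "dist y0 (snd c (\<gamma> 1)) < 2 * r" using BoD[OF all[of 1]] by auto
  show "ennreal (m * norm (snd c (\<gamma> 1) - snd c (\<gamma> 0))) \<le> curve_length A \<rho> \<gamma>"
    using disp[of 1] all l by (simp add: ennreal_leI)
qed

text \<open>Makes the Riemannian distance symmetric.\<close>

lemma pw_C1_path_reverse:
  assumes pw: "pw_C1_path A \<gamma>"
  shows "pw_C1_path A (\<lambda>u. \<gamma> (1 - u))" "curve_length A \<rho> (\<lambda>u. \<gamma> (1 - u)) \<le> curve_length A \<rho> \<gamma>"
proof -
  let ?\<eta> = "\<lambda>u. \<gamma> (1 - u)"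
  have cont: "continuous_on {0..1} \<gamma>" using pw by (simp add: pw_C1_path_def)
  obtain S where S: "finite S" "\<And>c. c \<in> A \<Longrightarrow> (snd c \<circ> \<gamma>) C1_differentiable_on ({s \<in> {0..1}. \<gamma> s \<in> fst c} - S)"
    using pw unfolding pw_C1_path_def by blast
  have aff: "((snd c \<circ> ?\<eta>) has_vector_derivative - D) (at u)"
    if "((snd c \<circ> \<gamma>) has_vector_derivative D) (at (1 - u))" for c :: "('m, 'e) chart" and D u
    using has_vector_derivative_affine[of "snd c \<circ> \<gamma>" D 1 "-1" u] that by (simp add: o_def)
  show "pw_C1_path A ?\<eta>"
    unfolding pw_C1_path_def
  proof (intro conjI exI[of _ "(\<lambda>s. 1 - s) ` S"] ballI)
    show "continuous_on {0..1} ?\<eta>"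
      by (rule continuous_on_compose2[OF cont]) (auto intro!: continuous_intros)
    fix c assume c: "c \<in> A"
    obtain D where D: "\<And>s. s \<in> {s \<in> {0..1}. \<gamma> s \<in> fst c} - S \<Longrightarrow> ((snd c \<circ> \<gamma>) has_vector_derivative D s) (at s)"
      "continuous_on ({s \<in> {0..1}. \<gamma> s \<in> fst c} - S) D"
      using S(2)[OF c] unfolding C1_differentiable_on_def by blast
    have im: "1 - u \<in> {s \<in> {0..1}. \<gamma> s \<in> fst c} - S" if "u \<in> {u \<in> {0..1}. ?\<eta> u \<in> fst c} - (\<lambda>s. 1 - s) ` S" for u
      using that by (auto simp: image_iff)
    show "(snd c \<circ> ?\<eta>) C1_differentiable_on ({u \<in> {0..1}. ?\<eta> u \<in> fst c} - (\<lambda>s. 1 - s) ` S)"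
      unfolding C1_differentiable_on_def
    proof (intro exI[of _ "\<lambda>u. - D (1 - u)"] conjI ballI)
      fix u assume "u \<in> {u \<in> {0..1}. ?\<eta> u \<in> fst c} - (\<lambda>s. 1 - s) ` S"
      then show "((snd c \<circ> ?\<eta>) has_vector_derivative - D (1 - u)) (at u)" by (intro aff D(1) im)
    next
      show "continuous_on ({u \<in> {0..1}. ?\<eta> u \<in> fst c} - (\<lambda>s. 1 - s) ` S) (\<lambda>u. - D (1 - u))"
        by (intro continuous_on_minus continuous_on_compose2[OF D(2)] continuous_intros) (use im in blast)
    qed
  qed (use S in auto)
  obtain S' where S': "finite S'"
    "\<And>s c. s \<in> {0..1} - S' \<Longrightarrow> c \<in> A \<Longrightarrow> \<gamma> s \<in> fst c \<Longrightarrow>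
      ((snd c \<circ> \<gamma>) has_vector_derivative velocity A \<gamma> s c) (at s) \<and> velocity A \<gamma> s = tvec_of A c (\<gamma> s) (velocity A \<gamma> s c)"
    using pw_C1_path_velocity[OF pw] by metis
  have speed: "riem_norm \<rho> (?\<eta> u) (velocity A ?\<eta> u) = riem_norm \<rho> (\<gamma> (1 - u)) (velocity A \<gamma> (1 - u))"
    if u: "u \<in> {0..1}" "1 - u \<notin> S'" for u
  proof -
    have s: "1 - u \<in> {0..1} - S'" using u by auto
    obtain c where c: "c \<in> A" "\<gamma> (1 - u) \<in> fst c" by (rule chart_exists)
    have vT: "velocity A \<gamma> (1 - u) \<in> tangent_space A (\<gamma> (1 - u))"
      using S'(2)[OF s c] tvec_of_in[OF c] by metis
    have "velocity A ?\<eta> u = (\<lambda>c. (-1) *\<^sub>R velocity A \<gamma> (1 - u) c)"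
    proof
      fix c'
      show "velocity A ?\<eta> u c' = (-1) *\<^sub>R velocity A \<gamma> (1 - u) c'"
      proof (cases "c' \<in> A \<and> \<gamma> (1 - u) \<in> fst c'")
        case True
        then have "((snd c' \<circ> ?\<eta>) has_vector_derivative - velocity A \<gamma> (1 - u) c') (at u)"
          using S'(2)[OF s] by (intro aff) blast
        then show ?thesis using True vector_derivative_at by (simp add: velocity_def)
      qed (auto simp: velocity_def)
    qed
    then show ?thesis using riem_norm_scale[OF vT, of "-1"] by simp
  qed
  have "finite ((\<lambda>s. 1 - s) ` S')" using S'(1) by simp
  then have "AE u in lborel. u \<notin> (\<lambda>s. 1 - s) ` S'" by (intro AE_not_in finite_imp_null_set_lborel)
  then have "AE u in lborel. ennreal (riem_norm \<rho> (?\<eta> u) (velocity A ?\<eta> u)) * indicator {0..1} u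
      \<le> ennreal (riem_norm \<rho> (\<gamma> (1 - u)) (velocity A \<gamma> (1 - u))) * indicator {0..1} (1 - u)"
  proof eventually_elim
    case (elim u)
    then have "1 - u \<notin> S'" by force
    then show ?case using speed[of u] by (auto split: split_indicator)
  qed
  then have "curve_length A \<rho> ?\<eta> \<le> (\<integral>\<^sup>+ u. ennreal (riem_norm \<rho> (\<gamma> (1 - u)) (velocity A \<gamma> (1 - u))) * indicator {0..1} (1 - u) \<partial>lborel)"
    unfolding curve_length_def by (rule nn_integral_mono_AE)
  also have "\<dots> \<le> curve_length A \<rho> \<gamma>"
    unfolding curve_length_def
    by (rule nn_integral_reflect_le[of "\<lambda>u. ennreal (riem_norm \<rho> (\<gamma> u) (velocity A \<gamma> u)) * indicator {0..1} u"])
  finally show "curve_length A \<rho> ?\<eta> \<le> curve_length A \<rho> \<gamma>" .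
qed

end

section \<open>Curves give chains\<close>

context stationary_ham
begin

text \<open>Any two points are joined by a chain, hence by a path of finite length; so the distance, which is a real number, is the
infimum of the lengths and not a default value.\<close>

lemma paths_finite:
  assumes "\<omega> \<in> W"
  shows "(INF \<eta>\<in>{\<eta>. pw_C1_path A \<eta> \<and> \<eta> 0 = x \<and> \<eta> 1 = y}. curve_length A \<rho> \<eta>) < \<infinity>"
proof -
  obtain l where "connects l x y" using connects_exists by blast
  then obtain a where "reach \<omega> x y 1 a" using assms by (auto simp: connects_def dest!: bspec spec[of _ 1])
  then obtain \<gamma> S V f where "\<gamma> 0 = x" "\<gamma> (1 * 1) = y" "nice_curve (1 * 1) V S \<gamma>"
    using chain_curve[OF assms zero_less_one] by blast
  then have "(INF \<eta>\<in>{\<eta>. pw_C1_path A \<eta> \<and> \<eta> 0 = x \<and> \<eta> 1 = y}. curve_length A \<rho> \<eta>) \<le> ennreal V"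
    using nice_curve_length[of 1 V S \<gamma> 0 1] by simp
  then show ?thesis by (rule le_less_trans) simp
qed

lemma riem_dist_sym: "riem_dist A \<rho> x y = riem_dist A \<rho> y x"
proof -
  have le: "(INF \<eta>\<in>{\<eta>. pw_C1_path A \<eta> \<and> \<eta> 0 = x \<and> \<eta> 1 = y}. curve_length A \<rho> \<eta>) \<le>
      (INF \<eta>\<in>{\<eta>. pw_C1_path A \<eta> \<and> \<eta> 0 = y \<and> \<eta> 1 = x}. curve_length A \<rho> \<eta>)" for x y
  proof (rule INF_greatest)
    fix \<eta> assume "\<eta> \<in> {\<eta>. pw_C1_path A \<eta> \<and> \<eta> 0 = y \<and> \<eta> 1 = x}"
    then show "(INF \<eta>\<in>{\<eta>. pw_C1_path A \<eta> \<and> \<eta> 0 = x \<and> \<eta> 1 = y}. curve_length A \<rho> \<eta>) \<le> curve_length A \<rho> \<eta>"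
      using pw_C1_path_reverse[of \<eta>] by (intro INF_lower2[of "\<lambda>u. \<eta> (1 - u)"]) auto
  qed
  show ?thesis unfolding riem_dist_def by (rule arg_cong[OF antisym[OF le le]])
qed

text \<open>Near a point, short paths stay in the chart, so distances dominate coordinate distances.\<close>

lemma riem_dist_local:
  assumes \<omega>: "\<omega> \<in> W" and c: "c \<in> A" and ball: "cball y0 (2 * r) \<subseteq> chart_image c"
    and m: "0 < m" "\<And>y a. y \<in> cball y0 (2 * r) \<Longrightarrow> m * norm a \<le> nm c y a"
    and x: "x \<in> fst c" "dist y0 (snd c x) < r" and d: "riem_dist A \<rho> x x' < m * r"
  shows "x' \<in> fst c" "dist y0 (snd c x') < 2 * r" "m * norm (snd c x' - snd c x) \<le> riem_dist A \<rho> x x'"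
proof -
  define D where "D = riem_dist A \<rho> x x'"
  have D: "(INF \<eta>\<in>{\<eta>. pw_C1_path A \<eta> \<and> \<eta> 0 = x \<and> \<eta> 1 = x'}. curve_length A \<rho> \<eta>) = ennreal D" "0 \<le> D"
    using paths_finite[OF \<omega>, of x x'] by (simp_all add: D_def riem_dist_def)
  have *: "x' \<in> fst c \<and> dist y0 (snd c x') < 2 * r \<and> m * norm (snd c x' - snd c x) \<le> D'" if D': "D < D'" "D' \<le> m * r" for D'
  proof -
    have "(INF \<eta>\<in>{\<eta>. pw_C1_path A \<eta> \<and> \<eta> 0 = x \<and> \<eta> 1 = x'}. curve_length A \<rho> \<eta>) < ennreal D'"
      unfolding D(1) using D' D(2) by (simp add: ennreal_less_iff)
    then obtain \<eta> where \<eta>: "pw_C1_path A \<eta>" "\<eta> 0 = x" "\<eta> 1 = x'" "curve_length A \<rho> \<eta> < ennreal D'"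
      by (auto simp: INF_less_iff)
    have "curve_length A \<rho> \<eta> < ennreal (m * r)"
      using \<eta>(4) ennreal_leI[OF D'(2)] by (rule less_le_trans)
    note conf = path_confined[OF \<eta>(1) c ball m _ _ this]
    have "ennreal (m * norm (snd c x' - snd c x)) \<le> ennreal D'"
      using conf(3) \<eta> x by simp
    then have "m * norm (snd c x' - snd c x) \<le> D'" using D' D(2) by (simp add: ennreal_le_iff)
    then show ?thesis using conf(1,2) \<eta> x by simp
  qed
  show "x' \<in> fst c" "dist y0 (snd c x') < 2 * r" using *[of "m * r"] d by (auto simp: D_def)
  have "m * norm (snd c x' - snd c x) \<le> D"
    by (rule dense_ge_bounded[of D "m * r"]) (use d * in \<open>auto simp: D_def\<close>)
  then show "m * norm (snd c x' - snd c x) \<le> riem_dist A \<rho> x x'" by (simp add: D_def)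
qed

lemma abs_cont_curve_single:
  assumes "abs_cont_curve d a b \<gamma>" "0 < e"
  obtains \<delta> where "0 < \<delta>" "\<And>s t. a \<le> s \<Longrightarrow> s \<le> t \<Longrightarrow> t \<le> b \<Longrightarrow> t - s < \<delta> \<Longrightarrow> d (\<gamma> s) (\<gamma> t) < e"
proof -
  obtain \<delta> where \<delta>: "0 < \<delta>" "\<And>I s t. nonoverlapping a b I s t \<Longrightarrow> (\<Sum>i\<in>I. t i - s i) < \<delta> \<Longrightarrow>
      (\<Sum>i\<in>I. d (\<gamma> (s i)) (\<gamma> (t i))) < e"
    using abs_cont_curve_nonoverlapping[OF assms] by blast
  show thesis
  proof (rule that[OF \<delta>(1)])
    fix s t assume "a \<le> s" "s \<le> t" "t \<le> b" "t - s < \<delta>"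
    then show "d (\<gamma> s) (\<gamma> t) < e"
      using \<delta>(2)[of "{0}" "\<lambda>_. s" "\<lambda>_. t"] by (simp add: nonoverlapping_def)
  qed
qed

lemma abs_cont_curve_continuous:
  assumes \<omega>: "\<omega> \<in> W" and ac: "abs_cont_curve (riem_dist A \<rho>) a b \<gamma>"
  shows "continuous_on {a..b} \<gamma>"
  unfolding continuous_on_topological
proof (intro ballI allI impI)
  fix s0 B assume s0: "s0 \<in> {a..b}" and B: "open B" "\<gamma> s0 \<in> B"
  obtain c where c: "c \<in> A" "\<gamma> s0 \<in> fst c" by (rule chart_exists)
  have y: "snd c (\<gamma> s0) \<in> chart_image c" using c by simp
  have "open (fst c \<inter> B)" using chart_open(1)[OF c(1)] B(1) by (rule open_Int)
  then have oS: "open (snd c ` (fst c \<inter> B))" by (rule chart_open_image[OF c(1)]) simp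
  have yS: "snd c (\<gamma> s0) \<in> snd c ` (fst c \<inter> B)" using c B by blast
  obtain R m M where R: "0 < R" "0 < m" "cball (snd c (\<gamma> s0)) R \<subseteq> chart_image c \<inter> snd c ` (fst c \<inter> B)"
    "\<And>y a. y \<in> cball (snd c (\<gamma> s0)) R \<Longrightarrow> m * norm a \<le> nm c y a"
    using nm_local[OF c(1) y oS yS] by metis
  define r where "r = R / 2"
  have r: "0 < r" "2 * r = R" using R(1) by (auto simp: r_def)
  have "0 < m * r" using R r by simp
  then obtain \<delta> where \<delta>: "0 < \<delta>" "\<And>s t. a \<le> s \<Longrightarrow> s \<le> t \<Longrightarrow> t \<le> b \<Longrightarrow> t - s < \<delta> \<Longrightarrow> riem_dist A \<rho> (\<gamma> s) (\<gamma> t) < m * r"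
    using abs_cont_curve_single[OF ac] by blast
  have "\<gamma> s \<in> B" if s: "s \<in> {a..b}" "s \<in> ball s0 \<delta>" for s
  proof -
    have "riem_dist A \<rho> (\<gamma> s0) (\<gamma> s) < m * r"
    proof (cases "s0 \<le> s")
      case True then show ?thesis using \<delta>(2)[of s0 s] s s0 by (auto simp: dist_real_def)
    next
      case False then show ?thesis using \<delta>(2)[of s s0] s s0 riem_dist_sym by (auto simp: dist_real_def)
    qed
    then have "\<gamma> s \<in> fst c" "dist (snd c (\<gamma> s0)) (snd c (\<gamma> s)) < 2 * r"
      using riem_dist_local[OF \<omega> c(1), of "snd c (\<gamma> s0)" r m "\<gamma> s0" "\<gamma> s"] R r c(2) by auto
    then have "snd c (\<gamma> s) \<in> snd c ` (fst c \<inter> B)" using R(3) r(2) by (auto simp: subset_iff)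
    then obtain z where "z \<in> fst c" "z \<in> B" "snd c (\<gamma> s) = snd c z" by blast
    then show ?thesis using chart_inv_left[OF c(1)] \<open>\<gamma> s \<in> fst c\<close> by metis
  qed
  then show "\<exists>T. open T \<and> s0 \<in> T \<and> (\<forall>s\<in>{a..b}. s \<in> T \<longrightarrow> \<gamma> s \<in> B)"
    using \<delta>(1) by (intro exI[of _ "ball s0 \<delta>"]) auto
qed

lemma coordinate_abs_cont:
  assumes \<omega>: "\<omega> \<in> W" and ac: "abs_cont_curve (riem_dist A \<rho>) a0 b0 \<gamma>" and ab: "a0 \<le> a" "b \<le> b0"
    and c: "c \<in> A" and ball: "cball y0 (2 * r) \<subseteq> chart_image c" and r: "0 < r"
    and m: "0 < m" "\<And>y a. y \<in> cball y0 (2 * r) \<Longrightarrow> m * norm a \<le> nm c y a"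
    and stay: "\<And>s. s \<in> {a..b} \<Longrightarrow> \<gamma> s \<in> fst c \<and> dist y0 (snd c (\<gamma> s)) < r"
  shows "abs_cont_curve dist a b (\<lambda>s. inner \<xi> (snd c (\<gamma> s)))"
  unfolding abs_cont_curve_def
proof (intro allI impI)
  fix e :: real assume e: "0 < e"
  define e' where "e' = min (m * r) (e * m / (norm \<xi> + 1))"
  have k: "0 < norm \<xi> + 1" by (simp add: add_nonneg_pos)
  have e': "0 < e'" "e' \<le> m * r" "e' \<le> e * m / (norm \<xi> + 1)"
    using e m(1) r k by (simp_all add: e'_def)
  obtain \<delta> where \<delta>: "0 < \<delta>" "\<forall>(n::nat) s t. (\<forall>i<n. a0 \<le> s i \<and> s i \<le> t i \<and> t i \<le> b0) \<longrightarrow>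
     (\<forall>i<n. \<forall>j<n. i \<noteq> j \<longrightarrow> {s i<..<t i} \<inter> {s j<..<t j} = {}) \<longrightarrow>
     (\<Sum>i<n. t i - s i) < \<delta> \<longrightarrow> (\<Sum>i<n. riem_dist A \<rho> (\<gamma> (s i)) (\<gamma> (t i))) < e'"
    using ac[unfolded abs_cont_curve_def, THEN spec, THEN mp, OF e'(1)] by (elim exE conjE)
  have "(\<Sum>i<n. dist (inner \<xi> (snd c (\<gamma> (s i)))) (inner \<xi> (snd c (\<gamma> (t i))))) < e"
    if st: "\<forall>i<n. a \<le> s i \<and> s i \<le> t i \<and> t i \<le> b"
      and dj: "\<forall>i<n. \<forall>j<n. i \<noteq> j \<longrightarrow> {s i<..<t i} \<inter> {s j<..<t j} = {}" and len: "(\<Sum>i<n. t i - s i) < \<delta>"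
    for n :: nat and s t
  proof -
    let ?d = "\<lambda>i. riem_dist A \<rho> (\<gamma> (s i)) (\<gamma> (t i))"
    have "\<forall>i<n. a0 \<le> s i \<and> s i \<le> t i \<and> t i \<le> b0" using st ab by (meson order_trans)
    then have sum: "(\<Sum>i<n. ?d i) < e'"
      using \<delta>(2)[THEN spec, THEN spec, THEN spec, THEN mp, THEN mp, THEN mp, OF _ dj len] by blast
    have dnn: "0 \<le> ?d i" for i by (simp add: riem_dist_def)
    have le: "dist (inner \<xi> (snd c (\<gamma> (s i)))) (inner \<xi> (snd c (\<gamma> (t i)))) \<le> norm \<xi> / m * ?d i" if i: "i < n" for i
    proof -
      have "?d i \<le> (\<Sum>i<n. ?d i)" using i dnn by (intro member_le_sum) auto
      then have "?d i < m * r" using sum e'(2) by linarith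
      have "s i \<in> {a..b}" using st i by (auto intro: order_trans)
      then have "m * norm (snd c (\<gamma> (t i)) - snd c (\<gamma> (s i))) \<le> ?d i"
        using riem_dist_local(3)[OF \<omega> c ball m _ _ \<open>?d i < m * r\<close>] stay by blast
      then have n: "norm (snd c (\<gamma> (t i)) - snd c (\<gamma> (s i))) \<le> ?d i / m" using m(1) by (simp add: field_simps)
      have "dist (inner \<xi> (snd c (\<gamma> (s i)))) (inner \<xi> (snd c (\<gamma> (t i)))) = \<bar>inner \<xi> (snd c (\<gamma> (t i)) - snd c (\<gamma> (s i)))\<bar>"
        by (simp add: dist_real_def inner_diff_right abs_minus_commute)
      also have "\<dots> \<le> norm \<xi> * norm (snd c (\<gamma> (t i)) - snd c (\<gamma> (s i)))" by (rule Cauchy_Schwarz_ineq2)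
      also have "\<dots> \<le> norm \<xi> * (?d i / m)" by (rule mult_left_mono[OF n]) simp
      finally show ?thesis by simp
    qed
    have "(\<Sum>i<n. dist (inner \<xi> (snd c (\<gamma> (s i)))) (inner \<xi> (snd c (\<gamma> (t i))))) \<le> (\<Sum>i<n. norm \<xi> / m * ?d i)"
      by (intro sum_mono le) simp
    also have "\<dots> = norm \<xi> / m * (\<Sum>i<n. ?d i)" by (rule sum_distrib_left[symmetric])
    also have "\<dots> \<le> norm \<xi> / m * (e * m / (norm \<xi> + 1))"
      using sum e'(3) m(1) by (intro mult_left_mono) auto
    also have "\<dots> = norm \<xi> * e / (norm \<xi> + 1)" using m(1) by simp
    also have "\<dots> < e" using e k by (simp add: pos_divide_less_eq algebra_simps)
    finally show ?thesis .
  qed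
  then show "\<exists>\<delta>>0. \<forall>(n::nat) s t. (\<forall>i<n. a \<le> s i \<and> s i \<le> t i \<and> t i \<le> b) \<longrightarrow>
      (\<forall>i<n. \<forall>j<n. i \<noteq> j \<longrightarrow> {s i<..<t i} \<inter> {s j<..<t j} = {}) \<longrightarrow>
      (\<Sum>i<n. t i - s i) < \<delta> \<longrightarrow> (\<Sum>i<n. dist (inner \<xi> (snd c (\<gamma> (s i)))) (inner \<xi> (snd c (\<gamma> (t i))))) < e"
    using \<delta>(1) by blast
qed

text \<open>The coordinates of the curve along an orthonormal basis are absolutely continuous, so the one-dimensional theorem
applies to each of them; \<open>v\<close> is the velocity in the chart \<open>c\<close>. The integrals are localized because the
one-dimensional theorem is.\<close>

lemma abs_cont_curve_velocity:
  assumes \<omega>: "\<omega> \<in> W" and ac: "abs_cont_curve (riem_dist A \<rho>) a0 b0 \<gamma>" and ab: "a0 \<le> a1" "b1 \<le> b0"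
    and c: "c \<in> A" and ball: "cball y0 (2 * r) \<subseteq> chart_image c" and r: "0 < r"
    and m: "0 < m" "\<And>y a. y \<in> cball y0 (2 * r) \<Longrightarrow> m * norm a \<le> nm c y a"
    and stay: "\<And>s. s \<in> {a1..b1} \<Longrightarrow> \<gamma> s \<in> fst c \<and> dist y0 (snd c (\<gamma> s)) < r"
  obtains \<delta> where "0 < \<delta>"
    "\<And>a b. a1 \<le> a \<Longrightarrow> a \<le> b \<Longrightarrow> b \<le> b1 \<Longrightarrow> b - a < \<delta> \<Longrightarrow>
      \<exists>v. (AE s in lborel. s \<in> {a<..<b} \<longrightarrow> velocity A \<gamma> s = tvec_of A c (\<gamma> s) (v s)) \<and>
        (\<forall>\<xi>. integrable lborel (\<lambda>s. inner \<xi> (v s)) \<and>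
           (LINT s:{a..b}|lborel. inner \<xi> (v s)) = inner \<xi> (snd c (\<gamma> b) - snd c (\<gamma> a)))"
proof -
  obtain B :: "'e set" where B: "finite B" "\<And>x. (\<Sum>b\<in>B. inner x b *\<^sub>R b) = x"
    using finite_orthonormal_basis by metis
  let ?f = "\<lambda>e s. inner e (snd c (\<gamma> s))"
  define good where "good e \<delta> \<longleftrightarrow> (\<forall>a b. a1 \<le> a \<longrightarrow> a \<le> b \<longrightarrow> b \<le> b1 \<longrightarrow> b - a < \<delta> \<longrightarrow>
      (\<exists>h. integrable lborel h \<and>
        (\<forall>x y. a \<le> x \<longrightarrow> x \<le> y \<longrightarrow> y \<le> b \<longrightarrow> ?f e y - ?f e x = (LINT s:{x..y}|lborel. h s)) \<and>
        (AE x in lborel. a < x \<and> x < b \<longrightarrow> (?f e has_real_derivative h x) (at x))))" for e \<delta>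
  have "\<exists>\<delta>>0. good e \<delta>" for e
  proof -
    have AC: "abs_cont_curve dist a1 b1 (?f e)"
      by (rule coordinate_abs_cont[OF \<omega> ac ab c ball r m stay])
    show ?thesis unfolding good_def by (rule abs_cont_local_FTC[OF AC]) blast
  qed
  then obtain \<delta> where \<delta>: "\<And>e. 0 < \<delta> e" "\<And>e. good e (\<delta> e)" by metis
  define d where "d = Min (insert 1 (\<delta> ` B))"
  have d: "0 < d" "\<And>e. e \<in> B \<Longrightarrow> d \<le> \<delta> e" using B(1) \<delta>(1) by (auto simp: d_def)
  show thesis
  proof (rule that[OF d(1)])
    fix a b assume a: "a1 \<le> a" "a \<le> b" "b \<le> b1" "b - a < d"
    have "\<forall>e\<in>B. \<exists>h. integrable lborel h \<and>
        (\<forall>x y. a \<le> x \<longrightarrow> x \<le> y \<longrightarrow> y \<le> b \<longrightarrow> ?f e y - ?f e x = (LINT s:{x..y}|lborel. h s)) \<and>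
        (AE x in lborel. a < x \<and> x < b \<longrightarrow> (?f e has_real_derivative h x) (at x))"
    proof
      fix e assume "e \<in> B"
      then have "b - a < \<delta> e" using d(2) a(4) by force
      then show "\<exists>h. integrable lborel h \<and>
        (\<forall>x y. a \<le> x \<longrightarrow> x \<le> y \<longrightarrow> y \<le> b \<longrightarrow> ?f e y - ?f e x = (LINT s:{x..y}|lborel. h s)) \<and>
        (AE x in lborel. a < x \<and> x < b \<longrightarrow> (?f e has_real_derivative h x) (at x))"
        using \<delta>(2)[of e] a unfolding good_def by blast
    qed
    from bchoice[OF this] obtain h where h: "\<And>e. e \<in> B \<Longrightarrow> integrable lborel (h e)"
      "\<And>e x y. e \<in> B \<Longrightarrow> a \<le> x \<Longrightarrow> x \<le> y \<Longrightarrow> y \<le> b \<Longrightarrow> ?f e y - ?f e x = (LINT s:{x..y}|lborel. h e s)"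
      "\<And>e. e \<in> B \<Longrightarrow> AE x in lborel. a < x \<and> x < b \<longrightarrow> (?f e has_real_derivative h e x) (at x)"
      by blast
    define v where "v s = (\<Sum>e\<in>B. h e s *\<^sub>R e)" for s
    have cont: "continuous_on {a0..b0} \<gamma>" by (rule abs_cont_curve_continuous[OF \<omega> ac])
    have "AE s in lborel. \<forall>e\<in>B. a < s \<and> s < b \<longrightarrow> (?f e has_real_derivative h e s) (at s)"
      by (rule AE_finite_allI[OF B(1)]) (rule h(3))
    then have "AE s in lborel. s \<in> {a<..<b} \<longrightarrow> velocity A \<gamma> s = tvec_of A c (\<gamma> s) (v s)"
    proof (eventually_elim, intro impI)
      fix s assume d: "\<forall>e\<in>B. a < s \<and> s < b \<longrightarrow> (?f e has_real_derivative h e s) (at s)" and s: "s \<in> {a<..<b}"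
      have "((snd c \<circ> \<gamma>) has_vector_derivative v s) (at s)"
        unfolding v_def by (rule has_vector_derivative_inner[OF B]) (use d s in \<open>simp add: inner_commute\<close>)
      moreover have "continuous_on {a<..<b} \<gamma>" by (rule continuous_on_subset[OF cont]) (use a ab in auto)
      then have "isCont \<gamma> s" using s by (simp add: continuous_on_eq_continuous_at)
      moreover have "\<gamma> s \<in> fst c" using stay[of s] s a by auto
      ultimately show "velocity A \<gamma> s = tvec_of A c (\<gamma> s) (v s)" by (intro velocity_chart[OF c])
    qed
    moreover have "integrable lborel (\<lambda>s. inner \<xi> (v s)) \<and>
        (LINT s:{a..b}|lborel. inner \<xi> (v s)) = inner \<xi> (snd c (\<gamma> b) - snd c (\<gamma> a))" for \<xi>
    proof
      have iv: "inner \<xi> (v s) = (\<Sum>e\<in>B. h e s * inner \<xi> e)" for s by (simp add: v_def inner_sum_right)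
      show "integrable lborel (\<lambda>s. inner \<xi> (v s))" unfolding iv
        by (intro Bochner_Integration.integrable_sum integrable_mult_left h(1))
      have si: "set_integrable lborel {a..b} (\<lambda>s. h e s * inner \<xi> e)" if "e \<in> B" for e
        unfolding set_integrable_def
        using integrable_mult_indicator[of "{a..b}" lborel "\<lambda>s. h e s * inner \<xi> e"] h(1)[OF that] by simp
      have "(LINT s:{a..b}|lborel. inner \<xi> (v s)) = (\<Sum>e\<in>B. (LINT s:{a..b}|lborel. h e s * inner \<xi> e))"
        unfolding iv set_lebesgue_integral_def scaleR_sum_right
        by (rule Bochner_Integration.integral_sum) (use si in \<open>simp add: set_integrable_def\<close>)
      also have "\<dots> = (\<Sum>e\<in>B. (?f e b - ?f e a) * inner \<xi> e)"
        using h(2)[of _ a b] a(2) by (intro sum.cong) simp_all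
      also have "\<dots> = inner \<xi> (\<Sum>e\<in>B. inner (snd c (\<gamma> b) - snd c (\<gamma> a)) e *\<^sub>R e)"
        by (simp add: inner_sum_right inner_diff_right inner_commute)
      finally show "(LINT s:{a..b}|lborel. inner \<xi> (v s)) = inner \<xi> (snd c (\<gamma> b) - snd c (\<gamma> a))"
        by (simp add: B(2))
    qed
    ultimately show "\<exists>v. (AE s in lborel. s \<in> {a<..<b} \<longrightarrow> velocity A \<gamma> s = tvec_of A c (\<gamma> s) (v s)) \<and>
        (\<forall>\<xi>. integrable lborel (\<lambda>s. inner \<xi> (v s)) \<and>
           (LINT s:{a..b}|lborel. inner \<xi> (v s)) = inner \<xi> (snd c (\<gamma> b) - snd c (\<gamma> a)))" by blast
  qed
qed

end

context stationary_ham
begin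

text \<open>On \<open>[a, b]\<close> the curve can be replaced by a chain whose duration and cost are controlled by the integral of some
minorant \<open>g\<close> of the Lagrangian. All bounds are additive in the interval, so pieces can be glued. The duration may
exceed \<open>(b - a) / \<epsilon>\<close>, by a small multiple of the action; this is where fast parts of the curve are slowed
down. The summand \<open>(|\<Theta> 0| + 2) * (b - a)\<close> makes the excess nonnegative.\<close>

definition piece :: "'w \<Rightarrow> real \<Rightarrow> real \<Rightarrow> (real \<Rightarrow> 'm) \<Rightarrow> real \<Rightarrow> real \<Rightarrow> bool" where
  "piece \<omega> \<epsilon> \<kappa> \<gamma> a b \<longleftrightarrow> (\<exists>g t c. set_integrable lborel {a..b} g \<and>
     (AE s in lborel. s \<in> {a..b} \<longrightarrow> g s \<le> lagrangian_eps A H \<epsilon> (\<gamma> s) (velocity A \<gamma> s) \<omega>) \<and>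
     reach \<omega> (\<gamma> a) (\<gamma> b) t c \<and> (b - a) / \<epsilon> \<le> t \<and>
     t \<le> (b - a) / \<epsilon> + \<kappa> * ((LINT s:{a..b}|lborel. g s) + (\<bar>\<Theta> 0\<bar> + 2) * (b - a)) / \<epsilon> \<and>
     c \<le> ((LINT s:{a..b}|lborel. g s) + 3 * \<kappa> * (b - a)) / \<epsilon>)"

lemma set_integral_Ioc_Icc:
  fixes g :: "real \<Rightarrow> real"
  assumes g: "set_integrable lborel {a..b} g"
  shows "set_integrable lborel {a<..b} g" "(LINT s:{a<..b}|lborel. g s) = (LINT s:{a..b}|lborel. g s)"
proof -
  show i: "set_integrable lborel {a<..b} g" by (rule set_integrable_subset[OF g]) auto
  show "(LINT s:{a<..b}|lborel. g s) = (LINT s:{a..b}|lborel. g s)"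
    unfolding set_lebesgue_integral_def
  proof (rule integral_cong_AE)
    show "(\<lambda>s. indicator {a<..b} s *\<^sub>R g s) \<in> borel_measurable lborel" "(\<lambda>s. indicator {a..b} s *\<^sub>R g s) \<in> borel_measurable lborel"
      using i g by (auto simp: set_integrable_def)
    show "AE s in lborel. indicator {a<..b} s *\<^sub>R g s = indicator {a..b} s *\<^sub>R g s"
      using AE_lborel_singleton[of a] by eventually_elim (auto split: split_indicator)
  qed
qed

lemma piece_trans:
  assumes 1: "piece \<omega> \<epsilon> \<kappa> \<gamma> a b" and 2: "piece \<omega> \<epsilon> \<kappa> \<gamma> b c" and ab: "a \<le> b" "b \<le> c"
  shows "piece \<omega> \<epsilon> \<kappa> \<gamma> a c"
proof -
  let ?F = "\<lambda>s. lagrangian_eps A H \<epsilon> (\<gamma> s) (velocity A \<gamma> s) \<omega>"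
  obtain g1 t1 c1 where g1: "set_integrable lborel {a..b} g1" "AE s in lborel. s \<in> {a..b} \<longrightarrow> g1 s \<le> ?F s"
     "reach \<omega> (\<gamma> a) (\<gamma> b) t1 c1" "(b - a) / \<epsilon> \<le> t1"
     "t1 \<le> (b - a) / \<epsilon> + \<kappa> * ((LINT s:{a..b}|lborel. g1 s) + (\<bar>\<Theta> 0\<bar> + 2) * (b - a)) / \<epsilon>"
     "c1 \<le> ((LINT s:{a..b}|lborel. g1 s) + 3 * \<kappa> * (b - a)) / \<epsilon>"
    using 1 unfolding piece_def by blast
  obtain g2 t2 c2 where g2: "set_integrable lborel {b..c} g2" "AE s in lborel. s \<in> {b..c} \<longrightarrow> g2 s \<le> ?F s"
     "reach \<omega> (\<gamma> b) (\<gamma> c) t2 c2" "(c - b) / \<epsilon> \<le> t2"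
     "t2 \<le> (c - b) / \<epsilon> + \<kappa> * ((LINT s:{b..c}|lborel. g2 s) + (\<bar>\<Theta> 0\<bar> + 2) * (c - b)) / \<epsilon>"
     "c2 \<le> ((LINT s:{b..c}|lborel. g2 s) + 3 * \<kappa> * (c - b)) / \<epsilon>"
    using 2 unfolding piece_def by blast
  define g where "g s = (if s \<le> b then g1 s else g2 s)" for s
  have i1: "set_integrable lborel {a..b} g"
  proof -
    have "set_integrable lborel {a..b} g = set_integrable lborel {a..b} g1"
      by (rule set_integrable_cong) (auto simp: g_def)
    then show ?thesis using g1(1) by simp
  qed
  have i2: "set_integrable lborel {b<..c} g"
  proof -
    have "set_integrable lborel {b<..c} g = set_integrable lborel {b<..c} g2"
      by (rule set_integrable_cong) (auto simp: g_def)
    then show ?thesis using set_integral_Ioc_Icc(1)[OF g2(1)] by simp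
  qed
  have split: "{a..c} = {a..b} \<union> {b<..c}" using ab by auto
  have i: "set_integrable lborel {a..c} g" unfolding split by (rule set_integrable_Un[OF i1 i2]) auto
  have "(LINT s:{a..c}|lborel. g s) = (LINT s:{a..b}|lborel. g s) + (LINT s:{b<..c}|lborel. g s)"
    unfolding split by (rule set_integral_Un[OF _ i1 i2]) auto
  also have "(LINT s:{a..b}|lborel. g s) = (LINT s:{a..b}|lborel. g1 s)"
    by (rule set_lebesgue_integral_cong) (auto simp: g_def)
  also have "(LINT s:{b<..c}|lborel. g s) = (LINT s:{b<..c}|lborel. g2 s)"
    by (rule set_lebesgue_integral_cong) (auto simp: g_def)
  also have "\<dots> = (LINT s:{b..c}|lborel. g2 s)" by (rule set_integral_Ioc_Icc(2)[OF g2(1)])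
  finally have I: "(LINT s:{a..c}|lborel. g s) = (LINT s:{a..b}|lborel. g1 s) + (LINT s:{b..c}|lborel. g2 s)" .
  have le: "AE s in lborel. s \<in> {a..c} \<longrightarrow> g s \<le> ?F s"
    using g1(2) g2(2) by eventually_elim (auto simp: g_def)
  show ?thesis
    unfolding piece_def
  proof (intro exI conjI)
    show "reach \<omega> (\<gamma> a) (\<gamma> c) (t1 + t2) (c1 + c2)" by (rule reach_trans[OF g1(3) g2(3)])
    show "(c - a) / \<epsilon> \<le> t1 + t2" using g1(4) g2(4) by (simp add: diff_divide_distrib)
    show "t1 + t2 \<le> (c - a) / \<epsilon> + \<kappa> * ((LINT s:{a..c}|lborel. g s) + (\<bar>\<Theta> 0\<bar> + 2) * (c - a)) / \<epsilon>"
      using g1(5) g2(5) unfolding I by (simp add: diff_divide_distrib add_divide_distrib algebra_simps)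
    show "c1 + c2 \<le> ((LINT s:{a..c}|lborel. g s) + 3 * \<kappa> * (c - a)) / \<epsilon>"
      using g1(6) g2(6) unfolding I by (simp add: diff_divide_distrib add_divide_distrib algebra_simps)
  qed (use i le in auto)
qed

text \<open>Short pieces stay in a small ball \<open>D\<close> of a chart, on which the metric varies at most by a factor 2 and, for
momenta in a ball, the Hamiltonian varies by at most \<open>\<kappa>\<close>. The piece is replaced by the straight segment
between its endpoints, with mean rescaled velocity \<open>q\<close>. For a fixed momentum \<open>\<xi>\<close> the function \<open>g \<xi>\<close> is a
minorant of the Lagrangian, whose integral is almost \<open>\<xi> \<bullet> q - H\<close> times the duration, because the integral
of the velocity is the displacement. If the mean speed \<open>n\<close> is at most \<open>V\<close>, a nearly optimal momentum for
\<open>q\<close> shows that the segment, travelled in the same time, is not more costly. If \<open>n\<close> is large, the momentum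
that norms \<open>q\<close> shows that the action is large compared with the length; then the segment is travelled with
speed at most 2, in a time that is small compared with the action and at a cost of at most the action.\<close>

lemma piece_local:
  assumes \<omega>: "\<omega> \<in> W" and \<epsilon>: "0 < \<epsilon>" and \<kappa>: "0 < \<kappa>" "\<kappa> \<le> 1"
    and Hcont: "\<And>c. c \<in> A \<Longrightarrow> continuous_on (chart_image c \<times> UNIV) (\<lambda>z. H (cot_param A c z) \<omega>)"
    and ac: "abs_cont_curve (riem_dist A \<rho>) 0 1 \<gamma>" and x: "x \<in> {0..1}"
  obtains d where "0 < d" "\<And>a b. 0 \<le> a \<Longrightarrow> a \<le> x \<Longrightarrow> x \<le> b \<Longrightarrow> b \<le> 1 \<Longrightarrow> b - a < d \<Longrightarrow> piece \<omega> \<epsilon> \<kappa> \<gamma> a b"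
proof -
  let ?F = "\<lambda>s. lagrangian_eps A H \<epsilon> (\<gamma> s) (velocity A \<gamma> s) \<omega>"
  obtain c where c: "c \<in> A" "\<gamma> x \<in> fst c" by (rule chart_exists)
  define y0 where "y0 = snd c (\<gamma> x)"
  have y0: "y0 \<in> chart_image c" using c by (simp add: y0_def)
  obtain r0 m M where r0: "0 < r0" "0 < m" "0 < M" "cball y0 r0 \<subseteq> chart_image c \<inter> UNIV"
    and mb: "\<And>y a. y \<in> cball y0 r0 \<Longrightarrow> m * norm a \<le> nm c y a"
    and Mb: "\<And>y a. y \<in> cball y0 r0 \<Longrightarrow> nm c y a \<le> M * norm a"
    and two: "\<And>y z a. y \<in> cball y0 r0 \<Longrightarrow> z \<in> cball y0 r0 \<Longrightarrow> nm c y a \<le> 2 * nm c z a"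
    using nm_local[OF c(1) y0 open_UNIV UNIV_I] by metis
  \<comment> \<open>\<open>R1\<close> is the norm of the momentum for fast pieces, and \<open>V\<close> separates slow from fast\<close>
  define R1 where "R1 = max 1 (max (\<theta>conj 2) (1 / \<kappa>)) + 1"
  have R1: "0 \<le> R1" "\<theta>conj 2 \<le> R1 - 1" "1 / \<kappa> \<le> R1 - 1" by (auto simp: R1_def)
  define V where "V = max 1 (\<Theta> R1 + 1)"
  have V: "1 \<le> V" "\<Theta> R1 + 1 \<le> V" by (auto simp: V_def)
  obtain R where R: "0 \<le> R" "\<And>\<omega> x q p. \<omega> \<in> W \<Longrightarrow> q \<in> tangent_space A x \<Longrightarrow> riem_norm \<rho> x q \<le> 2 * V \<Longrightarrow>
      p \<in> cotangent_space A x \<Longrightarrow> R < dual_norm A \<rho> x p \<Longrightarrow> p q - H (x, p) \<omega> \<le> - \<Theta> 0"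
    using small_momenta[of "2 * V"] by metis
  \<comment> \<open>all relevant momenta have coordinates of norm at most \<open>Rx\<close>\<close>
  define Rx where "Rx = M * max R R1"
  let ?f = "\<lambda>z. H (cot_param A c z) \<omega>"
  have "uniformly_continuous_on (cball y0 r0 \<times> cball (0::'e) Rx) ?f"
    by (rule compact_uniformly_continuous[OF continuous_on_subset[OF Hcont[OF c(1)]] compact_Times[OF compact_cball compact_cball]])
      (use r0(4) in auto)
  then obtain d1 where d1: "d1 > 0" "\<And>p q. p \<in> cball y0 r0 \<times> cball (0::'e) Rx \<Longrightarrow> q \<in> cball y0 r0 \<times> cball (0::'e) Rx \<Longrightarrow> dist q p < d1 \<Longrightarrow>
      dist (?f q) (?f p) < \<kappa>"
    using \<kappa>(1) unfolding uniformly_continuous_on_def by metis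
  define r where "r = min (r0 / 2) (d1 / 2)"
  have r: "0 < r" "2 * r \<le> r0" "2 * r \<le> d1" using r0(1) d1(1) by (auto simp: r_def)
  define D where "D = ball y0 r"
  have D0: "y \<in> cball y0 r0" if "y \<in> D" for y using that r by (auto simp: D_def)
  have Dc: "y \<in> chart_image c" if "y \<in> D" for y using D0[OF that] r0(4) by blast
  have osc: "\<bar>?f (y, \<xi>) - ?f (z, \<xi>)\<bar> \<le> \<kappa>" if "y \<in> D" "z \<in> D" "norm \<xi> \<le> Rx" for y z \<xi>
  proof -
    have "dist y z \<le> dist y0 y + dist y0 z" by (metis dist_commute dist_triangle)
    then have "dist y z < d1" using that(1,2) r(3) by (simp add: D_def)
    then show ?thesis using d1(2)[of "(z, \<xi>)" "(y, \<xi>)"] D0 that by (simp add: dist_Pair_Pair dist_real_def)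
  qed
  have cont: "continuous_on {0..1} \<gamma>" by (rule abs_cont_curve_continuous[OF \<omega> ac])
  have Dsub: "D \<subseteq> chart_image c" using Dc by blast
  have "open (chart_inv c ` D)" by (rule chart_inv_open_image[OF c(1) _ Dsub]) (simp add: D_def)
  moreover have "\<gamma> x \<in> chart_inv c ` D" using c r(1) by (intro image_eqI[of _ _ y0]) (auto simp: D_def y0_def)
  ultimately obtain T where T: "open T" "x \<in> T" "\<And>s. s \<in> {0..1} \<Longrightarrow> s \<in> T \<Longrightarrow> \<gamma> s \<in> chart_inv c ` D"
    using cont x unfolding continuous_on_topological by metis
  obtain d0 where d0: "0 < d0" "ball x d0 \<subseteq> T" using T(1,2) open_contains_ball by metis
  have inD: "\<gamma> s \<in> fst c \<and> snd c (\<gamma> s) \<in> D" if s: "s \<in> {0..1}" "dist x s < d0" for s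
  proof -
    have "\<gamma> s \<in> chart_inv c ` D" using T(3)[OF s(1)] d0(2) s(2) by auto
    then obtain y where y: "y \<in> D" "\<gamma> s = chart_inv c y" by blast
    then show ?thesis using chart_inv_in[OF c(1) Dc[OF y(1)]] chart_inv_right[OF c(1) Dc[OF y(1)]] by simp
  qed
  define a1 where "a1 = max 0 (x - d0 / 2)"
  define b1 where "b1 = min 1 (x + d0 / 2)"
  have ab1: "0 \<le> a1" "b1 \<le> 1" by (auto simp: a1_def b1_def)
  have near: "s \<in> {0..1}" "dist x s < d0" if "s \<in> {a1..b1}" for s
    using that d0(1) x by (auto simp: a1_def b1_def dist_real_def abs_less_iff)
  have ball2: "cball y0 (2 * r) \<subseteq> chart_image c" using r(2) r0(4) by auto
  have mb2: "m * norm a \<le> nm c y a" if "y \<in> cball y0 (2 * r)" for y a by (rule mb) (use that r(2) in auto)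
  have stay: "\<gamma> s \<in> fst c \<and> dist y0 (snd c (\<gamma> s)) < r" if "s \<in> {a1..b1}" for s
    using inD[OF near[OF that]] by (simp add: D_def)
  obtain \<delta> where \<delta>: "0 < \<delta>"
    "\<And>a b. a1 \<le> a \<Longrightarrow> a \<le> b \<Longrightarrow> b \<le> b1 \<Longrightarrow> b - a < \<delta> \<Longrightarrow>
      \<exists>v. (AE s in lborel. s \<in> {a<..<b} \<longrightarrow> velocity A \<gamma> s = tvec_of A c (\<gamma> s) (v s)) \<and>
        (\<forall>\<xi>. integrable lborel (\<lambda>s. inner \<xi> (v s)) \<and>
           (LINT s:{a..b}|lborel. inner \<xi> (v s)) = inner \<xi> (snd c (\<gamma> b) - snd c (\<gamma> a)))"
    by (rule abs_cont_curve_velocity[OF \<omega> ac ab1 c(1) ball2 r(1) r0(2) mb2 stay]) blast+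
  show thesis
  proof (rule that[of "min (d0 / 2) \<delta>"])
    show "0 < min (d0 / 2) \<delta>" using d0(1) \<delta>(1) by simp
    fix a b assume ab: "0 \<le> a" "a \<le> x" "x \<le> b" "b \<le> 1" "b - a < min (d0 / 2) \<delta>"
    show "piece \<omega> \<epsilon> \<kappa> \<gamma> a b"
    proof (cases "a = b")
      case True
      have "AE s in lborel. s \<in> {a..b} \<longrightarrow> 0 \<le> ?F s"
        using AE_lborel_singleton[of a] by eventually_elim (use True in auto)
      then show ?thesis
        unfolding piece_def using True reach_refl[of \<omega> "\<gamma> a"]
        by (intro exI[of _ "\<lambda>_. 0"] exI[of _ 0]) (simp add: set_integrable_def set_lebesgue_integral_def)
    next
      case False
      define \<Delta> where "\<Delta> = b - a"
      have \<Delta>: "0 < \<Delta>" using False ab by (simp add: \<Delta>_def)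
      have ab': "a1 \<le> a" "a \<le> b" "b \<le> b1" "b - a < \<delta>" using ab by (auto simp: a1_def b1_def)
      have in_D: "\<gamma> s \<in> fst c" "snd c (\<gamma> s) \<in> D" if "s \<in> {a..b}" for s
        using inD[OF near, of s] that ab' by auto
      obtain v where v: "AE s in lborel. s \<in> {a<..<b} \<longrightarrow> velocity A \<gamma> s = tvec_of A c (\<gamma> s) (v s)"
        "\<And>\<xi>. integrable lborel (\<lambda>s. inner \<xi> (v s))"
        "\<And>\<xi>. (LINT s:{a..b}|lborel. inner \<xi> (v s)) = inner \<xi> (snd c (\<gamma> b) - snd c (\<gamma> a))"
        using \<delta>(2)[OF ab'] by blast
      define ya where "ya = snd c (\<gamma> a)"
      define yb where "yb = snd c (\<gamma> b)"
      have yD: "ya \<in> D" "yb \<in> D" using in_D ab' by (auto simp: ya_def yb_def)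
      have \<gamma>ab: "chart_inv c ya = \<gamma> a" "chart_inv c yb = \<gamma> b" using in_D[of a] in_D[of b] ab' c by (auto simp: ya_def yb_def)
      define q where "q = (\<epsilon> / \<Delta>) *\<^sub>R (yb - ya)"
      have q: "(\<Delta> / \<epsilon>) *\<^sub>R q = yb - ya" using \<Delta> \<epsilon> by (simp add: q_def)
      define g where "g \<xi> s = \<epsilon> * inner \<xi> (v s) - ?f (snd c (\<gamma> s), \<xi>)" for \<xi> s
      have contw: "continuous_on {a..b} (\<lambda>s. snd c (\<gamma> s))"
        by (rule continuous_on_compose2[OF chart_cont(1)[OF c(1)] continuous_on_subset[OF cont]]) (use in_D ab in auto)
      have contf: "continuous_on {a..b} (\<lambda>s. ?f (snd c (\<gamma> s), \<xi>))" for \<xi>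
        by (rule continuous_on_compose2[OF Hcont[OF c(1)]])
          (use contw in_D Dc in \<open>auto intro!: continuous_on_Pair continuous_on_const\<close>)
      have v_int: "set_integrable lborel {a..b} (\<lambda>s. \<epsilon> * inner \<xi> (v s))" for \<xi>
        unfolding set_integrable_def
        using integrable_mult_indicator[of "{a..b}" lborel "\<lambda>s. \<epsilon> * inner \<xi> (v s)"] v(2)[of \<xi>] by simp
      have g_int: "set_integrable lborel {a..b} (g \<xi>)"
        and g_le: "AE s in lborel. s \<in> {a..b} \<longrightarrow> g \<xi> s \<le> ?F s" for \<xi>
      proof -
        show "set_integrable lborel {a..b} (g \<xi>)"
          unfolding g_def by (rule set_integral_diff(1)[OF v_int borel_integrable_atLeastAtMost'[OF contf]])
        show "AE s in lborel. s \<in> {a..b} \<longrightarrow> g \<xi> s \<le> ?F s"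
          using v(1) AE_lborel_singleton[of a] AE_lborel_singleton[of b]
        proof (eventually_elim, intro impI)
          fix s assume vs: "s \<in> {a<..<b} \<longrightarrow> velocity A \<gamma> s = tvec_of A c (\<gamma> s) (v s)" and sab: "s \<noteq> a" "s \<noteq> b" "s \<in> {a..b}"
          let ?y = "snd c (\<gamma> s)"
          have sc: "\<gamma> s \<in> fst c" "chart_inv c ?y = \<gamma> s" using in_D(1)[OF sab(3)] c(1) by auto
          have eps: "(\<lambda>c'. \<epsilon> *\<^sub>R velocity A \<gamma> s c') = tvec_of A c (\<gamma> s) (\<epsilon> *\<^sub>R v s)"
            using vs sab tvec_of_scale[OF c(1) sc(1)] by auto
          have "covec c ?y \<xi> (tvec_of A c (\<gamma> s) (\<epsilon> *\<^sub>R v s)) - H (\<gamma> s, covec c ?y \<xi>) \<omega> \<le> L (\<gamma> s) (tvec_of A c (\<gamma> s) (\<epsilon> *\<^sub>R v s)) \<omega>"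
            by (rule L_ge[OF \<omega> tvec_of_in[OF c(1) sc(1)]]) (use covec_in[of c ?y \<xi>] sc in simp)
          moreover have "covec c ?y \<xi> (tvec_of A c (\<gamma> s) (\<epsilon> *\<^sub>R v s)) = \<epsilon> * inner \<xi> (v s)"
            using covec_tvec[OF c(1), of ?y \<xi> "\<epsilon> *\<^sub>R v s"] sc by simp
          ultimately show "g \<xi> s \<le> ?F s"
            by (simp add: g_def lagrangian_eps_def eps cot_param_covec sc)
        qed
      qed
      have g_ge: "\<Delta> * (inner \<xi> q - ?f (ya, \<xi>) - \<kappa>) \<le> (LINT s:{a..b}|lborel. g \<xi> s)" if \<xi>: "norm \<xi> \<le> Rx" for \<xi>
      proof -
        have 2: "set_integrable lborel {a..b} (\<lambda>s. ?f (snd c (\<gamma> s), \<xi>))" by (rule borel_integrable_atLeastAtMost'[OF contf])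
        have 3: "set_integrable lborel {a..b} (\<lambda>s. ?f (ya, \<xi>) + \<kappa>)" by (rule borel_integrable_atLeastAtMost'[OF continuous_on_const])
        have "(LINT s:{a..b}|lborel. g \<xi> s) = (LINT s:{a..b}|lborel. \<epsilon> * inner \<xi> (v s)) - (LINT s:{a..b}|lborel. ?f (snd c (\<gamma> s), \<xi>))"
          unfolding g_def by (rule set_integral_diff(2)[OF v_int 2])
        also have "(LINT s:{a..b}|lborel. \<epsilon> * inner \<xi> (v s)) = \<epsilon> * inner \<xi> (yb - ya)"
          using v(3)[of \<xi>] by (simp add: ya_def yb_def)
        also have "\<dots> = \<Delta> * inner \<xi> q" using \<Delta> by (simp add: q_def)
        finally have eq: "(LINT s:{a..b}|lborel. g \<xi> s) = \<Delta> * inner \<xi> q - (LINT s:{a..b}|lborel. ?f (snd c (\<gamma> s), \<xi>))" .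
        have "(LINT s:{a..b}|lborel. ?f (snd c (\<gamma> s), \<xi>)) \<le> (LINT s:{a..b}|lborel. ?f (ya, \<xi>) + \<kappa>)"
        proof (rule set_integral_mono[OF 2 3])
          fix s assume "s \<in> {a..b}"
          then show "?f (snd c (\<gamma> s), \<xi>) \<le> ?f (ya, \<xi>) + \<kappa>" using osc[OF in_D(2) yD(1) \<xi>, of s] by linarith
        qed
        also have "\<dots> = \<Delta> * (?f (ya, \<xi>) + \<kappa>)" using ab' by (simp add: set_lebesgue_integral_def \<Delta>_def)
        finally show ?thesis unfolding eq by (simp add: algebra_simps)
      qed
      have travel: "reach \<omega> (\<gamma> a) (\<gamma> b) t (t * B)"
        if t: "0 < t" "t *\<^sub>R u = yb - ya"
          and B: "\<And>y \<omega>'. y \<in> D \<Longrightarrow> \<omega>' \<in> W \<Longrightarrow> (\<And>x p. p \<in> cotangent_space A x \<Longrightarrow> H (x, p) \<omega>' = H (x, p) \<omega>) \<Longrightarrow>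
            L (chart_inv c y) (tvec_of A c (chart_inv c y) u) \<omega>' \<le> B" for t u B
      proof -
        have seg: "ya + s *\<^sub>R u \<in> D" if "0 \<le> s" "s \<le> t" for s
        proof -
          have "s *\<^sub>R u = (s / t) *\<^sub>R (yb - ya)" unfolding t(2)[symmetric] using t(1) by simp
          then have "ya + s *\<^sub>R u = (1 - s / t) *\<^sub>R ya + (s / t) *\<^sub>R yb" by (simp add: algebra_simps)
          moreover have "convex D" by (simp add: D_def)
          ultimately show ?thesis using convexD_alt[OF _ yD, of "s / t"] that t(1) by simp
        qed
        have "hop \<omega> (chart_inv c ya) (chart_inv c (ya + t *\<^sub>R u)) t B"
          by (rule hop_chart[OF \<omega> c(1) t(1)]) (use seg Dc B in auto)
        then show ?thesis using reach_single t(2) \<gamma>ab by simp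
      qed
      have covec_of: "\<exists>\<xi>. p = covec c ya \<xi> \<and> norm \<xi> \<le> Rx"
        if p: "p \<in> cotangent_space A (chart_inv c y)" "dual_norm A \<rho> (chart_inv c y) p \<le> max R R1" "y = ya" for p y
      proof -
        obtain \<xi> where \<xi>: "p = covec c ya \<xi>"
          using covec_exists[OF p(1) c(1) chart_inv_in[OF c(1)]] Dc yD(1) p(3) chart_inv_right[OF c(1)] by metis
        have "norm \<xi> \<le> M * dual_norm A \<rho> (chart_inv c ya) (covec c ya \<xi>)"
          by (rule covec_norm_bounds(2)[OF c(1) Dc[OF yD(1)] r0(2) mb[OF D0[OF yD(1)]] r0(3) Mb[OF D0[OF yD(1)]]])
        also have "\<dots> \<le> Rx" unfolding Rx_def using p \<xi> r0(3) by (intro mult_left_mono) auto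
        finally show ?thesis using \<xi> by blast
      qed
      define tq where "tq = tvec_of A c (\<gamma> a) q"
      have ga: "\<gamma> a \<in> fst c" using in_D(1)[of a] ab' by simp
      have tq: "tq \<in> tangent_space A (\<gamma> a)" unfolding tq_def by (rule tvec_of_in[OF c(1) ga])
      define n where "n = nm c ya q"
      have n: "riem_norm \<rho> (\<gamma> a) tq = n" by (simp add: n_def tq_def nm_def \<gamma>ab)
      have val: "inner \<xi> q - ?f (ya, \<xi>) = covec c ya \<xi> tq - H (\<gamma> a, covec c ya \<xi>) \<omega>" for \<xi>
        using covec_tvec[OF c(1) Dc[OF yD(1)], of \<xi> q] by (simp add: tq_def \<gamma>ab cot_param_covec)
      show ?thesis
      proof (cases "n \<le> V")
        case True
        define L0 where "L0 = L (\<gamma> a) tq \<omega>"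
        have L0: "- \<Theta> 0 \<le> L0" unfolding L0_def by (rule L_lower[OF \<omega> tq])
        have "\<exists>p\<in>cotangent_space A (\<gamma> a). L0 - \<kappa> < p tq - H (\<gamma> a, p) \<omega>"
        proof (rule ccontr)
          assume "\<not> ?thesis"
          then have "L (\<gamma> a) tq \<omega> \<le> L0 - \<kappa>" by (intro L_le) (auto simp: not_less)
          then show False using \<kappa>(1) by (simp add: L0_def)
        qed
        then obtain p1 where p1: "p1 \<in> cotangent_space A (\<gamma> a)" "L0 - \<kappa> < p1 tq - H (\<gamma> a, p1) \<omega>" by blast
        have "\<exists>p\<in>cotangent_space A (\<gamma> a). dual_norm A \<rho> (\<gamma> a) p \<le> R \<and> L0 - \<kappa> \<le> p tq - H (\<gamma> a, p) \<omega>"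
        proof (cases "dual_norm A \<rho> (\<gamma> a) p1 \<le> R")
          case False
          then have "p1 tq - H (\<gamma> a, p1) \<omega> \<le> - \<Theta> 0"
            using R(2)[OF \<omega> tq _ p1(1)] n True V(1) by simp
          then show ?thesis
            using p1(2) H_zero_covector(1)[OF \<omega>, of "\<gamma> a"] R(1)
            by (intro bexI[OF _ cotangent_0]) (simp add: H_zero_covector(2))
        qed (use p1 in auto)
        then obtain p where p: "p \<in> cotangent_space A (\<gamma> a)" "dual_norm A \<rho> (\<gamma> a) p \<le> R" "L0 - \<kappa> \<le> p tq - H (\<gamma> a, p) \<omega>" by blast
        obtain \<xi> where \<xi>: "p = covec c ya \<xi>" "norm \<xi> \<le> Rx" using covec_of[of p ya] p(1,2) unfolding \<gamma>ab by fastforce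
        \<comment> \<open>one \<open>\<kappa>\<close> for the choice of the momentum, one for the variation of the Hamiltonian\<close>
        have I: "\<Delta> * (L0 - 2 * \<kappa>) \<le> (LINT s:{a..b}|lborel. g \<xi> s)"
        proof -
          have "\<Delta> * (L0 - 2 * \<kappa>) \<le> \<Delta> * (inner \<xi> q - ?f (ya, \<xi>) - \<kappa>)"
            using p(3) val[of \<xi>] \<Delta> \<xi>(1) by (intro mult_left_mono) auto
          then show ?thesis using g_ge[OF \<xi>(2)] by linarith
        qed
        have "reach \<omega> (\<gamma> a) (\<gamma> b) (\<Delta> / \<epsilon>) (\<Delta> / \<epsilon> * (L0 + \<kappa>))"
        proof (rule travel[OF _ q])
          fix y \<omega>' assume y: "y \<in> D" and \<omega>': "\<omega>' \<in> W" and same: "\<And>x p. p \<in> cotangent_space A x \<Longrightarrow> H (x, p) \<omega>' = H (x, p) \<omega>"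
          let ?x = "chart_inv c y" and ?q = "tvec_of A c (chart_inv c y) q"
          have qT: "?q \<in> tangent_space A ?x" by (rule tvec_of_in[OF c(1) chart_inv_in[OF c(1) Dc[OF y]]])
          show "L ?x ?q \<omega>' \<le> L0 + \<kappa>"
          proof (rule L_le)
            fix p' assume p': "p' \<in> cotangent_space A ?x"
            show "p' ?q - H (?x, p') \<omega>' \<le> L0 + \<kappa>"
            proof (cases "R < dual_norm A \<rho> ?x p'")
              case True
              have "riem_norm \<rho> ?x ?q \<le> 2 * V"
                using two[OF D0[OF y] D0[OF yD(1)], of q] \<open>n \<le> V\<close> by (simp add: nm_def n_def)
              then have "p' ?q - H (?x, p') \<omega>' \<le> - \<Theta> 0" by (rule R(2)[OF \<omega>' qT _ p' True])
              then show ?thesis using L0 \<kappa>(1) by linarith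
            next
              case False
              obtain \<xi>' where \<xi>': "p' = covec c y \<xi>'"
                using covec_exists[OF p' c(1) chart_inv_in[OF c(1) Dc[OF y]]] chart_inv_right[OF c(1) Dc[OF y]] by metis
              have "norm \<xi>' \<le> M * dual_norm A \<rho> ?x p'" unfolding \<xi>'
                by (rule covec_norm_bounds(2)[OF c(1) Dc[OF y] r0(2) mb[OF D0[OF y]] r0(3) Mb[OF D0[OF y]]])
              also have "\<dots> \<le> Rx" unfolding Rx_def using False r0(3) by (intro mult_left_mono) auto
              finally have "norm \<xi>' \<le> Rx" .
              then have "\<bar>?f (y, \<xi>') - ?f (ya, \<xi>')\<bar> \<le> \<kappa>" by (rule osc[OF y yD(1)])
              moreover have "inner \<xi>' q - ?f (ya, \<xi>') \<le> L0"
                unfolding val L0_def by (rule L_ge[OF \<omega> tq]) (use covec_in[of c ya \<xi>'] \<gamma>ab in simp)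
              moreover have "p' ?q - H (?x, p') \<omega>' = inner \<xi>' q - ?f (y, \<xi>')"
                using covec_tvec[OF c(1) Dc[OF y], of \<xi>' q] same[OF p'] by (simp add: \<xi>' cot_param_covec)
              ultimately show ?thesis by linarith
            qed
          qed
        qed (use \<Delta> \<epsilon> in simp)
        moreover have "0 \<le> \<kappa> * ((LINT s:{a..b}|lborel. g \<xi> s) + (\<bar>\<Theta> 0\<bar> + 2) * (b - a)) / \<epsilon>"
        proof -
          have "0 \<le> \<Delta> * ((L0 - 2 * \<kappa>) + (\<bar>\<Theta> 0\<bar> + 2))" using \<Delta> L0 \<kappa>(2) by (intro mult_nonneg_nonneg) auto
          also have "\<dots> \<le> (LINT s:{a..b}|lborel. g \<xi> s) + (\<bar>\<Theta> 0\<bar> + 2) * (b - a)"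
            using I by (simp add: \<Delta>_def algebra_simps)
          finally show ?thesis using \<kappa>(1) \<epsilon> by simp
        qed
        moreover have "\<Delta> / \<epsilon> * (L0 + \<kappa>) \<le> ((LINT s:{a..b}|lborel. g \<xi> s) + 3 * \<kappa> * (b - a)) / \<epsilon>"
        proof -
          have "\<Delta> * (L0 + \<kappa>) \<le> (LINT s:{a..b}|lborel. g \<xi> s) + 3 * \<kappa> * (b - a)"
            using I by (simp add: \<Delta>_def algebra_simps)
          then show ?thesis using \<epsilon> by (simp add: divide_right_mono)
        qed
        ultimately show ?thesis
          unfolding piece_def using g_int[of \<xi>] g_le[of \<xi>]
          by (intro exI[of _ "g \<xi>"] exI[of _ "\<Delta> / \<epsilon>"] exI[of _ "\<Delta> / \<epsilon> * (L0 + \<kappa>)"]) (simp add: \<Delta>_def)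
      next
        case False
        then have nV: "V < n" "1 \<le> n" using V(1) by auto
        obtain p where p: "p \<in> cotangent_space A (\<gamma> a)" "p tq = R1 * n" "dual_norm A \<rho> (\<gamma> a) p \<le> R1"
          using norming_covector[OF tq R1(1)] n by metis
        obtain \<xi> where \<xi>: "p = covec c ya \<xi>" "norm \<xi> \<le> Rx" using covec_of[of p ya] p(1,3) unfolding \<gamma>ab by fastforce
        have "H (\<gamma> a, p) \<omega> \<le> \<Theta> R1"
          using H_bounds[OF \<omega> p(1)] mono_onD[OF \<Theta>_mono, of "dual_norm A \<rho> (\<gamma> a) p" R1] p(3) dual_norm_nonneg[OF p(1)] R1(1)
          by fastforce
        then have "n * (R1 - 1) \<le> p tq - H (\<gamma> a, p) \<omega> - \<kappa>" using p(2) nV(1) V(2) \<kappa>(2) by (simp add: algebra_simps)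
        then have "\<Delta> * (n * (R1 - 1)) \<le> \<Delta> * (inner \<xi> q - ?f (ya, \<xi>) - \<kappa>)"
          using val[of \<xi>] \<xi>(1) \<Delta> by (intro mult_left_mono) auto
        then have I: "\<Delta> * n * (R1 - 1) \<le> (LINT s:{a..b}|lborel. g \<xi> s)" using g_ge[OF \<xi>(2)] by (simp add: mult.assoc)
        have \<Delta>n: "0 < \<Delta> * n" using \<Delta> nV by simp
        \<comment> \<open>stretching the time by the factor \<open>n\<close> reduces the speed to at most 2\<close>
        have "reach \<omega> (\<gamma> a) (\<gamma> b) (n * \<Delta> / \<epsilon>) (n * \<Delta> / \<epsilon> * \<theta>conj 2)"
        proof (rule travel[of _ "(1 / n) *\<^sub>R q"])
          show "0 < n * \<Delta> / \<epsilon>" using \<Delta> nV \<epsilon> by simp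
          show "(n * \<Delta> / \<epsilon>) *\<^sub>R (1 / n) *\<^sub>R q = yb - ya" using q nV by simp
          fix y \<omega>' assume y: "y \<in> D" and \<omega>': "\<omega>' \<in> W"
          let ?x = "chart_inv c y" and ?q = "tvec_of A c (chart_inv c y) ((1 / n) *\<^sub>R q)"
          have qT: "?q \<in> tangent_space A ?x" by (rule tvec_of_in[OF c(1) chart_inv_in[OF c(1) Dc[OF y]]])
          have "riem_norm \<rho> ?x ?q = nm c y ((1 / n) *\<^sub>R q)" by (simp add: nm_def)
          also have "\<dots> = nm c y q / n" using nm_scale[OF c(1) Dc[OF y]] nV by simp
          also have "\<dots> \<le> 2" using two[OF D0[OF y] D0[OF yD(1)], of q] nV by (simp add: pos_divide_le_eq n_def)
          finally show "L ?x ?q \<omega>' \<le> \<theta>conj 2"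
            using L_upper[OF \<omega>' qT] \<theta>conj_mono[OF riem_norm_nonneg[OF qT]] by (meson order_trans)
        qed
        moreover have "(b - a) / \<epsilon> \<le> n * \<Delta> / \<epsilon>"
          using \<Delta> nV \<epsilon> by (intro divide_right_mono) (auto simp: \<Delta>_def[symmetric])
        moreover have "n * \<Delta> / \<epsilon> \<le> (b - a) / \<epsilon> + \<kappa> * ((LINT s:{a..b}|lborel. g \<xi> s) + (\<bar>\<Theta> 0\<bar> + 2) * (b - a)) / \<epsilon>"
        proof -
          have "1 \<le> \<kappa> * (R1 - 1)" using R1(3) \<kappa>(1) by (simp add: pos_divide_le_eq mult.commute)
          then have "\<Delta> * n * 1 \<le> \<Delta> * n * (\<kappa> * (R1 - 1))" using \<Delta>n by (intro mult_left_mono) auto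
          also have "\<dots> \<le> \<kappa> * (LINT s:{a..b}|lborel. g \<xi> s)"
            using mult_left_mono[OF I, of \<kappa>] \<kappa>(1) by (simp add: algebra_simps)
          also have "\<dots> \<le> (b - a) + \<kappa> * ((LINT s:{a..b}|lborel. g \<xi> s) + (\<bar>\<Theta> 0\<bar> + 2) * (b - a))"
          proof -
            have "0 \<le> \<kappa> * ((\<bar>\<Theta> 0\<bar> + 2) * (b - a))" using \<kappa>(1) ab' by simp
            then show ?thesis using ab' by (simp add: algebra_simps)
          qed
          finally have "n * \<Delta> / \<epsilon> \<le> ((b - a) + \<kappa> * ((LINT s:{a..b}|lborel. g \<xi> s) + (\<bar>\<Theta> 0\<bar> + 2) * (b - a))) / \<epsilon>"
            using \<epsilon> by (intro divide_right_mono) (auto simp: mult.commute)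
          then show ?thesis by (simp add: add_divide_distrib)
        qed
        moreover have "n * \<Delta> / \<epsilon> * \<theta>conj 2 \<le> ((LINT s:{a..b}|lborel. g \<xi> s) + 3 * \<kappa> * (b - a)) / \<epsilon>"
        proof -
          have "\<Delta> * n * \<theta>conj 2 \<le> \<Delta> * n * (R1 - 1)" using R1(2) \<Delta>n by (intro mult_left_mono) auto
          also have "\<dots> \<le> (LINT s:{a..b}|lborel. g \<xi> s) + 3 * \<kappa> * (b - a)" using I \<kappa>(1) ab' by (intro add_increasing2) auto
          finally show ?thesis using \<epsilon> by (simp add: divide_right_mono mult.commute mult.left_commute)
        qed
        ultimately show ?thesis
          unfolding piece_def using g_int[of \<xi>] g_le[of \<xi>] by blast
      qed
    qed
  qed
qed

text \<open>Short pieces can be replaced by chains, and adjacent pieces can be glued; the bisection principle gives the whole curve.\<close>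

lemma curve_to_chain:
  assumes \<omega>: "\<omega> \<in> W" and \<epsilon>: "0 < \<epsilon>" and \<kappa>: "0 < \<kappa>" "\<kappa> \<le> 1"
    and Hcont: "\<And>c. c \<in> A \<Longrightarrow> continuous_on (chart_image c \<times> UNIV) (\<lambda>z. H (cot_param A c z) \<omega>)"
    and min: "min_action A \<rho> H \<epsilon> x y 1 \<omega> < ereal K"
  obtains t c where "reach \<omega> x y t c" "1 / \<epsilon> \<le> t" "t \<le> (1 + \<kappa> * (K + (\<bar>\<Theta> 0\<bar> + 2))) / \<epsilon>" "c \<le> (K + 3 * \<kappa>) / \<epsilon>"
proof -
  obtain \<gamma> where \<gamma>: "abs_cont_curve (riem_dist A \<rho>) 0 1 \<gamma>" "\<gamma> 0 = x" "\<gamma> 1 = y"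
    "ext_integral {0..1} (\<lambda>s. lagrangian_eps A H \<epsilon> (\<gamma> s) (velocity A \<gamma> s) \<omega>) < ereal K"
    using min unfolding min_action_def by (auto simp: INF_less_iff)
  have "0 \<le> (0::real) \<and> (1::real) \<le> 1 \<longrightarrow> piece \<omega> \<epsilon> \<kappa> \<gamma> 0 1"
  proof (rule Bolzano[where P = "\<lambda>a b. 0 \<le> a \<and> b \<le> 1 \<longrightarrow> piece \<omega> \<epsilon> \<kappa> \<gamma> a b"])
    fix a b c :: real
    assume "0 \<le> a \<and> b \<le> 1 \<longrightarrow> piece \<omega> \<epsilon> \<kappa> \<gamma> a b" "0 \<le> b \<and> c \<le> 1 \<longrightarrow> piece \<omega> \<epsilon> \<kappa> \<gamma> b c" "a \<le> b" "b \<le> c"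
    then show "0 \<le> a \<and> c \<le> 1 \<longrightarrow> piece \<omega> \<epsilon> \<kappa> \<gamma> a c" using piece_trans[of \<omega> \<epsilon> \<kappa> \<gamma> a b c] by auto
  next
    fix x :: real assume "0 \<le> x" "x \<le> 1"
    then have x: "x \<in> {0..1}" by simp
    obtain d where "0 < d" "\<And>a b. 0 \<le> a \<Longrightarrow> a \<le> x \<Longrightarrow> x \<le> b \<Longrightarrow> b \<le> 1 \<Longrightarrow> b - a < d \<Longrightarrow> piece \<omega> \<epsilon> \<kappa> \<gamma> a b"
      using piece_local[OF \<omega> \<epsilon> \<kappa> Hcont \<gamma>(1) x] by blast
    then show "\<exists>d>0. \<forall>a b. a \<le> x \<and> x \<le> b \<and> b - a < d \<longrightarrow> (0 \<le> a \<and> b \<le> 1 \<longrightarrow> piece \<omega> \<epsilon> \<kappa> \<gamma> a b)" by blast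
  qed simp
  then obtain g t c where g: "set_integrable lborel {0..1} g"
     "AE s in lborel. s \<in> {0..1} \<longrightarrow> g s \<le> lagrangian_eps A H \<epsilon> (\<gamma> s) (velocity A \<gamma> s) \<omega>"
     "reach \<omega> x y t c" "1 / \<epsilon> \<le> t" "t \<le> 1 / \<epsilon> + \<kappa> * ((LINT s:{0..1}|lborel. g s) + (\<bar>\<Theta> 0\<bar> + 2)) / \<epsilon>"
     "c \<le> ((LINT s:{0..1}|lborel. g s) + 3 * \<kappa>) / \<epsilon>"
    unfolding piece_def using \<gamma>(2,3) by auto
  have "ereal (LINT s:{0..1}|lborel. g s) < ereal K"
    using ext_integral_mono[OF g(2)] \<gamma>(4) unfolding ext_integral_integrable[OF g(1)] by (rule order.strict_trans1)
  then have K: "(LINT s:{0..1}|lborel. g s) \<le> K" by simp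
  show thesis
  proof (rule that[OF g(3,4)])
    have "\<kappa> * ((LINT s:{0..1}|lborel. g s) + (\<bar>\<Theta> 0\<bar> + 2)) \<le> \<kappa> * (K + (\<bar>\<Theta> 0\<bar> + 2))"
      using K \<kappa>(1) by (intro mult_left_mono) auto
    then have "\<kappa> * ((LINT s:{0..1}|lborel. g s) + (\<bar>\<Theta> 0\<bar> + 2)) / \<epsilon> \<le> \<kappa> * (K + (\<bar>\<Theta> 0\<bar> + 2)) / \<epsilon>"
      using \<epsilon> by (intro divide_right_mono) auto
    then show "t \<le> (1 + \<kappa> * (K + (\<bar>\<Theta> 0\<bar> + 2))) / \<epsilon>" using g(5) by (simp add: add_divide_distrib)
    have "((LINT s:{0..1}|lborel. g s) + 3 * \<kappa>) / \<epsilon> \<le> (K + 3 * \<kappa>) / \<epsilon>" using K \<epsilon> by (intro divide_right_mono) auto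
    then show "c \<le> (K + 3 * \<kappa>) / \<epsilon>" using g(6) by simp
  qed
qed

end

section \<open>The ergodic limit along powers of one group element\<close>

locale ergodic_ham = stationary_ham A \<rho> H "space P" \<theta> \<Theta> G \<alpha> \<tau> + prob_space P
  for A :: "('m::{t2_space, second_countable_topology}, 'e::{real_inner, heine_borel}) chart set"
    and \<rho> :: "'m \<Rightarrow> ('m, 'e) tvec \<Rightarrow> ('m, 'e) tvec \<Rightarrow> real"
    and H :: "'m \<times> ('m, 'e) covec \<Rightarrow> 'w \<Rightarrow> real" and P :: "'w measure" and \<theta> \<Theta> :: "real \<Rightarrow> real"
    and G :: "('g, 'r) monoid_scheme" (structure) and \<alpha> :: "'g \<Rightarrow> 'm \<Rightarrow> 'm" and \<tau> :: "'g \<Rightarrow> 'w \<Rightarrow> 'w" +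
  assumes \<tau>_measurable: "g \<in> carrier G \<Longrightarrow> \<tau> g \<in> P \<rightarrow>\<^sub>M P"
    and \<tau>_image: "g \<in> carrier G \<Longrightarrow> E \<in> sets P \<Longrightarrow> \<tau> g ` E \<in> sets P \<and> measure P (\<tau> g ` E) = measure P E"
    and ergodic: "ergodic_system G P \<tau>"
    and H_measurable: "(\<lambda>\<omega>. restrict (\<lambda>z. H z \<omega>) (cotangent_bundle A))
        \<in> P \<rightarrow>\<^sub>M borel_of (compact_conv_topology (cot_topology A))"
begin

text \<open>The set of costs is nonempty if \<open>0 < t\<close>, and bounded from below.\<close>

definition cost :: "'w \<Rightarrow> 'm \<Rightarrow> 'm \<Rightarrow> real \<Rightarrow> real" where
  "cost \<omega> x y t = Inf {a. reach \<omega> x y t a}"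

lemma reach_bdd_below: "\<omega> \<in> space P \<Longrightarrow> bdd_below {a. reach \<omega> x y t a}"
  using reach_lower unfolding bdd_below_def by blast

lemma reach_ex: "\<omega> \<in> space P \<Longrightarrow> 0 < t \<Longrightarrow> \<exists>a. reach \<omega> x y t a"
  using connects_exists[of x y] unfolding connects_def by blast

lemma cost_less_iff:
  assumes "\<omega> \<in> space P" "0 < t"
  shows "cost \<omega> x y t < e \<longleftrightarrow> (\<exists>a<e. reach \<omega> x y t a)"
  unfolding cost_def using reach_ex[OF assms, of x y] reach_bdd_below[OF assms(1), of x y t]
  by (subst cInf_less_iff) auto

lemma cost_le: "\<omega> \<in> space P \<Longrightarrow> reach \<omega> x y t a \<Longrightarrow> cost \<omega> x y t \<le> a"
  unfolding cost_def using reach_bdd_below by (intro cInf_lower) auto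

lemma cost_lower:
  assumes "\<omega> \<in> space P" "0 < t"
  shows "- \<Theta> 0 * t \<le> cost \<omega> x y t"
  unfolding cost_def using reach_ex[OF assms, of x y] reach_lower[OF assms(1)]
  by (intro cInf_greatest) auto

lemma cost_trans:
  assumes \<omega>: "\<omega> \<in> space P" and t: "0 < s" "0 < t"
  shows "cost \<omega> x z (s + t) \<le> cost \<omega> x y s + cost \<omega> y z t"
proof (rule field_le_epsilon)
  fix e :: real assume e: "0 < e"
  obtain a where a: "a < cost \<omega> x y s + e / 2" "reach \<omega> x y s a"
    using cost_less_iff[OF \<omega> t(1), of x y "cost \<omega> x y s + e / 2"] e by auto
  obtain a' where a': "a' < cost \<omega> y z t + e / 2" "reach \<omega> y z t a'"
    using cost_less_iff[OF \<omega> t(2), of y z "cost \<omega> y z t + e / 2"] e by auto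
  show "cost \<omega> x z (s + t) \<le> cost \<omega> x y s + cost \<omega> y z t + e"
    using cost_le[OF \<omega> reach_trans[OF a(2) a'(2)]] a(1) a'(1) by simp
qed

lemma cost_shift: "\<omega> \<in> space P \<Longrightarrow> g \<in> carrier G \<Longrightarrow> cost \<omega> (\<alpha> g x) (\<alpha> g y) t = cost (\<tau> g \<omega>) x y t"
proof -
  assume *: "\<omega> \<in> space P" "g \<in> carrier G"
  have "{a. reach \<omega> (\<alpha> g x) (\<alpha> g y) t a} = {a. reach (\<tau> g \<omega>) x y t a}"
    using reach_shift[OF *, of x y t] by blast
  then show ?thesis unfolding cost_def by simp
qed

lemma cost_connects:
  assumes "connects l x y" "\<omega> \<in> space P" "0 < t"
  shows "cost \<omega> x y t \<le> t * \<theta>conj (l / t)"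
proof -
  obtain a where "a \<le> t * \<theta>conj (l / t)" "reach \<omega> x y t a"
    using assms unfolding connects_def by blast
  then show ?thesis using cost_le[OF assms(2)] by fastforce
qed

lemma cost_connects_le:
  assumes "connects l x y" "\<omega> \<in> space P" "0 < t" "l \<le> V * t"
  shows "cost \<omega> x y t \<le> t * \<theta>conj V"
proof -
  have "0 < l" using assms(1) by (simp add: connects_def)
  then have "t * \<theta>conj (l / t) \<le> t * \<theta>conj V"
    using assms(3,4) by (intro mult_left_mono \<theta>conj_mono) (auto simp: pos_divide_le_eq)
  then show ?thesis using cost_connects[OF assms(1-3)] by linarith
qed

lemma cost_measurable:
  assumes "0 < t"
  shows "(\<lambda>\<omega>. cost \<omega> x y t) \<in> borel_measurable P"
  unfolding borel_measurable_iff_less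
proof
  fix e
  have "{\<omega> \<in> space P. cost \<omega> x y t < e} = {\<omega> \<in> space P. \<exists>a<e. reach \<omega> x y t a}"
    using cost_less_iff[OF _ assms] by blast
  then show "{\<omega> \<in> space P. cost \<omega> x y t < e} \<in> sets P"
    using reach_measurable[OF refl H_measurable] by simp
qed

lemma \<tau>_preserves:
  assumes g: "g \<in> carrier G"
  shows "distr P P (\<tau> g) = P"
proof (rule measure_eqI)
  note m[measurable] = \<tau>_measurable[OF g]
  \<comment> \<open>the image of the preimage of \<open>E\<close> lies in \<open>E\<close>, and likewise for the complement\<close>
  have le: "prob (\<tau> g -` E \<inter> space P) \<le> prob E" if E: "E \<in> sets P" for E
  proof -
    have "\<tau> g -` E \<inter> space P \<in> sets P" using E by measurable
    from \<tau>_image[OF g this] have "prob (\<tau> g -` E \<inter> space P) = prob (\<tau> g ` (\<tau> g -` E \<inter> space P))" by simp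
    also have "\<dots> \<le> prob E" by (rule finite_measure_mono) (use E in auto)
    finally show ?thesis .
  qed
  fix E assume "E \<in> sets (distr P P (\<tau> g))"
  then have E: "E \<in> sets P" by simp
  have E': "\<tau> g -` E \<inter> space P \<in> sets P" using E by measurable
  have "\<tau> g -` (space P - E) \<inter> space P = space P - (\<tau> g -` E \<inter> space P)"
    using measurable_space[OF m] by auto
  then have "1 - prob (\<tau> g -` E \<inter> space P) \<le> 1 - prob E"
    using le[of "space P - E"] prob_compl[OF E'] prob_compl[OF E] E by simp
  then have "prob (\<tau> g -` E \<inter> space P) = prob E" using le[OF E] by simp
  then show "emeasure (distr P P (\<tau> g)) E = emeasure P E"
    using E by (simp add: emeasure_distr emeasure_eq_measure)
qed simp

text \<open>By ergodicity the invariant sublevel sets have measure 0 or 1, and the jump occurs at a single level, the infimum of the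
levels of full measure.\<close>

lemma invariant_level:
  fixes Q :: "real \<Rightarrow> 'w \<Rightarrow> bool"
  assumes meas: "\<And>c. {\<omega> \<in> space P. Q c \<omega>} \<in> sets P"
    and mono: "\<And>c c' \<omega>. \<omega> \<in> space P \<Longrightarrow> Q c \<omega> \<Longrightarrow> c \<le> c' \<Longrightarrow> Q c' \<omega>"
    and inv: "\<And>c \<omega> g. \<omega> \<in> space P \<Longrightarrow> g \<in> carrier G \<Longrightarrow> Q c \<omega> \<Longrightarrow> Q c (\<tau> g \<omega>)"
    and bounds: "\<And>\<omega>. \<omega> \<in> space P \<Longrightarrow> Q K \<omega>" "\<And>\<omega>. \<omega> \<in> space P \<Longrightarrow> \<not> Q K' \<omega>"
  obtains l where "AE \<omega> in P. \<forall>\<delta>>0. Q (l + \<delta>) \<omega> \<and> \<not> Q (l - \<delta>) \<omega>"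
proof -
  define E where "E c = {\<omega> \<in> space P. Q c \<omega>}" for c
  have E: "E c \<in> sets P" for c unfolding E_def by (rule meas)
  have zero_one: "prob (E c) \<in> {0, 1}" for c
  proof -
    have "prob (sym_diff (\<tau> g ` E c) (E c)) = 0" if g: "g \<in> carrier G" for g
    proof -
      have sub: "\<tau> g ` E c \<subseteq> E c"
        using inv[OF _ g] measurable_space[OF \<tau>_measurable[OF g]] by (auto simp: E_def)
      then have "sym_diff (\<tau> g ` E c) (E c) = E c - \<tau> g ` E c" by blast
      then show ?thesis using \<tau>_image[OF g E] finite_measure_Diff[OF E _ sub] by simp
    qed
    then show ?thesis using ergodic E unfolding ergodic_system_def by blast
  qed
  define S where "S = {c. prob (E c) = 1}"
  have E_mono: "prob (E c) \<le> prob (E c')" if "c \<le> c'" for c c'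
    using that mono E by (intro finite_measure_mono) (auto simp: E_def)
  have "E K = space P" "E K' = {}" using bounds by (auto simp: E_def)
  then have K: "K \<in> S" "prob (E K') = 0" by (auto simp: S_def prob_space)
  have bdd: "bdd_below S"
  proof (rule bdd_belowI)
    fix c assume "c \<in> S"
    then show "K' \<le> c" using E_mono[of c K'] K(2) by (cases "c \<le> K'") (auto simp: S_def)
  qed
  define l where "l = Inf S"
  have step: "AE \<omega> in P. Q (l + \<delta>) \<omega> \<and> \<not> Q (l - \<delta>) \<omega>" if \<delta>: "0 < \<delta>" for \<delta>
  proof -
    obtain c where c: "c \<in> S" "c < l + \<delta>"
      using cInf_less_iff[of S "l + \<delta>"] K(1) bdd \<delta> unfolding l_def by auto
    have "AE \<omega> in P. \<omega> \<in> E c" using prob_eq_1[OF E[of c]] c(1) by (simp add: S_def)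
    then have 1: "AE \<omega> in P. Q (l + \<delta>) \<omega>"
      by (rule AE_mp) (use mono c(2) in \<open>auto intro!: AE_I2 simp: E_def\<close>)
    have "l - \<delta> \<notin> S" using cInf_lower[OF _ bdd, of "l - \<delta>"] \<delta> by (auto simp: l_def)
    then have "prob (E (l - \<delta>)) = 0" using zero_one[of "l - \<delta>"] by (auto simp: S_def)
    then have "AE \<omega> in P. \<omega> \<notin> E (l - \<delta>)" using prob_eq_0[OF E] by simp
    then have 2: "AE \<omega> in P. \<not> Q (l - \<delta>) \<omega>"
      by (rule AE_mp) (auto intro!: AE_I2 simp: E_def)
    from 1 2 show ?thesis by eventually_elim blast
  qed
  have "AE \<omega> in P. \<forall>j::nat. Q (l + 1 / Suc j) \<omega> \<and> \<not> Q (l - 1 / Suc j) \<omega>"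
    unfolding AE_all_countable using step by simp
  then have "AE \<omega> in P. \<forall>\<delta>>0. Q (l + \<delta>) \<omega> \<and> \<not> Q (l - \<delta>) \<omega>"
  proof (rule AE_mp, intro AE_I2 impI allI)
    fix \<omega> and \<delta> :: real
    assume \<omega>: "\<omega> \<in> space P" and *: "\<forall>j::nat. Q (l + 1 / Suc j) \<omega> \<and> \<not> Q (l - 1 / Suc j) \<omega>" and "0 < \<delta>"
    then obtain j where j: "1 / real (Suc j) < \<delta>" using nat_approx_posE by blast
    then show "Q (l + \<delta>) \<omega> \<and> \<not> Q (l - \<delta>) \<omega>"
      using * mono[OF \<omega>, of "l + 1 / Suc j" "l + \<delta>"] mono[OF \<omega>, of "l - \<delta>" "l - 1 / Suc j"] by auto
  qed
  then show thesis by (rule that)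
qed

text \<open>The value for \<open>n = 0\<close> is fixed separately because costs are only considered for positive durations.\<close>

definition orbit_cost :: "'m \<Rightarrow> 'g \<Rightarrow> real \<Rightarrow> nat \<Rightarrow> 'w \<Rightarrow> real" where
  "orbit_cost x g s n \<omega> = (if n = 0 then 0 else cost \<omega> x (\<alpha> (g [^] n) x) (real n * s))"

lemma orbit_cost_measurable: "0 < s \<Longrightarrow> orbit_cost x g s n \<in> borel_measurable P"
  unfolding orbit_cost_def[abs_def] by (cases "n = 0") (auto intro: cost_measurable)

lemma \<tau>_funpow:
  assumes "\<omega> \<in> space P" "g \<in> carrier G"
  shows "(\<tau> g ^^ Suc n) \<omega> = \<tau> (g [^] Suc n) \<omega>"
proof (induction n)
  case (Suc n)
  have "(\<tau> g ^^ Suc (Suc n)) \<omega> = \<tau> g (\<tau> (g [^] Suc n) \<omega>)" using Suc by simp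
  also have "\<dots> = \<tau> (g \<otimes> g [^] Suc n) \<omega>" by (rule \<tau>_comp[OF assms(2) nat_pow_closed[OF assms(2)] assms(1), symmetric])
  also have "g \<otimes> g [^] Suc n = g [^] Suc (Suc n)" by (rule nat_pow_Suc2[OF assms(2), symmetric])
  finally show ?case .
qed (use assms in simp)

lemma orbit_cost_subadditive:
  assumes \<omega>: "\<omega> \<in> space P" and g: "g \<in> carrier G" and s: "0 < s"
  shows "orbit_cost x g s (m + n) \<omega> \<le> orbit_cost x g s m \<omega> + orbit_cost x g s n ((\<tau> g ^^ m) \<omega>)"
proof (cases "m = 0 \<or> n = 0")
  case False
  then have m: "0 < real m * s" "0 < real n * s" using s by auto
  have gm: "g [^] m \<in> carrier G" "g [^] n \<in> carrier G" using g by auto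
  have "m = Suc (m - 1)" using False by simp
  then have \<tau>: "(\<tau> g ^^ m) \<omega> = \<tau> (g [^] m) \<omega>" using \<tau>_funpow[OF \<omega> g, of "m - 1"] by metis
  have "cost \<omega> x (\<alpha> (g [^] (m + n)) x) (real m * s + real n * s) \<le>
      cost \<omega> x (\<alpha> (g [^] m) x) (real m * s) + cost \<omega> (\<alpha> (g [^] m) x) (\<alpha> (g [^] (m + n)) x) (real n * s)"
    by (rule cost_trans[OF \<omega> m])
  moreover have eq: "\<alpha> (g [^] (m + n)) x = \<alpha> (g [^] m) (\<alpha> (g [^] n) x)"
    using \<alpha>_comp[OF gm] nat_pow_mult[OF g] by simp
  moreover have "cost \<omega> (\<alpha> (g [^] m) x) (\<alpha> (g [^] (m + n)) x) (real n * s) = cost (\<tau> (g [^] m) \<omega>) x (\<alpha> (g [^] n) x) (real n * s)"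
    unfolding eq by (rule cost_shift[OF \<omega> gm(1)])
  ultimately show ?thesis
    using False by (simp add: orbit_cost_def \<tau> distrib_right)
qed (auto simp: orbit_cost_def)

lemma connects_funpow:
  assumes l: "connects l x (\<alpha> g x)" and g: "g \<in> carrier G"
  shows "connects (real (Suc n) * l) x (\<alpha> (g [^] Suc n) x)"
proof (induction n)
  case 0
  then show ?case using l g by simp
next
  case (Suc n)
  have "connects (real (Suc n) * l + l) x (\<alpha> (g [^] Suc n) (\<alpha> g x))"
    by (rule connects_trans[OF Suc connects_shift[OF l]]) (use g in simp)
  moreover have "\<alpha> (g [^] Suc n) (\<alpha> g x) = \<alpha> (g [^] Suc (Suc n)) x"
    using \<alpha>_comp[OF nat_pow_closed[OF g] g, of "Suc n"] by simp
  ultimately show ?case by (simp add: algebra_simps)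
qed

lemma orbit_cost_bounded:
  assumes g: "g \<in> carrier G" and s: "0 < s"
  obtains K where "\<And>n \<omega>. \<omega> \<in> space P \<Longrightarrow> \<bar>orbit_cost x g s n \<omega>\<bar> \<le> K * real n"
proof -
  obtain l where l: "connects l x (\<alpha> g x)" using connects_exists by blast
  define K where "K = s * (\<bar>\<Theta> 0\<bar> + \<bar>\<theta>conj (l / s)\<bar>)"
  have "\<bar>orbit_cost x g s n \<omega>\<bar> \<le> K * real n" if \<omega>: "\<omega> \<in> space P" for n \<omega>
  proof (cases n)
    case (Suc m)
    have ns: "0 < real n * s" using Suc s by simp
    have "orbit_cost x g s n \<omega> \<le> real n * s * \<theta>conj (real n * l / (real n * s))"
      using cost_connects[OF connects_funpow[OF l g, of m] \<omega> ns] Suc by (simp add: orbit_cost_def)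
    also have "\<dots> = real n * s * \<theta>conj (l / s)" using Suc by simp
    also have "\<dots> \<le> real n * s * (\<bar>\<Theta> 0\<bar> + \<bar>\<theta>conj (l / s)\<bar>)" using ns by (intro mult_left_mono) auto
    finally have 1: "orbit_cost x g s n \<omega> \<le> K * real n" by (simp add: K_def mult_ac)
    have "- orbit_cost x g s n \<omega> \<le> real n * s * \<Theta> 0"
      using cost_lower[OF \<omega> ns, of x "\<alpha> (g [^] n) x"] Suc by (simp add: orbit_cost_def mult_ac)
    also have "\<dots> \<le> real n * s * (\<bar>\<Theta> 0\<bar> + \<bar>\<theta>conj (l / s)\<bar>)" using ns by (intro mult_left_mono) auto
    finally have "- orbit_cost x g s n \<omega> \<le> K * real n" by (simp add: K_def mult_ac)
    with 1 show ?thesis by simp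
  qed (simp add: orbit_cost_def)
  then show thesis by (rule that)
qed

text \<open>A shift of the environment by \<open>h\<close> amounts to moving both endpoints by \<open>h\<close>.  A fixed number of
  additional periods is long enough to go there and back at finite cost.\<close>

lemma orbit_cost_shift:
  assumes g: "g \<in> carrier G" and h: "h \<in> carrier G" and s: "0 < s"
  obtains m K where "\<And>n \<omega>. \<omega> \<in> space P \<Longrightarrow> 0 < n \<Longrightarrow> orbit_cost x g s (n + m) \<omega> \<le> orbit_cost x g s n (\<tau> h \<omega>) + K"
proof -
  have ih: "inv h \<in> carrier G" using h by simp
  obtain l where l: "connects l x (\<alpha> h x)" using connects_exists by blast
  obtain l' where l': "connects l' (\<alpha> h x) (\<alpha> (g [^] (2::nat)) x)" using connects_exists by blast
  define K where "K = s * \<theta>conj (l / s) + s * \<theta>conj (l' / s)"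
  \<comment> \<open>the first additional period serves to reach \<open>\<alpha> h x\<close>, the second to return from its translate by \<open>g [^] n\<close>\<close>
  have "orbit_cost x g s (n + 2) \<omega> \<le> orbit_cost x g s n (\<tau> h \<omega>) + K" if \<omega>: "\<omega> \<in> space P" and n: "0 < n" for n \<omega>
  proof -
    have gn: "g [^] n \<in> carrier G" "g [^] (2::nat) \<in> carrier G" using g by auto
    have eq: "\<alpha> (g [^] n) (\<alpha> h x) = \<alpha> h (\<alpha> (g [^] n) x)"
      using \<alpha>_comp[OF gn(1) h] \<alpha>_comp[OF h gn(1)] m_comm[OF gn(1) h] by simp
    have eq2: "\<alpha> (g [^] n) (\<alpha> (g [^] (2::nat)) x) = \<alpha> (g [^] (n + 2)) x"
      using \<alpha>_comp[OF gn] nat_pow_mult[OF g] by simp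
    have 1: "cost \<omega> x (\<alpha> h x) s \<le> s * \<theta>conj (l / s)" by (rule cost_connects[OF l \<omega> s])
    have 2: "cost \<omega> (\<alpha> h (\<alpha> (g [^] n) x)) (\<alpha> (g [^] (n + 2)) x) s \<le> s * \<theta>conj (l' / s)"
      using cost_connects[OF connects_shift[OF l' gn(1)] \<omega> s] unfolding eq eq2 .
    have ns: "0 < real n * s" using n s by simp
    have 3: "cost \<omega> (\<alpha> h x) (\<alpha> h (\<alpha> (g [^] n) x)) (real n * s) = orbit_cost x g s n (\<tau> h \<omega>)"
      using n by (simp add: orbit_cost_def cost_shift[OF \<omega> h])
    have "cost \<omega> x (\<alpha> (g [^] (n + 2)) x) (s + real n * s + s) \<le>
        cost \<omega> x (\<alpha> h x) s + cost \<omega> (\<alpha> h x) (\<alpha> h (\<alpha> (g [^] n) x)) (real n * s)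
        + cost \<omega> (\<alpha> h (\<alpha> (g [^] n) x)) (\<alpha> (g [^] (n + 2)) x) s"
      using cost_trans[OF \<omega> s ns, of x "\<alpha> h (\<alpha> (g [^] n) x)" "\<alpha> h x"]
        cost_trans[OF \<omega> _ s, of "s + real n * s" x "\<alpha> (g [^] (n + 2)) x" "\<alpha> h (\<alpha> (g [^] n) x)"] s ns by simp
    moreover have "s + real n * s + s = real (n + 2) * s" by (simp add: algebra_simps)
    ultimately have "orbit_cost x g s (n + 2) \<omega> \<le> cost \<omega> x (\<alpha> h x) s + orbit_cost x g s n (\<tau> h \<omega>)
        + cost \<omega> (\<alpha> h (\<alpha> (g [^] n) x)) (\<alpha> (g [^] (n + 2)) x) s"
      unfolding 3 by (simp add: orbit_cost_def)
    then show ?thesis using 1 2 by (simp add: K_def)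
  qed
  then show thesis by (rule that)
qed

lemma orbit_cost_one: "\<omega> \<in> space P \<Longrightarrow> orbit_cost x g s n (\<tau> \<one> \<omega>) = orbit_cost x g s n \<omega>"
  using cost_shift[OF _ one_closed, of \<omega> x "\<alpha> (g [^] n) x"] by (simp add: orbit_cost_def)

lemma orbit_cost_shift':
  assumes g: "g \<in> carrier G" and h: "h \<in> carrier G" and s: "0 < s"
  obtains m K where "\<And>n \<omega>. \<omega> \<in> space P \<Longrightarrow> 0 < n \<Longrightarrow> orbit_cost x g s (n + m) (\<tau> h \<omega>) \<le> orbit_cost x g s n \<omega> + K"
proof -
  have ih: "inv h \<in> carrier G" using h by simp
  obtain m K where mK: "\<And>n \<omega>. \<omega> \<in> space P \<Longrightarrow> 0 < n \<Longrightarrow> orbit_cost x g s (n + m) \<omega> \<le> orbit_cost x g s n (\<tau> (inv h) \<omega>) + K"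
    using orbit_cost_shift[OF g ih s] by blast
  have "orbit_cost x g s (n + m) (\<tau> h \<omega>) \<le> orbit_cost x g s n \<omega> + K" if \<omega>: "\<omega> \<in> space P" and n: "0 < n" for n \<omega>
    using mK[OF \<tau>_in[OF h \<omega>] n] \<tau>_comp[OF ih h \<omega>] orbit_cost_one[OF \<omega>] h by simp
  then show thesis by (rule that)
qed

lemma eventually_affine_le:
  assumes "(0::real) < d"
  shows "\<forall>\<^sub>F n in sequentially. B \<le> d * real n"
proof -
  obtain N where N: "B / d \<le> real N" using real_arch_simple by blast
  have "B \<le> d * real n" if "N \<le> n" for n
  proof -
    have "B / d \<le> real n" using N that by simp
    then show ?thesis using assms by (simp add: pos_divide_le_eq mult.commute)
  qed
  then show ?thesis unfolding eventually_sequentially by blast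
qed

text \<open>Covers the lower and the upper limit of \<open>orbit_cost x g s n / n\<close> at once: \<open>E\<close> stands for ``infinitely often'' or for ``almost
always'', and \<open>l\<close> is the corresponding limit, characterized by the levels that it does not exceed. It is constant by
invariance and ergodicity. The slack \<open>1 / (j + 1)\<close> in \<open>Q\<close> absorbs bounded errors and makes the levels invariant.\<close>

lemma orbit_cost_level:
  fixes E :: "(nat \<Rightarrow> bool) \<Rightarrow> bool"
  assumes g: "g \<in> carrier G" and s: "0 < s"
    and mono: "\<And>R R' m. E R \<Longrightarrow> \<forall>\<^sub>F n in sequentially. R n \<longrightarrow> R' (n + m) \<Longrightarrow> E R'"
    and meas: "\<And>R. (\<And>n. Measurable.pred P (R n)) \<Longrightarrow> Measurable.pred P (\<lambda>\<omega>. E (\<lambda>n. R n \<omega>))"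
    and triv: "E (\<lambda>n. True)" "\<not> E (\<lambda>n. n = 0)"
  obtains l where "AE \<omega> in P. \<forall>\<delta>>0. E (\<lambda>n. orbit_cost x g s n \<omega> \<le> (l + \<delta>) * real n) \<and>
      \<not> E (\<lambda>n. orbit_cost x g s n \<omega> \<le> (l - \<delta>) * real n)"
proof -
  define a where "a = orbit_cost x g s"
  note a_m[measurable] = orbit_cost_measurable[OF s, of x g, folded a_def]
  obtain K where K: "\<And>n \<omega>. \<omega> \<in> space P \<Longrightarrow> \<bar>a n \<omega>\<bar> \<le> K * real n"
    unfolding a_def using orbit_cost_bounded[OF g s] by blast
  define Q where "Q c \<omega> \<longleftrightarrow> (\<forall>j::nat. E (\<lambda>n. a n \<omega> \<le> (c + 1 / Suc j) * real n))" for c \<omega>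
  have mono0: "E R'" if "E R" "\<And>n. R n \<Longrightarrow> R' n" for R R' by (rule mono[OF that(1), of _ 0]) (use that(2) in simp)
  have le_mono: "a n \<omega> \<le> c' * real n" if "a n \<omega> \<le> c * real n" "c \<le> c'" for c c' n \<omega>
    using that(1) mult_right_mono[OF that(2), of "real n"] by linarith
  obtain l where l: "AE \<omega> in P. \<forall>\<delta>>0. Q (l + \<delta>) \<omega> \<and> \<not> Q (l - \<delta>) \<omega>"
  proof (rule invariant_level[of Q K "- K - 2"])
    show "{\<omega> \<in> space P. Q c \<omega>} \<in> sets P" for c
    proof -
      have [measurable]: "Measurable.pred P (\<lambda>\<omega>. E (\<lambda>n. a n \<omega> \<le> (c + 1 / Suc j) * real n))" for j :: nat
        by (rule meas) measurable
      show ?thesis unfolding Q_def by measurable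
    qed
    show "Q c' \<omega>" if "Q c \<omega>" "c \<le> c'" for c c' \<omega>
      unfolding Q_def
    proof
      fix j
      show "E (\<lambda>n. a n \<omega> \<le> (c' + 1 / Suc j) * real n)"
        by (rule mono0[OF that(1)[unfolded Q_def, rule_format, of j]]) (erule le_mono, use that(2) in simp)
    qed
    show "Q c (\<tau> h \<omega>)" if \<omega>: "\<omega> \<in> space P" and h: "h \<in> carrier G" and Q: "Q c \<omega>" for c \<omega> h
      unfolding Q_def
    proof
      fix j
      obtain m B where mB: "\<And>n \<omega>. \<omega> \<in> space P \<Longrightarrow> 0 < n \<Longrightarrow> a (n + m) (\<tau> h \<omega>) \<le> a n \<omega> + B"
        unfolding a_def using orbit_cost_shift'[OF g h s] by blast
      define d where "d = 1 / real (Suc (Suc (2 * j)))"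
      have d: "0 < d" "1 / real (Suc j) = 2 * d" by (auto simp: d_def field_simps)
      show "E (\<lambda>n. a n (\<tau> h \<omega>) \<le> (c + 1 / Suc j) * real n)"
      proof (rule mono)
        show "E (\<lambda>n. a n \<omega> \<le> (c + d) * real n)" using Q unfolding Q_def d_def by blast
        show "\<forall>\<^sub>F n in sequentially. a n \<omega> \<le> (c + d) * real n \<longrightarrow> a (n + m) (\<tau> h \<omega>) \<le> (c + 1 / Suc j) * real (n + m)"
          using eventually_affine_le[OF d(1), of "B - (c + 2 * d) * real m"] eventually_gt_at_top[of 0]
        proof eventually_elim
          case (elim n)
          then show ?case using mB[OF \<omega>, of n] unfolding d(2) by (simp add: algebra_simps)
        qed
      qed
    qed
    show "Q K \<omega>" if \<omega>: "\<omega> \<in> space P" for \<omega>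
      unfolding Q_def
    proof (intro allI mono0[OF triv(1)])
      fix j n
      have "a n \<omega> \<le> K * real n" using K[OF \<omega>, of n] by linarith
      then show "a n \<omega> \<le> (K + 1 / Suc j) * real n" by (rule le_mono) simp
    qed
    show "\<not> Q (- K - 2) \<omega>" if \<omega>: "\<omega> \<in> space P" for \<omega>
    proof
      assume "Q (- K - 2) \<omega>"
      then have "E (\<lambda>n. a n \<omega> \<le> (- K - 2 + 1 / Suc 0) * real n)" unfolding Q_def by blast
      then have "E (\<lambda>n. n = 0)"
      proof (rule mono0)
        fix n assume "a n \<omega> \<le> (- K - 2 + 1 / Suc 0) * real n"
        then show "n = 0" using K[OF \<omega>, of n] by (simp add: algebra_simps)
      qed
      then show False using triv(2) by simp
    qed
  qed blast
  have "AE \<omega> in P. \<forall>\<delta>>0. E (\<lambda>n. a n \<omega> \<le> (l + \<delta>) * real n) \<and> \<not> E (\<lambda>n. a n \<omega> \<le> (l - \<delta>) * real n)"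
    using l
  proof (eventually_elim, intro allI impI conjI)
    fix \<omega> and \<delta> :: real
    assume Q: "\<forall>\<delta>>0. Q (l + \<delta>) \<omega> \<and> \<not> Q (l - \<delta>) \<omega>" and \<delta>: "0 < \<delta>"
    then obtain j where j: "1 / real (Suc j) < \<delta> / 2" using nat_approx_posE[of "\<delta> / 2"] by auto
    have "Q (l + \<delta> / 2) \<omega>" using Q \<delta> by (meson half_gt_zero)
    then have "E (\<lambda>n. a n \<omega> \<le> (l + \<delta> / 2 + 1 / Suc j) * real n)" unfolding Q_def by blast
    then show "E (\<lambda>n. a n \<omega> \<le> (l + \<delta>) * real n)" by (rule mono0) (erule le_mono, use j in linarith)
    show "\<not> E (\<lambda>n. a n \<omega> \<le> (l - \<delta>) * real n)"
    proof
      assume "E (\<lambda>n. a n \<omega> \<le> (l - \<delta>) * real n)"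
      then have "Q (l - \<delta>) \<omega>" unfolding Q_def by (intro allI) (erule mono0, erule le_mono, simp)
      then show False using Q \<delta> by blast
    qed
  qed
  then show thesis unfolding a_def by (rule that)
qed

text \<open>The lower and the upper limit are constant almost surely, and subadditivity makes the constants agree.\<close>

lemma orbit_cost_limit:
  assumes g: "g \<in> carrier G" and s: "0 < s"
  obtains l where "AE \<omega> in P. (\<lambda>n. orbit_cost x g s n \<omega> / real n) \<longlonglongrightarrow> l"
proof -
  define a where "a = orbit_cost x g s"
  obtain K where K: "\<And>n \<omega>. \<omega> \<in> space P \<Longrightarrow> \<bar>a n \<omega>\<bar> \<le> K * real n"
    unfolding a_def using orbit_cost_bounded[OF g s] by blast
  obtain l where l: "AE \<omega> in P. \<forall>\<delta>>0. (\<exists>\<^sub>F n in sequentially. a n \<omega> \<le> (l + \<delta>) * real n) \<and>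
      \<not> (\<exists>\<^sub>F n in sequentially. a n \<omega> \<le> (l - \<delta>) * real n)"
    unfolding a_def
  proof (rule orbit_cost_level[OF g s, of "\<lambda>R. \<exists>\<^sub>F n in sequentially. R n" x])
    fix R R' :: "nat \<Rightarrow> bool" and m
    assume 1: "\<exists>\<^sub>F n in sequentially. R n" and 2: "\<forall>\<^sub>F n in sequentially. R n \<longrightarrow> R' (n + m)"
    show "\<exists>\<^sub>F n in sequentially. R' n"
      unfolding frequently_sequentially
    proof
      fix N
      obtain n where "n \<ge> N" "R n" "R n \<longrightarrow> R' (n + m)"
        using frequently_eventually_frequently[OF 1 2] unfolding frequently_sequentially by blast
      then show "\<exists>n\<ge>N. R' n" by (intro exI[of _ "n + m"]) auto
    qed
  next
    fix R :: "nat \<Rightarrow> 'w \<Rightarrow> bool" assume [measurable]: "\<And>n. Measurable.pred P (R n)"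
    show "Measurable.pred P (\<lambda>\<omega>. \<exists>\<^sub>F n in sequentially. R n \<omega>)" unfolding frequently_sequentially by measurable
  qed (auto simp: frequently_sequentially)
  obtain u where u: "AE \<omega> in P. \<forall>\<delta>>0. (\<forall>\<^sub>F n in sequentially. a n \<omega> \<le> (u + \<delta>) * real n) \<and>
      \<not> (\<forall>\<^sub>F n in sequentially. a n \<omega> \<le> (u - \<delta>) * real n)"
    unfolding a_def
  proof (rule orbit_cost_level[OF g s, of "\<lambda>R. \<forall>\<^sub>F n in sequentially. R n" x])
    fix R R' :: "nat \<Rightarrow> bool" and m
    assume "\<forall>\<^sub>F n in sequentially. R n" "\<forall>\<^sub>F n in sequentially. R n \<longrightarrow> R' (n + m)"
    then have "\<forall>\<^sub>F n in sequentially. R' (n + m)" by eventually_elim simp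
    then show "\<forall>\<^sub>F n in sequentially. R' n" by (subst (asm) eventually_sequentially_seg)
  next
    fix R :: "nat \<Rightarrow> 'w \<Rightarrow> bool" assume [measurable]: "\<And>n. Measurable.pred P (R n)"
    show "Measurable.pred P (\<lambda>\<omega>. \<forall>\<^sub>F n in sequentially. R n \<omega>)" unfolding eventually_sequentially by measurable
  next
    show "\<not> (\<forall>\<^sub>F n in sequentially. n = (0::nat))"
      unfolding eventually_sequentially by (metis le_SucI nat.distinct(1) order_refl)
  qed simp
  have "u \<le> l"
  proof (rule subadditive_limits_agree[OF prob_space_axioms \<tau>_measurable[OF g] \<tau>_preserves[OF g], of a K])
    show "a (m + n) \<omega> \<le> a m \<omega> + a n ((\<tau> g ^^ m) \<omega>)" if "\<omega> \<in> space P" for m n \<omega>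
      unfolding a_def by (rule orbit_cost_subadditive[OF that g s])
    show "a n \<in> borel_measurable P" for n unfolding a_def by (rule orbit_cost_measurable[OF s])
    fix \<delta> :: real assume \<delta>: "0 < \<delta>"
    from l show "AE \<omega> in P. \<exists>\<^sub>F n in sequentially. a n \<omega> \<le> (l + \<delta>) * real n"
      by eventually_elim (use \<delta> in blast)
    from u show "AE \<omega> in P. \<exists>\<^sub>F n in sequentially. (u - \<delta>) * real n \<le> a n \<omega>"
    proof eventually_elim
      case (elim \<omega>)
      then have "\<exists>\<^sub>F n in sequentially. \<not> a n \<omega> \<le> (u - \<delta>) * real n" using \<delta> by (simp only: not_eventually)
      then show ?case by (rule frequently_elim1) simp
    qed
  qed (use K in auto)
  have "AE \<omega> in P. (\<lambda>n. a n \<omega> / real n) \<longlonglongrightarrow> l"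
    using l u
  proof eventually_elim
    case (elim \<omega>)
    show ?case
    proof (rule order_tendstoI)
      fix e assume "e < l"
      then have "\<not> (\<exists>\<^sub>F n in sequentially. a n \<omega> \<le> (l - (l - e)) * real n)" using elim(1) by (meson diff_gt_0_iff_gt)
      then have "\<forall>\<^sub>F n in sequentially. \<not> a n \<omega> \<le> e * real n" by (simp add: not_frequently)
      then show "\<forall>\<^sub>F n in sequentially. e < a n \<omega> / real n"
        using eventually_gt_at_top[of 0] by eventually_elim (simp add: pos_less_divide_eq)
    next
      fix e assume e: "l < e"
      then have "\<forall>\<^sub>F n in sequentially. a n \<omega> \<le> (u + (e - l) / 2) * real n" using elim(2) by (meson diff_gt_0_iff_gt half_gt_zero)
      then show "\<forall>\<^sub>F n in sequentially. a n \<omega> / real n < e"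
        using eventually_gt_at_top[of 0]
      proof eventually_elim
        case (elim n)
        have "u + (e - l) / 2 < e" using e \<open>u \<le> l\<close> by (simp add: field_simps)
        then have "(u + (e - l) / 2) * real n < e * real n" using elim(2) by (intro mult_strict_right_mono) auto
        then have "a n \<omega> < e * real n" using elim(1) by linarith
        then show ?case using elim(2) by (simp add: pos_divide_less_eq)
      qed
    qed
  qed
  then show thesis unfolding a_def by (rule that)
qed

end

section \<open>The rescaled action and costs along lattice rays\<close>

text \<open>Used with \<open>r\<close> slightly smaller or larger than 1, when \<open>n e\<close> periods of length \<open>N\<close> take about the time \<open>r / e\<close>.\<close>

lemma rescaled_limit:
  fixes a :: "nat \<Rightarrow> real"
  assumes lim: "(\<lambda>k. a k / real k) \<longlonglongrightarrow> l" and r: "0 < r" and N: "0 < N"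
    and n: "\<forall>\<^sub>F e in at_right 0. \<bar>real (n e) * N - r / e\<bar> \<le> N"
  shows "((\<lambda>e. e * a (n e)) \<longlongrightarrow> r * (l / N)) (at_right 0)"
proof -
  have pos: "\<forall>\<^sub>F e in at_right (0::real). 0 < e" by (rule eventually_at_right_less)
  have "filterlim (\<lambda>e. real (n e)) at_top (at_right 0)"
  proof (rule filterlim_at_top_mono)
    have "filterlim (\<lambda>e. - 1 + (r / N) * inverse e) at_top (at_right (0::real))"
      using r N by (intro filterlim_tendsto_add_at_top[OF tendsto_const]
        filterlim_tendsto_pos_mult_at_top[OF tendsto_const] filterlim_inverse_at_top_right) auto
    then show "filterlim (\<lambda>e. - 1 + (r / N) * inverse e) at_top (at_right (0::real))" .
    show "\<forall>\<^sub>F e in at_right 0. - 1 + (r / N) * inverse e \<le> real (n e)"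
      using n pos
    proof eventually_elim
      case (elim e)
      then have "r / e - N \<le> real (n e) * N" by linarith
      then have "(r / e - N) / N \<le> real (n e)" using N by (simp add: pos_divide_le_eq)
      moreover have "(r / e - N) / N = - 1 + (r / N) * inverse e" using N by (simp add: field_simps)
      ultimately show ?case by simp
    qed
  qed
  then have top: "filterlim n sequentially (at_right 0)"
    by (subst (asm) filterlim_sequentially_iff_filterlim_real[symmetric])
  have 1: "((\<lambda>e. a (n e) / real (n e)) \<longlongrightarrow> l) (at_right 0)"
    by (rule filterlim_compose[OF lim top])
  have 2: "((\<lambda>e. e * (real (n e) * N)) \<longlongrightarrow> r) (at_right 0)"
  proof (rule Lim_transform)
    show "((\<lambda>e. r) \<longlongrightarrow> r) (at_right (0::real))" by simp
    show "((\<lambda>e. e * (real (n e) * N) - r) \<longlongrightarrow> 0) (at_right 0)"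
    proof (rule Lim_null_comparison)
      show "\<forall>\<^sub>F e in at_right 0. norm (e * (real (n e) * N) - r) \<le> e * N"
        using n pos
      proof eventually_elim
        case (elim e)
        have "norm (e * (real (n e) * N) - r) = e * \<bar>real (n e) * N - r / e\<bar>"
          using elim(2) by (simp add: abs_mult_pos' algebra_simps abs_minus_commute)
        also have "\<dots> \<le> e * N" using elim by (intro mult_left_mono) auto
        finally show ?case .
      qed
      show "((\<lambda>e. e * N) \<longlongrightarrow> 0) (at_right 0)" by (auto intro!: tendsto_eq_intros)
    qed
  qed
  have "((\<lambda>e. (e * (real (n e) * N)) * (a (n e) / real (n e)) * (1 / N)) \<longlongrightarrow> r * l * (1 / N)) (at_right 0)"
    by (intro tendsto_mult 1 2 tendsto_const)
  moreover have "\<forall>\<^sub>F e in at_right 0. (e * (real (n e) * N)) * (a (n e) / real (n e)) * (1 / N) = e * a (n e)"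
    using filterlim_at_top_dense[THEN iffD1, OF \<open>filterlim (\<lambda>e. real (n e)) at_top (at_right 0)\<close>, rule_format, of 0]
    by eventually_elim (use N in simp)
  ultimately show ?thesis using tendsto_cong by fastforce
qed

text \<open>Both \<open>w\<close> and \<open>n * z\<close> are close to \<open>T * h\<close>: the first because \<open>w / T\<close> is close to \<open>h\<close>, the second because \<open>z / N\<close> is
close to \<open>h\<close> and \<open>n * N\<close> to \<open>T\<close>.\<close>

lemma lattice_displacement:
  fixes h :: "nat \<Rightarrow> real" and z w :: "nat \<Rightarrow> int"
  assumes \<eta>: "0 < \<eta>" "\<eta> \<le> 1 / 2" and T: "0 < T" and N: "0 < N"
    and z: "\<And>i. i < b \<Longrightarrow> \<bar>h i - z i / N\<bar> \<le> \<eta>" and w: "\<And>i. i < b \<Longrightarrow> \<bar>w i / T - h i\<bar> \<le> \<eta>"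
    and n: "\<bar>real n * N - T\<bar> \<le> 3 * \<eta> * T"
  shows "(\<Sum>i<b. \<bar>real_of_int (w i - int n * z i)\<bar>) \<le> \<eta> * T * (4 * real b + 3 * (\<Sum>i<b. \<bar>h i\<bar>))"
proof -
  have "\<bar>real_of_int (w i - int n * z i)\<bar> \<le> \<eta> * T * (4 + 3 * \<bar>h i\<bar>)" if i: "i < b" for i
  proof -
    have 1: "\<bar>w i - T * h i\<bar> \<le> \<eta> * T"
    proof -
      have "\<bar>w i - T * h i\<bar> = T * \<bar>w i / T - h i\<bar>" using T by (simp add: abs_mult_pos' algebra_simps)
      also have "\<dots> \<le> T * \<eta>" using w[OF i] T by (intro mult_left_mono) auto
      finally show ?thesis by (simp add: mult.commute)
    qed
    have 2: "\<bar>T * h i - real n * N * h i\<bar> \<le> 3 * \<eta> * T * \<bar>h i\<bar>"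
    proof -
      have "\<bar>T * h i - real n * N * h i\<bar> = \<bar>real n * N - T\<bar> * \<bar>h i\<bar>"
        by (simp add: abs_mult[symmetric] left_diff_distrib abs_minus_commute)
      also have "\<dots> \<le> 3 * \<eta> * T * \<bar>h i\<bar>" using n by (intro mult_right_mono) auto
      finally show ?thesis .
    qed
    have 3: "\<bar>real n * N * h i - real n * z i\<bar> \<le> 3 * (\<eta> * T)"
    proof -
      have "\<bar>real n * N * h i - real n * z i\<bar> = real n * N * \<bar>h i - z i / N\<bar>"
        using N by (simp add: abs_mult_pos' algebra_simps)
      also have "\<dots> \<le> real n * N * \<eta>" using z[OF i] N by (intro mult_left_mono) auto
      also have "\<dots> \<le> (3 * T) * \<eta>"
      proof (rule mult_right_mono)
        have "3 * \<eta> * T \<le> 3 * (1 / 2) * T" using \<eta> T by (intro mult_right_mono) auto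
        then show "real n * N \<le> 3 * T" using n T by linarith
      qed (use \<eta> in simp)
      finally show ?thesis by (simp add: mult_ac)
    qed
    have "\<bar>real_of_int (w i - int n * z i)\<bar> \<le> \<eta> * T + 3 * \<eta> * T * \<bar>h i\<bar> + 3 * (\<eta> * T)"
    proof -
      have "real_of_int (w i - int n * z i) = (w i - T * h i) + (T * h i - real n * N * h i) + (real n * N * h i - real n * z i)" by simp
      then show ?thesis using 1 2 3 by linarith
    qed
    then show ?thesis by (simp add: algebra_simps)
  qed
  then have "(\<Sum>i<b. \<bar>real_of_int (w i - int n * z i)\<bar>) \<le> (\<Sum>i<b. \<eta> * T * (4 + 3 * \<bar>h i\<bar>))"
    by (intro sum_mono) auto
  also have "\<dots> = \<eta> * T * (4 * real b + 3 * (\<Sum>i<b. \<bar>h i\<bar>))"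
    by (simp add: sum_distrib_left[symmetric] sum.distrib)
  finally show ?thesis .
qed

lemma carrier_Zpow: "carrier (Zpow b) = (\<Pi>\<^sub>E i\<in>{..<b}. UNIV)"
  and mult_Zpow: "x \<otimes>\<^bsub>Zpow b\<^esub> y = (\<lambda>i\<in>{..<b}. x i + y i)"
  and one_Zpow: "\<one>\<^bsub>Zpow b\<^esub> = (\<lambda>i\<in>{..<b}. 0)"
  by (simp_all add: Zpow_def)

lemma group_Zpow: "group (Zpow b)"
  by (simp add: Zpow_def)

locale lattice_ham = ergodic_ham A \<rho> H P \<theta> \<Theta> G \<alpha> \<tau>
  for A :: "('m::{t2_space, second_countable_topology}, 'e::{real_inner, heine_borel}) chart set"
    and \<rho> :: "'m \<Rightarrow> ('m, 'e) tvec \<Rightarrow> ('m, 'e) tvec \<Rightarrow> real"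
    and H :: "'m \<times> ('m, 'e) covec \<Rightarrow> 'w \<Rightarrow> real" and P :: "'w measure" and \<theta> \<Theta> :: "real \<Rightarrow> real"
    and G :: "('g, 'r) monoid_scheme" (structure) and \<alpha> :: "'g \<Rightarrow> 'm \<Rightarrow> 'm" and \<tau> :: "'g \<Rightarrow> 'w \<Rightarrow> 'w" +
  fixes T :: "('t, 's) monoid_scheme" and b :: nat and \<iota> :: "(nat \<Rightarrow> int) \<times> 't \<Rightarrow> 'g"
  assumes T_group: "group T" and \<iota>_hom: "\<iota> \<in> hom (Zpow b \<times>\<times> T) G"
    and H_cont: "\<omega> \<in> space P \<Longrightarrow> c \<in> A \<Longrightarrow> continuous_on (chart_image c \<times> UNIV) (\<lambda>z. H (cot_param A c z) \<omega>)"
begin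

definition shift :: "(nat \<Rightarrow> int) \<Rightarrow> 'g" where
  "shift z = \<iota> (z, \<one>\<^bsub>T\<^esub>)"

lemma \<iota>_closed: "z \<in> carrier (Zpow b) \<Longrightarrow> k \<in> carrier T \<Longrightarrow> \<iota> (z, k) \<in> carrier G"
  using \<iota>_hom by (auto simp: hom_def)

lemma \<iota>_mult: "z \<in> carrier (Zpow b) \<Longrightarrow> k \<in> carrier T \<Longrightarrow> z' \<in> carrier (Zpow b) \<Longrightarrow> k' \<in> carrier T \<Longrightarrow>
    \<iota> (z \<otimes>\<^bsub>Zpow b\<^esub> z', k \<otimes>\<^bsub>T\<^esub> k') = \<iota> (z, k) \<otimes> \<iota> (z', k')"
  using hom_mult[OF \<iota>_hom, of "(z, k)" "(z', k')"] by simp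

lemma T_one: "\<one>\<^bsub>T\<^esub> \<in> carrier T" using group.is_monoid[OF T_group] by (rule monoid.one_closed)

lemma shift_closed: "z \<in> carrier (Zpow b) \<Longrightarrow> shift z \<in> carrier G"
  unfolding shift_def by (rule \<iota>_closed[OF _ T_one])

lemma shift_mult:
  assumes "z \<in> carrier (Zpow b)" "z' \<in> carrier (Zpow b)"
  shows "shift (\<lambda>i\<in>{..<b}. z i + z' i) = shift z \<otimes> shift z'"
  using \<iota>_mult[OF assms(1) T_one assms(2) T_one] monoid.l_one[OF group.is_monoid[OF T_group] T_one]
  by (simp add: shift_def mult_Zpow)

lemma shift_torsion:
  assumes "z \<in> carrier (Zpow b)" "k \<in> carrier T"
  shows "\<iota> (z, k) = shift z \<otimes> \<iota> (\<one>\<^bsub>Zpow b\<^esub>, k)"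
  using \<iota>_mult[OF assms(1) T_one monoid.one_closed[OF group.is_monoid[OF group_Zpow]] assms(2)]
    monoid.l_one[OF group.is_monoid[OF T_group] assms(2)] monoid.r_one[OF group.is_monoid[OF group_Zpow] assms(1)]
  by (simp add: shift_def)

lemma shift_zero: "shift (\<lambda>i\<in>{..<b}. 0) = \<one>"
proof -
  interpret D: group "Zpow b \<times>\<times> T" by (rule DirProd_group[OF group_Zpow T_group])
  interpret hom: group_hom "Zpow b \<times>\<times> T" G \<iota> by unfold_locales (rule \<iota>_hom)
  show ?thesis unfolding shift_def one_Zpow[symmetric] using hom.hom_one by simp
qed

lemma shift_pow:
  assumes z: "z \<in> carrier (Zpow b)"
  shows "shift z [^] n = shift (\<lambda>i\<in>{..<b}. int n * z i)"
proof (induction n)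
  case 0
  have "(\<lambda>i\<in>{..<b}. int 0 * z i) = (\<lambda>i\<in>{..<b}. 0)" by simp
  then show ?case using shift_zero nat_pow_0 by metis
next
  case (Suc n)
  have "shift z [^] Suc n = shift (\<lambda>i\<in>{..<b}. int n * z i) \<otimes> shift z" by (simp only: nat_pow_Suc Suc)
  also have "\<dots> = shift (\<lambda>i\<in>{..<b}. (\<lambda>i\<in>{..<b}. int n * z i) i + z i)"
    by (rule shift_mult[symmetric]) (use z in \<open>auto simp: carrier_Zpow\<close>)
  also have "(\<lambda>i\<in>{..<b}. (\<lambda>i\<in>{..<b}. int n * z i) i + z i) = (\<lambda>i\<in>{..<b}. int (Suc n) * z i)"
    by (auto simp: fun_eq_iff algebra_simps)
  finally show ?case .
qed

text \<open>Along the finitely many generators the orbit moves a bounded length; hence the length grows at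
  most linearly in the \<open>\<ell>\<^sup>1\<close>-norm.\<close>

lemma linear_growth:
  obtains K where "0 < K" "\<And>z. z \<in> carrier (Zpow b) \<Longrightarrow>
    connects (K * (1 + (\<Sum>i<b. \<bar>real_of_int (z i)\<bar>))) x (\<alpha> (shift z) x)"
proof -
  define e where "e i s = (\<lambda>j\<in>{..<b}. if j = i then s else (0::int))" for i s
  have e: "e i s \<in> carrier (Zpow b)" for i s by (auto simp: e_def carrier_Zpow)
  define l where "l p = (SOME l. connects l x (\<alpha> (shift (e (fst p) (snd p))) x))" for p
  have l: "connects (l p) x (\<alpha> (shift (e (fst p) (snd p))) x)" for p
    unfolding l_def using someI_ex[OF connects_exists] .
  have l_pos: "0 < l p" for p using l[of p] by (simp add: connects_def)
  define S where "S = {..<b} \<times> {1, -1::int}"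
  define K where "K = 1 + sum l S"
  have K: "0 < K" unfolding K_def using l_pos by (intro add_pos_nonneg sum_nonneg) (auto intro: less_imp_le)
  have "l p \<le> K" if "p \<in> S" for p
    unfolding K_def 
  proof -
    have "l p \<le> sum l S" using that l_pos by (intro member_le_sum) (auto simp: S_def intro: less_imp_le)
    then show "l p \<le> 1 + sum l S" by simp
  qed
  then have gen: "connects K x (\<alpha> (shift (e i s)) x)" if "i < b" "s = 1 \<or> s = -1" for i s
    using connects_mono[OF l[of "(i, s)"]] that by (auto simp: S_def)
  have "connects (K * (1 + real n)) x (\<alpha> (shift z) x)"
    if "z \<in> carrier (Zpow b)" "(\<Sum>i<b. \<bar>z i\<bar>) = int n" for n z
    using that
  proof (induction n arbitrary: z)
    case 0
    then have "\<forall>i<b. z i = 0" by (subst (asm) of_nat_0, subst (asm) sum_nonneg_eq_0_iff) auto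
    then have "z = (\<lambda>i\<in>{..<b}. 0)" using 0(1) by (auto simp: carrier_Zpow fun_eq_iff PiE_def extensional_def)
    then have "\<alpha> (shift z) x = x" using shift_zero \<alpha>_one by metis
    then show ?case using connects_refl[of "K * (1 + real 0)" x] K by simp
  next
    case (Suc n)
    have "\<exists>i<b. z i \<noteq> 0"
    proof (rule ccontr)
      assume "\<not> ?thesis"
      then have "(\<Sum>i<b. \<bar>z i\<bar>) = 0" by simp
      then show False using Suc.prems(2) by simp
    qed
    then obtain i where i: "i < b" "z i \<noteq> 0" by blast
    \<comment> \<open>remove one generator, in a coordinate that does not vanish\<close>
    define s where "s = sgn (z i)"
    have s: "s = 1 \<or> s = -1" using i(2) by (auto simp: s_def sgn_if)
    define z' where "z' = (\<lambda>j\<in>{..<b}. z j + e i (- s) j)"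
    have z': "z' \<in> carrier (Zpow b)" by (auto simp: z'_def carrier_Zpow)
    have "(\<Sum>j<b. \<bar>z j\<bar>) = \<bar>z i\<bar> + (\<Sum>j\<in>{..<b} - {i}. \<bar>z j\<bar>)" using i(1) by (intro sum.remove) auto
    moreover have "(\<Sum>j<b. \<bar>z' j\<bar>) = \<bar>z' i\<bar> + (\<Sum>j\<in>{..<b} - {i}. \<bar>z' j\<bar>)" using i(1) by (intro sum.remove) auto
    moreover have "(\<Sum>j\<in>{..<b} - {i}. \<bar>z' j\<bar>) = (\<Sum>j\<in>{..<b} - {i}. \<bar>z j\<bar>)"
      by (intro sum.cong) (auto simp: z'_def e_def)
    moreover have "\<bar>z' i\<bar> = \<bar>z i\<bar> - 1" using i by (auto simp: z'_def e_def s_def sgn_if)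
    ultimately have "(\<Sum>j<b. \<bar>z' j\<bar>) = int n" using Suc.prems(2) by simp
    then have c: "connects (K * (1 + real n)) x (\<alpha> (shift z') x)" using Suc.IH z' by blast
    have "z = (\<lambda>j\<in>{..<b}. z' j + e i s j)"
      using Suc.prems(1) by (auto simp: z'_def e_def carrier_Zpow fun_eq_iff PiE_def extensional_def)
    then have sh: "shift z = shift z' \<otimes> shift (e i s)" using shift_mult[OF z' e] by simp
    have "connects (K * (1 + real n) + K) x (\<alpha> (shift z') (\<alpha> (shift (e i s)) x))"
      by (rule connects_trans[OF c connects_shift[OF gen[OF i(1) s] shift_closed[OF z']]])
    then show ?case
      unfolding sh using \<alpha>_comp[OF shift_closed[OF z'] shift_closed[OF e]] by (simp add: algebra_simps)
  qed
  from this[of _ "nat (\<Sum>i<b. \<bar>z i\<bar>)" for z]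
  have "connects (K * (1 + (\<Sum>i<b. \<bar>real_of_int (z i)\<bar>))) x (\<alpha> (shift z) x)" if "z \<in> carrier (Zpow b)" for z
    using that by (simp add: sum_nonneg of_nat_nat flip: of_int_abs of_int_sum)
  with K show thesis by (rule that)
qed

lemma relative_growth:
  assumes K: "\<And>z. z \<in> carrier (Zpow b) \<Longrightarrow> connects (K * (1 + (\<Sum>i<b. \<bar>real_of_int (z i)\<bar>))) x (\<alpha> (shift z) x)"
    and z: "z \<in> carrier (Zpow b)" and w: "w \<in> carrier (Zpow b)"
  shows "connects (K * (1 + (\<Sum>i<b. \<bar>real_of_int (w i - z i)\<bar>))) (\<alpha> (shift z) x) (\<alpha> (shift w) x)"
proof -
  define v where "v = (\<lambda>i\<in>{..<b}. w i - z i)"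
  have v: "v \<in> carrier (Zpow b)" by (auto simp: v_def carrier_Zpow)
  have "w = (\<lambda>i\<in>{..<b}. z i + v i)"
    using w by (auto simp: v_def carrier_Zpow fun_eq_iff PiE_def extensional_def)
  then have "shift w = shift z \<otimes> shift v" using shift_mult[OF z v] by simp
  then have "\<alpha> (shift w) x = \<alpha> (shift z) (\<alpha> (shift v) x)" using \<alpha>_comp[OF shift_closed[OF z] shift_closed[OF v]] by simp
  moreover have "(\<Sum>i<b. \<bar>real_of_int (v i)\<bar>) = (\<Sum>i<b. \<bar>real_of_int (w i - z i)\<bar>)"
    by (intro sum.cong) (auto simp: v_def)
  ultimately show ?thesis using connects_shift[OF K[OF v] shift_closed[OF z]] by simp
qed

end

context lattice_ham
begin

text \<open>For the first bound, travel from \<open>x1\<close> to \<open>x\<close>, along the ray, and from there to the translate of \<open>x1\<close>. For the second one,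
travel from \<open>x\<close> to \<open>x1\<close>, along a given chain to the translate of \<open>x1\<close>, and from there to the ray. The two connecting
parts take the time \<open>t\<close> each and have speed at most \<open>V\<close>.\<close>

lemma ray_detour:
  assumes \<omega>: "\<omega> \<in> space P" and z: "z \<in> carrier (Zpow b)" and w: "w \<in> carrier (Zpow b)"
    and K: "\<And>z. z \<in> carrier (Zpow b) \<Longrightarrow> connects (K * (1 + (\<Sum>i<b. \<bar>real_of_int (z i)\<bar>))) x (\<alpha> (shift z) x)"
    and R: "connects R x1 x" "connects R x x1"
    and N: "0 < N" "0 < n" and t: "0 < t"
    and V: "K * (1 + (\<Sum>i<b. \<bar>real_of_int (w i - int n * z i)\<bar>)) + R \<le> V * t"
  shows "cost \<omega> x1 (\<alpha> (shift w) x1) (real n * N + 2 * t) \<le> orbit_cost x (shift z) N n \<omega> + 2 * t * \<theta>conj V"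
    and "\<And>s c. reach \<omega> x1 (\<alpha> (shift w) x1) s c \<Longrightarrow> real n * N = s + 2 * t \<Longrightarrow> 0 < s \<Longrightarrow>
      orbit_cost x (shift z) N n \<omega> \<le> c + 2 * t * \<theta>conj V"
proof -
  define nz where "nz = (\<lambda>i\<in>{..<b}. int n * z i)"
  have nz: "nz \<in> carrier (Zpow b)" by (auto simp: nz_def carrier_Zpow)
  have pow: "shift z [^] n = shift nz" using shift_pow[OF z] by (simp add: nz_def)
  have nN: "0 < real n * N" using N by simp
  have orb: "orbit_cost x (shift z) N n \<omega> = cost \<omega> x (\<alpha> (shift nz) x) (real n * N)"
    using N(2) by (simp add: orbit_cost_def pow)
  define d where "d = (\<Sum>i<b. \<bar>real_of_int (w i - int n * z i)\<bar>)"
  have d: "(\<Sum>i<b. \<bar>real_of_int (w i - nz i)\<bar>) = d" "(\<Sum>i<b. \<bar>real_of_int (nz i - w i)\<bar>) = d"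
    unfolding d_def by (auto intro!: sum.cong simp: nz_def)
  have K1: "connects (K * (1 + d)) (\<alpha> (shift nz) x) (\<alpha> (shift w) x)"
    using relative_growth[OF K nz w] unfolding d(1) .
  have K2: "connects (K * (1 + d)) (\<alpha> (shift w) x) (\<alpha> (shift nz) x)"
    using relative_growth[OF K w nz] unfolding d(2) .
  have Kpos: "0 < K * (1 + d)" using K1 by (simp add: connects_def)
  then have RV: "R \<le> V * t" "K * (1 + d) + R \<le> V * t" "R + K * (1 + d) \<le> V * t" using V by (auto simp: d_def)
  have sw: "shift w \<in> carrier G" by (rule shift_closed[OF w])
  have end1: "connects (K * (1 + d) + R) (\<alpha> (shift nz) x) (\<alpha> (shift w) x1)"
    by (rule connects_trans[OF K1 connects_shift[OF R(2) sw]])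
  have end2: "connects (R + K * (1 + d)) (\<alpha> (shift w) x1) (\<alpha> (shift nz) x)"
    by (rule connects_trans[OF connects_shift[OF R(1) sw] K2])
  have "cost \<omega> x1 (\<alpha> (shift w) x1) (t + (real n * N + t)) \<le> cost \<omega> x1 x t + cost \<omega> x (\<alpha> (shift w) x1) (real n * N + t)"
    by (rule cost_trans[OF \<omega> t]) (use nN t in simp)
  moreover have "cost \<omega> x (\<alpha> (shift w) x1) (real n * N + t) \<le> cost \<omega> x (\<alpha> (shift nz) x) (real n * N) + cost \<omega> (\<alpha> (shift nz) x) (\<alpha> (shift w) x1) t"
    by (rule cost_trans[OF \<omega> nN t])
  moreover have "cost \<omega> x1 x t \<le> t * \<theta>conj V" by (rule cost_connects_le[OF R(1) \<omega> t RV(1)])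
  moreover have "cost \<omega> (\<alpha> (shift nz) x) (\<alpha> (shift w) x1) t \<le> t * \<theta>conj V" by (rule cost_connects_le[OF end1 \<omega> t RV(2)])
  moreover have "t + (real n * N + t) = real n * N + 2 * t" by simp
  ultimately show "cost \<omega> x1 (\<alpha> (shift w) x1) (real n * N + 2 * t) \<le> orbit_cost x (shift z) N n \<omega> + 2 * t * \<theta>conj V"
    unfolding orb by simp
  show "orbit_cost x (shift z) N n \<omega> \<le> c + 2 * t * \<theta>conj V"
    if s: "reach \<omega> x1 (\<alpha> (shift w) x1) s c" "real n * N = s + 2 * t" "0 < s" for s c
  proof -
    have "cost \<omega> x (\<alpha> (shift nz) x) (t + (s + t)) \<le> cost \<omega> x x1 t + cost \<omega> x1 (\<alpha> (shift nz) x) (s + t)"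
      by (rule cost_trans[OF \<omega> t]) (use s t in simp)
    moreover have "cost \<omega> x1 (\<alpha> (shift nz) x) (s + t) \<le> cost \<omega> x1 (\<alpha> (shift w) x1) s + cost \<omega> (\<alpha> (shift w) x1) (\<alpha> (shift nz) x) t"
      by (rule cost_trans[OF \<omega> s(3) t])
    moreover have "cost \<omega> x x1 t \<le> t * \<theta>conj V" by (rule cost_connects_le[OF R(2) \<omega> t RV(1)])
    moreover have "cost \<omega> (\<alpha> (shift w) x1) (\<alpha> (shift nz) x) t \<le> t * \<theta>conj V" by (rule cost_connects_le[OF end2 \<omega> t RV(3)])
    moreover have "cost \<omega> x1 (\<alpha> (shift w) x1) s \<le> c" by (rule cost_le[OF \<omega> s(1)])
    moreover have "t + (s + t) = real n * N" using s(2) by simp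
    ultimately show ?thesis unfolding orb by simp
  qed
qed

lemma min_action_le_cost:
  assumes "\<omega> \<in> space P" "0 < \<epsilon>" "cost \<omega> x y (1 / \<epsilon>) < e"
  shows "min_action A \<rho> H \<epsilon> x y 1 \<omega> \<le> ereal (\<epsilon> * e)"
proof -
  obtain a where a: "a < e" "reach \<omega> x y (1 / \<epsilon>) a"
    using cost_less_iff[OF assms(1), of "1 / \<epsilon>" x y e] assms(2,3) by auto
  have "min_action A \<rho> H \<epsilon> x y 1 \<omega> \<le> ereal (\<epsilon> * a)" by (rule reach_min_action[OF assms(1,2) a(2)])
  also have "\<dots> \<le> ereal (\<epsilon> * e)" using a(1) assms(2) by simp
  finally show ?thesis .
qed

text \<open>For the upper bound, the ray is followed for a time of about \<open>(1 - \<eta>) / \<epsilon>\<close>, and the remaining time of about \<open>\<eta> / \<epsilon>\<close>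
suffices to join the endpoints at bounded speed. For the lower bound, a curve of small action gives a chain of duration
at most \<open>(1 + \<eta>) / \<epsilon>\<close>, which is completed to a chain that competes with the ray over the time \<open>(1 + 2 * \<eta>) / \<epsilon>\<close>. The
constant \<open>D\<close> must not depend on \<open>x1\<close>, \<open>\<omega>\<close> and \<open>\<eta>\<close>. The distance \<open>R\<close> from \<open>x1\<close> to the base point does not enter, because it is
negligible compared with \<open>\<eta> / \<epsilon>\<close>.\<close>

lemma action_near_ray_cost:
  obtains D where "\<And>x1 \<omega> \<eta> N z l w. \<omega> \<in> space P \<Longrightarrow> 0 < \<eta> \<Longrightarrow> \<eta> < 1 / 2 \<Longrightarrow> 0 < N \<Longrightarrow> z \<in> carrier (Zpow b) \<Longrightarrow>
      (\<And>i. i < b \<Longrightarrow> \<bar>h i - real_of_int (z i) / N\<bar> \<le> \<eta>) \<Longrightarrow>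
      (\<lambda>n. orbit_cost x (shift z) N n \<omega> / real n) \<longlonglongrightarrow> l \<Longrightarrow>
      \<forall>\<^sub>F \<epsilon> in at_right 0. w \<epsilon> \<in> carrier (Zpow b) \<and> (\<forall>i<b. \<bar>\<epsilon> * real_of_int (w \<epsilon> i) - h i\<bar> \<le> \<eta>) \<Longrightarrow>
      \<forall>\<^sub>F \<epsilon> in at_right 0. ereal (l / N - D * \<eta>) \<le> min_action A \<rho> H \<epsilon> x1 (\<alpha> (shift (w \<epsilon>)) x1) 1 \<omega> \<and>
         min_action A \<rho> H \<epsilon> x1 (\<alpha> (shift (w \<epsilon>)) x1) 1 \<omega> \<le> ereal (l / N + D * \<eta>)"
proof -
  obtain K where K: "0 < K" "\<And>z. z \<in> carrier (Zpow b) \<Longrightarrow>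
      connects (K * (1 + (\<Sum>i<b. \<bar>real_of_int (z i)\<bar>))) x (\<alpha> (shift z) x)"
    using linear_growth[of x] by blast
  define Dh where "Dh = 4 * real b + 3 * (\<Sum>i<b. \<bar>h i\<bar>)"
  have Dh: "0 \<le> Dh" unfolding Dh_def by (intro add_nonneg_nonneg mult_nonneg_nonneg sum_nonneg) auto
  define V where "V = 2 * (K * Dh) + 2"
  define U where "U = \<bar>\<theta>conj V\<bar>"
  define D where "D = 2 * \<bar>\<Theta> 0\<bar> + 5 + 3 * U"
  have D_pos: "0 \<le> U" "0 \<le> D" by (auto simp: U_def D_def)
  show thesis
  proof (rule that[of D])
    fix x1 \<omega> \<eta> N z l w
    assume \<omega>: "\<omega> \<in> space P" and \<eta>: "0 < \<eta>" "\<eta> < 1 / 2" and N: "0 < N" and z: "z \<in> carrier (Zpow b)"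
      and hz: "\<And>i. i < b \<Longrightarrow> \<bar>h i - real_of_int (z i) / N\<bar> \<le> \<eta>"
      and lim: "(\<lambda>n. orbit_cost x (shift z) N n \<omega> / real n) \<longlonglongrightarrow> l"
      and w: "\<forall>\<^sub>F \<epsilon> in at_right 0. w \<epsilon> \<in> carrier (Zpow b) \<and> (\<forall>i<b. \<bar>\<epsilon> * real_of_int (w \<epsilon> i) - h i\<bar> \<le> \<eta>)"
    let ?u = "\<lambda>\<epsilon>. min_action A \<rho> H \<epsilon> x1 (\<alpha> (shift (w \<epsilon>)) x1) 1 \<omega>"
    obtain R1 where R1: "connects R1 x1 x" using connects_exists by blast
    obtain R2 where R2: "connects R2 x x1" using connects_exists by blast
    define R where "R = max R1 R2"
    have R: "connects R x1 x" "connects R x x1"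
      using connects_mono[OF R1, of R] connects_mono[OF R2, of R] by (auto simp: R_def)
    have R_pos: "0 < R" using R(1) by (simp add: connects_def)
    define a where "a n = orbit_cost x (shift z) N n \<omega>" for n
    define \<mu> where "\<mu> = l / N"
    have a_lim: "(\<lambda>n. a n / real n) \<longlonglongrightarrow> l" unfolding a_def by (rule lim)
    have "- \<Theta> 0 * N \<le> l"
    proof (rule tendsto_lowerbound[OF a_lim])
      show "\<forall>\<^sub>F n in sequentially. - \<Theta> 0 * N \<le> a n / real n"
        using eventually_gt_at_top[of 0]
      proof eventually_elim
        case (elim n)
        have "- \<Theta> 0 * (real n * N) \<le> a n" using cost_lower[OF \<omega>, of "real n * N"] elim N by (simp add: a_def orbit_cost_def)
        then show ?case using elim by (simp add: pos_le_divide_eq mult_ac)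
      qed
    qed simp
    then have "- \<Theta> 0 \<le> \<mu>" using N by (simp add: \<mu>_def pos_le_divide_eq)
    then have \<mu>: "- \<bar>\<Theta> 0\<bar> \<le> \<mu>" by linarith
    have base: "\<forall>\<^sub>F \<epsilon> in at_right 0. 0 < \<epsilon> \<and> N \<le> \<eta> * (1 / \<epsilon>) \<and> K + R \<le> \<eta> * (1 / \<epsilon>)"
    proof -
      have "\<forall>\<^sub>F \<epsilon> in at_right 0. \<epsilon> \<in> {0<..<\<eta> / (N + (K + R))}"
        by (rule eventually_at_right_real) (use \<eta> N K R_pos in simp)
      then show ?thesis
      proof eventually_elim
        case (elim \<epsilon>)
        have s: "0 < N + (K + R)" using N K R_pos by simp
        have "\<epsilon> * (N + (K + R)) \<le> \<eta>" using elim s by (simp add: pos_less_divide_eq)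
        then have "N + (K + R) \<le> \<eta> * (1 / \<epsilon>)" using elim by (simp add: pos_le_divide_eq mult.commute)
        then show ?case using elim N K(1) R_pos by auto
      qed
    qed
    \<comment> \<open>a connecting part of duration \<open>t\<close>, at least \<open>\<eta> / (2 * \<epsilon>)\<close>, has speed at most \<open>V\<close>\<close>
    have legs: "K * (1 + (\<Sum>i<b. \<bar>real_of_int (w \<epsilon> i - int n * z i)\<bar>)) + R \<le> V * t"
      if \<epsilon>: "0 < \<epsilon>" "K + R \<le> \<eta> * (1 / \<epsilon>)" and w: "\<forall>i<b. \<bar>\<epsilon> * real_of_int (w \<epsilon> i) - h i\<bar> \<le> \<eta>"
        and n: "\<bar>real n * N - 1 / \<epsilon>\<bar> \<le> 3 * \<eta> * (1 / \<epsilon>)" and t: "\<eta> * (1 / \<epsilon>) \<le> 2 * t" for \<epsilon> n t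
    proof -
      have "(\<Sum>i<b. \<bar>real_of_int (w \<epsilon> i - int n * z i)\<bar>) \<le> \<eta> * (1 / \<epsilon>) * Dh"
        unfolding Dh_def
        by (rule lattice_displacement[OF \<eta>(1) less_imp_le[OF \<eta>(2)] _ N hz _ n]) (use \<epsilon> w in \<open>auto simp: mult.commute\<close>)
      also have "\<dots> \<le> 2 * t * Dh" using t Dh by (intro mult_right_mono)
      finally have "K * (\<Sum>i<b. \<bar>real_of_int (w \<epsilon> i - int n * z i)\<bar>) \<le> K * (2 * t * Dh)"
        using K(1) by (intro mult_left_mono) auto
      then show ?thesis using \<epsilon> t by (simp add: V_def algebra_simps)
    qed
    have half: "2 * (r / 2) = r" for r :: real by simp
    define n where "n \<epsilon> = nat \<lfloor>(1 - \<eta>) * (1 / \<epsilon>) / N\<rfloor>" for \<epsilon>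
    define m where "m \<epsilon> = nat \<lceil>(1 + 2 * \<eta>) * (1 / \<epsilon>) / N\<rceil>" for \<epsilon>
    have n: "real (n \<epsilon>) * N \<le> (1 - \<eta>) * (1 / \<epsilon>) \<and> (1 - \<eta>) * (1 / \<epsilon>) - N \<le> real (n \<epsilon>) * N" if \<epsilon>: "0 < \<epsilon>" for \<epsilon>
    proof -
      define q where "q = (1 - \<eta>) * (1 / \<epsilon>) / N"
      have q: "0 \<le> q" "q * N = (1 - \<eta>) * (1 / \<epsilon>)" using \<epsilon> \<eta> N by (auto simp: q_def)
      have "real (n \<epsilon>) = of_int \<lfloor>q\<rfloor>" using q(1) by (simp add: n_def q_def)
      then have "real (n \<epsilon>) \<le> q" "q - 1 \<le> real (n \<epsilon>)" by linarith+
      then have "real (n \<epsilon>) * N \<le> q * N" "(q - 1) * N \<le> real (n \<epsilon>) * N" using N by (auto intro!: mult_right_mono)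
      then show ?thesis unfolding q(2)[symmetric] by (simp add: algebra_simps)
    qed
    have m: "(1 + 2 * \<eta>) * (1 / \<epsilon>) \<le> real (m \<epsilon>) * N \<and> real (m \<epsilon>) * N \<le> (1 + 2 * \<eta>) * (1 / \<epsilon>) + N" if \<epsilon>: "0 < \<epsilon>" for \<epsilon>
    proof -
      define q where "q = (1 + 2 * \<eta>) * (1 / \<epsilon>) / N"
      have q: "0 \<le> q" "q * N = (1 + 2 * \<eta>) * (1 / \<epsilon>)" using \<epsilon> \<eta> N by (auto simp: q_def)
      have "real (m \<epsilon>) = of_int \<lceil>q\<rceil>" using q(1) by (simp add: m_def q_def)
      then have "q \<le> real (m \<epsilon>)" "real (m \<epsilon>) \<le> q + 1" by linarith+
      then have "q * N \<le> real (m \<epsilon>) * N" "real (m \<epsilon>) * N \<le> (q + 1) * N" using N by (auto intro!: mult_right_mono)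
      then show ?thesis unfolding q(2)[symmetric] by (simp add: algebra_simps)
    qed
    have n_lim: "((\<lambda>\<epsilon>. \<epsilon> * a (n \<epsilon>)) \<longlongrightarrow> (1 - \<eta>) * \<mu>) (at_right 0)"
      unfolding \<mu>_def
    proof (rule rescaled_limit[OF a_lim _ N])
      show "\<forall>\<^sub>F \<epsilon> in at_right 0. \<bar>real (n \<epsilon>) * N - (1 - \<eta>) / \<epsilon>\<bar> \<le> N"
        using base by eventually_elim (use n N in fastforce)
    qed (use \<eta> in simp)
    have m_lim: "((\<lambda>\<epsilon>. \<epsilon> * a (m \<epsilon>)) \<longlongrightarrow> (1 + 2 * \<eta>) * \<mu>) (at_right 0)"
      unfolding \<mu>_def
    proof (rule rescaled_limit[OF a_lim _ N])
      show "\<forall>\<^sub>F \<epsilon> in at_right 0. \<bar>real (m \<epsilon>) * N - (1 + 2 * \<eta>) / \<epsilon>\<bar> \<le> N"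
        using base by eventually_elim (use m N in fastforce)
    qed (use \<eta> in simp)
    have n_ev: "\<forall>\<^sub>F \<epsilon> in at_right 0. \<epsilon> * a (n \<epsilon>) < (1 - \<eta>) * \<mu> + \<eta>"
      by (rule order_tendstoD(2)[OF n_lim]) (use \<eta> in simp)
    have m_ev: "\<forall>\<^sub>F \<epsilon> in at_right 0. (1 + 2 * \<eta>) * \<mu> - \<eta> < \<epsilon> * a (m \<epsilon>)"
      by (rule order_tendstoD(1)[OF m_lim]) (use \<eta> in simp)
    have "\<forall>\<^sub>F \<epsilon> in at_right 0. ?u \<epsilon> \<le> ereal (\<mu> + D * \<eta>)"
      using base w n_ev
    proof eventually_elim
      case (elim \<epsilon>)
      then have \<epsilon>: "0 < \<epsilon>" "N \<le> \<eta> * (1 / \<epsilon>)" "K + R \<le> \<eta> * (1 / \<epsilon>)" by auto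
      define t where "t = (1 / \<epsilon> - real (n \<epsilon>) * N) / 2"
      have nb: "real (n \<epsilon>) * N \<le> 1 / \<epsilon> - \<eta> * (1 / \<epsilon>)" "1 / \<epsilon> - \<eta> * (1 / \<epsilon>) - N \<le> real (n \<epsilon>) * N"
        using n[OF \<epsilon>(1)] by (auto simp: diff_divide_distrib)
      have \<eta>\<epsilon>: "0 < \<eta> * (1 / \<epsilon>)" "2 * (\<eta> * (1 / \<epsilon>)) < 1 / \<epsilon>"
        using \<eta> \<epsilon>(1) by (auto simp: divide_strict_right_mono)
      have t: "\<eta> * (1 / \<epsilon>) \<le> 2 * t" "2 * t \<le> 2 * (\<eta> * (1 / \<epsilon>))" "real (n \<epsilon>) * N + 2 * t = 1 / \<epsilon>"
        using nb \<epsilon>(2) half[of "1 / \<epsilon> - real (n \<epsilon>) * N"] unfolding t_def by - linarith+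
      have t0: "0 < t" using t(1) \<eta>\<epsilon>(1) by linarith
      have n0: "0 < n \<epsilon>"
        using t(2,3) \<eta>\<epsilon>(2) by (cases "n \<epsilon>") auto
      have nn: "\<bar>real (n \<epsilon>) * N - 1 / \<epsilon>\<bar> \<le> 3 * \<eta> * (1 / \<epsilon>)" using t \<eta>\<epsilon> by linarith
      have wi: "\<forall>i<b. \<bar>\<epsilon> * real_of_int (w \<epsilon> i) - h i\<bar> \<le> \<eta>" "w \<epsilon> \<in> carrier (Zpow b)" using elim(2) by auto
      have "cost \<omega> x1 (\<alpha> (shift (w \<epsilon>)) x1) (1 / \<epsilon>) \<le> a (n \<epsilon>) + 2 * t * \<theta>conj V"
        using ray_detour(1)[OF \<omega> z wi(2) K(2) R N n0 t0 legs[OF \<epsilon>(1,3) wi(1) nn t(1)]] unfolding t(3) a_def .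
      also have "2 * t * \<theta>conj V \<le> 2 * (\<eta> * (1 / \<epsilon>)) * U"
        
          using t0 D_pos(1) by (intro order_trans[OF mult_left_mono mult_right_mono[OF t(2)]]) (auto simp: U_def)
      also have "a (n \<epsilon>) + 2 * (\<eta> * (1 / \<epsilon>)) * U < a (n \<epsilon>) + 2 * (\<eta> * (1 / \<epsilon>)) * U + \<eta> * (1 / \<epsilon>)"
        using \<eta>\<epsilon> by simp
      finally have "?u \<epsilon> \<le> ereal (\<epsilon> * (a (n \<epsilon>) + 2 * (\<eta> * (1 / \<epsilon>)) * U + \<eta> * (1 / \<epsilon>)))"
        by (intro min_action_le_cost[OF \<omega> \<epsilon>(1)]) simp
      also have "\<epsilon> * (a (n \<epsilon>) + 2 * (\<eta> * (1 / \<epsilon>)) * U + \<eta> * (1 / \<epsilon>)) = \<epsilon> * a (n \<epsilon>) + 2 * \<eta> * U + \<eta>"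
        using \<epsilon>(1) by (simp add: field_simps)
      also have "ereal \<dots> \<le> ereal (\<mu> + D * \<eta>)"
      proof -
        have "- (\<eta> * \<mu>) \<le> \<eta> * \<bar>\<Theta> 0\<bar>" using mult_left_mono[OF \<mu>, of \<eta>] \<eta> by simp
        moreover have "0 \<le> \<eta> * U" "0 \<le> \<eta> * \<bar>\<Theta> 0\<bar>" using \<eta> D_pos by auto
        moreover have "D * \<eta> = 2 * (\<eta> * \<bar>\<Theta> 0\<bar>) + 5 * \<eta> + 3 * (\<eta> * U)" by (simp add: D_def algebra_simps)
        moreover have "(1 - \<eta>) * \<mu> = \<mu> - \<eta> * \<mu>" by (simp add: algebra_simps)
        ultimately have "\<epsilon> * a (n \<epsilon>) + 2 * \<eta> * U + \<eta> \<le> \<mu> + D * \<eta>" using elim(3) \<eta> by linarith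
        then show ?thesis by simp
      qed
      finally show ?case .
    qed
    moreover have "\<forall>\<^sub>F \<epsilon> in at_right 0. ereal (\<mu> - D * \<eta>) \<le> ?u \<epsilon>"
      using base w m_ev
    proof eventually_elim
      case (elim \<epsilon>)
      then have \<epsilon>: "0 < \<epsilon>" "N \<le> \<eta> * (1 / \<epsilon>)" "K + R \<le> \<eta> * (1 / \<epsilon>)" by auto
      define v where "v = (1 + 2 * \<eta>) * \<mu> - 4 * \<eta> - 3 * \<eta> * U"
      have "ereal v \<le> ?u \<epsilon>"
      proof (rule ccontr)
        assume "\<not> ereal v \<le> ?u \<epsilon>"
        then have lt: "?u \<epsilon> < ereal v" by simp
        \<comment> \<open>with this \<open>\<kappa>\<close>, a curve of action less than \<open>v\<close> gives a chain of duration at most \<open>(1 + \<eta>) / \<epsilon>\<close>\<close>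
        define B where "B = v + (\<bar>\<Theta> 0\<bar> + 2)"
        define \<kappa> where "\<kappa> = \<eta> / (1 + \<bar>B\<bar>)"
        have \<kappa>: "0 < \<kappa>" "\<kappa> \<le> \<eta>" "\<kappa> * B \<le> \<eta>"
        proof -
          show "0 < \<kappa>" using \<eta> by (simp add: \<kappa>_def add_pos_nonneg)
          show "\<kappa> \<le> \<eta>" using \<eta> by (simp add: \<kappa>_def divide_le_eq add_pos_nonneg)
          have "\<kappa> * B \<le> \<kappa> * (1 + \<bar>B\<bar>)" using \<open>0 < \<kappa>\<close> by (intro mult_left_mono) auto
          also have "\<dots> = \<eta>" by (simp add: \<kappa>_def)
          finally show "\<kappa> * B \<le> \<eta>" .
        qed
        have \<kappa>1: "\<kappa> \<le> 1" using \<kappa>(2) \<eta> by simp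
        obtain s c where s: "reach \<omega> x1 (\<alpha> (shift (w \<epsilon>)) x1) s c" "1 / \<epsilon> \<le> s"
          "s \<le> (1 + \<kappa> * (v + (\<bar>\<Theta> 0\<bar> + 2))) / \<epsilon>" "c \<le> (v + 3 * \<kappa>) / \<epsilon>"
          using curve_to_chain[OF \<omega> \<epsilon>(1) \<kappa>(1) \<kappa>1 H_cont[OF \<omega>] lt] by blast
        have s3: "s \<le> 1 / \<epsilon> + \<eta> * (1 / \<epsilon>)"
        proof -
          have "(1 + \<kappa> * (v + (\<bar>\<Theta> 0\<bar> + 2))) / \<epsilon> \<le> (1 + \<eta>) / \<epsilon>"
            using \<kappa>(3) \<epsilon>(1) by (intro divide_right_mono) (auto simp: B_def)
          then show ?thesis using s(3) by (simp add: add_divide_distrib)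
        qed
        have c: "c \<le> (v + 3 * \<eta>) * (1 / \<epsilon>)"
        proof -
          have "(v + 3 * \<kappa>) / \<epsilon> \<le> (v + 3 * \<eta>) / \<epsilon>" using \<kappa>(2) \<epsilon>(1) by (intro divide_right_mono) auto
          then show ?thesis using s(4) by simp
        qed
        define t where "t = (real (m \<epsilon>) * N - s) / 2"
        have mb: "1 / \<epsilon> + 2 * (\<eta> * (1 / \<epsilon>)) \<le> real (m \<epsilon>) * N" "real (m \<epsilon>) * N \<le> 1 / \<epsilon> + 2 * (\<eta> * (1 / \<epsilon>)) + N"
          using m[OF \<epsilon>(1)] by (auto simp: add_divide_distrib)
        have \<eta>\<epsilon>: "0 < \<eta> * (1 / \<epsilon>)" "0 < 1 / \<epsilon>" using \<eta> \<epsilon>(1) by auto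
        have t: "\<eta> * (1 / \<epsilon>) \<le> 2 * t" "2 * t \<le> 3 * (\<eta> * (1 / \<epsilon>))" "real (m \<epsilon>) * N = s + 2 * t"
          using mb \<epsilon>(2) s(2) s3 half[of "real (m \<epsilon>) * N - s"] unfolding t_def by - linarith+
        have t0: "0 < t" using t(1) \<eta>\<epsilon>(1) by linarith
        have s0: "0 < s" using s(2) \<eta>\<epsilon>(2) by linarith
        have m0: "0 < m \<epsilon>" using t(3) t0 s0 by (cases "m \<epsilon>") auto
        have nn: "\<bar>real (m \<epsilon>) * N - 1 / \<epsilon>\<bar> \<le> 3 * \<eta> * (1 / \<epsilon>)" using mb \<eta>\<epsilon> \<epsilon>(2) by linarith
        have wi: "\<forall>i<b. \<bar>\<epsilon> * real_of_int (w \<epsilon> i) - h i\<bar> \<le> \<eta>" "w \<epsilon> \<in> carrier (Zpow b)" using elim(2) by auto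
        have "a (m \<epsilon>) \<le> c + 2 * t * \<theta>conj V"
          unfolding a_def
          by (rule ray_detour(2)[OF \<omega> z wi(2) K(2) R N m0 t0 legs[OF \<epsilon>(1,3) wi(1) nn t(1)] s(1) t(3) s0])
        also have "2 * t * \<theta>conj V \<le> 3 * (\<eta> * (1 / \<epsilon>)) * U"
          
          using t0 D_pos(1) by (intro order_trans[OF mult_left_mono mult_right_mono[OF t(2)]]) (auto simp: U_def)
        also have "c + 3 * (\<eta> * (1 / \<epsilon>)) * U \<le> (v + 3 * \<eta>) * (1 / \<epsilon>) + 3 * (\<eta> * (1 / \<epsilon>)) * U"
          using c by simp
        also have "\<dots> = ((1 + 2 * \<eta>) * \<mu> - \<eta>) / \<epsilon>" by (simp add: v_def algebra_simps add_divide_distrib diff_divide_distrib)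
        finally have "\<epsilon> * a (m \<epsilon>) \<le> (1 + 2 * \<eta>) * \<mu> - \<eta>" using \<epsilon>(1) by (simp add: pos_le_divide_eq mult.commute)
        then show False using elim(3) by simp
      qed
      moreover have "\<mu> - D * \<eta> \<le> v"
      proof -
        have "- (2 * \<eta> * \<mu>) \<le> 2 * \<eta> * \<bar>\<Theta> 0\<bar>" using mult_left_mono[OF \<mu>, of "2 * \<eta>"] \<eta> by simp
        then show ?thesis using \<eta> by (simp add: v_def D_def algebra_simps)
      qed
      ultimately show ?case by (meson ereal_less_eq(3) order_trans)
    qed
    ultimately show "\<forall>\<^sub>F \<epsilon> in at_right 0. ereal (l / N - D * \<eta>) \<le> ?u \<epsilon> \<and> ?u \<epsilon> \<le> ereal (l / N + D * \<eta>)"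
      unfolding \<mu>_def by eventually_elim simp
  qed
qed

end

section \<open>The effective Lagrangian\<close>

lemma tendsto_ereal_of_approximations:
  fixes u :: "real \<Rightarrow> ereal"
  assumes near: "\<And>j::nat. \<forall>\<^sub>F \<epsilon> in F. ereal (l j - d j) \<le> u \<epsilon> \<and> u \<epsilon> \<le> ereal (l j + d j)"
    and l: "l \<longlonglongrightarrow> L" and d: "d \<longlonglongrightarrow> 0"
  shows "(u \<longlongrightarrow> ereal L) F"
proof (rule order_tendstoI)
  fix a assume a: "a < ereal L"
  have "(\<lambda>j. ereal (l j - d j)) \<longlonglongrightarrow> ereal L"
    using tendsto_diff[OF l d] by simp
  from order_tendstoD(1)[OF this a] obtain j where "a < ereal (l j - d j)"
    using eventually_happens' sequentially_bot by blast
  then show "\<forall>\<^sub>F \<epsilon> in F. a < u \<epsilon>" using near[of j] by (auto elim: eventually_mono)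
next
  fix a assume a: "ereal L < a"
  have "(\<lambda>j. ereal (l j + d j)) \<longlonglongrightarrow> ereal L"
    using tendsto_add[OF l d] by simp
  from order_tendstoD(2)[OF this a] obtain j where "ereal (l j + d j) < a"
    using eventually_happens' sequentially_bot by blast
  then show "\<forall>\<^sub>F \<epsilon> in F. u \<epsilon> < a" using near[of j] by (auto elim: eventually_mono)
qed

text \<open>Two approximations of the same function differ by at most the sum of their errors.\<close>

lemma convergent_of_approximations:
  fixes u :: "real \<Rightarrow> ereal"
  assumes near: "\<And>j::nat. \<forall>\<^sub>F \<epsilon> in F. ereal (l j - d j) \<le> u \<epsilon> \<and> u \<epsilon> \<le> ereal (l j + d j)"
    and d: "d \<longlonglongrightarrow> 0" and F: "F \<noteq> bot"
  shows "convergent l"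
proof -
  have close: "\<bar>l i - l j\<bar> \<le> d i + d j" for i j
  proof -
    have "\<exists>\<epsilon>. (ereal (l i - d i) \<le> u \<epsilon> \<and> u \<epsilon> \<le> ereal (l i + d i)) \<and> (ereal (l j - d j) \<le> u \<epsilon> \<and> u \<epsilon> \<le> ereal (l j + d j))"
      by (rule eventually_happens'[OF F eventually_conj[OF near near]])
    then obtain \<epsilon> where "ereal (l i - d i) \<le> u \<epsilon>" "u \<epsilon> \<le> ereal (l i + d i)" "ereal (l j - d j) \<le> u \<epsilon>" "u \<epsilon> \<le> ereal (l j + d j)" by blast
    then have "ereal (l i - d i) \<le> ereal (l j + d j)" "ereal (l j - d j) \<le> ereal (l i + d i)" by (meson order_trans)+
    then show ?thesis by (simp add: abs_le_iff)
  qed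
  have "Cauchy l"
  proof (rule CauchyI)
    fix e :: real assume e: "0 < e"
    obtain N where N: "\<And>n. n \<ge> N \<Longrightarrow> d n < e / 2"
      using order_tendstoD(2)[OF d, of "e / 2"] e unfolding eventually_sequentially by auto
    show "\<exists>M. \<forall>m\<ge>M. \<forall>n\<ge>M. norm (l m - l n) < e"
    proof (intro exI allI impI)
      fix m n assume "N \<le> m" "N \<le> n"
      then show "norm (l m - l n) < e" using N[of m] N[of n] close[of m n] by simp
    qed
  qed
  then show ?thesis by (rule Cauchy_convergent)
qed

context lattice_ham
begin

lemma lattice_ray_limits:
  obtains \<Omega> l where "\<Omega> \<in> sets P" "prob \<Omega> = 1"
    "\<And>\<omega> z N. \<omega> \<in> \<Omega> \<Longrightarrow> z \<in> carrier (Zpow b) \<Longrightarrow>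
       (\<lambda>n. orbit_cost x (shift z) (real (Suc N)) n \<omega> / real n) \<longlonglongrightarrow> l z N"
proof -
  define R where "R z N l \<omega> \<longleftrightarrow> (\<lambda>n. orbit_cost x (shift z) (real (Suc N)) n \<omega> / real n) \<longlonglongrightarrow> l" for z N l \<omega>
  define l where "l z N = (SOME l. AE \<omega> in P. R z N l \<omega>)" for z N
  have l: "AE \<omega> in P. R z N (l z N) \<omega>" if z: "z \<in> carrier (Zpow b)" for z N
  proof -
    obtain l' where "AE \<omega> in P. R z N l' \<omega>"
      unfolding R_def using orbit_cost_limit[OF shift_closed[OF z], of "real (Suc N)" x] by auto
    then show ?thesis unfolding l_def by (rule someI)
  qed
  have "countable (carrier (Zpow b))" unfolding carrier_Zpow by (intro countable_PiE) auto
  then have "AE \<omega> in P. \<forall>z\<in>carrier (Zpow b). \<forall>N. R z N (l z N) \<omega>"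
    using l by (simp add: AE_ball_countable AE_all_countable)
  then obtain E where E: "E \<in> sets P" "emeasure P E = 0" "{\<omega> \<in> space P. \<not> (\<forall>z\<in>carrier (Zpow b). \<forall>N. R z N (l z N) \<omega>)} \<subseteq> E"
    by (auto elim: AE_E)
  show thesis
  proof (rule that[of "space P - E" l])
    show "space P - E \<in> sets P" using E(1) by blast
    show "prob (space P - E) = 1" using prob_compl[OF E(1)] E(2) by (simp add: measure_def)
    fix \<omega> z N assume "\<omega> \<in> space P - E" "z \<in> carrier (Zpow b)"
    then show "(\<lambda>n. orbit_cost x (shift z) (real (Suc N)) n \<omega> / real n) \<longlonglongrightarrow> l z N"
      using E(3) unfolding R_def by blast
  qed
qed

text \<open>The torsion part \<open>k\<close> moves the starting point and the target by the same element, so it only changes the starting point,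
on which the limit does not depend. The vector \<open>h\<close> is approximated by \<open>\<lfloor>N * h\<rfloor> / N\<close>, with \<open>N = j + 3\<close> to have an error below
\<open>1 / 2\<close>.\<close>

lemma min_action_converges:
  fixes \<Phi> :: "real \<Rightarrow> (nat \<Rightarrow> real) \<Rightarrow> (nat \<Rightarrow> int)" and C :: "real \<Rightarrow> real"
  assumes \<Phi>: "\<forall>\<epsilon>>0. \<forall>h\<in>Rpow b. \<Phi> \<epsilon> h \<in> carrier (Zpow b) \<and>
        L2_set (\<lambda>i. \<epsilon> * of_int (\<Phi> \<epsilon> h i) - h i) {..<b} \<le> C \<epsilon>"
      and C: "(C \<longlongrightarrow> 0) (at_right 0)"
  shows "\<exists>(Lbar :: (nat \<Rightarrow> real) \<Rightarrow> real). \<exists>\<Omega>bar\<in>sets P. measure P \<Omega>bar = 1 \<and>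
    (\<forall>x. \<forall>k\<in>carrier T. \<forall>h\<in>Rpow b. \<forall>\<omega>\<in>\<Omega>bar.
       ((\<lambda>\<epsilon>. min_action A \<rho> H \<epsilon> (\<alpha> (\<iota> (\<one>\<^bsub>Zpow b\<^esub>, k)) x) (\<alpha> (\<iota> (\<Phi> \<epsilon> h, k)) x) 1 \<omega>)
          \<longlongrightarrow> ereal (Lbar h)) (at_right 0))"
proof -
  define x0 :: 'm where "x0 = (SOME x. True)"
  obtain \<Omega> l where \<Omega>: "\<Omega> \<in> sets P" "prob \<Omega> = 1"
    and l: "\<And>\<omega> z N. \<omega> \<in> \<Omega> \<Longrightarrow> z \<in> carrier (Zpow b) \<Longrightarrow>
       (\<lambda>n. orbit_cost x0 (shift z) (real (Suc N)) n \<omega> / real n) \<longlonglongrightarrow> l z N"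
    by (rule lattice_ray_limits[of x0]) (rule that)
  define z where "z h j = (\<lambda>i\<in>{..<b}. \<lfloor>real (Suc (j + 2)) * h i\<rfloor>)" for h :: "nat \<Rightarrow> real" and j
  define \<mu> where "\<mu> h j = l (z h j) (j + 2) / real (Suc (j + 2))" for h j
  define \<eta> where "\<eta> j = 1 / real (Suc (j + 2))" for j
  have \<eta>: "0 < \<eta> j" "\<eta> j < 1 / 2" for j by (auto simp: \<eta>_def field_simps)
  have z: "z h j \<in> carrier (Zpow b)" for h j by (auto simp: z_def carrier_Zpow)
  have hz: "\<bar>h i - real_of_int (z h j i) / real (Suc (j + 2))\<bar> \<le> \<eta> j" if "i < b" for h j i
  proof -
    define N where "N = real (Suc (j + 2))"
    have N: "0 < N" by (simp add: N_def)
    have "\<bar>N * h i - of_int \<lfloor>N * h i\<rfloor>\<bar> \<le> 1" by linarith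
    then have "\<bar>N * h i - of_int \<lfloor>N * h i\<rfloor>\<bar> / N \<le> 1 / N" using N by (intro divide_right_mono) auto
    moreover have "\<bar>N * h i - of_int \<lfloor>N * h i\<rfloor>\<bar> / N = \<bar>h i - of_int \<lfloor>N * h i\<rfloor> / N\<bar>"
    proof -
      have "h i - of_int \<lfloor>N * h i\<rfloor> / N = (N * h i - of_int \<lfloor>N * h i\<rfloor>) / N" using N by (simp add: diff_divide_distrib)
      then show ?thesis using N by (simp only: abs_divide abs_of_pos)
    qed
    ultimately show ?thesis unfolding z_def \<eta>_def N_def[symmetric] using that by simp
  qed
  have "(\<lambda>j. 1 / real (Suc j)) \<longlonglongrightarrow> 0" using LIMSEQ_inverse_real_of_nat by (simp add: inverse_eq_divide)
  from LIMSEQ_ignore_initial_segment[OF this, of 2] have \<eta>0: "\<eta> \<longlonglongrightarrow> 0" by (simp add: \<eta>_def[abs_def])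
  define u where "u h x k \<omega> = (\<lambda>\<epsilon>. min_action A \<rho> H \<epsilon> (\<alpha> (\<iota> (\<one>\<^bsub>Zpow b\<^esub>, k)) x) (\<alpha> (\<iota> (\<Phi> \<epsilon> h, k)) x) 1 \<omega>)" for h x k \<omega>
  define near where "near h D \<longleftrightarrow> (\<forall>x. \<forall>k\<in>carrier T. \<forall>\<omega>\<in>\<Omega>. \<forall>j.
      \<forall>\<^sub>F \<epsilon> in at_right 0. ereal (\<mu> h j - D * \<eta> j) \<le> u h x k \<omega> \<epsilon> \<and> u h x k \<omega> \<epsilon> \<le> ereal (\<mu> h j + D * \<eta> j))" for h D
  have "\<exists>D. near h D" if h: "h \<in> Rpow b" for h
  proof -
    obtain D where D: "\<And>x1 \<omega> \<eta> N z l w. \<omega> \<in> space P \<Longrightarrow> 0 < \<eta> \<Longrightarrow> \<eta> < 1 / 2 \<Longrightarrow> 0 < N \<Longrightarrow> z \<in> carrier (Zpow b) \<Longrightarrow>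
      (\<And>i. i < b \<Longrightarrow> \<bar>h i - real_of_int (z i) / N\<bar> \<le> \<eta>) \<Longrightarrow>
      (\<lambda>n. orbit_cost x0 (shift z) N n \<omega> / real n) \<longlonglongrightarrow> l \<Longrightarrow>
      \<forall>\<^sub>F \<epsilon> in at_right 0. w \<epsilon> \<in> carrier (Zpow b) \<and> (\<forall>i<b. \<bar>\<epsilon> * real_of_int (w \<epsilon> i) - h i\<bar> \<le> \<eta>) \<Longrightarrow>
      \<forall>\<^sub>F \<epsilon> in at_right 0. ereal (l / N - D * \<eta>) \<le> min_action A \<rho> H \<epsilon> x1 (\<alpha> (shift (w \<epsilon>)) x1) 1 \<omega> \<and>
         min_action A \<rho> H \<epsilon> x1 (\<alpha> (shift (w \<epsilon>)) x1) 1 \<omega> \<le> ereal (l / N + D * \<eta>)"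
    proof (rule action_near_ray_cost[of h x0], goal_cases)
      case (1 D)
      show ?case by (rule that[of D]) (fact 1)
    qed
    have w: "\<forall>\<^sub>F \<epsilon> in at_right 0. \<Phi> \<epsilon> h \<in> carrier (Zpow b) \<and> (\<forall>i<b. \<bar>\<epsilon> * real_of_int (\<Phi> \<epsilon> h i) - h i\<bar> \<le> \<eta> j)" for j
      using order_tendstoD(2)[OF C \<eta>(1)[of j]] eventually_at_right_less[of 0]
    proof eventually_elim
      case (elim \<epsilon>)
      have "\<bar>\<epsilon> * real_of_int (\<Phi> \<epsilon> h i) - h i\<bar> \<le> \<eta> j" if i: "i < b" for i
      proof -
        have "\<bar>\<epsilon> * real_of_int (\<Phi> \<epsilon> h i) - h i\<bar> \<le> L2_set (\<lambda>i. \<bar>\<epsilon> * real_of_int (\<Phi> \<epsilon> h i) - h i\<bar>) {..<b}"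
          by (rule member_le_L2_set) (use i in auto)
        also have "\<dots> = L2_set (\<lambda>i. \<epsilon> * real_of_int (\<Phi> \<epsilon> h i) - h i) {..<b}" by (simp add: L2_set_def)
        also have "\<dots> \<le> C \<epsilon>" using \<Phi> h elim(2) by blast
        finally show ?thesis using elim(1) by linarith
      qed
      then show ?case using \<Phi> h elim(2) by blast
    qed
    have "near h D"
      unfolding near_def
    proof (intro allI ballI)
      fix x k \<omega> j assume k: "k \<in> carrier T" and \<omega>: "\<omega> \<in> \<Omega>"
      have \<omega>P: "\<omega> \<in> space P" using sets.sets_into_space[OF \<Omega>(1)] \<omega> by blast
      define x1 where "x1 = \<alpha> (\<iota> (\<one>\<^bsub>Zpow b\<^esub>, k)) x"
      have one: "\<one>\<^bsub>Zpow b\<^esub> \<in> carrier (Zpow b)" by (rule monoid.one_closed[OF group.is_monoid[OF group_Zpow]])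
      have "\<forall>\<^sub>F \<epsilon> in at_right 0. ereal (\<mu> h j - D * \<eta> j) \<le> min_action A \<rho> H \<epsilon> x1 (\<alpha> (shift (\<Phi> \<epsilon> h)) x1) 1 \<omega> \<and>
         min_action A \<rho> H \<epsilon> x1 (\<alpha> (shift (\<Phi> \<epsilon> h)) x1) 1 \<omega> \<le> ereal (\<mu> h j + D * \<eta> j)"
        unfolding \<mu>_def by (rule D[OF \<omega>P \<eta> _ z hz l[OF \<omega> z] w]) simp_all
      then show "\<forall>\<^sub>F \<epsilon> in at_right 0. ereal (\<mu> h j - D * \<eta> j) \<le> u h x k \<omega> \<epsilon> \<and> u h x k \<omega> \<epsilon> \<le> ereal (\<mu> h j + D * \<eta> j)"
        using w[of j]
      proof eventually_elim
        case (elim \<epsilon>)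
        have "\<iota> (\<Phi> \<epsilon> h, k) = shift (\<Phi> \<epsilon> h) \<otimes> \<iota> (\<one>\<^bsub>Zpow b\<^esub>, k)" using shift_torsion elim(2) k by blast
        then have "\<alpha> (\<iota> (\<Phi> \<epsilon> h, k)) x = \<alpha> (shift (\<Phi> \<epsilon> h)) x1"
          unfolding x1_def using \<alpha>_comp[OF shift_closed \<iota>_closed[OF one k]] elim(2) by simp
        then show ?case using elim(1) by (simp add: u_def x1_def)
      qed
    qed
    then show ?thesis by blast
  qed
  then obtain D where "\<And>h. h \<in> Rpow b \<Longrightarrow> near h (D h)" by metis
  then have D: "\<And>h x k \<omega> j. h \<in> Rpow b \<Longrightarrow> k \<in> carrier T \<Longrightarrow> \<omega> \<in> \<Omega> \<Longrightarrow>
      \<forall>\<^sub>F \<epsilon> in at_right 0. ereal (\<mu> h j - D h * \<eta> j) \<le> u h x k \<omega> \<epsilon> \<and> u h x k \<omega> \<epsilon> \<le> ereal (\<mu> h j + D h * \<eta> j)"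
    unfolding near_def by blast
  have D0: "(\<lambda>j. D h * \<eta> j) \<longlonglongrightarrow> 0" for h using tendsto_mult_left[OF \<eta>0, of "D h"] by simp
  have "\<Omega> \<noteq> {}" using \<Omega>(2) by auto
  then obtain \<omega>0 where \<omega>0: "\<omega>0 \<in> \<Omega>" by blast
  define Lbar where "Lbar h = lim (\<mu> h)" for h
  have Lbar: "\<mu> h \<longlonglongrightarrow> Lbar h" if h: "h \<in> Rpow b" for h
    unfolding Lbar_def convergent_LIMSEQ_iff[symmetric]
    by (rule convergent_of_approximations[OF D[OF h T_one \<omega>0] D0]) simp
  have "(u h x k \<omega> \<longlongrightarrow> ereal (Lbar h)) (at_right 0)" if "h \<in> Rpow b" "k \<in> carrier T" "\<omega> \<in> \<Omega>" for h x k \<omega>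
    by (rule tendsto_ereal_of_approximations[OF D[OF that] Lbar[OF that(1)] D0])
  then show ?thesis unfolding u_def using \<Omega> by blast
qed

end

theorem theorem4p1:
  fixes A :: "('m::{t2_space, second_countable_topology}, 'e::{real_inner, heine_borel}) chart set"
    and \<rho> :: "'m \<Rightarrow> ('m, 'e) tvec \<Rightarrow> ('m, 'e) tvec \<Rightarrow> real"
    and G :: "('g, 'r) monoid_scheme"
    and \<T>\<^sub>G :: "'g topology"
    and T :: "('t, 's) monoid_scheme"
    and b :: nat
    and \<iota> :: "(nat \<Rightarrow> int) \<times> 't \<Rightarrow> 'g"
    and \<alpha> :: "'g \<Rightarrow> 'm \<Rightarrow> 'm"
    and P :: "'w measure"
    and \<tau> :: "'g \<Rightarrow> 'w \<Rightarrow> 'w"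
    and H :: "'m \<times> ('m, 'e) covec \<Rightarrow> 'w \<Rightarrow> real"
    and \<theta> \<Theta> :: "real \<Rightarrow> real"
    and \<Phi> :: "real \<Rightarrow> (nat \<Rightarrow> real) \<Rightarrow> (nat \<Rightarrow> int)"
    and C :: "real \<Rightarrow> real"
  assumes manifold: "smooth_atlas A" "connected (UNIV :: 'm set)"
    and metric: "riemannian_metric A \<rho>" "riem_complete A \<rho>"
    and group: "comm_group G" "comm_group T" "finite (carrier T)"
      "\<iota> \<in> iso (Zpow b \<times>\<times> T) G"
    and action: "group_action G UNIV \<alpha>" "\<forall>g\<in>carrier G. riem_isometry A \<rho> (\<alpha> g)"
      "free_action G \<alpha>" "totally_discontinuous_action G \<alpha>" "cocompact_action G \<alpha>"
    and prob: "prob_space P" "topspace \<T>\<^sub>G = carrier G"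
      "dynamical_system G \<T>\<^sub>G P \<tau>" "ergodic_system G P \<tau>"
    and H_a: "(\<lambda>\<omega>. restrict (\<lambda>z. H z \<omega>) (cotangent_bundle A))
        \<in> P \<rightarrow>\<^sub>M borel_of (compact_conv_topology (cot_topology A))"
    and H_b: "\<forall>\<omega>\<in>space P. \<forall>c\<in>A.
        Ck_on 2 (chart_image c \<times> UNIV) (\<lambda>z. H (cot_param A c z) \<omega>)"
    and H_c: "\<forall>\<omega>\<in>space P. \<forall>x. \<forall>p\<in>cotangent_space A x. \<forall>q\<in>cotangent_space A x.
        \<forall>s. p \<noteq> q \<longrightarrow> 0 < s \<longrightarrow> s < 1 \<longrightarrow>
          H (x, \<lambda>v. (1 - s) * p v + s * q v) \<omega> < (1 - s) * H (x, p) \<omega> + s * H (x, q) \<omega>"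
    and H_d: "convex_on {0..} \<theta>" "mono_on {0..} \<theta>" "superlinearly_coercive \<theta>"
      "convex_on {0..} \<Theta>" "mono_on {0..} \<Theta>" "superlinearly_coercive \<Theta>"
      "\<forall>\<omega>\<in>space P. \<forall>x. \<forall>p\<in>cotangent_space A x.
         \<theta> (dual_norm A \<rho> x p) \<le> H (x, p) \<omega> \<and> H (x, p) \<omega> \<le> \<Theta> (dual_norm A \<rho> x p)"
    and H_e: "\<forall>\<omega>\<in>space P. \<forall>g\<in>carrier G. \<forall>x. \<forall>p\<in>cotangent_space A x.
        H (x, p) (\<tau> g \<omega>) = H (cot_lift A (\<alpha> g) (x, p)) \<omega>"
    and Phi: "\<forall>\<epsilon>>0. \<forall>h\<in>Rpow b. \<Phi> \<epsilon> h \<in> carrier (Zpow b) \<and>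
        L2_set (\<lambda>i. \<epsilon> * of_int (\<Phi> \<epsilon> h i) - h i) {..<b} \<le> C \<epsilon>"
      "(C \<longlongrightarrow> 0) (at_right 0)"
  shows "\<exists>(Lbar :: (nat \<Rightarrow> real) \<Rightarrow> real). \<exists>\<Omega>bar\<in>sets P. measure P \<Omega>bar = 1 \<and>
    (\<forall>x. \<forall>k\<in>carrier T. \<forall>h\<in>Rpow b. \<forall>\<omega>\<in>\<Omega>bar.
       ((\<lambda>\<epsilon>. min_action A \<rho> H \<epsilon> (\<alpha> (\<iota> (\<one>\<^bsub>Zpow b\<^esub>, k)) x) (\<alpha> (\<iota> (\<Phi> \<epsilon> h, k)) x) 1 \<omega>)
          \<longlongrightarrow> ereal (Lbar h)) (at_right 0))"
proof -
  have \<tau>_comp: "\<tau> (g \<otimes>\<^bsub>G\<^esub> g') \<omega> = \<tau> g (\<tau> g' \<omega>)"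
    if "g \<in> carrier G" "g' \<in> carrier G" "\<omega> \<in> space P" for g g' \<omega>
    using prob(3) that unfolding dynamical_system_def by blast
  have \<tau>_measurable: "\<tau> g \<in> P \<rightarrow>\<^sub>M P" if "g \<in> carrier G" for g
    using prob(3) that unfolding dynamical_system_def by blast
  have \<tau>_image: "\<tau> g ` E \<in> sets P \<and> measure P (\<tau> g ` E) = measure P E" if "g \<in> carrier G" "E \<in> sets P" for g E
    using prob(3) that unfolding dynamical_system_def by blast
  have riem: "riem_manifold A \<rho>" by (rule riem_manifold.intro[OF manifold(1) metric(1)])
  have ham: "ham_manifold A \<rho> H (space P) \<theta> \<Theta>"
    by (rule ham_manifold.intro[OF riem], rule ham_manifold_axioms.intro[OF H_d(2,3,5)]) (use H_d(7) in blast)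
  have stat: "stationary_ham A \<rho> H (space P) \<theta> \<Theta> G \<alpha> \<tau>"
    by (rule stationary_ham.intro[OF ham], rule stationary_ham_axioms.intro[OF group(1) action(1) _ _ _ _ manifold(2)])
      (use action(2) H_e \<tau>_comp measurable_space[OF \<tau>_measurable] in blast)+
  have erg: "ergodic_ham A \<rho> H P \<theta> \<Theta> G \<alpha> \<tau>"
    by (rule ergodic_ham.intro[OF stat prob(1)], rule ergodic_ham_axioms.intro[OF \<tau>_measurable \<tau>_image prob(4) H_a])
  have "lattice_ham A \<rho> H P \<theta> \<Theta> G \<alpha> \<tau> T b \<iota>"
  proof (rule lattice_ham.intro[OF erg], rule lattice_ham_axioms.intro)
    show "group T" using group(2) by (rule comm_group.axioms(2))
    show "\<iota> \<in> hom (Zpow b \<times>\<times> T) G" using group(4) by (simp add: iso_def)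
    show "continuous_on (chart_image c \<times> UNIV) (\<lambda>z. H (cot_param A c z) \<omega>)" if "\<omega> \<in> space P" "c \<in> A" for \<omega> c
    proof (rule continuous_at_imp_continuous_on, rule ballI)
      fix y :: "'e \<times> 'e" assume "y \<in> chart_image c \<times> UNIV"
      moreover have "Ck_on (Suc (Suc 0)) (chart_image c \<times> UNIV) (\<lambda>z. H (cot_param A c z) \<omega>)"
        using H_b that unfolding numeral_2_eq_2 by blast
      ultimately have "(\<lambda>z. H (cot_param A c z) \<omega>) differentiable (at y)"
        unfolding Ck_on.simps(2)[of "Suc 0"] by blast
      then show "isCont (\<lambda>z. H (cot_param A c z) \<omega>) y" by (rule differentiable_imp_continuous_within)
    qed
  qed
  then show ?thesis by (rule lattice_ham.min_action_converges[OF _ Phi])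
qed

end
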